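(* Let $u \in L^{\infty}(\mathbb{B}_n)$ be continuous on $\overline{\mathbb{B}}_n\setminus K$ for some compact $K \subseteq \mathbb{B}_n$. The following are equivalent: (a) $T_u$ acts compactly on $L^p$ for some $p \in (1,\infty)$; (b) $T_u$ acts compactly on $L^p_{\sigma}$ for all $p \in (1,\infty)$ and all $\sigma \in B_p$; (c) $T_u$ acts compactly from $L^1_{\sigma}$ to $L^{1,\infty}_{\sigma}$ for all $\sigma \in B_1$; (d) $\widetilde{T_u}(z)\rightarrow 0$ as $|z| \rightarrow 1^-$.
   Context: $\mathbb{B}_n$ is the open unit ball of $\mathbb{C}^n$, $V$ is normalized Lebesgue measure on $\mathbb{B}_n$, $|A|=V(A)$, $z\overline{w}=\sum_{j=1}^n z_j\overline{w}_j$, and $L^p=L^p(\mathbb{B}_n,V)$. For $u\in L^\infty$ the Toeplitz operator is $T_uf(z)=\int_{\mathbb{B}_n}\frac{u(w)f(w)}{(1-z\overline{w})^{n+1}}\,dV(w)$. Its Berezin transform is $\widetilde{T_u}(z)=\langle T_uk_z,k_z\rangle$ (inner product of $L^2$), where $k_z(w)=\frac{(1-|z|^2)^{(n+1)/2}}{(1-\overline{z}w)^{n+1}}$. A weight is a locally integrable function on $\mathbb{B}_n$ that is positive almost everywhere; $\sigma(A)=\int_A\sigma\,dV$; $\langle f\rangle_A=\frac{1}{|A|}\int_A f\,dV$. $L^p_\sigma$ is the space of $f$ with $\|f\|_{L^p_\sigma}^p=\int_{\mathbb{B}_n}|f|^p\sigma\,dV<\infty$, and $L^{1,\infty}_\sigma$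 is the space of $f$ with $\|f\|_{L^{1,\infty}_\sigma}=\sup_{\lambda>0}\lambda\,\sigma(\{z:|f(z)|>\lambda\})<\infty$. The Carleson tent over $z\in\mathbb{B}_n\setminus\{0\}$ is $\mathcal{T}_z=\{w\in\mathbb{B}_n: |1-\overline{w}\frac{z}{|z|}|<1-|z|\}$, and $\mathcal{T}_0=\mathbb{B}_n$. With $p'=p/(p-1)$, a weight $\sigma$ is in $B_p$, $p\in(1,\infty)$, if $\sup_{z}\langle\sigma\rangle_{\mathcal{T}_z}\langle\sigma^{1-p'}\rangle_{\mathcal{T}_z}^{p-1}<\infty$, and in $B_1$ if $\sup_z\langle\sigma\rangle_{\mathcal{T}_z}\|\sigma^{-1}\|_{L^\infty(\mathcal{T}_z)}<\infty$. An operator is compact if it maps bounded sets to precompact sets. *)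

theory Defs
  imports "HOL-Probability.Probability"
begin

section \<open>The unit ball of complex n-space\<close>

text \<open>
  Complex n-space is \<open>complex ^ 'n\<close>, so \<open>n = CARD('n)\<close>. Functions on the ball are total
  functions on \<open>complex ^ 'n\<close>; their values off the ball are irrelevant, because the measure
  \<open>vol\<close> below has the ball as its underlying space. The Lebesgue measure is the completed one.
\<close>

abbreviation unit_ball :: "(complex ^ 'n::finite) set" where
  "unit_ball \<equiv> ball 0 1"

definition vol :: "(complex ^ 'n::finite) measure" where
  "vol = uniform_measure (lebesgue_on unit_ball) unit_ball"

definition herm :: "complex ^ 'n::finite \<Rightarrow> complex ^ 'n \<Rightarrow> complex" where
  "herm z w = (\<Sum>j\<in>UNIV. z $ j * cnj (w $ j))"


section \<open>Function spaces\<close>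

text \<open>Powers of extended nonnegative numbers, used for positive exponents only.\<close>

definition epowr :: "ennreal \<Rightarrow> real \<Rightarrow> ennreal" where
  "epowr x q = (if x = \<top> then \<top> else ennreal (enn2real x powr q))"

definition Linf_norm :: "'a measure \<Rightarrow> ('a \<Rightarrow> 'b::real_normed_vector) \<Rightarrow> ennreal" where
  "Linf_norm M f = esssup M (\<lambda>x. ennreal (norm (f x)))"

definition Linf :: "(complex ^ 'n::finite \<Rightarrow> complex) set" where
  "Linf = {u \<in> borel_measurable vol. Linf_norm vol u < \<top>}"

definition weight :: "(complex ^ 'n::finite \<Rightarrow> real) \<Rightarrow> bool" where
  "weight \<sigma> \<longleftrightarrow> \<sigma> \<in> borel_measurable vol \<and> (AE z in vol. 0 < \<sigma> z) \<and>
     (\<forall>K. compact K \<and> K \<subseteq> unit_ball \<longrightarrow> set_integrable vol K \<sigma>)"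

definition wmeasure :: "(complex ^ 'n::finite \<Rightarrow> real) \<Rightarrow> (complex ^ 'n) set \<Rightarrow> ennreal" where
  "wmeasure \<sigma> A = (\<integral>\<^sup>+z\<in>A. ennreal (\<sigma> z) \<partial>vol)"

definition Lp_norm ::
  "real \<Rightarrow> (complex ^ 'n::finite \<Rightarrow> real) \<Rightarrow> (complex ^ 'n \<Rightarrow> complex) \<Rightarrow> ennreal" where
  "Lp_norm p \<sigma> f = epowr (\<integral>\<^sup>+z. ennreal (norm (f z) powr p * \<sigma> z) \<partial>vol) (1 / p)"

definition weak_L1_norm ::
  "(complex ^ 'n::finite \<Rightarrow> real) \<Rightarrow> (complex ^ 'n \<Rightarrow> complex) \<Rightarrow> ennreal" where
  "weak_L1_norm \<sigma> f = (SUP t\<in>{0<..}. ennreal t * wmeasure \<sigma> {z \<in> unit_ball. t < norm (f z)})"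

text \<open>
  A function space is given by its extended (quasi-)norm \<open>N\<close>. Functions that agree almost
  everywhere are not identified, so the topology is that of a (quasi-)seminorm. It is
  defined by requiring each point of an open set to be the centre of a ball inside the set,
  because the balls of a quasi-norm need not themselves be open.
\<close>

definition fspace ::
  "((complex ^ 'n::finite \<Rightarrow> complex) \<Rightarrow> ennreal) \<Rightarrow> (complex ^ 'n \<Rightarrow> complex) set" where
  "fspace N = {f \<in> borel_measurable vol. N f < \<top>}"

definition ftopology ::
  "((complex ^ 'n::finite \<Rightarrow> complex) \<Rightarrow> ennreal) \<Rightarrow> (complex ^ 'n \<Rightarrow> complex) topology" where
  "ftopology N = topology (\<lambda>U. U \<subseteq> fspace N \<and>
     (\<forall>f\<in>U. \<exists>\<epsilon>>0. \<forall>g\<in>fspace N. N (\<lambda>z. g z - f z) < \<epsilon> \<longrightarrow> g \<in> U))"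

lemma openin_ftopology:
  "openin (ftopology N) U \<longleftrightarrow> U \<subseteq> fspace N \<and>
     (\<forall>f\<in>U. \<exists>\<epsilon>>0. \<forall>g\<in>fspace N. N (\<lambda>z. g z - f z) < \<epsilon> \<longrightarrow> g \<in> U)"
proof -
  let ?P = "\<lambda>U. U \<subseteq> fspace N \<and>
     (\<forall>f\<in>U. \<exists>\<epsilon>>0. \<forall>g\<in>fspace N. N (\<lambda>z. g z - f z) < \<epsilon> \<longrightarrow> g \<in> U)"
  have "?P (S \<inter> T)" if S: "?P S" and T: "?P T" for S T
  proof (intro conjI ballI)
    show "S \<inter> T \<subseteq> fspace N"
      using S by blast
    fix f
    assume f: "f \<in> S \<inter> T"
    obtain d where "d > 0" "\<forall>g\<in>fspace N. N (\<lambda>z. g z - f z) < d \<longrightarrow> g \<in> S"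
      using S f by blast
    moreover obtain e where "e > 0" "\<forall>g\<in>fspace N. N (\<lambda>z. g z - f z) < e \<longrightarrow> g \<in> T"
      using T f by blast
    ultimately show "\<exists>\<epsilon>>0. \<forall>g\<in>fspace N. N (\<lambda>z. g z - f z) < \<epsilon> \<longrightarrow> g \<in> S \<inter> T"
      by (intro exI[of _ "min d e"]) auto
  qed
  moreover have "?P (\<Union>\<K>)" if "\<forall>U\<in>\<K>. ?P U" for \<K>
    using that by (meson Sup_le_iff UnionE UnionI)
  ultimately have "istopology ?P"
    unfolding istopology_def by blast
  then show ?thesis
    by (simp add: ftopology_def topology_inverse')
qed

lemma topspace_ftopology: "topspace (ftopology N) = fspace N"
proof
  show "topspace (ftopology N) \<subseteq> fspace N"
    by (metis openin_ftopology openin_topspace)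
  have "openin (ftopology N) (fspace N)"
    unfolding openin_ftopology using zero_less_one by blast
  then show "fspace N \<subseteq> topspace (ftopology N)"
    by (rule openin_subset)
qed

definition precompact_in ::
  "((complex ^ 'n::finite \<Rightarrow> complex) \<Rightarrow> ennreal) \<Rightarrow> (complex ^ 'n \<Rightarrow> complex) set \<Rightarrow> bool" where
  "precompact_in N S \<longleftrightarrow>
     S \<subseteq> fspace N \<and> compactin (ftopology N) (ftopology N closure_of S)"

definition bounded_in ::
  "((complex ^ 'n::finite \<Rightarrow> complex) \<Rightarrow> ennreal) \<Rightarrow> (complex ^ 'n \<Rightarrow> complex) set \<Rightarrow> bool" where
  "bounded_in N S \<longleftrightarrow> S \<subseteq> fspace N \<and> (\<exists>C::real. \<forall>f\<in>S. N f \<le> ennreal C)"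

definition acts_compactly ::
  "((complex ^ 'n::finite \<Rightarrow> complex) \<Rightarrow> ennreal) \<Rightarrow>
   ((complex ^ 'n \<Rightarrow> complex) \<Rightarrow> ennreal) \<Rightarrow>
   ((complex ^ 'n \<Rightarrow> complex) \<Rightarrow> (complex ^ 'n \<Rightarrow> complex)) \<Rightarrow> bool" where
  "acts_compactly N M T \<longleftrightarrow>
     T \<in> fspace N \<rightarrow> fspace M \<and> (\<forall>S. bounded_in N S \<longrightarrow> precompact_in M (T ` S))"


section \<open>Bekolle--Bonami weights\<close>

definition tent :: "complex ^ 'n::finite \<Rightarrow> (complex ^ 'n) set" where
  "tent z = (if z = 0 then unit_ball
     else {w \<in> unit_ball. norm (1 - herm (z /\<^sub>R norm z) w) < 1 - norm z})"

definition avg :: "(complex ^ 'n::finite \<Rightarrow> real) \<Rightarrow> (complex ^ 'n) set \<Rightarrow> ennreal" where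
  "avg f A = (\<integral>\<^sup>+w\<in>A. ennreal (f w) \<partial>vol) / emeasure vol A"

text \<open>
  Averages are only taken of functions that are positive almost everywhere, over tents, which
  have positive measure. Hence no product below is of the form \<open>0 * \<top>\<close>, which is \<open>0\<close> in
  \<^typ>\<open>ennreal\<close>.
\<close>

definition Bp :: "real \<Rightarrow> (complex ^ 'n::finite \<Rightarrow> real) set" where
  "Bp p = {\<sigma>. weight \<sigma> \<and>
     (let p' = p / (p - 1) in
        (SUP z\<in>unit_ball. avg \<sigma> (tent z) * epowr (avg (\<lambda>w. \<sigma> w powr (1 - p')) (tent z)) (p - 1)) < \<top>)}"

definition B1 :: "(complex ^ 'n::finite \<Rightarrow> real) set" where
  "B1 = {\<sigma>. weight \<sigma> \<and>
     (SUP z\<in>unit_ball. avg \<sigma> (tent z) *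
        Linf_norm (restrict_space vol (tent z)) (\<lambda>w. inverse (\<sigma> w))) < \<top>}"


section \<open>Toeplitz operators and the Berezin transform\<close>

text \<open>
  For \<open>z\<close> in the ball the kernel is bounded in \<open>w\<close>, so the integral converges whenever
  \<open>u\<close> is essentially bounded and \<open>f\<close> is integrable; the weighted spaces with weights in
  \<open>Bp p\<close> (respectively \<open>B1\<close>) consist of integrable functions.
\<close>

definition toeplitz ::
  "(complex ^ 'n::finite \<Rightarrow> complex) \<Rightarrow> (complex ^ 'n \<Rightarrow> complex) \<Rightarrow> complex ^ 'n \<Rightarrow> complex" where
  "toeplitz u f z = (\<integral>w. u w * f w / (1 - herm z w) ^ (CARD('n) + 1) \<partial>vol)"

definition kz :: "complex ^ 'n::finite \<Rightarrow> complex ^ 'n \<Rightarrow> complex" where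
  "kz z w = complex_of_real ((1 - (norm z)\<^sup>2) powr ((real CARD('n) + 1) / 2)) /
     (1 - herm w z) ^ (CARD('n) + 1)"

definition L2_inner ::
  "(complex ^ 'n::finite \<Rightarrow> complex) \<Rightarrow> (complex ^ 'n \<Rightarrow> complex) \<Rightarrow> complex" where
  "L2_inner f g = (\<integral>w. f w * cnj (g w) \<partial>vol)"

definition berezin :: "(complex ^ 'n::finite \<Rightarrow> complex) \<Rightarrow> complex ^ 'n \<Rightarrow> complex" where
  "berezin u z = L2_inner (toeplitz u (kz z)) (kz z)"

end

theory Submission
 imports Defs
begin

text \<open>
  Each of the conditions holds exactly when \<open>u\<close> vanishes on the unit sphere, near which it is continuous.

  Suppose that \<open>u\<close> vanishes there. Weighted bounds are needed only for the positive operator \<open>Pplus\<close> whose kernel is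
  the absolute value of the Bergman kernel. That kernel is dominated by a superposition of indicators of squares of
  tent-like sets (\<open>kernel_le_superposition\<close>), so \<open>Pplus f\<close> is dominated by a superposition of averages of
  \<open>f\<close>. Weights of class \<open>Bp\<close> or \<open>B1\<close> define measures that are doubling on these sets, and a covering lemma
  with interpolation and duality gives the strong and weak type inequalities (\<open>Bp_Pplus\<close>, \<open>B1_Pplus\<close>). A symbol that is
  at most \<open>\<epsilon>\<close> in absolute value gives an operator dominated by \<open>\<epsilon>\<close> times \<open>Pplus\<close>. So \<open>u\<close> may be cut off outside a
  smaller ball, and then the kernel is uniformly continuous and bounded sets go to totally bounded sets (\<open>toeplitz_compact\<close>).
  The topologies are those of complete quasi-norms, in which total boundedness implies precompactness (\<open>precompactI\<close>).

  If \<open>u \<zeta>\<close> is not \<open>0\<close> at a point \<open>\<zeta>\<close> of the sphere, then the normalized indicators of boxes that shrink geometrically to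
  \<open>\<zeta>\<close> have uniformly separated images, already without weight (\<open>compact_imp_vanishing\<close>).

  The Berezin transform at \<open>z\<close> is governed by the values of the symbol near \<open>z\<close> (\<open>berezin_small\<close>). So it tends to
  \<open>0\<close> if \<open>u\<close> vanishes on the sphere, and near \<open>\<zeta>\<close> it is asymptotically \<open>u \<zeta>\<close> times the transform of the constant \<open>1\<close>.
  The latter is bounded away from \<open>0\<close> because the Bergman kernel is positive definite (\<open>berezin_one_ge\<close>).
\<close>

abbreviation meas :: "(complex ^ 'n::finite => 'b::topological_space) set" where
  "meas \<equiv> borel_measurable (vol :: (complex ^ 'n) measure)"

abbreviation vol_nn_integral :: "(complex ^ 'n::finite => ennreal) => ennreal" (binder "\<integral>\<^sub>+" 10) where
  "vol_nn_integral f \<equiv> nn_integral vol f"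

section \<open>The Hermitian form and the quantity \<open>\<bar>1 - \<langle>z, w\<rangle>\<bar>\<close>\<close>

lemma herm_add_left: "herm (x + y) z = herm x z + herm y z"
 by (simp add: herm_def sum.distrib algebra_simps)

lemma herm_diff_left: "herm (x - y) z = herm x z - herm y z"
 by (simp add: herm_def sum_subtractf algebra_simps)

lemma herm_add_right: "herm x (y + z) = herm x y + herm x z"
 by (simp add: herm_def sum.distrib algebra_simps)

lemma herm_diff_right: "herm x (y - z) = herm x y - herm x z"
 by (simp add: herm_def sum_subtractf algebra_simps)

lemma herm_smult_left: "herm (c *s x) y = c*herm x y"
 by (simp add: herm_def sum_distrib_left algebra_simps)

lemma herm_smult_right: "herm x (c *s y) = cnj c*herm x y"
 by (simp add: herm_def sum_distrib_left algebra_simps)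

lemma herm_scaleR_left: "herm (r *\<^sub>R x) y = of_real r*herm x y"
 by (simp add: herm_def sum_distrib_left mult.assoc) (simp add: scaleR_conv_of_real mult.assoc)

lemma herm_scaleR_right: "herm x (r *\<^sub>R y) = of_real r*herm x y"
 by (simp add: herm_def sum_distrib_left) (simp add: scaleR_conv_of_real mult.left_commute)

lemma herm_zero [simp]: "herm 0 y = 0" "herm x 0 = 0"
 by (simp_all add: herm_def)

lemma cnj_herm: "cnj (herm x y) = herm y x"
 by (simp add: herm_def mult.commute)

lemma Re_herm: "Re (herm x y) = inner x y"
 by (simp add: herm_def inner_vec_def inner_complex_def)

lemma herm_self: "herm x x = of_real ((norm x)\<^sup>2)"
proof -
 have "Re (herm x x) = (norm x)\<^sup>2" by (simp add: Re_herm power2_norm_eq_inner)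
 moreover have "Im (herm x x) = 0" by (simp add: herm_def)
 ultimately show ?thesis by (simp add: complex_eq_iff)
qed

lemma norm_smult: "norm (c *s (x :: complex^'n::finite)) = cmod c*norm x"
proof -
 have "complex_of_real ((norm (c *s x))\<^sup>2) = c*cnj c * of_real ((norm x)\<^sup>2)"
  unfolding herm_self[symmetric] by (simp add: herm_smult_left herm_smult_right)
 also have "... = of_real ((cmod c*norm x)\<^sup>2)"
  by (simp add: complex_norm_square[symmetric] power_mult_distrib)
 finally have "complex_of_real ((norm (c *s x))\<^sup>2) = of_real ((cmod c*norm x)\<^sup>2)" .
 hence "(norm (c *s x))\<^sup>2 = (cmod c*norm x)\<^sup>2"
  unfolding of_real_eq_iff .
 thus ?thesis by (simp add: power2_eq_iff_nonneg)
qed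

lemma norm_herm_le: "cmod (herm x y) <= norm x*norm y"
proof (cases "herm x y = 0")
 case False
 define c where "c = cnj (sgn (herm x y))"
 have c: "cmod c = 1" using False by (simp add: c_def norm_sgn)
 have "herm (c *s x) y = of_real (cmod (herm x y))"
  unfolding herm_smult_left c_def sgn_eq
  using False complex_norm_square[of "herm x y"] by (simp add: field_simps power2_eq_square)
 hence "cmod (herm x y) = inner (c *s x) y" by (metis Re_herm Re_complex_of_real)
 also have "... <= norm (c *s x)*norm y" by (rule norm_cauchy_schwarz)
 finally show ?thesis by (simp add: norm_smult c)
qed simp

definition hdist :: "complex^'n::finite => complex^'n => real" where
 "hdist z w = cmod (1 - herm z w)"

lemma hdist_nonneg [simp]: "0 <= hdist z w"
 by (simp add: hdist_def)

lemma hdist_commute: "hdist z w = hdist w z"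
proof -
 have "1 - herm w z = cnj (1 - herm z w)" by (simp add: cnj_herm)
 thus ?thesis unfolding hdist_def by (metis complex_mod_cnj)
qed

lemma hdist_self: "norm x <= 1 ==> hdist x x = 1 - (norm x)\<^sup>2"
proof -
 assume "norm x <= 1"
 moreover have "hdist x x = cmod (of_real (1 - (norm x)\<^sup>2))"
  by (simp add: hdist_def herm_self)
 ultimately show ?thesis by (simp only: norm_of_real) (simp add: power_le_one)
qed

lemma hdist_self_le: "norm x <= 1 ==> hdist x x <= 2*(1 - norm x)"
 using mult_left_mono[of "1 + norm x" 2 "1 - norm x"]
 by (simp add: hdist_self power2_eq_square algebra_simps)

lemma hdist_ge: "1 - norm z*norm w <= hdist z w"
 using norm_triangle_ineq2[of 1 "herm z w"] norm_herm_le[of z w] by (simp add: hdist_def)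

lemma hdist_ge_left: "norm w <= 1 ==> 1 - norm z <= hdist z w"
 using hdist_ge[of z w] mult_left_mono[of "norm w" 1 "norm z"] by simp

lemma hdist_ge_right: "norm z <= 1 ==> 1 - norm w <= hdist z w"
 using hdist_ge_left[of z w] by (simp add: hdist_commute)

lemma hdist_le2: "norm z <= 1 ==> norm w <= 1 ==> hdist z w <= 2"
 using norm_triangle_ineq4[of 1 "herm z w"] norm_herm_le[of z w] mult_le_one[of "norm z" "norm w"]
 by (simp add: hdist_def)

lemma hdist_pos: "norm z < 1 ==> norm w <= 1 ==> 0 < hdist z w"
 using hdist_ge_left[of w z] by simp

lemma hdist_diff_le: "norm z <= 1 ==> \<bar>hdist z v - hdist z w\<bar> <= norm (v - w)"
proof -
 assume z: "norm z <= 1"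
 have "\<bar>hdist z v - hdist z w\<bar> <= cmod ((1 - herm z v) - (1 - herm z w))"
  unfolding hdist_def by (rule norm_triangle_ineq3)
 also have "(1 - herm z v) - (1 - herm z w) = herm z (w - v)" by (simp add: herm_diff_right)
 also have "cmod ... <= norm z*norm (w - v)" by (rule norm_herm_le)
 also have "... <= norm (v - w)"
  using z by (simp add: mult_left_le_one_le norm_minus_commute)
 finally show ?thesis .
qed

lemma norm_diff_square_le_hdist:
 assumes "norm z <= 1" "norm w <= 1"
 shows "(norm (z - w))\<^sup>2 <= 2*hdist z w"
proof -
 have "(norm (z - w))\<^sup>2 = (norm z)\<^sup>2 + (norm w)\<^sup>2 - 2 * Re (herm z w)"
  by (simp add: Re_herm power2_norm_eq_inner inner_diff inner_commute)
 also have "... <= 2 * Re (1 - herm z w)"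
  using power_le_one[OF _ assms(1), of 2] power_le_one[OF _ assms(2), of 2] by simp
 also have "... <= 2*hdist z w"
  unfolding hdist_def using complex_Re_le_cmod[of "1 - herm z w"] by simp
 finally show ?thesis .
qed

text \<open>
 The difference \<open>\<langle>x, z\<rangle> - \<langle>x, y\<rangle>\<langle>y, z\<rangle>\<close> is a positive semidefinite form in \<open>x\<close> and \<open>z\<close> when
 \<open>norm y \<le> 1\<close>: it is the Hermitian form of the shifted vectors \<open>x - s\<langle>x, y\<rangle>y\<close> and
 \<open>z - s\<langle>z, y\<rangle>y\<close> for a suitable real \<open>s\<close>. The Cauchy--Schwarz inequality for it gives the quasi-triangle
 inequality.
\<close>

lemma herm_reduced_le:
 fixes x y z :: "complex^'n::finite"
 assumes "norm y <= 1"
 shows "(cmod (herm x z - herm x y*herm y z))\<^sup>2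
  <= ((norm x)\<^sup>2 - (cmod (herm x y))\<^sup>2)*((norm z)\<^sup>2 - (cmod (herm z y))\<^sup>2)"
proof -
 define s where "s = 1/(1 + sqrt (1 - (norm y)\<^sup>2))"
 have y1: "(norm y)\<^sup>2 <= 1" using assms by (simp add: power_le_one)
 have s: "2 * s - s\<^sup>2*(norm y)\<^sup>2 = 1"
 proof -
  define q where "q = sqrt (1 - (norm y)\<^sup>2)"
  have q: "q \<ge> 0" "(norm y)\<^sup>2 = 1 - q\<^sup>2" using y1 by (simp_all add: q_def)
  have "1 + q \<noteq> 0" using q by simp
  thus ?thesis
   unfolding s_def q_def[symmetric] q(2)
   by (simp add: divide_simps) (simp add: power2_eq_square algebra_simps)
 qed
 define T where "T v = v - (of_real s*herm v y) *s y" for v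
 have T: "herm (T v) (T w) = herm v w - herm v y*herm y w" for v w
 proof -
  have "herm (T v) (T w) = herm v w - of_real (2 * s - s\<^sup>2*(norm y)\<^sup>2)*(herm v y*herm y w)"
   unfolding T_def herm_diff_left herm_diff_right herm_smult_left herm_smult_right herm_self
   by (simp add: cnj_herm power2_eq_square algebra_simps)
  thus ?thesis by (simp add: s)
 qed
 have T2: "(norm (T v))\<^sup>2 = (norm v)\<^sup>2 - (cmod (herm v y))\<^sup>2" for v
 proof -
  have "complex_of_real ((norm (T v))\<^sup>2) = of_real ((norm v)\<^sup>2 - (cmod (herm v y))\<^sup>2)"
   using T[of v v] unfolding herm_self cnj_herm[of v y, symmetric] complex_norm_square[symmetric]
   by (simp only: of_real_diff)
  thus ?thesis
   unfolding of_real_eq_iff .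
 qed
 have "(cmod (herm (T x) (T z)))\<^sup>2 <= (norm (T x)*norm (T z))\<^sup>2"
  by (intro power_mono norm_herm_le) simp
 thus ?thesis by (simp add: T T2 power_mult_distrib)
qed

lemma hdist_quasi_triangle:
 fixes x y z :: "complex^'n::finite"
 assumes "norm x <= 1" "norm y <= 1" "norm z <= 1"
 shows "hdist x z <= 2*(hdist x y + hdist y z)"
proof -
 define a where "a = hdist x y"
 define b where "b = hdist y z"
 have ab: "a \<ge> 0" "b \<ge> 0" by (simp_all add: a_def b_def)
 have defect: "(norm v)\<^sup>2 - (cmod (herm v y))\<^sup>2 <= 2*hdist v y" if "norm v <= 1" for v
 proof -
  have le1: "cmod (herm v y) <= 1"
   using norm_herm_le[of v y] mult_le_one[of "norm v" "norm y"] that assms(2) by simp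
  have "(norm v)\<^sup>2 - (cmod (herm v y))\<^sup>2 <= 1 - (cmod (herm v y))\<^sup>2"
   using power_le_one[OF norm_ge_zero that, of 2] by linarith
  also have "... = (1 + cmod (herm v y))*(1 - cmod (herm v y))"
   by (simp add: power2_eq_square algebra_simps)
  also have "... <= 2*hdist v y"
  proof (rule mult_mono)
   show "1 - cmod (herm v y) <= hdist v y"
    unfolding hdist_def using norm_triangle_ineq2[of 1 "herm v y"] by simp
  qed (use le1 in auto)
  finally show ?thesis .
 qed
 have "(cmod (herm x z - herm x y*herm y z))\<^sup>2 <= (2*a)*(2*b)"
 proof (rule order_trans[OF herm_reduced_le[OF assms(2)]], rule mult_mono)
  show "(norm x)\<^sup>2 - (cmod (herm x y))\<^sup>2 <= 2*a"
   unfolding a_def by (rule defect[OF assms(1)])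
  show "(norm z)\<^sup>2 - (cmod (herm z y))\<^sup>2 <= 2*b"
   unfolding b_def hdist_commute[of y z] by (rule defect[OF assms(3)])
  have "cmod (herm z y) <= norm z"
   using norm_herm_le[of z y] mult_left_mono[OF assms(2), of "norm z"] by simp
  thus "0 <= (norm z)\<^sup>2 - (cmod (herm z y))\<^sup>2" by (simp add: power_mono)
 qed (use ab in simp)
 also have "... <= (a + b)\<^sup>2"
  using sum_squares_bound[of a b] unfolding power2_sum by linarith
 finally have 1: "cmod (herm x z - herm x y*herm y z) <= a + b"
  by (rule power2_le_imp_le) (use ab in simp)
 have "1 - herm x y*herm y z = (1 - herm x y) + herm x y*(1 - herm y z)"
  by (simp only: right_diff_distrib) simp
 hence "cmod (1 - herm x y*herm y z) = cmod ((1 - herm x y) + herm x y*(1 - herm y z))"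
  by (rule arg_cong)
 also have "... <= a + cmod (herm x y)*b"
  unfolding a_def b_def hdist_def norm_mult[symmetric] by (rule norm_triangle_ineq)
 also have "cmod (herm x y)*b <= 1*b"
  using norm_herm_le[of x y] mult_le_one[of "norm x" "norm y"] assms ab
  by (intro mult_right_mono) auto
 finally have 2: "cmod (1 - herm x y*herm y z) <= a + b" by simp
 have "hdist x z <= cmod (1 - herm x y*herm y z) + cmod (herm x z - herm x y*herm y z)"
 proof -
  have "1 - herm x z = (1 - herm x y*herm y z) - (herm x z - herm x y*herm y z)" by simp
  thus ?thesis unfolding hdist_def by (metis norm_triangle_ineq4)
 qed
 also have "... <= (a + b) + (a + b)" by (rule add_mono[OF 2 1])
 finally show ?thesis
  unfolding a_def b_def mult_2 .
qed

lemma continuous_on_herm [continuous_intros]: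
 "continuous_on S f ==> continuous_on S g ==> continuous_on S (\<lambda>x. herm (f x) (g x))"
 unfolding herm_def by (intro continuous_intros)

lemma continuous_on_hdist [continuous_intros]:
 "continuous_on S f ==> continuous_on S g ==> continuous_on S (\<lambda>x. hdist (f x) (g x))"
 unfolding hdist_def by (intro continuous_intros)

lemma borel_measurable_herm [measurable]:
 fixes f g :: "'b => complex^'a::finite"
 assumes "f \<in> M \<rightarrow>\<^sub>M borel" "g \<in> M \<rightarrow>\<^sub>M borel"
 shows "(\<lambda>x. herm (f x) (g x)) \<in> borel_measurable M"
proof -
 have "continuous_on UNIV (\<lambda>p :: (complex^'a) \<times> (complex^'a). herm (fst p) (snd p))"
  by (intro continuous_intros)
 hence "(\<lambda>p :: (complex^'a) \<times> (complex^'a). herm (fst p) (snd p)) \<in> borel_measurable borel"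
  by (rule borel_measurable_continuous_onI)
 hence "(\<lambda>p :: (complex^'a) \<times> (complex^'a). herm (fst p) (snd p)) \<in> borel_measurable (borel \<Otimes>\<^sub>M borel)"
  by (simp add: borel_prod)
 from measurable_compose[OF measurable_Pair[OF assms] this] show ?thesis by simp
qed

lemma borel_measurable_hdist [measurable]:
 fixes f g :: "'b => complex^'a::finite"
 assumes [measurable]: "f \<in> M \<rightarrow>\<^sub>M borel" "g \<in> M \<rightarrow>\<^sub>M borel"
 shows "(\<lambda>x. hdist (f x) (g x)) \<in> borel_measurable M"
 unfolding hdist_def by measurable

section \<open>Unitary maps and the invariance of Lebesgue measure\<close>

text \<open>
 Two translation invariant measures are proportional: by Fubini's theorem, the product of the
 measure of \<open>A\<close> for one and of \<open>B\<close> for the other is symmetric in \<open>A\<close> and \<open>B\<close>. The image of Lebesgue measure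
 under an orthogonal map is translation invariant and gives the unit ball its Lebesgue measure.
\<close>

lemma lborel_distr_translate: "distr lborel borel (\<lambda>x. a + x) = (lborel :: 'a::euclidean_space measure)"
 using lborel_affine[of 1 a] by (simp add: density_1)

lemma lborel_distr_uminus_euclidean: "distr lborel borel uminus = (lborel :: 'a::euclidean_space measure)"
 using lborel_affine[of "-1" "0 :: 'a"] by (simp add: density_1 fun_Compl_def)

lemma translation_invariant_measures_proportional:
 fixes \<nu> :: "'a::euclidean_space measure"
 assumes sets: "sets \<nu> = sets borel" and sf: "sigma_finite_measure \<nu>"
  and inv: "\<And>a. distr \<nu> borel (\<lambda>x. a + x) = \<nu>"
  and A [measurable]: "A \<in> sets borel" and B [measurable]: "B \<in> sets borel"
 shows "emeasure \<nu> A*emeasure lborel B = emeasure \<nu> B*emeasure lborel A"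
proof -
 interpret sigma_finite_measure \<nu> by fact
 interpret pair_sigma_finite \<nu> lborel ..
 note sets [measurable_cong]
 have tr: "(\<integral>\<^sup>+y. f y \<partial>lborel) = (\<integral>\<^sup>+y. f (a + y) \<partial>lborel)" if [measurable]: "f \<in> borel_measurable borel"
  for f :: "'a => ennreal" and a
  by (subst lborel_distr_translate[of a, symmetric], subst nn_integral_distr) auto
 have tr': "(\<integral>\<^sup>+y. f y \<partial>\<nu>) = (\<integral>\<^sup>+y. f (a + y) \<partial>\<nu>)" if [measurable]: "f \<in> borel_measurable borel"
  for f :: "'a => ennreal" and a
  by (subst inv[of a, symmetric], subst nn_integral_distr) auto
 have um: "(\<integral>\<^sup>+y. f y \<partial>lborel) = (\<integral>\<^sup>+y. f (- y) \<partial>lborel)" if [measurable]: "f \<in> borel_measurable borel"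
  for f :: "'a => ennreal"
  by (subst lborel_distr_uminus_euclidean[symmetric], subst nn_integral_distr) auto
 let ?iA = "indicator A :: 'a => ennreal" and ?iB = "indicator B :: 'a => ennreal"
 have "emeasure \<nu> A*emeasure lborel B = (\<integral>\<^sup>+x. ?iA x*(\<integral>\<^sup>+y. ?iB y \<partial>lborel) \<partial>\<nu>)"
  by (simp add: nn_integral_multc)
 also have "... = (\<integral>\<^sup>+x. (\<integral>\<^sup>+y. ?iA x*?iB (x + y) \<partial>lborel) \<partial>\<nu>)"
 proof (rule nn_integral_cong)
  fix x :: 'a
  have "(\<integral>\<^sup>+y. ?iB y \<partial>lborel) = (\<integral>\<^sup>+y. ?iB (x + y) \<partial>lborel)"
   by (rule tr) measurable
  thus "?iA x*(\<integral>\<^sup>+y. ?iB y \<partial>lborel) = (\<integral>\<^sup>+y. ?iA x*?iB (x + y) \<partial>lborel)"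
   by (simp add: nn_integral_cmult)
 qed
 also have "... = (\<integral>\<^sup>+y. (\<integral>\<^sup>+x. ?iA x*?iB (x + y) \<partial>\<nu>) \<partial>lborel)"
  by (rule Fubini'[symmetric]) measurable
 also have "... = (\<integral>\<^sup>+y. (\<integral>\<^sup>+x. ?iA (- y + x)*?iB (- y + x + y) \<partial>\<nu>) \<partial>lborel)"
  by (intro nn_integral_cong tr') measurable
 also have "... = (\<integral>\<^sup>+y. (\<integral>\<^sup>+x. ?iA (- y + x)*?iB x \<partial>\<nu>) \<partial>lborel)"
  by simp
 also have "... = (\<integral>\<^sup>+x. (\<integral>\<^sup>+y. ?iA (- y + x)*?iB x \<partial>lborel) \<partial>\<nu>)"
  by (rule Fubini') measurable
 also have "... = (\<integral>\<^sup>+x. emeasure lborel A*?iB x \<partial>\<nu>)"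
 proof (rule nn_integral_cong)
  fix x :: 'a
  have "(\<integral>\<^sup>+y. ?iA (- y + x) \<partial>lborel) = (\<integral>\<^sup>+y. ?iA (x + y) \<partial>lborel)"
   by (subst um) (simp_all add: add.commute)
  also have "... = (\<integral>\<^sup>+y. ?iA y \<partial>lborel)"
   by (rule tr[symmetric]) measurable
  finally show "(\<integral>\<^sup>+y. ?iA (- y + x)*?iB x \<partial>lborel) = emeasure lborel A*?iB x"
   by (simp add: nn_integral_multc)
 qed
 also have "... = emeasure \<nu> B*emeasure lborel A" by (simp add: nn_integral_cmult)
    (simp add: mult.commute)
 finally show ?thesis .
qed

lemma lborel_distr_orthogonal:
 fixes f :: "'a::euclidean_space => 'a"
 assumes f: "orthogonal_transformation f"
 shows "distr lborel borel f = lborel"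
proof -
 have lin: "linear f" and nrm: "norm (f x) = norm x" for x
  using f by (auto simp: orthogonal_transformation)
 have [measurable]: "f \<in> borel \<rightarrow>\<^sub>M borel"
  using lin by (intro borel_measurable_continuous_onI linear_continuous_on linear_conv_bounded_linear[THEN iffD1])
 let ?\<nu> = "distr lborel borel f"
 have inv: "distr ?\<nu> borel (\<lambda>x. a + x) = ?\<nu>" for a
 proof -
  obtain b where b: "a = f b" using orthogonal_transformation_surj[OF f] by (metis surjD)
  have "distr ?\<nu> borel (\<lambda>x. a + x) = distr lborel borel (\<lambda>x. f (b + x))"
   by (subst distr_distr) (auto simp: comp_def b linear_add[OF lin])
  also have "... = distr (distr lborel borel (\<lambda>x. b + x)) borel f"
   by (subst distr_distr) (auto simp: comp_def)
  finally show ?thesis by (simp add: lborel_distr_translate)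
 qed
 have ball: "emeasure ?\<nu> (ball 0 r) = emeasure lborel (ball (0::'a) r)" for r
  by (subst emeasure_distr) (auto simp: vimage_def nrm dist_norm intro!: arg_cong[of _ _ "emeasure _"])
 have sf: "sigma_finite_measure ?\<nu>"
 proof (standard, intro exI conjI)
  show "countable (range (\<lambda>n::nat. ball (0::'a) (real n)))" by simp
  show "range (\<lambda>n::nat. ball (0::'a) (real n)) \<subseteq> sets ?\<nu>" by auto
  show "\<Union> (range (\<lambda>n::nat. ball (0::'a) (real n))) = space ?\<nu>"
   using reals_Archimedean2 by (auto simp: dist_norm)
  show "\<forall>a\<in>range (\<lambda>n::nat. ball (0::'a) (real n)). emeasure ?\<nu> a \<noteq> \<infinity>"
   using emeasure_lborel_ball_finite by (auto simp: ball less_top[symmetric] infinity_ennreal_def)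
 qed
 let ?b = "emeasure lborel (ball (0::'a) 1)"
 have b: "?b \<noteq> 0" "?b \<noteq> \<infinity>"
 proof -
  have "emeasure lborel (ball (0::'a) 1) = ennreal (unit_ball_vol (real DIM('a))*1^DIM('a))"
   by (rule emeasure_ball) simp
  thus "?b \<noteq> 0" by (simp add: ennreal_eq_0_iff not_le)
  show "?b \<noteq> \<infinity>" using emeasure_lborel_ball_finite[of "0::'a" 1] by simp
 qed
 show ?thesis
 proof (rule measure_eqI)
  fix A assume "A \<in> sets ?\<nu>"
  hence A: "A \<in> sets borel" by simp
  have "emeasure ?\<nu> A*?b = emeasure ?\<nu> (ball 0 1)*emeasure lborel A"
   using translation_invariant_measures_proportional[OF _ sf inv A, of "ball 0 1"] by simp
  hence "emeasure ?\<nu> A*?b = emeasure lborel A*?b" by (simp add: ball mult.commute)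
  thus "emeasure ?\<nu> A = emeasure lborel A"
   using b by (metis ennreal_mult_divide_eq infinity_ennreal_def)
 qed simp
qed

text \<open>
 The complex reflection \<open>w \<mapsto> w + c\<langle>w, v\<rangle>v\<close> with \<open>norm v = 1\<close> is unitary when \<open>\<bar>1 + c\<bar> = 1\<close>.
\<close>

lemma unitary_to_unit_vector:
 fixes \<zeta> e :: "complex^'n::finite"
 assumes "norm \<zeta> = 1" "norm e = 1"
 obtains U where "orthogonal_transformation U" "U \<zeta> = e" "\<And>x y. herm (U x) (U y) = herm x y"
proof (cases "\<zeta> = e")
 case True
 thus ?thesis using that[of "\<lambda>x. x"] by simp
next
 case False
 define h where "h = herm \<zeta> e"
 define v where "v = \<zeta> - e"
 define c where "c = - 1/(1 - h)"
 have vv: "herm v v = (1 - h) + (1 - cnj h)"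
  unfolding v_def h_def herm_diff_left herm_diff_right
  by (simp add: herm_self assms cnj_herm)
 have h1: "h \<noteq> 1"
 proof
  assume "h = 1"
  hence "herm v v = 0" by (simp add: vv)
  thus False using False by (simp add: herm_self v_def)
 qed
 \<comment> \<open>\<open>c\<close> is chosen so that \<open>\<zeta>\<close> is sent to \<open>e\<close>, and \<open>c + cnj c + c cnj c \<langle>v, v\<rangle>\<close> vanishes.\<close>
 define U where "U x = x + (c*herm x v) *s v" for x
 have hv: "herm \<zeta> v = 1 - h" unfolding v_def herm_diff_right herm_self assms h_def by simp
 have cc: "c + cnj c + c*cnj c*herm v v = 0"
 proof -
  have "1 - h \<noteq> 0" "1 - cnj h \<noteq> 0" using h1 by (auto simp: complex_eq_iff)
  thus ?thesis unfolding vv c_def by (simp add: divide_simps)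
 qed
 have pres: "herm (U x) (U y) = herm x y" for x y
 proof -
  have "herm (U x) (U y) = herm x y + (c + cnj c + c*cnj c*herm v v)*(herm x v * herm v y)"
   unfolding U_def herm_add_left herm_add_right herm_smult_left herm_smult_right
   by (simp add: cnj_herm algebra_simps)
  thus ?thesis by (simp add: cc)
 qed
 have "linear U"
  unfolding U_def
  by (intro linearI)
   (simp_all add: herm_add_left herm_scaleR_left vec_eq_iff algebra_simps, simp add: scaleR_conv_of_real)
 moreover have "inner (U x) (U y) = inner x y" for x y using pres[of x y] by (metis Re_herm)
 ultimately have "orthogonal_transformation U" by (simp add: orthogonal_transformation_def)
 moreover have "U \<zeta> = e" using h1 unfolding U_def hv c_def by (simp add: v_def vec_eq_iff)
 ultimately show ?thesis using that pres by blast
qed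

section \<open>The normalized Lebesgue measure of the ball\<close>

lemma emeasure_lborel_unit_ball:
 "emeasure lborel (unit_ball :: (complex^'n::finite) set) \<noteq> 0"
 "emeasure lborel (unit_ball :: (complex^'n::finite) set) \<noteq> \<infinity>"
proof -
 have "emeasure lborel (unit_ball :: (complex^'n::finite) set)
   = ennreal (unit_ball_vol (real DIM(complex^'n))*1^DIM(complex^'n))" by (rule emeasure_ball) simp
 thus "emeasure lborel (unit_ball :: (complex^'n::finite) set) \<noteq> 0"
  by (simp add: ennreal_eq_0_iff not_le)
 show "emeasure lborel (unit_ball :: (complex^'n::finite) set) \<noteq> \<infinity>"
  using emeasure_lborel_ball_finite[of "0 :: complex^'n" 1] by simp
qed

lemma space_vol [simp]: "space vol = unit_ball"
 by (simp add: vol_def)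

lemma sets_vol: "sets vol = sets (lebesgue_on unit_ball)"
 by (simp add: vol_def)

lemma borel_subset_sets_vol: "A \<in> sets borel ==> A \<subseteq> unit_ball ==> A \<in> sets vol"
 by (simp add: sets_vol sets_restrict_space_iff)

lemma emeasure_vol:
 fixes A :: "(complex^'n::finite) set"
 assumes "A \<in> sets borel" "A \<subseteq> unit_ball"
 shows "emeasure vol A = emeasure lborel A/emeasure lborel (unit_ball :: (complex^'n::finite) set)"
proof -
 have "emeasure (lebesgue_on (unit_ball :: (complex^'n) set)) B = emeasure lborel B"
  if "B \<in> sets borel" "B \<subseteq> unit_ball" for B
  using that by (simp add: emeasure_restrict_space)
 from this[OF assms] this[of unit_ball] show ?thesis
  unfolding vol_def using assms
  by (subst emeasure_uniform_measure)
    (auto simp: sets_restrict_space_iff Int_absorb1)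
qed

lemma prob_space_vol: "prob_space (vol :: (complex^'n::finite) measure)"
proof
 show "emeasure vol (space (vol :: (complex^'n) measure)) = 1"
  using emeasure_lborel_unit_ball[where ?'n = 'n]
  by (simp add: emeasure_vol[of unit_ball] ennreal_divide_self less_top[symmetric])
qed

interpretation vol: prob_space vol by (rule prob_space_vol)

lemma measurable_ident_vol_borel [measurable]: "(\<lambda>x. x) \<in> vol \<rightarrow>\<^sub>M borel"
proof -
 have "id \<in> borel_measurable (lebesgue_on (unit_ball :: (complex^'n::finite) set))"
  by (rule id_borel_measurable_lebesgue_on)
 thus ?thesis by (simp add: id_def measurable_def sets_vol)
qed

lemma measurable_vol_fst_borel [measurable]: "fst \<in> vol \<Otimes>\<^sub>M M \<rightarrow>\<^sub>M borel"
 using measurable_compose[OF measurable_fst measurable_ident_vol_borel] .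

lemma measurable_vol_snd_borel [measurable]: "snd \<in> M \<Otimes>\<^sub>M vol \<rightarrow>\<^sub>M borel"
 using measurable_compose[OF measurable_snd measurable_ident_vol_borel] .

lemma sets_vol_Collect [measurable (raw)]:
 assumes "Measurable.pred borel P"
 shows "{w \<in> unit_ball. P w} \<in> sets vol"
proof (rule borel_subset_sets_vol)
 have [measurable]: "{w. P w} \<in> sets borel" using assms by (simp add: pred_def)
 have "{w \<in> unit_ball. P w} = {w. P w} \<inter> unit_ball" by auto
 also have "... \<in> sets borel" by measurable
 finally show "{w \<in> unit_ball. P w} \<in> sets borel" .
qed auto

section \<open>Tent-shaped neighbourhoods\<close>

definition rad :: "complex^'n::finite => real" where
 "rad x = 1 - norm x"

text \<open>
 For large \<open>b\<close> the set \<open>nbhd b x\<close> is comparable with the Carleson tent over \<open>x\<close>. It is a ball of the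
 quasi-metric \<open>hdist\<close>, so that tents can be treated as balls of a space of homogeneous type.
\<close>

definition nbhd :: "real => complex^'n::finite => (complex^'n) set" where
 "nbhd b x = {w \<in> unit_ball. hdist x w < b*rad x}"

text \<open>
 The part of \<open>nbhd 16 x\<close> that stays away from the sphere. The second condition makes the relation
 symmetric, and radii vary on a core by bounded factors only.
\<close>

definition core :: "complex^'n::finite => (complex^'n) set" where
 "core x = {w \<in> unit_ball. hdist x w < 16*rad x \<and> hdist x w < 16*rad w}"

lemma rad_pos [simp]: "x \<in> unit_ball ==> 0 < rad x"
 by (simp add: rad_def)

lemma rad_nonneg [simp]: "x \<in> unit_ball ==> 0 <= rad x"
 by (simp add: rad_def)

lemma rad_le1: "rad x <= 1"
 by (simp add: rad_def)

lemma borel_measurable_rad [measurable]: "rad \<in> borel_measurable borel"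
 unfolding rad_def by measurable

lemma rad_le_hdist: "x \<in> unit_ball ==> w \<in> unit_ball ==> rad x <= hdist x w"
 "x \<in> unit_ball ==> w \<in> unit_ball ==> rad w <= hdist x w"
 using hdist_ge_left[of w x] hdist_ge_right[of x w] by (auto simp: rad_def)

lemma hdist_triangle_ball:
 "x \<in> unit_ball ==> y \<in> unit_ball ==> z \<in> unit_ball ==> hdist x z <= 2*(hdist x y + hdist y z)"
 by (rule hdist_quasi_triangle) auto

lemma nbhd_subset: "nbhd b x \<subseteq> unit_ball"
 by (auto simp: nbhd_def)

lemma nbhd_mono: "b <= c ==> x \<in> unit_ball ==> nbhd b x \<subseteq> nbhd c x"
proof -
 assume "b <= c" "x \<in> unit_ball"
 hence "b*rad x <= c*rad x" by (intro mult_right_mono) auto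
 thus ?thesis by (auto simp: nbhd_def)
qed

lemma core_subset_nbhd: "16 <= b ==> x \<in> unit_ball ==> core x \<subseteq> nbhd b x"
 using nbhd_mono[of 16 b x] by (auto simp: nbhd_def core_def)

lemma mem_nbhd_self: "x \<in> unit_ball ==> 2 < b ==> x \<in> nbhd b x"
 using hdist_self_le[of x] mult_strict_right_mono[of 2 b "rad x"]
 by (auto simp: nbhd_def rad_def)

lemma sets_nbhd [measurable]: "nbhd b x \<in> sets vol"
 unfolding nbhd_def by measurable

lemma sets_core [measurable]: "core x \<in> sets vol"
 unfolding core_def by measurable

lemma open_nbhd: "open (nbhd b x)"
proof -
 have "nbhd b x = {w. hdist x w < b*rad x} \<inter> unit_ball" by (auto simp: nbhd_def)
 moreover have "open {w. hdist x w < b*rad x}" by (intro open_Collect_less continuous_intros)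
 ultimately show ?thesis by auto
qed

subsection \<open>Volumes of boxes and of tent-shaped sets\<close>

definition cbox_at :: "'n => complex^'n => real => real => (complex^'n::finite) set" where
 "cbox_at k c s t = {w. \<forall>j. \<bar>Re (w $ j - c $ j)\<bar> < (if j = k then s else t)
   \<and> \<bar>Im (w $ j - c $ j)\<bar> < (if j = k then s else t)}"

lemma cbox_at_eq_box:
 fixes c :: "complex^'n::finite" and k :: 'n
 defines "h \<equiv> \<lambda>s t. (\<chi> j. if j = k then Complex s s else Complex t t) :: complex^'n"
 shows "cbox_at k c s t = box (c - h s t) (c + h s t)"
proof -
 have box: "x \<in> box a b \<longleftrightarrow> (\<forall>j. Re (a $ j) < Re (x $ j) \<and> Re (x $ j) < Re (b $ j) \<and>
   Im (a $ j) < Im (x $ j) \<and> Im (x $ j) < Im (b $ j))" for a b x :: "complex^'n"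
  by (auto simp: mem_box Basis_vec_def inner_axis Basis_complex_def inner_complex_def)
 have "x \<in> cbox_at k c s t \<longleftrightarrow> x \<in> box (c - h s t) (c + h s t)" for x
  unfolding box cbox_at_def mem_Collect_eq by (rule iff_allI) (auto simp: h_def abs_less_iff)
 thus ?thesis by blast
qed

lemma emeasure_cbox_at:
 fixes c :: "complex^'n::finite"
 assumes "s \<ge> 0" "t \<ge> 0"
 shows "emeasure lborel (cbox_at k c s t) = ennreal ((2 * s)\<^sup>2*((2*t)\<^sup>2)^(CARD('n) - 1))"
proof -
 define h where "h = ((\<chi> j. if j = k then Complex s s else Complex t t) :: complex^'n)"
 have B: "(Basis :: (complex^'n) set) = (\<lambda>(i, u). axis i u) ` (UNIV \<times> Basis)"
  by (auto simp: Basis_vec_def)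
 have inj: "inj_on (\<lambda>(i, u). axis i u :: complex^'n) (UNIV \<times> Basis)"
  by (auto simp: inj_on_def axis_eq_axis)
 have hh: "(c + h) - (c - h) = 2 *\<^sub>R h" by (simp add: scaleR_2)
 have "(\<Prod>b\<in>Basis. (2 *\<^sub>R h) \<bullet> b) = (\<Prod>(i, u)\<in>UNIV \<times> Basis. 2*(h $ i \<bullet> u))"
  unfolding B by (subst prod.reindex[OF inj]) (simp add: comp_def case_prod_beta inner_axis)
 also have "... = (\<Prod>i\<in>UNIV. \<Prod>u\<in>Basis. 2*(h $ i \<bullet> u))"
  by (rule prod.cartesian_product[symmetric])
 also have "... = (\<Prod>i\<in>UNIV. if i = k then (2 * s)\<^sup>2 else (2*t)\<^sup>2)"
  by (rule prod.cong) (simp_all add: Basis_complex_def inner_complex_def h_def power2_eq_square)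
 also have "... = (2 * s)\<^sup>2*(\<Prod>i\<in>UNIV - {k}. (2*t)\<^sup>2)"
  by (subst prod.remove[of _ k]) simp_all
 also have "... = (2 * s)\<^sup>2*((2*t)\<^sup>2)^(CARD('n) - 1)"
  by (simp add: card_Diff_singleton)
 finally have *: "(\<Prod>b\<in>Basis. ((c + h) - (c - h)) \<bullet> b) = (2 * s)\<^sup>2*((2*t)\<^sup>2)^(CARD('n) - 1)"
  unfolding hh .
 have "emeasure lborel (cbox_at k c s t) = emeasure lborel (box (c - h) (c + h))"
  by (simp add: cbox_at_eq_box h_def)
 also have "... = ennreal (\<Prod>b\<in>Basis. ((c + h) - (c - h)) \<bullet> b)"
 proof (rule emeasure_lborel_box)
  fix b :: "complex^'n" assume "b \<in> Basis"
  then obtain i u where "b = axis i u" "u = 1 \<or> u = \<i>" by (auto simp: B Basis_complex_def)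
  hence "0 <= h \<bullet> b" using assms by (auto simp: inner_axis inner_complex_def h_def)
  thus "(c - h) \<bullet> b <= (c + h) \<bullet> b" by (simp add: inner_diff_left inner_add_left)
 qed
 finally show ?thesis
  unfolding * .
qed

lemma norm_square_split:
 fixes w :: "complex^'n::finite"
 shows "(norm w)\<^sup>2 = (cmod (w $ k))\<^sup>2 + (\<Sum>j\<in>UNIV - {k}. (cmod (w $ j))\<^sup>2)"
proof -
 have "(norm w)\<^sup>2 = (\<Sum>j\<in>UNIV. (cmod (w $ j))\<^sup>2)"
  by (simp add: norm_vec_def L2_set_def sum_nonneg)
 thus ?thesis by (simp add: sum.remove[of UNIV k])
qed

lemma herm_split:
 fixes v w :: "complex^'n::finite"
 shows "herm v w = v $ k*cnj (w $ k) + (\<Sum>j\<in>UNIV - {k}. v $ j*cnj (w $ j))"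
 by (simp add: herm_def sum.remove[of UNIV k])

lemma herm_axis: "herm (axis k 1) w = cnj (w $ k)"
proof -
 have "(\<Sum>j\<in>UNIV - {k}. axis k 1 $ j*cnj (w $ j)) = 0"
  by (rule sum.neutral) (simp add: axis_def)
 thus ?thesis by (subst herm_split[of _ _ k]) simp
qed

lemma norm_axis_one: "norm (axis k 1 :: complex^'n::finite) = 1"
 by (simp add: norm_eq_sqrt_inner inner_axis_axis)

lemma obtain_polar:
 fixes x :: "complex^'n::finite"
 obtains \<zeta> where "norm \<zeta> = 1" "x = norm x *\<^sub>R \<zeta>"
proof (cases "x = 0")
 case True
 thus ?thesis using that[of "axis undefined 1"] by (simp add: norm_axis_one)
next
 case False
 thus ?thesis using that[of "x /\<^sub>R norm x"] by simp
qed

lemma emeasure_lborel_orthogonal_vimage: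
 fixes f :: "'a::euclidean_space => 'a"
 assumes f: "orthogonal_transformation f" and A: "A \<in> sets borel"
 shows "f -` A \<in> sets borel" "emeasure lborel (f -` A) = emeasure lborel A"
proof -
 have [measurable]: "f \<in> borel \<rightarrow>\<^sub>M borel"
  using orthogonal_transformation_linear[OF f]
  by (intro borel_measurable_continuous_onI linear_continuous_on linear_conv_bounded_linear[THEN iffD1])
 show "f -` A \<in> sets borel" using measurable_sets[of f borel borel A] A by simp
 show "emeasure lborel (f -` A) = emeasure lborel A"
  using A by (subst (2) lborel_distr_orthogonal[OF f, symmetric]) (simp add: emeasure_distr)
qed

text \<open>
 After a rotation \<open>\<zeta>\<close> is a coordinate vector. The cap then lies in a box whose sides are of order \<open>r\<close> in
 that complex coordinate and of order \<open>sqrt r\<close> in the others, because that coordinate has absolute value at least \<open>1 - r\<close>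
 and the norm is less than \<open>1\<close>.
\<close>

lemma emeasure_cap_le:
 obtains C where "0 < C" "\<And>(\<zeta> :: complex^'n::finite) r. norm \<zeta> = 1 ==> 0 < r ==>
  emeasure lborel {w \<in> unit_ball. hdist \<zeta> w < r} <= ennreal (C*r^(CARD('n) + 1))"
proof
 let ?C = "4*16^(CARD('n) - 1) :: real"
 show "0 < ?C" by simp
 fix \<zeta> :: "complex^'n" and r :: real
 assume \<zeta>: "norm \<zeta> = 1" and r: "0 < r"
 define k :: 'n where "k = undefined"
 obtain U where U: "orthogonal_transformation U" "U \<zeta> = axis k 1"
  and pres: "\<And>x y. herm (U x) (U y) = herm x y"
  using unitary_to_unit_vector[OF \<zeta> norm_axis_one, of k] by blast
 have nU: "norm (U w) = norm w" for w using U(1) by (simp add: orthogonal_transformation)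
 let ?B = "cbox_at k (axis k 1 :: complex^'n) r (2 * sqrt r)"
 have "{w \<in> unit_ball. hdist \<zeta> w < r} \<subseteq> U -` ?B"
 proof clarify
  fix w assume w: "w \<in> unit_ball" "hdist \<zeta> w < r"
  define v where "v = U w"
  have nv: "norm v < 1" using w by (simp add: v_def nU)
  have "hdist \<zeta> w = cmod (1 - cnj (v $ k))"
   using pres[of \<zeta> w] by (simp add: hdist_def U(2) v_def herm_axis)
  also have "... = cmod (v $ k - 1)"
   by (metis complex_cnj_diff complex_cnj_one complex_mod_cnj norm_minus_commute)
  finally have vk: "cmod (v $ k - 1) < r" using w(2) by simp
  have "\<bar>Re (v $ j - axis k 1 $ j)\<bar> < (if j = k then r else 2 * sqrt r) \<and>
     \<bar>Im (v $ j - axis k 1 $ j)\<bar> < (if j = k then r else 2 * sqrt r)" for j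
  proof (cases "j = k")
   case True
   thus ?thesis
    using vk abs_Re_le_cmod[of "v $ k - 1"] abs_Im_le_cmod[of "v $ k - 1"] by (simp add: axis_def)
  next
   case False
   have "(cmod (v $ j))\<^sup>2 <= (\<Sum>j\<in>UNIV - {k}. (cmod (v $ j))\<^sup>2)"
    using False by (intro member_le_sum) auto
   also have "... = (norm v)\<^sup>2 - (cmod (v $ k))\<^sup>2"
    by (simp add: norm_square_split[of v k])
   also have "... <= 1 - (cmod (v $ k))\<^sup>2" using nv by (simp add: power_le_one)
   also have "... = (1 + cmod (v $ k))*(1 - cmod (v $ k))"
    by (simp add: power2_eq_square algebra_simps)
   also have "... <= 2*r"
   proof (rule mult_mono)
    have "cmod (v $ k) <= norm v" by (rule Finite_Cartesian_Product.norm_nth_le)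
    thus "1 + cmod (v $ k) <= 2" using nv by simp
    show "0 <= 1 - cmod (v $ k)" using \<open>cmod (v $ k) \<le> norm v\<close> nv by simp
    show "1 - cmod (v $ k) <= r"
     using vk norm_triangle_ineq2[of 1 "v $ k"] by (simp add: norm_minus_commute)
   qed simp
   also have "... < (2 * sqrt r)\<^sup>2" using r by (simp add: power_mult_distrib)
   finally have "cmod (v $ j) < 2 * sqrt r" by (rule power2_less_imp_less) (use r in simp)
   thus ?thesis
    using False abs_Re_le_cmod[of "v $ j"] abs_Im_le_cmod[of "v $ j"] by (simp add: axis_def)
  qed
  thus "w \<in> U -` ?B" by (simp add: cbox_at_def v_def)
 qed
 moreover have B: "?B \<in> sets borel" by (simp add: cbox_at_eq_box)
 ultimately have "emeasure lborel {w \<in> unit_ball. hdist \<zeta> w < r} <= emeasure lborel (U -` ?B)"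
  using emeasure_lborel_orthogonal_vimage(1)[OF U(1) B] by (intro emeasure_mono) auto
 also have "... = emeasure lborel ?B" by (rule emeasure_lborel_orthogonal_vimage(2)[OF U(1) B])
 also have "... = ennreal ((2*r)\<^sup>2*((2*(2 * sqrt r))\<^sup>2)^(CARD('n) - 1))"
  using r by (intro emeasure_cbox_at) auto
 also have "(2*r)\<^sup>2*((2*(2 * sqrt r))\<^sup>2)^(CARD('n) - 1) = ?C*(r^2*r^(CARD('n) - 1))"
  using r by (simp add: power_mult_distrib)
 also have "r^2*r^(CARD('n) - 1) = r^(CARD('n) + 1)"
  using zero_less_card_finite[where 'a = 'n] by (simp add: power_add[symmetric])
 finally show "emeasure lborel {w \<in> unit_ball. hdist \<zeta> w < r} <= ennreal (?C*r^(CARD('n) + 1))" .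
qed

text \<open>
 The sets \<open>D\<close> below play the role of Bergman balls: on them the kernel \<open>1 - \<langle>v, w\<rangle>\<close> is as close to the
 constant \<open>1 - norm x ^ 2\<close> as desired, and their volume is comparable with that of the tent over \<open>x\<close>.
\<close>

lemma bergman_box:
 assumes "0 < c" "c < 1"
 obtains \<kappa> where "0 < \<kappa>" "\<And>x :: complex^'n::finite. x \<in> unit_ball ==>
  \<exists>D. D \<in> sets borel \<and> D \<subseteq> unit_ball \<and> x \<in> D \<and> ennreal (\<kappa>*rad x^(CARD('n) + 1)) <= emeasure lborel D \<and>
   (\<forall>v\<in>D. \<forall>w\<in>D. cmod (herm v w - of_real ((norm x)\<^sup>2)) <= c*rad x)"
proof
 define a where "a = c/8"
 have a: "0 < a" "a < 1" using assms by (simp_all add: a_def)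
 let ?n = "real CARD('n)"
 define \<kappa> where "\<kappa> = a\<^sup>2*(2*a/?n)^(CARD('n) - 1)"
 show "0 < \<kappa>" using a by (simp add: \<kappa>_def)
 fix x :: "complex^'n"
 assume x: "x \<in> unit_ball"
 define \<rho> where "\<rho> = norm x"
 define r where "r = rad x"
 have \<rho>: "0 <= \<rho>" "\<rho> < 1" "r = 1 - \<rho>"
  using x by (simp_all add: \<rho>_def r_def rad_def)
 define k :: 'n where "k = undefined"
 obtain \<zeta> where \<zeta>: "norm \<zeta> = 1" "x = norm x *\<^sub>R \<zeta>"
  by (rule obtain_polar)
 obtain U where U: "orthogonal_transformation U" "U \<zeta> = axis k 1"
  and pres: "\<And>x y. herm (U x) (U y) = herm x y"
  using unitary_to_unit_vector[OF \<zeta>(1) norm_axis_one, of k] by blast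
 have Ux: "U x = \<rho> *\<^sub>R axis k 1"
  by (subst \<zeta>(2)) (simp add: \<rho>_def U orthogonal_transformation_scaleR)
 let ?B = "cbox_at k (\<rho> *\<^sub>R axis k 1 :: complex^'n) (a*r/2) (sqrt (a*r/(2*?n)))"
 define D where "D = U -` ?B"
 have r: "0 < r" "r <= 1" using \<rho> by simp_all
 have near: "cmod (v $ k - of_real \<rho>) <= a*r" and off: "(\<Sum>j\<in>UNIV - {k}. (cmod (v $ j))\<^sup>2) <= a*r"
  if v: "v \<in> ?B" for v
 proof -
  have "cmod (v $ k - of_real \<rho>) <= \<bar>Re (v $ k - of_real \<rho>)\<bar> + \<bar>Im (v $ k - of_real \<rho>)\<bar>"
   by (rule cmod_le)
  also have "... <= a*r"
   using v[unfolded cbox_at_def, THEN CollectD, THEN spec[of _ k]]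
   by (simp add: axis_def)
  finally show "cmod (v $ k - of_real \<rho>) <= a*r" .
  have "(cmod (v $ j))\<^sup>2 <= a*r/?n" if j: "j \<noteq> k" for j
  proof -
   have "\<bar>Re (v $ j)\<bar> <= sqrt (a*r/(2*?n))" "\<bar>Im (v $ j)\<bar> <= sqrt (a*r/(2*?n))"
    using v[unfolded cbox_at_def, THEN CollectD, THEN spec[of _ j]] j
    by (simp_all add: axis_def)
   hence "\<bar>Re (v $ j)\<bar>\<^sup>2 <= (sqrt (a*r/(2*?n)))\<^sup>2" "\<bar>Im (v $ j)\<bar>\<^sup>2 <= (sqrt (a*r/(2*?n)))\<^sup>2"
    by (intro power_mono; simp)+
   hence "(Re (v $ j))\<^sup>2 <= a*r/(2*?n)" "(Im (v $ j))\<^sup>2 <= a*r/(2*?n)"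
    using a r by simp_all
   thus ?thesis by (simp add: cmod_power2)
  qed
  hence "(\<Sum>j\<in>UNIV - {k}. (cmod (v $ j))\<^sup>2) <= (\<Sum>j\<in>UNIV - {k}. a*r/?n)"
   by (intro sum_mono) auto
  also have "... = (?n - 1)*(a*r/?n)" by (simp add: card_Diff_singleton of_nat_diff Suc_leI)
  also have "... <= ?n*(a*r/?n)" using a r by (intro mult_right_mono) auto
  finally show "(\<Sum>j\<in>UNIV - {k}. (cmod (v $ j))\<^sup>2) <= a*r" by simp
 qed
 have close: "cmod (herm v w - of_real (\<rho>\<^sup>2)) <= c*r" if v: "v \<in> ?B" and w: "w \<in> ?B" for v w
 proof -
  have "cmod (\<Sum>j\<in>UNIV - {k}. v $ j*cnj (w $ j)) <= (\<Sum>j\<in>UNIV - {k}. cmod (v $ j)*cmod (w $ j))"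
   by (rule order_trans[OF norm_sum]) (simp add: norm_mult)
  also have "... <= (\<Sum>j\<in>UNIV - {k}. (cmod (v $ j))\<^sup>2 + (cmod (w $ j))\<^sup>2)"
  proof (rule sum_mono)
   fix j
   show "cmod (v $ j)*cmod (w $ j) <= (cmod (v $ j))\<^sup>2 + (cmod (w $ j))\<^sup>2"
   proof -
    have "0 <= cmod (v $ j)*cmod (w $ j)" by simp
    thus ?thesis using sum_squares_bound[of "cmod (v $ j)" "cmod (w $ j)"] by linarith
   qed
  qed
  also have "... <= 2*(a*r)" using off[OF v] off[OF w] by (simp add: sum.distrib)
  finally have 1: "cmod (\<Sum>j\<in>UNIV - {k}. v $ j*cnj (w $ j)) <= 2*(a*r)" .
  have wk: "cmod (cnj (w $ k) - of_real \<rho>) <= a*r"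
   using near[OF w] by (metis complex_cnj_complex_of_real complex_cnj_diff complex_mod_cnj)
  have ar: "a*r <= 1" using a r by (simp add: mult_le_one)
  have "cmod (w $ k) <= cmod (of_real \<rho>) + cmod (w $ k - of_real \<rho>)"
   by (rule norm_triangle_sub)
  hence wk2: "cmod (w $ k) <= 2" using near[OF w] ar \<rho> by simp
  have "v $ k*cnj (w $ k) - of_real (\<rho>\<^sup>2)
    = (v $ k - of_real \<rho>)*cnj (w $ k) + of_real \<rho>*(cnj (w $ k) - of_real \<rho>)"
   by (simp add: algebra_simps power2_eq_square)
  hence "cmod (v $ k*cnj (w $ k) - of_real (\<rho>\<^sup>2))
    <= cmod (v $ k - of_real \<rho>)*cmod (w $ k) + \<rho>*cmod (cnj (w $ k) - of_real \<rho>)"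
   using norm_triangle_ineq[of "(v $ k - of_real \<rho>)*cnj (w $ k)" "of_real \<rho>*(cnj (w $ k) - of_real \<rho>)"] \<rho>(1)
   by (simp add: norm_mult)
  also have "... <= (a*r)*2 + 1*(a*r)"
   using near[OF v] wk wk2 \<rho> a r by (intro add_mono mult_mono) auto
  finally have 2: "cmod (v $ k*cnj (w $ k) - of_real (\<rho>\<^sup>2)) <= 3*(a*r)" by simp
  have "herm v w - of_real (\<rho>\<^sup>2)
    = (v $ k*cnj (w $ k) - of_real (\<rho>\<^sup>2)) + (\<Sum>j\<in>UNIV - {k}. v $ j*cnj (w $ j))"
   by (subst herm_split[of _ _ k]) simp
  hence "cmod (herm v w - of_real (\<rho>\<^sup>2)) <= cmod (v $ k*cnj (w $ k) - of_real (\<rho>\<^sup>2))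
    + cmod (\<Sum>j\<in>UNIV - {k}. v $ j*cnj (w $ j))" by (simp only: norm_triangle_ineq)
  also have "... <= 3*(a*r) + 2*(a*r)" by (rule add_mono[OF 2 1])
  also have "... <= c*r" using assms r by (simp add: a_def)
  finally show ?thesis .
 qed
 have B: "?B \<in> sets borel" by (simp add: cbox_at_eq_box)
 show "\<exists>D. D \<in> sets borel \<and> D \<subseteq> unit_ball \<and> x \<in> D \<and> ennreal (\<kappa>*rad x^(CARD('n) + 1)) <= emeasure lborel D \<and>
   (\<forall>v\<in>D. \<forall>w\<in>D. cmod (herm v w - of_real ((norm x)\<^sup>2)) <= c*rad x)"
 proof (intro exI[of _ D] conjI ballI)
  show "D \<in> sets borel"
   unfolding D_def by (rule emeasure_lborel_orthogonal_vimage(1)[OF U(1) B])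
  show cl: "cmod (herm v w - of_real ((norm x)\<^sup>2)) <= c*rad x" if "v \<in> D" "w \<in> D" for v w
   using close[of "U v" "U w"] that by (simp add: D_def pres \<rho>_def r_def)
  show "D \<subseteq> unit_ball"
  proof
   fix w assume "w \<in> D"
   from cl[OF this this] have "cmod (of_real ((norm w)\<^sup>2 - (norm x)\<^sup>2)) <= c*rad x"
    unfolding herm_self of_real_diff .
   hence "\<bar>(norm w)\<^sup>2 - \<rho>\<^sup>2\<bar> <= c*r"
    unfolding norm_of_real by (simp add: \<rho>_def r_def)
   moreover have "c*r < r" using assms r by simp
   moreover have "r <= 1 - \<rho>\<^sup>2"
    using \<rho> by (simp add: power2_eq_square mult_left_le_one_le)
   ultimately have "(norm w)\<^sup>2 < 1\<^sup>2" by simp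
   hence "norm w < 1" by (rule power2_less_imp_less) simp
   thus "w \<in> unit_ball" by simp
  qed
  show "x \<in> D" using a r by (simp add: D_def Ux cbox_at_def)
  have "emeasure lborel D = emeasure lborel ?B"
   unfolding D_def by (rule emeasure_lborel_orthogonal_vimage(2)[OF U(1) B])
  also have "... = ennreal ((2*(a*r/2))\<^sup>2*((2 * sqrt (a*r/(2*?n)))\<^sup>2)^(CARD('n) - 1))"
   using a r by (intro emeasure_cbox_at) auto
  also have "(2*(a*r/2))\<^sup>2*((2 * sqrt (a*r/(2*?n)))\<^sup>2)^(CARD('n) - 1)
    = \<kappa>*(r^2*r^(CARD('n) - 1))"
  proof -
   have "(2 * sqrt (a*r/(2*?n)))\<^sup>2 = (2*a/?n)*r" using a r by (simp add: power_mult_distrib)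
   thus ?thesis
    unfolding \<kappa>_def by (simp only: power_mult_distrib[of "2*a/?n" r]) (simp add: power2_eq_square)
  qed
  also have "r^2*r^(CARD('n) - 1) = r^(CARD('n) + 1)"
   using zero_less_card_finite[where 'a = 'n] by (simp add: power_add[symmetric])
  finally show "ennreal (\<kappa>*rad x^(CARD('n) + 1)) <= emeasure lborel D"
   by (simp add: r_def)
 qed
qed

lemma emeasure_nbhd_le:
 obtains C where "0 < C" "\<And>(x :: complex^'n::finite). x \<in> unit_ball ==>
  emeasure vol (nbhd b x) <= ennreal (C*rad x^(CARD('n) + 1))"
proof -
 obtain C where C: "0 < C" "\<And>(\<zeta> :: complex^'n::finite) r. norm \<zeta> = 1 ==> 0 < r ==>
  emeasure lborel {w \<in> unit_ball. hdist \<zeta> w < r} <= ennreal (C*r^(CARD('n) + 1))"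
  using emeasure_cap_le[where ?'n = 'n] by blast
 obtain V where V: "emeasure lborel (unit_ball :: (complex^'n) set) = ennreal V" "0 < V"
  using emeasure_lborel_unit_ball[where ?'n = 'n]
  by (cases "emeasure lborel (unit_ball :: (complex^'n) set)") (auto simp: less_le)
 define b' where "b' = max b 0"
 let ?C = "C*(2*(1 + b'))^(CARD('n) + 1)/V"
 show ?thesis
 proof
  show "0 < ?C" using C(1) V(2) by (simp add: b'_def)
  fix x :: "complex^'n"
  assume x: "x \<in> unit_ball"
  obtain \<zeta> where \<zeta>: "norm \<zeta> = 1" "x = norm x *\<^sub>R \<zeta>"
   by (rule obtain_polar)
  have zx: "hdist \<zeta> x = rad x"
  proof -
   have "herm \<zeta> x = of_real (norm x)"
    by (subst \<zeta>(2)) (simp add: herm_scaleR_right herm_self \<zeta>(1))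
   hence "hdist \<zeta> x = cmod (of_real (rad x))" by (simp add: hdist_def rad_def)
   thus ?thesis using x by simp
  qed
  have "nbhd b x \<subseteq> {w \<in> unit_ball. hdist \<zeta> w < 2*(1 + b')*rad x}"
  proof clarify
   fix w assume w: "w \<in> nbhd b x"
   have "hdist \<zeta> w <= 2*(hdist \<zeta> x + hdist x w)"
    using w x \<zeta> by (intro hdist_quasi_triangle) (auto simp: nbhd_def)
   also have "... < 2*(rad x + b*rad x)" using w by (simp add: zx nbhd_def)
   also have "... <= 2*(1 + b')*rad x" using x by (simp add: b'_def algebra_simps)
   finally show "w \<in> unit_ball \<and> hdist \<zeta> w < 2*(1 + b')*rad x"
    using w by (simp add: nbhd_def)
  qed
  moreover have "{w \<in> unit_ball. hdist \<zeta> w < 2*(1 + b')*rad x} \<in> sets borel"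
  proof -
   have "{w \<in> unit_ball. hdist \<zeta> w < 2*(1 + b')*rad x} = {w. hdist \<zeta> w < 2*(1 + b')*rad x} \<inter> unit_ball"
    by auto
   thus ?thesis by simp
  qed
  ultimately have "emeasure lborel (nbhd b x) <= emeasure lborel {w \<in> unit_ball. hdist \<zeta> w < 2*(1 + b')*rad x}"
   by (intro emeasure_mono) auto
  also have "... <= ennreal (C*(2*(1 + b')*rad x)^(CARD('n) + 1))"
   using x by (intro C(2) \<zeta>) (simp add: b'_def)
  finally have "emeasure vol (nbhd b x) <= ennreal (C*(2*(1 + b')*rad x)^(CARD('n) + 1))/ennreal V"
   by (subst emeasure_vol) (auto simp: V nbhd_subset borel_open open_nbhd intro: divide_right_mono_ennreal)
  also have "... = ennreal (?C*rad x^(CARD('n) + 1))"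
   using C(1) V(2) x by (subst divide_ennreal) (auto simp: b'_def power_mult_distrib)
  finally show "emeasure vol (nbhd b x) <= ennreal (?C*rad x^(CARD('n) + 1))" .
 qed
qed

lemma bergman_box_vol:
 assumes "0 < c" "c < 1"
 obtains \<kappa> where "0 < \<kappa>" "\<And>x :: complex^'n::finite. x \<in> unit_ball ==>
  \<exists>D. D \<in> sets vol \<and> x \<in> D \<and> ennreal (\<kappa>*rad x^(CARD('n) + 1)) <= emeasure vol D \<and>
   (\<forall>v\<in>D. \<forall>w\<in>D. cmod (herm v w - of_real ((norm x)\<^sup>2)) <= c*rad x)"
proof -
 obtain \<kappa> where \<kappa>: "0 < \<kappa>" "\<And>x :: complex^'n::finite. x \<in> unit_ball ==>
  \<exists>D. D \<in> sets borel \<and> D \<subseteq> unit_ball \<and> x \<in> D \<and> ennreal (\<kappa>*rad x^(CARD('n) + 1)) <= emeasure lborel D \<and>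
   (\<forall>v\<in>D. \<forall>w\<in>D. cmod (herm v w - of_real ((norm x)\<^sup>2)) <= c*rad x)"
  using bergman_box[where ?'n = 'n, OF assms] by blast
 obtain V where V: "emeasure lborel (unit_ball :: (complex^'n) set) = ennreal V" "0 < V"
  using emeasure_lborel_unit_ball[where ?'n = 'n]
  by (cases "emeasure lborel (unit_ball :: (complex^'n) set)") (auto simp: less_le)
 show ?thesis
 proof
  show "0 < \<kappa>/V" using \<kappa> V by simp
  fix x :: "complex^'n"
  assume x: "x \<in> unit_ball"
  obtain D where D: "D \<in> sets borel" "D \<subseteq> unit_ball" "x \<in> D"
   and m: "ennreal (\<kappa>*rad x^(CARD('n) + 1)) <= emeasure lborel D"
   and cl: "\<forall>v\<in>D. \<forall>w\<in>D. cmod (herm v w - of_real ((norm x)\<^sup>2)) <= c*rad x"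
   using \<kappa>(2)[OF x] by blast
  have "ennreal (\<kappa>/V * rad x^(CARD('n) + 1)) = ennreal (\<kappa>*rad x^(CARD('n) + 1))/ennreal V"
   using \<kappa>(1) V(2) x by (subst divide_ennreal) auto
  also have "... <= emeasure vol D"
   using D m by (simp add: emeasure_vol V divide_right_mono_ennreal)
  finally have "ennreal (\<kappa>/V * rad x^(CARD('n) + 1)) <= emeasure vol D" .
  thus "\<exists>D. D \<in> sets vol \<and> x \<in> D \<and> ennreal (\<kappa>/V * rad x^(CARD('n) + 1)) <= emeasure vol D \<and>
   (\<forall>v\<in>D. \<forall>w\<in>D. cmod (herm v w - of_real ((norm x)\<^sup>2)) <= c*rad x)"
   by (intro exI[of _ D] conjI borel_subset_sets_vol D cl)
 qed
qed

lemma emeasure_core_ge: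
 obtains \<kappa> where "0 < \<kappa>" "\<And>(x :: complex^'n::finite). x \<in> unit_ball ==>
  ennreal (\<kappa>*rad x^(CARD('n) + 1)) <= emeasure vol (core x)"
proof -
 obtain \<kappa> where \<kappa>: "0 < \<kappa>" "\<And>x :: complex^'n::finite. x \<in> unit_ball ==>
  \<exists>D. D \<in> sets vol \<and> x \<in> D \<and> ennreal (\<kappa>*rad x^(CARD('n) + 1)) <= emeasure vol D \<and>
   (\<forall>v\<in>D. \<forall>w\<in>D. cmod (herm v w - of_real ((norm x)\<^sup>2)) <= 1/4*rad x)"
  using bergman_box_vol[where ?'n = 'n, of "1/4"] by (simp, blast)
 show ?thesis
 proof
  show "0 < \<kappa>" by fact
  fix x :: "complex^'n"
  assume x: "x \<in> unit_ball"
  obtain D where D: "D \<in> sets vol" "x \<in> D"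
   and m: "ennreal (\<kappa>*rad x^(CARD('n) + 1)) <= emeasure vol D"
   and cl: "\<forall>v\<in>D. \<forall>w\<in>D. cmod (herm v w - of_real ((norm x)\<^sup>2)) <= 1/4*rad x"
   using \<kappa>(2)[OF x] by blast
  have "D \<subseteq> core x"
  proof
   fix w assume w: "w \<in> D"
   hence wb: "w \<in> unit_ball" using sets.sets_into_space[OF D(1)] by auto
   define r where "r = rad x"
   have r: "0 < r" using x by (simp add: r_def)
   have nx: "r <= 1 - (norm x)\<^sup>2" "1 - (norm x)\<^sup>2 <= 2*r"
   proof -
    show "r <= 1 - (norm x)\<^sup>2"
     using x by (simp add: r_def rad_def power2_eq_square mult_left_le_one_le)
    show "1 - (norm x)\<^sup>2 <= 2*r"
     using hdist_self_le[of x] hdist_self[of x] x by (simp add: r_def rad_def)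
   qed
   have "cmod (1 - herm x w) <= cmod (of_real (1 - (norm x)\<^sup>2)) + cmod (herm x w - of_real ((norm x)\<^sup>2))"
    using norm_triangle_ineq4[of "of_real (1 - (norm x)\<^sup>2)" "herm x w - of_real ((norm x)\<^sup>2)"] by simp
   also have "... <= 2*r + 1/4*r"
    using cl D(2) w nx r unfolding norm_of_real r_def[symmetric] by (intro add_mono) auto
   finally have h: "hdist x w <= 9/4*r" by (simp add: hdist_def)
   have "cmod (of_real ((norm w)\<^sup>2 - (norm x)\<^sup>2)) <= 1/4*r"
    using cl[rule_format, OF w w] unfolding herm_self r_def of_real_diff by simp
   hence "\<bar>(norm w)\<^sup>2 - (norm x)\<^sup>2\<bar> <= 1/4*r"
    unfolding norm_of_real .
   hence "3/4*r <= 1 - (norm w)\<^sup>2" using nx(1) unfolding abs_le_iff by argo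
   also have "... <= 2*rad w"
    using hdist_self_le[of w] hdist_self[of w] wb by (simp add: rad_def)
   finally have "3/8*r <= rad w" by simp
   with h r wb show "w \<in> core x" by (simp add: core_def r_def)
  qed
  hence "emeasure vol D <= emeasure vol (core x)" by (intro emeasure_mono) auto
  with m show "ennreal (\<kappa>*rad x^(CARD('n) + 1)) <= emeasure vol (core x)" by simp
 qed
qed

text \<open>
 The kernel is dominated by a superposition of indicators of squares of neighbourhoods. If \<open>\<delta> = hdist z w\<close>
 then every point \<open>x\<close> of the core of \<open>x0 = (1 - \<delta>/2) z\<close> has radius comparable with \<open>\<delta>\<close> and a neighbourhood
 containing both \<open>z\<close> and \<open>w\<close>.
\<close>

definition bb :: real where "bb = 512"

lemma kernel_le_superposition:
 obtains C where "0 < C" "\<And>z w :: complex^'n::finite. z \<in> unit_ball ==> w \<in> unit_ball ==>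
  ennreal (1/hdist z w^(CARD('n) + 1)) <= ennreal C *
   (\<integral>\<^sub>+x. ennreal (1/rad x^(2*(CARD('n) + 1)))*indicator (nbhd bb x) z*indicator (nbhd bb x) w)"
proof -
 obtain \<kappa> where \<kappa>: "0 < \<kappa>" "\<And>(x :: complex^'n::finite). x \<in> unit_ball ==>
  ennreal (\<kappa>*rad x^(CARD('n) + 1)) <= emeasure vol (core x)"
  using emeasure_core_ge[where ?'n = 'n] by blast
 let ?N = "CARD('n) + 1"
 define C where "C = 2^?N*24^(2*?N)/\<kappa>"
 show ?thesis
 proof
  show C: "0 < C" using \<kappa> by (simp add: C_def)
  fix z w :: "complex^'n"
  assume z: "z \<in> unit_ball" and w: "w \<in> unit_ball"
  define \<delta> where "\<delta> = hdist z w"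
  have \<delta>: "0 < \<delta>" "\<delta> <= 2"
   using hdist_pos[of z w] hdist_le2[of z w] z w by (simp_all add: \<delta>_def)
  define x0 where "x0 = (1 - \<delta>/2) *\<^sub>R z"
  have nx0: "norm x0 = (1 - \<delta>/2)*norm z" using \<delta> by (simp add: x0_def)
  have nle: "norm x0 <= norm z" unfolding nx0 using \<delta> by (simp add: mult_left_le_one_le)
  hence x0: "x0 \<in> unit_ball" using z by simp
  have rz: "rad z <= \<delta>" using rad_le_hdist(1)[OF z w] by (simp add: \<delta>_def)
  have r0: "\<delta>/2 <= rad x0" "rad x0 <= 3/2*\<delta>"
  proof -
   have e: "rad x0 = rad z + \<delta>/2*norm z" by (simp add: rad_def nx0 algebra_simps)
   have "\<delta>/2*norm z <= \<delta>/2*1" using z \<delta> by (intro mult_left_mono) auto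
   thus "rad x0 <= 3/2*\<delta>" using rz e by simp
   have "norm x0 <= 1 - \<delta>/2"
    unfolding nx0 using z \<delta> by (simp add: mult_right_le_one_le)
   thus "\<delta>/2 <= rad x0" by (simp add: rad_def)
  qed
  have h0z: "hdist x0 z <= 5/2*\<delta>"
  proof -
   have "z - x0 = (\<delta>/2) *\<^sub>R z" by (simp add: x0_def scaleR_left_diff_distrib)
   hence "norm (z - x0) = \<delta>/2*norm z" using \<delta> by simp
   also have "... <= \<delta>/2" using z \<delta> by (simp add: mult_left_le)
   finally have "hdist z x0 <= hdist z z + \<delta>/2" using hdist_diff_le[of z z x0] z by simp
   moreover have "hdist z z <= 2*\<delta>" using hdist_self_le[of z] z rz by (simp add: rad_def)
   ultimately show ?thesis by (simp add: hdist_commute)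
  qed
  have h0w: "hdist x0 w <= 7*\<delta>"
   using hdist_triangle_ball[OF x0 z w] h0z by (simp add: \<delta>_def)
  have inn: "z \<in> nbhd bb x \<and> w \<in> nbhd bb x \<and> rad x <= 24*\<delta>" if x: "x \<in> core x0" for x
  proof -
   have xb: "x \<in> unit_ball" and h: "hdist x0 x < 16*rad x0" "hdist x0 x < 16*rad x"
    using x by (auto simp: core_def)
   have rx: "rad x0 <= 16*rad x" "rad x <= 16*rad x0"
    using rad_le_hdist[OF x0 xb] h by simp_all
   have "hdist x z <= 2*(hdist x x0 + hdist x0 z)" by (rule hdist_triangle_ball[OF xb x0 z])
   also have "... < 512*rad x" using h h0z r0 rx xb by (simp add: hdist_commute)
   finally have 1: "hdist x z < 512*rad x" .
   have "hdist x w <= 2*(hdist x x0 + hdist x0 w)" by (rule hdist_triangle_ball[OF xb x0 w])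
   also have "... < 512*rad x" using h h0w r0 rx xb by (simp add: hdist_commute)
   finally have 2: "hdist x w < 512*rad x" .
   have "rad x <= 24*\<delta>" using rx r0 by simp
   with 1 2 z w show ?thesis by (simp add: nbhd_def bb_def)
  qed
  have "ennreal (1/\<delta>^?N) <= ennreal (C*(1/(24*\<delta>)^(2*?N)*(\<kappa>*rad x0^?N)))"
  proof (rule ennreal_leI)
   have "(\<delta>/2)^?N <= rad x0^?N" using r0 \<delta> by (intro power_mono) auto
   hence le: "C*(1/(24*\<delta>)^(2*?N)*(\<kappa>*(\<delta>/2)^?N)) <= C*(1/(24*\<delta>)^(2*?N)*(\<kappa>*rad x0^?N))"
    using C \<kappa>(1) \<delta> by (intro mult_left_mono) auto
   have eq: "C*(1/(24*\<delta>)^(2*?N)*(\<kappa>*(\<delta>/2)^?N)) = 1/\<delta>^?N"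
   proof -
    have "\<delta>^(2*?N) = \<delta>^?N*\<delta>^?N" by (simp only: mult_2 power_add)
    thus ?thesis
     unfolding C_def power_mult_distrib power_divide using \<kappa>(1) \<delta> by (simp del: power_Suc)
   qed
   show "1/\<delta>^?N <= C*(1/(24*\<delta>)^(2*?N)*(\<kappa>*rad x0^?N))"
    using le unfolding eq .
  qed
  also have "... = ennreal C*(ennreal (1/(24*\<delta>)^(2*?N))*ennreal (\<kappa>*rad x0^?N))"
   using C \<kappa>(1) \<delta> x0 by (subst ennreal_mult'[symmetric], simp)+ simp
  also have "... <= ennreal C*(ennreal (1/(24*\<delta>)^(2*?N))*emeasure vol (core x0))"
   by (intro mult_left_mono \<kappa>(2)[OF x0]) auto
  also have "ennreal (1/(24*\<delta>)^(2*?N))*emeasure vol (core x0)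
    = (\<integral>\<^sub>+x. ennreal (1/(24*\<delta>)^(2*?N))*indicator (core x0) x)"
   by (simp add: nn_integral_cmult)
  also have "... <= (\<integral>\<^sub>+x. ennreal (1/rad x^(2*?N))*indicator (nbhd bb x) z*indicator (nbhd bb x) w)"
  proof (rule nn_integral_mono)
   fix x :: "complex^'n" assume "x \<in> space vol"
   hence xb: "x \<in> unit_ball" by simp
   show "ennreal (1/(24*\<delta>)^(2*?N))*indicator (core x0) x
     <= ennreal (1/rad x^(2*?N))*indicator (nbhd bb x) z*indicator (nbhd bb x) w"
   proof (cases "x \<in> core x0")
    case True
    have "rad x^(2*?N) <= (24*\<delta>)^(2*?N)" using inn[OF True] xb by (intro power_mono) auto
    hence "1/(24*\<delta>)^(2*?N) <= 1/rad x^(2*?N)"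
     using xb by (intro divide_left_mono mult_pos_pos zero_less_power) (use \<delta> in auto)
    thus ?thesis using inn[OF True] True by (simp add: ennreal_leI)
   qed simp
  qed
  finally show "ennreal (1/hdist z w^?N) <= ennreal C *
   (\<integral>\<^sub>+x. ennreal (1/rad x^(2*?N))*indicator (nbhd bb x) z*indicator (nbhd bb x) w)"
   unfolding \<delta>_def by (simp add: mult_left_mono)
 qed
qed

section \<open>Powers of extended nonnegative numbers\<close>

lemma epowr_ennreal [simp]: "0 <= x ==> epowr (ennreal x) q = ennreal (x powr q)"
 by (simp add: epowr_def)

lemma epowr_top [simp]: "epowr \<top> q = \<top>"
 by (simp add: epowr_def)

lemma epowr_zero [simp]: "epowr 0 q = 0"
 by (simp add: epowr_def)

lemma epowr_mono: "0 <= q ==> x <= y ==> epowr x q <= epowr y q"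
 by (cases x; cases y) (auto intro!: ennreal_leI powr_mono2 simp: top_unique)

lemma borel_measurable_epowr [measurable]:
 assumes [measurable]: "f \<in> borel_measurable M"
 shows "(\<lambda>x. epowr (f x) q) \<in> borel_measurable M"
 unfolding epowr_def by measurable

lemma epowr_mult:
 assumes "0 < q"
 shows "epowr (x*y) q = epowr x q*epowr y q"
proof (cases x; cases y)
 fix a b :: real assume ab: "0 <= a" "x = ennreal a" "0 <= b" "y = ennreal b"
 thus ?thesis by (simp add: powr_mult flip: ennreal_mult)
next
 fix a :: real assume "0 <= a" "x = ennreal a" "y = \<top>"
 thus ?thesis using assms by (cases "a = 0") (simp_all add: ennreal_mult_top powr_gt_zero less_le)
next
 fix b :: real assume "0 <= b" "x = \<top>" "y = ennreal b"
 thus ?thesis using assms by (cases "b = 0") (simp_all add: ennreal_top_mult powr_gt_zero less_le)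
qed simp

lemma epowr_epowr: "0 < q ==> 0 < r ==> epowr (epowr x q) r = epowr x (q*r)"
 by (cases x) (simp_all add: powr_powr)

lemma epowr_one [simp]: "epowr x 1 = x"
 by (cases x) simp_all

lemma epowr_le_iff: "0 < q ==> epowr x q <= epowr y q \<longleftrightarrow> x <= y"
proof
 assume q: "0 < q" and le: "epowr x q <= epowr y q"
 have "epowr (epowr x q) (1/q) <= epowr (epowr y q) (1/q)"
  using q le by (intro epowr_mono[of "1/q" "epowr x q"]) auto
 thus "x <= y" using q by (simp add: epowr_epowr)
qed (auto intro: epowr_mono)

lemma epowr_less_top_iff [simp]: "epowr x q < \<top> \<longleftrightarrow> x < \<top>"
 by (cases x) simp_all

lemma epowr_le_SUP_min:
 assumes "0 < q"
 shows "epowr x q <= (SUP m. epowr (min x (ennreal (real m))) q)"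
proof (cases x)
 case (real a)
 obtain m :: nat where "a <= real m" using real_arch_simple by blast
 hence "min x (ennreal (real m)) = x" using real by (simp add: min_absorb1 ennreal_leI)
 thus ?thesis by (intro SUP_upper2[of m]) auto
next
 case top
 have "(SUP m. epowr (min x (ennreal (real m))) q) = \<top>"
 proof (rule ennreal_SUP_eq_top)
  fix n :: nat
  obtain m :: nat where m: "real n powr (1/q) <= real m" using real_arch_simple by blast
  have "real n <= real m powr q"
   using powr_mono2[of q "real n powr (1/q)" "real m"] m assms by (simp add: powr_powr)
  hence "of_nat n <= epowr (min x (ennreal (real m))) q"
   using top by (simp add: ennreal_of_nat_eq_real_of_nat ennreal_leI)
  thus "\<exists>m\<in>UNIV. of_nat n <= epowr (min x (ennreal (real m))) q" by blast
 qed
 thus ?thesis by (simp only: top_greatest)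
qed

text \<open>
 A weighted Young inequality with exponents \<open>p\<close> and \<open>p / (p - 1)\<close>, without sharp constants: compare
 \<open>a\<close> with \<open>\<epsilon> b powr (1 / (p - 1))\<close>.
\<close>

lemma young_eps:
 fixes a b e p :: real
 assumes p: "1 < p" and e: "0 < e" and ab: "0 <= a" "0 <= b"
 shows "a*b <= e*b powr (p/(p - 1)) + e powr (1 - p)*a powr p"
proof (cases "a <= e*b powr (1/(p - 1))")
 case True
 have "p - 1 \<noteq> 0" using p by simp
 hence "p/(p - 1) = 1/(p - 1) + 1" by (simp add: field_simps)
 hence "b powr (p/(p - 1)) = b powr (1/(p - 1))*b"
  using ab(2) by (cases "b = 0") (simp_all add: powr_add)
 hence "a*b <= e*b powr (p/(p - 1))"
  using mult_right_mono[OF True ab(2)] by (simp add: mult.assoc)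
 thus ?thesis using e by (simp add: add_increasing2)
next
 case False
 hence a: "0 < a" using e ab by (smt (verit) mult_nonneg_nonneg powr_ge_zero)
 have "b powr (1/(p - 1)) <= a/e" using False e by (simp add: field_simps)
 hence "(b powr (1/(p - 1))) powr (p - 1) <= (a/e) powr (p - 1)"
  using p by (intro powr_mono2) auto
 hence "b <= (a/e) powr (p - 1)" using p ab by (simp add: powr_powr)
 also have "... = a powr (p - 1)*e powr (1 - p)"
  using a e by (simp add: powr_divide powr_minus_divide[of e "p - 1", simplified])
 finally have "a*b <= a*(a powr (p - 1)*e powr (1 - p))" using a by (intro mult_left_mono) auto
 also have "... = e powr (1 - p)*a powr p" using a powr_add[of a 1 "p - 1"] by simp
 finally show ?thesis using e by (simp add: add_increasing)
qed

lemma young_eps_ennreal: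
 fixes x y :: ennreal
 assumes p: "1 < p" and e: "0 < e"
 shows "x*y <= ennreal e*epowr y (p/(p - 1)) + ennreal (e powr (1 - p))*epowr x p"
proof (cases x; cases y)
 fix a b :: real assume ab: "0 <= a" "x = ennreal a" "0 <= b" "y = ennreal b"
 hence "x*y = ennreal (a*b)" by (simp add: ennreal_mult)
 also have "... <= ennreal (e*b powr (p/(p - 1)) + e powr (1 - p)*a powr p)"
  by (intro ennreal_leI young_eps p e ab)
 also have "... = ennreal e*epowr y (p/(p - 1)) + ennreal (e powr (1 - p))*epowr x p"
  using ab e by (simp add: ennreal_mult)
 finally show ?thesis .
qed (use e in \<open>auto simp: ennreal_mult_top\<close>)

lemma nn_integral_powr_Ioo:
 fixes a q :: real
 assumes "- 1 < q" "0 <= a"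
 shows "(\<integral>\<^sup>+t. ennreal (t powr q)*indicator {0<..<a} t \<partial>lborel) = ennreal (a powr (q + 1)/(q + 1))"
proof -
 have "((\<lambda>t. t powr q) has_integral (a powr (q + 1)/(q + 1))) {0..a}"
  using has_integral_powr_from_0[OF assms] .
 hence "(\<integral>\<^sup>+t. ennreal (t powr q)*indicator {0..a} t \<partial>lborel) = ennreal (a powr (q + 1)/(q + 1))"
  by (intro nn_integral_has_integral_lebesgue') auto
 moreover have "(\<integral>\<^sup>+t. ennreal (t powr q)*indicator {0<..<a} t \<partial>lborel)
   = (\<integral>\<^sup>+t. ennreal (t powr q)*indicator {0..a} t \<partial>lborel)"
 proof (rule nn_integral_cong_AE)
  have "AE t in lborel. t \<noteq> 0 \<and> t \<noteq> a"
   using AE_lborel_singleton[of 0] AE_lborel_singleton[of a] by auto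
  thus "AE t in lborel. ennreal (t powr q)*indicator {0<..<a} t = ennreal (t powr q)*indicator {0..a} t"
   by eventually_elim (auto simp: indicator_def)
 qed
 ultimately show ?thesis by simp
qed

section \<open>Averages over neighbourhoods with respect to a doubling measure\<close>

lemma borel_measurable_indicator_nbhd:
 assumes A: "sets A = sets vol" and B: "sets B = sets vol"
 shows "(\<lambda>p. indicator (nbhd b (fst p)) (snd p) :: ennreal) \<in> borel_measurable (A \<Otimes>\<^sub>M B)"
  "(\<lambda>p. indicator (nbhd b (snd p)) (fst p) :: ennreal) \<in> borel_measurable (A \<Otimes>\<^sub>M B)"
  "(\<lambda>p. indicator (core (fst p)) (snd p) :: ennreal) \<in> borel_measurable (A \<Otimes>\<^sub>M B)"
proof -
 have [measurable_cong]: "sets (A \<Otimes>\<^sub>M B) = sets (vol \<Otimes>\<^sub>M vol)"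
  by (rule sets_pair_measure_cong[OF A B])
 have "(\<lambda>p. if norm (snd p) < 1 \<and> hdist (fst p) (snd p) < b*rad (fst p) then 1 else 0 :: ennreal) \<in> borel_measurable (A \<Otimes>\<^sub>M B)"
  by measurable
 also have "(\<lambda>p. if norm (snd p) < 1 \<and> hdist (fst p) (snd p) < b*rad (fst p) then 1 else 0 :: ennreal)
   = (\<lambda>p. indicator (nbhd b (fst p)) (snd p))"
  by (auto simp: indicator_def nbhd_def fun_eq_iff)
 finally show "(\<lambda>p. indicator (nbhd b (fst p)) (snd p) :: ennreal) \<in> borel_measurable (A \<Otimes>\<^sub>M B)" .
 have "(\<lambda>p. if norm (fst p) < 1 \<and> hdist (snd p) (fst p) < b*rad (snd p) then 1 else 0 :: ennreal) \<in> borel_measurable (A \<Otimes>\<^sub>M B)"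
  by measurable
 also have "(\<lambda>p. if norm (fst p) < 1 \<and> hdist (snd p) (fst p) < b*rad (snd p) then 1 else 0 :: ennreal)
   = (\<lambda>p. indicator (nbhd b (snd p)) (fst p))"
  by (auto simp: indicator_def nbhd_def fun_eq_iff)
 finally show "(\<lambda>p. indicator (nbhd b (snd p)) (fst p) :: ennreal) \<in> borel_measurable (A \<Otimes>\<^sub>M B)" .
 have "(\<lambda>p. if norm (snd p) < 1 \<and> hdist (fst p) (snd p) < 16*rad (fst p) \<and> hdist (fst p) (snd p) < 16*rad (snd p) then 1 else 0 :: ennreal) \<in> borel_measurable (A \<Otimes>\<^sub>M B)"
  by measurable
 also have "(\<lambda>p. if norm (snd p) < 1 \<and> hdist (fst p) (snd p) < 16*rad (fst p) \<and> hdist (fst p) (snd p) < 16*rad (snd p) then 1 else 0 :: ennreal)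
   = (\<lambda>p. indicator (core (fst p)) (snd p))"
  by (auto simp: indicator_def core_def fun_eq_iff)
 finally show "(\<lambda>p. indicator (core (fst p)) (snd p) :: ennreal) \<in> borel_measurable (A \<Otimes>\<^sub>M B)" .
qed

subsection \<open>A covering lemma\<close>

lemma finite_vitali:
 fixes A :: "'a => 'b set" and r :: "'a => real"
 assumes "finite F" "\<And>x. x \<in> F ==> A x \<noteq> {}"
 shows "\<exists>G\<subseteq>F. disjoint_family_on A G \<and> (\<forall>x\<in>F. \<exists>y\<in>G. A x \<inter> A y \<noteq> {} \<and> r x <= r y)"
 using assms
proof (induction "card F" arbitrary: F rule: less_induct)
 case less
 show ?case
 proof (cases "F = {}")
  case False
  define y where "y = arg_max_on r F"
  have y: "y \<in> F" "\<And>x. x \<in> F ==> r x <= r y"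
  proof -
   have "Max (r ` F) \<in> r ` F" using False less.prems(1) by (intro Max_in) auto
   then obtain y0 where y0: "y0 \<in> F" "r y0 = Max (r ` F)" by auto
   hence m: "r x <= r y0" if "x \<in> F" for x using that less.prems(1) by simp
   have "is_arg_max r (\<lambda>x. x \<in> F) y0" using y0 m by (auto simp: is_arg_max_linorder)
   hence "is_arg_max r (\<lambda>x. x \<in> F) y"
    unfolding y_def arg_max_on_def arg_max_def by (rule someI)
   thus "y \<in> F" "\<And>x. x \<in> F ==> r x <= r y"
    by (auto simp: is_arg_max_linorder)
  qed
  define F' where "F' = {x \<in> F. A x \<inter> A y = {}}"
  have "F' \<subset> F" using y(1) less.prems(2)[OF y(1)] by (auto simp: F'_def)
  hence "card F' < card F" "finite F'"
   using less.prems(1) by (auto intro: psubset_card_mono finite_subset)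
  from less.hyps[OF this] less.prems(2) obtain G where G: "G \<subseteq> F'" "disjoint_family_on A G"
   "\<forall>x\<in>F'. \<exists>y\<in>G. A x \<inter> A y \<noteq> {} \<and> r x <= r y"
   by (auto simp: F'_def)
  show ?thesis
  proof (intro exI[of _ "insert y G"] conjI ballI)
   show "insert y G \<subseteq> F" using G(1) y(1) by (auto simp: F'_def)
   show "disjoint_family_on A (insert y G)"
    using G(1,2) unfolding disjoint_family_on_def F'_def by blast
   fix x assume x: "x \<in> F"
   show "\<exists>y'\<in>insert y G. A x \<inter> A y' \<noteq> {} \<and> r x <= r y'"
   proof (cases "x \<in> F'")
    case True
    thus ?thesis using G(3) by blast
   next
    case False
    thus ?thesis using x y(2)[OF x] by (auto simp: F'_def)
   qed
  qed
 qed (auto simp: disjoint_family_on_def)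
qed

text \<open>
 The radii are at least \<open>\<delta>\<close>, so the neighbourhood of a point lies in a dilate of the neighbourhood of any
 centre at distance less than \<open>\<delta>\<close>. Hence the selection can be made among the points of a finite \<open>\<delta>\<close>-net.
\<close>

lemma vitali_nbhd:
 fixes \<Omega> :: "(complex^'n::finite) set"
 assumes \<Omega>: "\<Omega> \<subseteq> unit_ball" and \<delta>: "0 < \<delta>" "\<forall>x\<in>\<Omega>. \<delta> <= rad x"
 shows "\<exists>G\<subseteq>\<Omega>. finite G \<and> disjoint_family_on (nbhd bb) G \<and>
  (\<forall>x\<in>\<Omega>. \<exists>y\<in>G. nbhd bb x \<subseteq> nbhd (21*bb) y)"
proof -
 have comp: "compact (closure \<Omega>)"
  using bounded_subset[OF bounded_ball \<Omega>] by (simp add: compact_closure)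
 have cov: "closure \<Omega> \<subseteq> (\<Union>x\<in>\<Omega>. ball x \<delta>)"
 proof
  fix y assume "y \<in> closure \<Omega>"
  then obtain x where "x \<in> \<Omega>" "dist x y < \<delta>"
   using \<delta>(1) by (auto simp: closure_approachable)
  thus "y \<in> (\<Union>x\<in>\<Omega>. ball x \<delta>)" by auto
 qed
 obtain F where F: "F \<subseteq> \<Omega>" "finite F" "closure \<Omega> \<subseteq> (\<Union>x\<in>F. ball x \<delta>)"
  by (rule compactE_image[OF comp _ cov]) simp
 have ne: "nbhd bb x \<noteq> {}" if "x \<in> F" for x
  using mem_nbhd_self[of x bb] that F(1) \<Omega> by (auto simp: bb_def)
 have "\<exists>G\<subseteq>F. disjoint_family_on (nbhd bb) G \<and>
   (\<forall>x\<in>F. \<exists>y\<in>G. nbhd bb x \<inter> nbhd bb y \<noteq> {} \<and> rad x <= rad y)"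
  by (rule finite_vitali[OF F(2)]) (rule ne)
 then obtain G where G: "G \<subseteq> F" "disjoint_family_on (nbhd bb) G"
  "\<forall>x\<in>F. \<exists>y\<in>G. nbhd bb x \<inter> nbhd bb y \<noteq> {} \<and> rad x <= rad y"
  by (elim exE conjE) (rule that)
 show ?thesis
 proof (intro exI[of _ G] conjI ballI)
  show "finite G" by (rule finite_subset[OF G(1) F(2)])
  show "G \<subseteq> \<Omega>" using G(1) F(1) by (rule subset_trans)
  show "disjoint_family_on (nbhd bb) G" by (rule G(2))
  fix x assume x: "x \<in> \<Omega>"
  hence xb: "x \<in> unit_ball" using \<Omega> by blast
  have "x \<in> closure \<Omega>" using x closure_subset by blast
  then obtain x0 where x0: "x0 \<in> F" "dist x0 x < \<delta>" using F(3) by auto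
  have x0\<Omega>: "x0 \<in> \<Omega>" using F(1) x0(1) by (rule subsetD)
  have x0b: "x0 \<in> unit_ball" and x0r: "\<delta> <= rad x0"
   using subsetD[OF \<Omega> x0\<Omega>] bspec[OF \<delta>(2) x0\<Omega>] by simp_all
  have rx: "rad x <= 2*rad x0"
  proof -
   have "norm x0 - norm x <= norm (x0 - x)" by (rule norm_triangle_ineq2)
   thus ?thesis using x0(2) x0r unfolding rad_def dist_norm by argo
  qed
  have h0: "hdist x0 x <= 3*rad x0"
  proof -
   have "norm x0 <= 1" using x0b by simp
   hence "\<bar>hdist x0 x - hdist x0 x0\<bar> <= norm (x0 - x)" "hdist x0 x0 <= 2*rad x0"
    using hdist_diff_le[of x0 x x0] hdist_self_le[of x0] by (simp_all add: rad_def norm_minus_commute)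
   thus ?thesis using x0(2) x0r unfolding dist_norm abs_le_iff by argo
  qed
  obtain y where y: "y \<in> G" "rad x0 <= rad y" and meet: "nbhd bb x0 \<inter> nbhd bb y \<noteq> {}"
   using bspec[OF G(3) x0(1)] by auto
  obtain v where v: "v \<in> nbhd bb x0" "v \<in> nbhd bb y" using meet by auto
  have yb: "y \<in> unit_ball" by (rule subsetD[OF \<Omega> subsetD[OF F(1) subsetD[OF G(1) y(1)]]])
  have vb: "v \<in> unit_ball" "hdist x0 v < 512*rad x0" "hdist y v < 512*rad y"
   using v by (auto simp: nbhd_def bb_def)
  have yx0: "hdist y x0 <= 2048*rad y"
   using hdist_triangle_ball[OF yb vb(1) x0b] vb(2,3) y(2) unfolding hdist_commute[of v x0] by argo
  have yx: "hdist y x <= 4102*rad y" using hdist_triangle_ball[OF yb x0b xb] yx0 h0 y(2) by argo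
  have "nbhd bb x \<subseteq> nbhd (21*bb) y"
  proof
   fix w assume "w \<in> nbhd bb x"
   hence w: "w \<in> unit_ball" "hdist x w < 512*rad x" by (auto simp: nbhd_def bb_def)
   have "hdist y w <= 2*(hdist y x + hdist x w)" by (rule hdist_triangle_ball[OF yb xb w(1)])
   hence "hdist y w < 10752*rad y" using w(2) yx rx y(2) rad_pos[OF yb] by argo
   thus "w \<in> nbhd (21*bb) y" using w(1) by (simp add: nbhd_def bb_def)
  qed
  thus "\<exists>y\<in>G. nbhd bb x \<subseteq> nbhd (21*bb) y" using y(1) by blast
 qed
qed

definition wt :: "complex^'n => ennreal" where
 "wt x = ennreal (1/rad x^(CARD('n) + 1))"

lemma measurable_wt [measurable]: "wt \<in> borel_measurable borel"
 unfolding wt_def by measurable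

lemma measurable_wt_vol [measurable]: "wt \<in> meas"
 using measurable_compose[OF measurable_ident_vol_borel measurable_wt] .

text \<open>
 The measure \<open>wt * mass * vol\<close> on the set of centres takes the place of \<open>S\<close> in the harmonic analysis below:
 averages map functions on the ball with the measure \<open>S\<close> to functions on the set of centres, and
 superpositions map in the other direction. The two maps are dual to each other.
\<close>

locale doubling_measure =
 fixes S :: "(complex^'n::finite) measure"
 assumes sets_S: "sets S = sets vol"
  and emeasure_finite': "emeasure S unit_ball \<noteq> \<infinity>"
  and doubling: "\<And>b. \<exists>C. \<forall>x\<in>unit_ball. emeasure S (nbhd b x) <= ennreal C*emeasure S (core x)"
  and core_pos: "\<And>x. x \<in> unit_ball ==> 0 < emeasure S (core x)"
begin

lemma space_S [simp]: "space S = unit_ball"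
 using sets_eq_imp_space_eq[OF sets_S] by simp

sublocale finite_measure S using emeasure_finite' by (intro finite_measureI) simp

lemma emeasure_S_less_top [simp]: "emeasure S A < \<top>"
 using emeasure_finite[of A] unfolding less_top .

lemma sigma_finite_S: "sigma_finite_measure S"
 ..

sublocale pair_sigma_finite vol S ..

definition mass :: "complex^'n => ennreal" where
 "mass x = emeasure S (nbhd bb x)"

definition av :: "(complex^'n => ennreal) => complex^'n => ennreal" where
 "av \<phi> x = (\<integral>\<^sup>+w. \<phi> w*indicator (nbhd bb x) w \<partial>S)/mass x"

lemma sets_nbhd_S [measurable]: "nbhd b x \<in> sets S" "core x \<in> sets S"
 by (simp_all add: sets_S)

lemma measurable_indicator_vol_S [measurable]:
 "(\<lambda>p. indicator (nbhd b (fst p)) (snd p) :: ennreal) \<in> borel_measurable (vol \<Otimes>\<^sub>M S)"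
 "(\<lambda>p. indicator (core (fst p)) (snd p) :: ennreal) \<in> borel_measurable (vol \<Otimes>\<^sub>M S)"
 by (rule borel_measurable_indicator_nbhd[OF refl sets_S])+

lemma measurable_mass [measurable]: "mass \<in> meas"
proof -
 have "mass = (\<lambda>x. \<integral>\<^sup>+w. indicator (nbhd bb x) w \<partial>S)"
  by (simp add: mass_def fun_eq_iff)
 also have "... \<in> meas"
  by (rule sigma_finite_measure.borel_measurable_nn_integral[OF sigma_finite_S, of "\<lambda>x w. indicator (nbhd bb x) w"]) measurable
 finally show ?thesis .
qed

lemma measurable_av [measurable]:
 assumes [measurable]: "\<phi> \<in> borel_measurable S"
 shows "av \<phi> \<in> meas"
proof -
 have "(\<lambda>x. \<integral>\<^sup>+w. \<phi> w*indicator (nbhd bb x) w \<partial>S) \<in> meas"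
  by (rule sigma_finite_measure.borel_measurable_nn_integral[OF sigma_finite_S, of "\<lambda>x w. \<phi> w*indicator (nbhd bb x) w"]) measurable
 thus ?thesis unfolding av_def[abs_def] by measurable
qed

lemma core_le_mass: "x \<in> unit_ball ==> emeasure S (core x) <= mass x"
 unfolding mass_def by (intro emeasure_mono core_subset_nbhd) (auto simp: bb_def)

lemma mass_pos: "x \<in> unit_ball ==> 0 < mass x"
 using core_le_mass core_pos by (metis order_less_le_trans)

lemma mass_less_top: "mass x < \<top>"
 unfolding mass_def using emeasure_finite less_top by blast

lemma av_mass: "x \<in> unit_ball ==> av \<phi> x*mass x = (\<integral>\<^sup>+w. \<phi> w*indicator (nbhd bb x) w \<partial>S)"
 unfolding av_def using mass_pos[of x] mass_less_top[of x]
 by (simp add: ennreal_divide_times ennreal_divide_self)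

lemma doubling_mass:
 obtains C where "0 <= C" "\<And>x. x \<in> unit_ball ==> emeasure S (nbhd b x) <= ennreal C*mass x"
proof -
 obtain C where C: "\<forall>x\<in>unit_ball. emeasure S (nbhd b x) <= ennreal C*emeasure S (core x)"
  using doubling by blast
 show ?thesis
 proof
  fix x :: "complex^'n" assume x: "x \<in> unit_ball"
  have "emeasure S (nbhd b x) <= ennreal C*emeasure S (core x)" using C x by blast
  also have "... <= ennreal (max C 0)*mass x"
   by (intro mult_mono core_le_mass x ennreal_leI) auto
  finally show "emeasure S (nbhd b x) <= ennreal (max C 0)*mass x" .
 qed simp
qed

text \<open>
 By doubling, \<open>mass x\<close> may be replaced by the measure of the core of \<open>x\<close>. After an interchange of the
 integrals it remains to integrate \<open>wt\<close> over the points \<open>x\<close> whose core contains a given \<open>v\<close>, and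
 these have radius comparable with that of \<open>v\<close>.
\<close>

lemma wt_mass_nbhd_le:
 obtains C where "0 <= C" "\<And>y. y \<in> unit_ball ==>
  (\<integral>\<^sub>+x. wt x*mass x*indicator (nbhd b y) x) <= ennreal C*mass y"
proof -
 let ?N = "CARD('n) + 1"
 define b' where "b' = max b 1"
 obtain D where D: "\<forall>x\<in>unit_ball. emeasure S (nbhd bb x) <= ennreal D*emeasure S (core x)"
  using doubling by blast
 obtain E where E: "0 <= E" "\<And>x. x \<in> unit_ball ==> emeasure S (nbhd (34*b') x) <= ennreal E*mass x"
  using doubling_mass[of "34*b'"] by blast
 obtain V where V: "0 < V" "\<And>x :: complex^'n. x \<in> unit_ball ==> emeasure vol (nbhd 16 x) <= ennreal (V * rad x^?N)"
  using emeasure_nbhd_le[where ?'n = 'n, of 16] by blast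
 define K where "K = 16^?N*V"
 have K: "0 < K" using V by (simp add: K_def)
 show ?thesis
 proof
  show "0 <= max D 0*(K*E)" using K E by simp
  fix y :: "complex^'n" assume y: "y \<in> unit_ball"
  have inner: "(\<integral>\<^sub>+x. wt x*indicator (nbhd b y) x*indicator (core x) v)
    <= ennreal K*indicator (nbhd (34*b') y) v" if v: "v \<in> unit_ball" for v
  proof -
   have "(\<integral>\<^sub>+x. wt x*indicator (nbhd b y) x*indicator (core x) v)
     <= (\<integral>\<^sub>+x. (ennreal (16^?N/rad v ^ ?N)*indicator (nbhd (34*b') y) v)*indicator (nbhd 16 v) x)"
   proof (rule nn_integral_mono)
    fix x :: "complex^'n" assume "x \<in> space vol"
    hence xb: "x \<in> unit_ball" by simp
    show "wt x*indicator (nbhd b y) x*indicator (core x) v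
      <= (ennreal (16^?N/rad v ^ ?N)*indicator (nbhd (34*b') y) v)*indicator (nbhd 16 v) x"
    proof (cases "x \<in> nbhd b y \<and> v \<in> core x")
     case True
     hence h: "hdist y x < b*rad y" "hdist x v < 16*rad x" "hdist x v < 16*rad v"
      by (auto simp: nbhd_def core_def)
     have rv: "rad v <= 16*rad x" using rad_le_hdist(2)[OF xb v] h(2) by simp
     have hyx: "hdist y x < b'*rad y"
     proof -
      have "b*rad y <= b'*rad y" using y by (intro mult_right_mono) (auto simp: b'_def)
      with h(1) show ?thesis by (rule order_less_le_trans)
     qed
     have rx: "rad x <= b'*rad y" using rad_le_hdist(2)[OF y xb] hyx by simp
     have "hdist y v <= 2*(hdist y x + hdist x v)" by (rule hdist_triangle_ball[OF y xb v])
     also have "... < 2*(b'*rad y + 16*(b'*rad y))" using hyx h(2) rx by simp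
     finally have 1: "v \<in> nbhd (34*b') y" using v by (simp add: nbhd_def)
     have 2: "x \<in> nbhd 16 v" using h(3) xb by (simp add: nbhd_def hdist_commute)
     have "1/rad x^?N <= 16^?N/rad v ^ ?N"
     proof -
      have "rad v ^ ?N <= (16*rad x)^?N" using rv v by (intro power_mono) auto
      moreover have "0 < rad v ^ ?N" "0 < rad x^?N" using rad_pos[OF v] rad_pos[OF xb] by simp_all
      ultimately show ?thesis unfolding power_mult_distrib by (simp add: divide_simps)
     qed
     with 1 2 True show ?thesis by (simp add: wt_def ennreal_leI)
    next
     case False
     hence "indicator (nbhd b y) x*indicator (core x) v = (0 :: ennreal)"
      by (auto simp: indicator_def)
     thus ?thesis by (simp only: mult.assoc mult_zero_right zero_le)
    qed
   qed
   also have "... = (ennreal (16^?N/rad v ^ ?N)*indicator (nbhd (34*b') y) v)*emeasure vol (nbhd 16 v)"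
    by (simp add: nn_integral_cmult)
   also have "... <= (ennreal (16^?N/rad v ^ ?N)*indicator (nbhd (34*b') y) v)*ennreal (V * rad v ^ ?N)"
    by (intro mult_left_mono V(2) v) simp
   also have "... = (ennreal (16^?N/rad v ^ ?N)*ennreal (V * rad v ^ ?N))*indicator (nbhd (34*b') y) v"
    by (simp only: mult_ac)
   also have "ennreal (16^?N/rad v ^ ?N)*ennreal (V * rad v ^ ?N) = ennreal (16^?N/rad v ^ ?N*(V * rad v ^ ?N))"
    using rad_pos[OF v] V(1) by (intro ennreal_mult[symmetric]) auto
   also have "16^?N/rad v ^ ?N*(V * rad v ^ ?N) = K" using rad_pos[OF v] by (simp add: K_def)
   finally show ?thesis .
  qed
  have "(\<integral>\<^sub>+x. wt x*mass x*indicator (nbhd b y) x)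
    <= (\<integral>\<^sub>+x. ennreal (max D 0)*(\<integral>\<^sup>+v. wt x*indicator (nbhd b y) x*indicator (core x) v \<partial>S))"
  proof (rule nn_integral_mono)
   fix x :: "complex^'n" assume "x \<in> space vol"
   hence xb: "x \<in> unit_ball" by simp
   have "mass x <= ennreal D*emeasure S (core x)" using D xb by (simp add: mass_def)
   also have "... <= ennreal (max D 0)*emeasure S (core x)"
    by (intro mult_right_mono ennreal_leI) auto
   finally have "wt x*mass x*indicator (nbhd b y) x
     <= wt x*(ennreal (max D 0)*emeasure S (core x))*indicator (nbhd b y) x"
    by (intro mult_right_mono mult_left_mono) auto
   also have "... = ennreal (max D 0)*(wt x*indicator (nbhd b y) x*emeasure S (core x))"
    by (simp only: mult_ac)
   also have "... = ennreal (max D 0)*(\<integral>\<^sup>+v. wt x*indicator (nbhd b y) x*indicator (core x) v \<partial>S)"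
    by (simp add: nn_integral_cmult)
   finally show "wt x*mass x*indicator (nbhd b y) x
     <= ennreal (max D 0)*(\<integral>\<^sup>+v. wt x*indicator (nbhd b y) x*indicator (core x) v \<partial>S)" .
  qed
  also have "... = ennreal (max D 0)*(\<integral>\<^sub>+x. (\<integral>\<^sup>+v. wt x*indicator (nbhd b y) x*indicator (core x) v \<partial>S))"
   by (rule nn_integral_cmult, rule sigma_finite_measure.borel_measurable_nn_integral[OF sigma_finite_S, of "\<lambda>x v. wt x*indicator (nbhd b y) x*indicator (core x) v"]) measurable
  also have "(\<integral>\<^sub>+x. (\<integral>\<^sup>+v. wt x*indicator (nbhd b y) x*indicator (core x) v \<partial>S))
    = (\<integral>\<^sup>+v. (\<integral>\<^sub>+x. wt x*indicator (nbhd b y) x*indicator (core x) v) \<partial>S)"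
   by (rule Fubini'[symmetric]) measurable
  also have "... <= (\<integral>\<^sup>+v. ennreal K*indicator (nbhd (34*b') y) v \<partial>S)"
   by (intro nn_integral_mono inner) simp
  also have "... = ennreal K*emeasure S (nbhd (34*b') y)" by (simp add: nn_integral_cmult)
  also have "... <= ennreal K*(ennreal E*mass y)" by (intro mult_left_mono E y) simp
  also have "ennreal (max D 0)*(ennreal K*(ennreal E*mass y)) = ennreal (max D 0*(K*E))*mass y"
   using K E(1) by (simp add: ennreal_mult mult.assoc)
  finally show "(\<integral>\<^sub>+x. wt x*mass x*indicator (nbhd b y) x) <= ennreal (max D 0*(K*E))*mass y"
   by (simp add: mult_left_mono)
 qed
qed

lemma sum_mass_le:
 assumes G: "finite G" "disjoint_family_on (nbhd bb) G"
  and t: "0 < t" "\<And>y. y \<in> G ==> y \<in> unit_ball \<and> ennreal t < av \<phi> y"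
  and [measurable]: "\<phi> \<in> borel_measurable S"
 shows "(\<Sum>y\<in>G. mass y) <= ennreal (1/t)*(\<integral>\<^sup>+w. \<phi> w \<partial>S)"
proof -
 have "(\<Sum>y\<in>G. mass y) = (\<Sum>y\<in>G. ennreal (1/t)*(ennreal t*mass y))"
  using t(1) by (simp add: mult.assoc[symmetric] ennreal_mult[symmetric])
 also have "... <= (\<Sum>y\<in>G. ennreal (1/t)*(av \<phi> y*mass y))"
  using t(2) by (intro sum_mono mult_left_mono mult_right_mono) (auto intro: less_imp_le)
 also have "... = (\<Sum>y\<in>G. ennreal (1/t)*(\<integral>\<^sup>+w. \<phi> w*indicator (nbhd bb y) w \<partial>S))"
  using t(2) by (intro sum.cong refl) (simp add: av_mass)
 also have "... = ennreal (1/t)*(\<Sum>y\<in>G. \<integral>\<^sup>+w. \<phi> w*indicator (nbhd bb y) w \<partial>S)"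
  by (rule sum_distrib_left[symmetric])
 also have "(\<Sum>y\<in>G. \<integral>\<^sup>+w. \<phi> w*indicator (nbhd bb y) w \<partial>S) = (\<integral>\<^sup>+w. (\<Sum>y\<in>G. \<phi> w*indicator (nbhd bb y) w) \<partial>S)"
  by (rule nn_integral_sum[symmetric]) measurable
 also have "... = (\<integral>\<^sup>+w. \<phi> w*indicator (\<Union>y\<in>G. nbhd bb y) w \<partial>S)"
  by (simp add: indicator_UN_disjoint[OF G] sum_distrib_left)
 also have "... <= (\<integral>\<^sup>+w. \<phi> w \<partial>S)"
  by (intro nn_integral_mono) (auto simp: indicator_def)
 finally show ?thesis by (simp add: mult_left_mono)
qed

text \<open>
 The weak type inequality for \<open>av\<close>, by the covering lemma, in two forms: for the measure with density
 \<open>wt * mass\<close> on the set of centres, and for \<open>S\<close> on the union of the neighbourhoods.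
\<close>

lemma weak_type:
 "\<exists>C>0. \<forall>\<phi>\<in>borel_measurable S. \<forall>t>0.
   (\<integral>\<^sub>+x. wt x*mass x*indicator {x \<in> unit_ball. ennreal t < av \<phi> x} x)
    <= ennreal (C/t)*(\<integral>\<^sup>+w. \<phi> w \<partial>S) \<and>
   emeasure S (\<Union>x\<in>{x \<in> unit_ball. ennreal t < av \<phi> x}. nbhd bb x)
    <= ennreal (C/t)*(\<integral>\<^sup>+w. \<phi> w \<partial>S)"
proof -
 obtain C1 where C1: "0 <= C1" "\<And>y. y \<in> unit_ball ==>
  (\<integral>\<^sub>+x. wt x*mass x*indicator (nbhd (21*bb) y) x) <= ennreal C1*mass y"
  using wt_mass_nbhd_le[of "21*bb"] by blast
 obtain C2 where C2: "0 <= C2" "\<And>x. x \<in> unit_ball ==> emeasure S (nbhd (21*bb) x) <= ennreal C2*mass x"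
  using doubling_mass[of "21*bb"] by blast
 define C where "C = C1 + C2 + 1"
 have C: "0 < C" "C1 <= C" "C2 <= C" using C1 C2 by (simp_all add: C_def)
 define \<mu> where "\<mu> = density vol (\<lambda>x. wt x*mass x)"
 have sets_\<mu>: "sets \<mu> = sets vol" by (simp add: \<mu>_def)
 have \<mu>: "emeasure \<mu> A = (\<integral>\<^sub>+x. wt x*mass x*indicator A x)" if "A \<in> sets vol" for A
  using that unfolding \<mu>_def by (intro emeasure_density) measurable
 show ?thesis
 proof (intro exI[of _ C] conjI ballI allI impI)
  show "0 < C" by fact
 next
  fix \<phi> :: "complex^'n => ennreal" and t :: real
  assume \<phi> [measurable]: "\<phi> \<in> borel_measurable S" and t: "0 < t"
  define \<Omega> where "\<Omega> = {x \<in> unit_ball. ennreal t < av \<phi> x}"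
  define \<Omega>' where "\<Omega>' m = {x \<in> \<Omega>. 1/real (Suc m) <= rad x}" for m
  define I where "I = (\<integral>\<^sup>+w. \<phi> w \<partial>S)"
  have cover: "\<exists>G. finite G \<and> G \<subseteq> unit_ball \<and> (\<Sum>y\<in>G. mass y) <= ennreal (1/t)*I
    \<and> (\<forall>x\<in>\<Omega>' m. \<exists>y\<in>G. nbhd bb x \<subseteq> nbhd (21*bb) y)" for m
  proof -
   have "\<Omega>' m \<subseteq> unit_ball" "0 < 1/real (Suc m)" "\<forall>x\<in>\<Omega>' m. 1/real (Suc m) <= rad x"
    by (auto simp: \<Omega>'_def \<Omega>_def)
   from vitali_nbhd[OF this] obtain G where G: "finite G" "G \<subseteq> \<Omega>' m" "disjoint_family_on (nbhd bb) G"
    "\<forall>x\<in>\<Omega>' m. \<exists>y\<in>G. nbhd bb x \<subseteq> nbhd (21*bb) y"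
    by (elim exE conjE) (rule that)
   have "(\<Sum>y\<in>G. mass y) <= ennreal (1/t)*I"
    unfolding I_def
    by (rule sum_mass_le[OF G(1,3) t]) (use G(2) in \<open>auto simp: \<Omega>'_def \<Omega>_def\<close>)
   moreover have "G \<subseteq> unit_ball" using G(2) by (auto simp: \<Omega>'_def \<Omega>_def)
   ultimately show ?thesis using G(1,4) by blast
  qed
  have inc: "incseq \<Omega>'"
  proof (rule incseq_SucI)
   fix m
   have "1/real (Suc (Suc m)) <= 1/real (Suc m)" by (intro divide_left_mono) auto
   thus "\<Omega>' m \<subseteq> \<Omega>' (Suc m)"
    by (auto simp: \<Omega>'_def simp del: of_nat_Suc)
  qed
  have un: "(\<Union>m. \<Omega>' m) = \<Omega>"
  proof -
   have "\<exists>m. x \<in> \<Omega>' m" if x: "x \<in> \<Omega>" for x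
   proof -
    have "0 < rad x" using x by (intro rad_pos) (auto simp: \<Omega>_def)
    then obtain m where "inverse (real (Suc m)) < rad x" using reals_Archimedean by blast
    thus ?thesis using x by (intro exI[of _ m]) (auto simp: \<Omega>'_def inverse_eq_divide)
   qed
   thus ?thesis by (auto simp: \<Omega>'_def)
  qed
  have \<Omega>'_sets: "\<Omega>' m \<in> sets vol" for m
  proof -
   have "\<Omega>' m = {x \<in> space vol. ennreal t < av \<phi> x \<and> 1/real (Suc m) <= rad x}"
    by (auto simp: \<Omega>'_def \<Omega>_def)
   also have "... \<in> sets vol" by measurable
   finally show ?thesis .
  qed
  have \<Omega>_sets: "\<Omega> \<in> sets vol"
   unfolding un[symmetric] using \<Omega>'_sets by (intro sets.countable_UN) auto
  have mass_bound: "ennreal c*(\<Sum>y\<in>G. mass y) <= ennreal (C/t)*I"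
   if "(\<Sum>y\<in>G. mass y) <= ennreal (1/t)*I" "c <= C" for c G
  proof -
   have "ennreal c*(\<Sum>y\<in>G. mass y) <= ennreal C*(ennreal (1/t)*I)"
    using that by (intro mult_mono ennreal_leI) auto
   also have "... = ennreal (C/t)*I"
    using t C(1) by (simp add: mult.assoc[symmetric] ennreal_mult[symmetric])
   finally show ?thesis .
  qed
  have "emeasure \<mu> (\<Omega>' m) <= ennreal (C/t)*I" for m
  proof -
   obtain G where G: "finite G" "G \<subseteq> unit_ball" "(\<Sum>y\<in>G. mass y) <= ennreal (1/t)*I"
    "\<forall>x\<in>\<Omega>' m. \<exists>y\<in>G. nbhd bb x \<subseteq> nbhd (21*bb) y"
    using cover[of m] by (elim exE conjE) (rule that)
   have "\<Omega>' m \<subseteq> (\<Union>y\<in>G. nbhd (21*bb) y)"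
   proof
    fix x assume x: "x \<in> \<Omega>' m"
    hence "x \<in> nbhd bb x"
     by (intro mem_nbhd_self) (auto simp: \<Omega>'_def \<Omega>_def bb_def)
    thus "x \<in> (\<Union>y\<in>G. nbhd (21*bb) y)" using G(4) x by blast
   qed
   hence "emeasure \<mu> (\<Omega>' m) <= emeasure \<mu> (\<Union>y\<in>G. nbhd (21*bb) y)"
    using G(1) by (intro emeasure_mono) (auto simp: sets_\<mu>)
   also have "... <= (\<Sum>y\<in>G. emeasure \<mu> (nbhd (21*bb) y))"
    using G(1) by (intro emeasure_subadditive_finite) (auto simp: sets_\<mu>)
   also have "... <= (\<Sum>y\<in>G. ennreal C1*mass y)"
    using G(2) by (intro sum_mono) (auto simp: \<mu> intro!: C1(2))
   also have "... = ennreal C1*(\<Sum>y\<in>G. mass y)" by (rule sum_distrib_left[symmetric])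
   also have "... <= ennreal (C/t)*I" by (rule mass_bound[OF G(3) C(2)])
   finally show ?thesis .
  qed
  hence "(SUP m. emeasure \<mu> (\<Omega>' m)) <= ennreal (C/t)*I" by (rule SUP_least)
  also have "(SUP m. emeasure \<mu> (\<Omega>' m)) = emeasure \<mu> \<Omega>"
   unfolding un[symmetric] using \<Omega>'_sets by (intro SUP_emeasure_incseq inc) (auto simp: sets_\<mu>)
  also have "emeasure \<mu> \<Omega> = (\<integral>\<^sub>+x. wt x*mass x*indicator \<Omega> x)"
   by (rule \<mu>[OF \<Omega>_sets])
  finally show "(\<integral>\<^sub>+x. wt x*mass x*indicator {x \<in> unit_ball. ennreal t < av \<phi> x} x)
    <= ennreal (C/t)*(\<integral>\<^sup>+w. \<phi> w \<partial>S)"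
   unfolding I_def \<Omega>_def .
  define O' where "O' m = (\<Union>x\<in>\<Omega>' m. nbhd bb x)" for m
  have O'_sets: "O' m \<in> sets S" for m
   unfolding sets_S O'_def
   by (intro borel_subset_sets_vol borel_open open_UN ballI open_nbhd) (auto simp: nbhd_def)
  have "emeasure S (O' m) <= ennreal (C/t)*I" for m
  proof -
   obtain G where G: "finite G" "G \<subseteq> unit_ball" "(\<Sum>y\<in>G. mass y) <= ennreal (1/t)*I"
    "\<forall>x\<in>\<Omega>' m. \<exists>y\<in>G. nbhd bb x \<subseteq> nbhd (21*bb) y"
    using cover[of m] by (elim exE conjE) (rule that)
   have "O' m \<subseteq> (\<Union>y\<in>G. nbhd (21*bb) y)" unfolding O'_def using G(4) by blast
   hence "emeasure S (O' m) <= emeasure S (\<Union>y\<in>G. nbhd (21*bb) y)"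
    using G(1) by (intro emeasure_mono) (auto simp: sets_S)
   also have "... <= (\<Sum>y\<in>G. emeasure S (nbhd (21*bb) y))"
    using G(1) by (intro emeasure_subadditive_finite) (auto simp: sets_S)
   also have "... <= (\<Sum>y\<in>G. ennreal C2*mass y)"
    using G(2) by (intro sum_mono C2(2)) auto
   also have "... = ennreal C2*(\<Sum>y\<in>G. mass y)" by (rule sum_distrib_left[symmetric])
   also have "... <= ennreal (C/t)*I" by (rule mass_bound[OF G(3) C(3)])
   finally show ?thesis .
  qed
  hence "(SUP m. emeasure S (O' m)) <= ennreal (C/t)*I" by (rule SUP_least)
  also have "(SUP m. emeasure S (O' m)) = emeasure S (\<Union>m. O' m)"
  proof (rule SUP_emeasure_incseq)
   show "range O' \<subseteq> sets S" using O'_sets by auto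
   show "incseq O'" unfolding O'_def using inc by (intro monoI UN_mono) (auto dest: monoD)
  qed
  also have "(\<Union>m. O' m) = (\<Union>x\<in>\<Omega>. nbhd bb x)"
   unfolding O'_def un[symmetric] by blast
  finally show "emeasure S (\<Union>x\<in>{x \<in> unit_ball. ennreal t < av \<phi> x}. nbhd bb x)
    <= ennreal (C/t)*(\<integral>\<^sup>+w. \<phi> w \<partial>S)"
   unfolding I_def \<Omega>_def .
 qed
qed

text \<open>
 Marcinkiewicz interpolation between the weak type inequality and the trivial bound on bounded functions.
\<close>

lemma av_strong_type:
 assumes p: "1 < p"
 shows "\<exists>C>0. \<forall>\<phi>\<in>borel_measurable S. (\<forall>w. 0 <= \<phi> w) -->
  (\<integral>\<^sub>+x. wt x*mass x*epowr (av (\<lambda>w. ennreal (\<phi> w)) x) p)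
   <= ennreal C*(\<integral>\<^sup>+w. ennreal (\<phi> w powr p) \<partial>S)"
proof -
 obtain C0 where C0: "0 < C0" and weak: "\<forall>\<phi>\<in>borel_measurable S. \<forall>t>0.
   (\<integral>\<^sub>+x. wt x*mass x*indicator {x \<in> unit_ball. ennreal t < av \<phi> x} x)
    <= ennreal (C0/t)*(\<integral>\<^sup>+w. \<phi> w \<partial>S) \<and>
   emeasure S (\<Union>x\<in>{x \<in> unit_ball. ennreal t < av \<phi> x}. nbhd bb x)
    <= ennreal (C0/t)*(\<integral>\<^sup>+w. \<phi> w \<partial>S)"
  using weak_type by (elim exE conjE) (rule that)
 define C where "C = p*(2*C0*2 powr (p - 1)/(p - 1))"
 have C: "0 < C" using C0 p by (simp add: C_def)
 show ?thesis
 proof (intro exI[of _ C] conjI ballI allI impI)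
  show "0 < C" by fact
 next
  fix \<phi> :: "complex^'n => real"
  assume \<phi>_meas: "\<phi> \<in> borel_measurable S" and "\<forall>w. 0 <= \<phi> w"
  hence nn: "0 <= \<phi> w" for w by blast
  note [measurable] = \<phi>_meas
  define f where "f = (\<lambda>w. ennreal (\<phi> w))"
  have f [measurable]: "f \<in> borel_measurable S" unfolding f_def by measurable
  define R where "R = (\<integral>\<^sup>+w. ennreal (\<phi> w powr p) \<partial>S)"
  show "(\<integral>\<^sub>+x. wt x*mass x*epowr (av (\<lambda>w. ennreal (\<phi> w)) x) p)
   <= ennreal C*(\<integral>\<^sup>+w. ennreal (\<phi> w powr p) \<partial>S)"
  proof (cases "R = \<top>")
   case True
   thus ?thesis using C by (simp add: R_def ennreal_mult_top)
  next
   case False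
   interpret L: pair_sigma_finite vol "lborel :: real measure" ..
   interpret LS: pair_sigma_finite S "lborel :: real measure" ..
   have fin: "av f x < \<top>" if x: "x \<in> unit_ball" for x
   proof -
    have "(\<integral>\<^sup>+w. f w*indicator (nbhd bb x) w \<partial>S) <= (\<integral>\<^sup>+w. 1 + ennreal (\<phi> w powr p) \<partial>S)"
    proof (rule nn_integral_mono)
     fix w
     have "\<phi> w <= 1 + \<phi> w powr p"
     proof (cases "\<phi> w <= 1")
      case False
      hence "\<phi> w powr 1 <= \<phi> w powr p" using p by (intro powr_mono) auto
      thus ?thesis using False by simp
     qed (simp add: add_increasing2)
     hence "f w <= 1 + ennreal (\<phi> w powr p)"
      unfolding f_def by (metis ennreal_1 ennreal_leI ennreal_plus powr_ge_zero zero_le_one)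
     thus "f w*indicator (nbhd bb x) w <= 1 + ennreal (\<phi> w powr p)"
      by (simp add: indicator_def)
    qed
    also have "... = emeasure S (space S) + R" by (subst nn_integral_add) (auto simp: R_def)
    also have "... < \<top>" using False by (simp add: less_top)
    finally have "(\<integral>\<^sup>+w. f w*indicator (nbhd bb x) w \<partial>S) < \<top>" .
    thus ?thesis
     unfolding av_def using mass_pos[OF x] by (auto simp: ennreal_divide_eq_top_iff less_top[symmetric])
   qed
   define L where "L t = (\<integral>\<^sub>+x. wt x*mass x*(if ennreal t < av f x then 1 else 0))" for t
   have lay: "epowr (av f x) p = (\<integral>\<^sup>+t. ennreal p*(ennreal (t powr (p - 1))*indicator {0<..} t)*(if ennreal t < av f x then 1 else 0) \<partial>lborel)"
    if x: "x \<in> unit_ball" for x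
   proof -
    obtain r where r: "av f x = ennreal r" "0 <= r" using fin[OF x] by (cases "av f x") auto
    have "epowr (av f x) p = ennreal p*ennreal (r powr (p - 1 + 1)/(p - 1 + 1))"
     using r p by (simp add: ennreal_mult[symmetric])
    also have "ennreal (r powr (p - 1 + 1)/(p - 1 + 1)) = (\<integral>\<^sup>+t. ennreal (t powr (p - 1))*indicator {0<..<r} t \<partial>lborel)"
     using p r by (intro nn_integral_powr_Ioo[symmetric]) auto
    also have "ennreal p*... = (\<integral>\<^sup>+t. ennreal p*(ennreal (t powr (p - 1))*indicator {0<..<r} t) \<partial>lborel)"
     by (rule nn_integral_cmult[symmetric]) measurable
    also have "... = (\<integral>\<^sup>+t. ennreal p*(ennreal (t powr (p - 1))*indicator {0<..} t)*(if ennreal t < av f x then 1 else 0) \<partial>lborel)"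
     by (rule nn_integral_cong) (auto simp: r indicator_def ennreal_less_iff)
    finally show ?thesis .
   qed
   have "(\<integral>\<^sub>+x. wt x*mass x*epowr (av f x) p)
     = (\<integral>\<^sub>+x. (\<integral>\<^sup>+t. wt x*mass x*(ennreal p*(ennreal (t powr (p - 1))*indicator {0<..} t)*(if ennreal t < av f x then 1 else 0)) \<partial>lborel))"
   proof (rule nn_integral_cong)
    fix x :: "complex^'n" assume "x \<in> space vol"
    hence x: "x \<in> unit_ball" by simp
    show "wt x*mass x*epowr (av f x) p
      = (\<integral>\<^sup>+t. wt x*mass x*(ennreal p*(ennreal (t powr (p - 1))*indicator {0<..} t)*(if ennreal t < av f x then 1 else 0)) \<partial>lborel)"
     unfolding lay[OF x] by (rule nn_integral_cmult[symmetric]) measurable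
   qed
   also have "... = (\<integral>\<^sup>+t. (\<integral>\<^sub>+x. wt x*mass x*(ennreal p*(ennreal (t powr (p - 1))*indicator {0<..} t)*(if ennreal t < av f x then 1 else 0))) \<partial>lborel)"
    by (rule L.Fubini'[symmetric]) measurable
   also have "... = (\<integral>\<^sup>+t. ennreal p*(ennreal (t powr (p - 1))*indicator {0<..} t)*L t \<partial>lborel)"
   proof (rule nn_integral_cong)
    fix t :: real
    have "(\<integral>\<^sub>+x. wt x*mass x*(ennreal p*(ennreal (t powr (p - 1))*indicator {0<..} t)*(if ennreal t < av f x then 1 else 0)))
      = (\<integral>\<^sub>+x. ennreal p*(ennreal (t powr (p - 1))*indicator {0<..} t)*(wt x*mass x*(if ennreal t < av f x then 1 else 0)))"
     by (rule nn_integral_cong) (simp only: mult_ac)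
    also have "... = ennreal p*(ennreal (t powr (p - 1))*indicator {0<..} t)*L t"
     unfolding L_def by (rule nn_integral_cmult) measurable
    finally show "(\<integral>\<^sub>+x. wt x*mass x*(ennreal p*(ennreal (t powr (p - 1))*indicator {0<..} t)*(if ennreal t < av f x then 1 else 0)))
      = ennreal p*(ennreal (t powr (p - 1))*indicator {0<..} t)*L t" .
   qed
   also have "... <= (\<integral>\<^sup>+t. (\<integral>\<^sup>+w. ennreal (p*(2*C0))*f w*(ennreal (t powr (p - 2))*indicator {0<..<2*\<phi> w} t) \<partial>S) \<partial>lborel)"
   proof (rule nn_integral_mono)
    fix t :: real
    show "ennreal p*(ennreal (t powr (p - 1))*indicator {0<..} t)*L t
      <= (\<integral>\<^sup>+w. ennreal (p*(2*C0))*f w*(ennreal (t powr (p - 2))*indicator {0<..<2*\<phi> w} t) \<partial>S)"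
    proof (cases "0 < t")
     case t: True
     define g where "g w = f w*indicator {w \<in> space S. t < 2*\<phi> w} w" for w
     have g [measurable]: "g \<in> borel_measurable S" unfolding g_def by measurable
     have sub: "ennreal (t/2) < av g x" if x: "x \<in> unit_ball" and lt: "ennreal t < av f x" for x
     proof (rule ccontr)
      assume "\<not> ennreal (t/2) < av g x"
      hence le: "av g x <= ennreal (t/2)" by simp
      have "(\<integral>\<^sup>+w. f w*indicator (nbhd bb x) w \<partial>S)
        <= (\<integral>\<^sup>+w. g w*indicator (nbhd bb x) w + ennreal (t/2)*indicator (nbhd bb x) w \<partial>S)"
      proof (rule nn_integral_mono)
       fix w assume "w \<in> space S"
       hence "f w <= g w + ennreal (t/2)"
        by (cases "t < 2*\<phi> w") (auto simp: g_def f_def intro: ennreal_leI)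
       thus "f w*indicator (nbhd bb x) w <= g w*indicator (nbhd bb x) w + ennreal (t/2)*indicator (nbhd bb x) w"
        by (auto simp: indicator_def)
      qed
      also have "... = (\<integral>\<^sup>+w. g w*indicator (nbhd bb x) w \<partial>S) + (\<integral>\<^sup>+w. ennreal (t/2)*indicator (nbhd bb x) w \<partial>S)"
       by (rule nn_integral_add) measurable
      also have "(\<integral>\<^sup>+w. ennreal (t/2)*indicator (nbhd bb x) w \<partial>S) = ennreal (t/2)*mass x"
       by (simp add: mass_def nn_integral_cmult)
      also have "(\<integral>\<^sup>+w. g w*indicator (nbhd bb x) w \<partial>S) = av g x*mass x"
       by (rule av_mass[OF x, symmetric])
      also have "av g x*mass x + ennreal (t/2)*mass x <= ennreal (t/2)*mass x + ennreal (t/2)*mass x"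
       by (intro add_right_mono mult_right_mono le) simp
      also have "... = ennreal t*mass x"
       using t by (simp add: distrib_right[symmetric] ennreal_plus[symmetric] del: ennreal_plus)
      finally have "av f x <= ennreal t"
       unfolding av_def by (intro divide_le_posI_ennreal mass_pos x) (simp only: mult.commute)
      with lt show False by simp
     qed
     have "L t <= (\<integral>\<^sub>+x. wt x*mass x*indicator {x \<in> unit_ball. ennreal (t/2) < av g x} x)"
      unfolding L_def using sub by (intro nn_integral_mono mult_left_mono) auto
     also have "... <= ennreal (C0/(t/2))*(\<integral>\<^sup>+w. g w \<partial>S)"
      using weak[THEN bspec, OF g, THEN spec, of "t/2"] t by simp
     finally have "ennreal p*(ennreal (t powr (p - 1))*indicator {0<..} t)*L t
       <= ennreal p*(ennreal (t powr (p - 1))*indicator {0<..} t)*(ennreal (C0/(t/2))*(\<integral>\<^sup>+w. g w \<partial>S))"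
      by (intro mult_left_mono) auto
     also have "... = (ennreal p*ennreal (t powr (p - 1))*ennreal (C0/(t/2)))*(\<integral>\<^sup>+w. g w \<partial>S)"
      using t by (simp add: mult.assoc)
     also have "ennreal p*ennreal (t powr (p - 1))*ennreal (C0/(t/2)) = ennreal (p*(2*C0))*ennreal (t powr (p - 2))"
     proof -
      have "t powr (p - 1) = t powr (p - 2)*t" using t powr_add[of t "p - 2" 1] by simp
      hence "p*t powr (p - 1)*(C0/(t/2)) = p*(2*C0)*t powr (p - 2)" using t by simp
      thus ?thesis using t p C0 by (simp add: ennreal_mult[symmetric])
     qed
     also have "ennreal (p*(2*C0))*ennreal (t powr (p - 2))*(\<integral>\<^sup>+w. g w \<partial>S)
       = (\<integral>\<^sup>+w. ennreal (p*(2*C0))*ennreal (t powr (p - 2))*g w \<partial>S)"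
      by (rule nn_integral_cmult[symmetric]) measurable
     also have "... = (\<integral>\<^sup>+w. ennreal (p*(2*C0))*f w*(ennreal (t powr (p - 2))*indicator {0<..<2*\<phi> w} t) \<partial>S)"
      using t by (intro nn_integral_cong) (auto simp: g_def indicator_def mult_ac)
     finally show ?thesis .
    qed simp
   qed
   also have "... = (\<integral>\<^sup>+w. (\<integral>\<^sup>+t. ennreal (p*(2*C0))*f w*(ennreal (t powr (p - 2))*indicator {0<..<2*\<phi> w} t) \<partial>lborel) \<partial>S)"
   proof -
    have "(\<lambda>q. indicator {0<..<2*\<phi> (fst q)} (snd q) :: ennreal) = (\<lambda>q. if 0 < snd q \<and> snd q < 2*\<phi> (fst q) then 1 else 0)"
     by (auto simp: indicator_def fun_eq_iff)
    moreover have "(\<lambda>q. if 0 < snd q \<and> snd q < 2*\<phi> (fst q) then 1 else 0 :: ennreal) \<in> borel_measurable (S \<Otimes>\<^sub>M (lborel :: real measure))"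
     by measurable
    ultimately have [measurable]: "(\<lambda>q. indicator {0<..<2*\<phi> (fst q)} (snd q) :: ennreal) \<in> borel_measurable (S \<Otimes>\<^sub>M (lborel :: real measure))"
     by simp
    show ?thesis by (rule LS.Fubini') measurable
   qed
   also have "... = (\<integral>\<^sup>+w. ennreal C*ennreal (\<phi> w powr p) \<partial>S)"
   proof (rule nn_integral_cong)
    fix w
    have "(\<integral>\<^sup>+t. ennreal (p*(2*C0))*f w*(ennreal (t powr (p - 2))*indicator {0<..<2*\<phi> w} t) \<partial>lborel)
      = ennreal (p*(2*C0))*f w*(\<integral>\<^sup>+t. ennreal (t powr (p - 2))*indicator {0<..<2*\<phi> w} t \<partial>lborel)"
     by (rule nn_integral_cmult) measurable
    also have "(\<integral>\<^sup>+t. ennreal (t powr (p - 2))*indicator {0<..<2*\<phi> w} t \<partial>lborel)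
      = ennreal ((2*\<phi> w) powr (p - 2 + 1)/(p - 2 + 1))"
     using p nn by (intro nn_integral_powr_Ioo) auto
    also have "ennreal (p*(2*C0))*f w*... = ennreal (p*(2*C0)*\<phi> w*((2*\<phi> w) powr (p - 2 + 1)/(p - 2 + 1)))"
     using p C0 nn[of w] by (simp add: f_def ennreal_mult[symmetric])
    also have "p*(2*C0)*\<phi> w*((2*\<phi> w) powr (p - 2 + 1)/(p - 2 + 1)) = C*\<phi> w powr p"
    proof (cases "\<phi> w = 0")
     case False
     hence "\<phi> w powr p = \<phi> w*\<phi> w powr (p - 1)"
      using nn[of w] powr_add[of "\<phi> w" 1 "p - 1"] by simp
     moreover have "(2*\<phi> w) powr (p - 1) = 2 powr (p - 1)*\<phi> w powr (p - 1)"
      using nn[of w] by (simp add: powr_mult)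
     moreover have "p - 2 + 1 = p - 1" by simp
     ultimately show ?thesis by (simp only: C_def) (simp add: mult_ac)
    qed simp
    finally show "(\<integral>\<^sup>+t. ennreal (p*(2*C0))*f w*(ennreal (t powr (p - 2))*indicator {0<..<2*\<phi> w} t) \<partial>lborel)
      = ennreal C*ennreal (\<phi> w powr p)" using C nn[of w] by (simp add: ennreal_mult)
   qed
   also have "... = ennreal C * R" unfolding R_def by (rule nn_integral_cmult) measurable
   finally show ?thesis by (simp add: f_def R_def)
  qed
 qed
qed

lemma measurable_superposition:
 assumes [measurable]: "H \<in> meas"
 shows "(\<lambda>z. \<integral>\<^sup>+x. wt x*indicator (nbhd bb x) z*H x \<partial>vol) \<in> borel_measurable S"
proof -
 have "(\<lambda>p. wt (fst p)*indicator (nbhd bb (fst p)) (snd p)*H (fst p)) \<in> borel_measurable (vol \<Otimes>\<^sub>M S)"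
  by measurable
 from measurable_compose[OF measurable_pair_swap' this]
 have "(\<lambda>(z, x). wt x*indicator (nbhd bb x) z*H x) \<in> borel_measurable (S \<Otimes>\<^sub>M vol)"
  by (simp add: case_prod_beta')
 thus ?thesis by (rule vol.borel_measurable_nn_integral)
qed

text \<open>
 The dual inequality. Test the superposition \<open>\<Psi>\<close> against the power \<open>p - 1\<close> of its truncations \<open>\<Phi>\<close>,
 use the strong type inequality for \<open>av\<close> with the dual exponent, and absorb; the truncations have finite norm because
 \<open>S\<close> is a finite measure.
\<close>

lemma superposition_strong_type:
 assumes p: "1 < p"
 shows "\<exists>C>0. \<forall>H\<in>meas.
  (\<integral>\<^sup>+z. epowr (\<integral>\<^sub>+x. wt x*indicator (nbhd bb x) z*H x) p \<partial>S)
   <= ennreal C*(\<integral>\<^sub>+x. wt x*mass x*epowr (H x) p)"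
proof -
 define q where "q = p/(p - 1)"
 have q: "1 < q" "(p - 1)*q = p" using p by (simp_all add: q_def field_simps)
 obtain A where A: "0 < A" "\<forall>\<phi>\<in>borel_measurable S. (\<forall>w. 0 <= \<phi> w) -->
  (\<integral>\<^sub>+x. wt x*mass x*epowr (av (\<lambda>w. ennreal (\<phi> w)) x) q)
   <= ennreal A*(\<integral>\<^sup>+w. ennreal (\<phi> w powr q) \<partial>S)"
  using av_strong_type[OF q(1)] by (elim exE conjE) (rule that)
 define e where "e = 1/(2*A)"
 have e: "0 < e" "e*A = 1/2" using A by (simp_all add: e_def)
 define K where "K = e powr (1 - p)"
 have K: "0 < K" using e by (simp add: K_def)
 show ?thesis
 proof (intro exI[of _ "2*K"] conjI ballI)
  show "0 < 2*K" using K by simp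
  fix H :: "complex^'n => ennreal"
  assume H: "H \<in> meas"
  note [measurable] = H
  define \<Psi> where "\<Psi> z = (\<integral>\<^sub>+x. wt x*indicator (nbhd bb x) z*H x)" for z
  define R where "R = (\<integral>\<^sub>+x. wt x*mass x*epowr (H x) p)"
  have [measurable]: "\<Psi> \<in> borel_measurable S"
   unfolding \<Psi>_def[abs_def] by (rule measurable_superposition[OF H])
  define \<Phi> where "\<Phi> m z = enn2real (min (\<Psi> z) (ennreal (real m)))" for m z
  have \<Phi>: "ennreal (\<Phi> m z) = min (\<Psi> z) (ennreal (real m))" "0 <= \<Phi> m z" "\<Phi> m z <= real m" for m z
  proof -
   have "min (\<Psi> z) (ennreal (real m)) < \<top>" by (simp add: min_less_iff_disj)
   thus 1: "ennreal (\<Phi> m z) = min (\<Psi> z) (ennreal (real m))" by (simp add: \<Phi>_def)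
   show "0 <= \<Phi> m z" by (simp add: \<Phi>_def)
   have "ennreal (\<Phi> m z) <= ennreal (real m)" by (simp add: 1)
   thus "\<Phi> m z <= real m" by simp
  qed
  have [measurable]: "\<Phi> m \<in> borel_measurable S" for m
   unfolding \<Phi>_def[abs_def] by measurable
  define I where "I m = (\<integral>\<^sup>+z. ennreal (\<Phi> m z powr p) \<partial>S)" for m
  have I_le: "I m <= ennreal (2*K) * R" for m
  proof -
   define g where "g z = \<Phi> m z powr (p - 1)" for z
   have [measurable]: "g \<in> borel_measurable S" unfolding g_def[abs_def] by measurable
   have "I m <= (\<integral>\<^sup>+z. ennreal (real m powr p) \<partial>S)"
    unfolding I_def using \<Phi> p by (intro nn_integral_mono ennreal_leI powr_mono2) auto
   also have "... < \<top>" by (simp add: ennreal_mult_less_top)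
   finally have fin: "I m < \<top>" .
   have "I m <= (\<integral>\<^sup>+z. \<Psi> z*ennreal (g z) \<partial>S)"
    unfolding I_def
   proof (rule nn_integral_mono)
    fix z
    have "\<Phi> m z powr p = \<Phi> m z*g z"
     using \<Phi>(2)[of m z] powr_add[of "\<Phi> m z" 1 "p - 1"] by (cases "\<Phi> m z = 0") (simp_all add: g_def)
    hence "ennreal (\<Phi> m z powr p) = ennreal (\<Phi> m z)*ennreal (g z)"
     using \<Phi>(2) by (simp add: ennreal_mult' g_def)
    also have "... <= \<Psi> z*ennreal (g z)"
     by (intro mult_right_mono) (simp_all add: \<Phi>(1))
    finally show "ennreal (\<Phi> m z powr p) <= \<Psi> z*ennreal (g z)" .
   qed
   also have "... = (\<integral>\<^sup>+z. (\<integral>\<^sub>+x. wt x*indicator (nbhd bb x) z*H x*ennreal (g z)) \<partial>S)"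
    unfolding \<Psi>_def
   proof (rule nn_integral_cong)
    fix z assume z: "z \<in> space S"
    have "(\<lambda>x. indicator (nbhd bb x) z :: ennreal) \<in> meas"
     using measurable_compose[OF measurable_Pair2'[OF z, of vol] measurable_indicator_vol_S(1)[of bb]] by simp
    thus "(\<integral>\<^sub>+x. wt x*indicator (nbhd bb x) z*H x)*ennreal (g z)
      = (\<integral>\<^sub>+x. wt x*indicator (nbhd bb x) z*H x*ennreal (g z))"
     by (intro nn_integral_multc[symmetric] borel_measurable_times_ennreal measurable_wt_vol H)
   qed
   also have "... = (\<integral>\<^sub>+x. (\<integral>\<^sup>+z. wt x*indicator (nbhd bb x) z*H x*ennreal (g z) \<partial>S))"
    by (rule Fubini') measurable
   also have "... = (\<integral>\<^sub>+x. wt x*mass x*(H x*av (\<lambda>z. ennreal (g z)) x))"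
   proof (rule nn_integral_cong)
    fix x :: "complex^'n" assume "x \<in> space vol"
    hence x: "x \<in> unit_ball" by simp
    have "(\<integral>\<^sup>+z. wt x*indicator (nbhd bb x) z*H x*ennreal (g z) \<partial>S)
      = (\<integral>\<^sup>+z. wt x*H x*(ennreal (g z)*indicator (nbhd bb x) z) \<partial>S)"
     by (rule nn_integral_cong) (simp only: mult_ac)
    also have "... = wt x*H x*(\<integral>\<^sup>+z. ennreal (g z)*indicator (nbhd bb x) z \<partial>S)"
     by (rule nn_integral_cmult) measurable
    also have "... = wt x*H x*(av (\<lambda>z. ennreal (g z)) x*mass x)"
     by (simp only: av_mass[OF x])
    finally show "(\<integral>\<^sup>+z. wt x*indicator (nbhd bb x) z*H x*ennreal (g z) \<partial>S)
      = wt x*mass x*(H x*av (\<lambda>z. ennreal (g z)) x)" by (simp only: mult_ac)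
   qed
   also have "... <= (\<integral>\<^sub>+x. ennreal e*(wt x*mass x*epowr (av (\<lambda>z. ennreal (g z)) x) q)
     + ennreal K*(wt x*mass x*epowr (H x) p))"
   proof (rule nn_integral_mono)
    fix x
    have "wt x*mass x*(H x*av (\<lambda>z. ennreal (g z)) x)
      <= wt x*mass x*(ennreal e*epowr (av (\<lambda>z. ennreal (g z)) x) q + ennreal K*epowr (H x) p)"
     unfolding q_def K_def by (intro mult_left_mono young_eps_ennreal p e) simp
    thus "wt x*mass x*(H x*av (\<lambda>z. ennreal (g z)) x)
      <= ennreal e*(wt x*mass x*epowr (av (\<lambda>z. ennreal (g z)) x) q) + ennreal K*(wt x*mass x*epowr (H x) p)"
     by (simp add: distrib_left mult_ac)
   qed
   also have "... = ennreal e*(\<integral>\<^sub>+x. wt x*mass x*epowr (av (\<lambda>z. ennreal (g z)) x) q) + ennreal K * R"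
    unfolding R_def by (subst nn_integral_add) (auto simp: nn_integral_cmult)
   also have "... <= ennreal e*(ennreal A*(\<integral>\<^sup>+w. ennreal (g w powr q) \<partial>S)) + ennreal K * R"
    by (intro add_right_mono mult_left_mono A(2)[rule_format]) (auto simp: g_def)
   also have "(\<integral>\<^sup>+w. ennreal (g w powr q) \<partial>S) = I m"
    by (simp add: I_def g_def powr_powr q(2))
   also have "ennreal e*(ennreal A*I m) = ennreal (e*A)*I m"
    using e(1) A(1) by (simp only: ennreal_mult less_imp_le mult.assoc)
   also have "ennreal (e*A) = ennreal (1/2)" by (simp only: e(2))
   finally have le: "I m <= ennreal (1/2)*I m + ennreal K * R" .
   obtain i where i: "I m = ennreal i" "0 <= i" using fin by (cases "I m") auto
   show ?thesis
   proof (cases R)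
    case (real r)
    have "ennreal (1/2)*ennreal i = ennreal (1/2*i)"
     by (rule ennreal_mult[symmetric]) (use i in simp_all)
    moreover have "ennreal K*ennreal r = ennreal (K*r)"
     by (rule ennreal_mult[symmetric]) (use K real in simp_all)
    moreover have "ennreal (1/2*i) + ennreal (K*r) = ennreal (1/2*i + K*r)"
     by (rule ennreal_plus[symmetric]) (use K real i in simp_all)
    ultimately have "ennreal i <= ennreal (1/2*i + K*r)"
     using le unfolding i(1) real(2) by (simp only:)
    hence "i <= 1/2*i + K*r" using i real K by (subst (asm) ennreal_le_iff) auto
    hence "i <= 2*K*r" by simp
    thus ?thesis using i real K by (simp add: ennreal_mult[symmetric] ennreal_leI)
   next
    case top
    thus ?thesis using K by (simp add: ennreal_mult_top)
   qed
  qed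
  have "(\<integral>\<^sup>+z. epowr (\<Psi> z) p \<partial>S) <= (\<integral>\<^sup>+z. (SUP m. epowr (min (\<Psi> z) (ennreal (real m))) p) \<partial>S)"
   using p by (intro nn_integral_mono epowr_le_SUP_min) auto
  also have "... = (SUP m. \<integral>\<^sup>+z. epowr (min (\<Psi> z) (ennreal (real m))) p \<partial>S)"
  proof (rule nn_integral_monotone_convergence_SUP)
   show "incseq (\<lambda>m z. epowr (min (\<Psi> z) (ennreal (real m))) p)"
    using p by (intro incseq_SucI le_funI epowr_mono min.mono ennreal_leI) auto
  qed measurable
  also have "... = (SUP m. I m)" unfolding I_def \<Phi>(1)[symmetric] using \<Phi>(2) by simp
  also have "... <= ennreal (2*K) * R" by (rule SUP_least) (rule I_le)
  finally show "(\<integral>\<^sup>+z. epowr (\<integral>\<^sub>+x. wt x*indicator (nbhd bb x) z*H x) p \<partial>S)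
   <= ennreal (2*K)*(\<integral>\<^sub>+x. wt x*mass x*epowr (H x) p)"
   unfolding \<Psi>_def R_def .
 qed
qed

text \<open>
 The weak type inequality for superpositions of averages. Off the union \<open>V\<close> of the neighbourhoods on which
 the average exceeds \<open>t\<close>, the averages may be replaced by their truncations at \<open>t\<close>, and these are square
 integrable by the weak type inequality for the averages.
\<close>

lemma superposition_weak_type:
 "\<exists>C>0. \<forall>\<phi>\<in>borel_measurable S. \<forall>t>0.
  emeasure S {z \<in> unit_ball. ennreal t < (\<integral>\<^sub>+x. wt x*indicator (nbhd bb x) z*av \<phi> x)}
   <= ennreal (C/t)*(\<integral>\<^sup>+w. \<phi> w \<partial>S)"
proof -
 obtain C0 where C0: "0 < C0" and weak: "\<forall>\<phi>\<in>borel_measurable S. \<forall>t>0.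
   (\<integral>\<^sub>+x. wt x*mass x*indicator {x \<in> unit_ball. ennreal t < av \<phi> x} x)
    <= ennreal (C0/t)*(\<integral>\<^sup>+w. \<phi> w \<partial>S) \<and>
   emeasure S (\<Union>x\<in>{x \<in> unit_ball. ennreal t < av \<phi> x}. nbhd bb x)
    <= ennreal (C0/t)*(\<integral>\<^sup>+w. \<phi> w \<partial>S)"
  using weak_type by (elim exE conjE) (rule that)
 have "(1 :: real) < 2" by simp
 from superposition_strong_type[OF this] obtain A where A: "0 < A" and strong: "\<forall>H\<in>meas.
  (\<integral>\<^sup>+z. epowr (\<integral>\<^sub>+x. wt x*indicator (nbhd bb x) z*H x) 2 \<partial>S)
   <= ennreal A*(\<integral>\<^sub>+x. wt x*mass x*epowr (H x) 2)"
  by (elim exE conjE) (rule that)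
 show ?thesis
 proof (intro exI[of _ "C0 + 2*A*C0"] conjI ballI allI impI)
  show "0 < C0 + 2*A*C0" using A C0 by (simp add: add_pos_pos)
 next
  fix \<phi> :: "complex^'n => ennreal" and t :: real
  assume \<phi>: "\<phi> \<in> borel_measurable S" and t: "0 < t"
  note [measurable] = \<phi>
  define R where "R = (\<integral>\<^sup>+w. \<phi> w \<partial>S)"
  define V where "V = (\<Union>x\<in>{x \<in> unit_ball. ennreal t < av \<phi> x}. nbhd bb x)"
  define H where "H x = min (av \<phi> x) (ennreal t)" for x
  have H [measurable]: "H \<in> meas" unfolding H_def[abs_def] by measurable
  define \<Psi> where "\<Psi> z = (\<integral>\<^sub>+x. wt x*indicator (nbhd bb x) z*av \<phi> x)" for z
  define \<Psi>' where "\<Psi>' z = (\<integral>\<^sub>+x. wt x*indicator (nbhd bb x) z*H x)" for z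
  have [measurable]: "\<Psi> \<in> borel_measurable S" "\<Psi>' \<in> borel_measurable S"
   unfolding \<Psi>_def[abs_def] \<Psi>'_def[abs_def] by (intro measurable_superposition measurable_av \<phi> H)+
  have V: "V \<in> sets S"
   unfolding sets_S V_def
   by (intro borel_subset_sets_vol borel_open open_UN ballI open_nbhd) (auto simp: nbhd_def)
  have W: "{z \<in> space S. ennreal t < \<Psi>' z} \<in> sets S" by measurable
  have off: "\<Psi> z = \<Psi>' z" if z: "z \<notin> V" for z
   unfolding \<Psi>_def \<Psi>'_def
  proof (rule nn_integral_cong)
   fix x :: "complex^'n" assume "x \<in> space vol"
   hence x: "x \<in> unit_ball" by simp
   show "wt x*indicator (nbhd bb x) z*av \<phi> x = wt x*indicator (nbhd bb x) z*H x"
   proof (cases "z \<in> nbhd bb x")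
    case True
    hence "\<not> ennreal t < av \<phi> x" using z x by (auto simp: V_def)
    thus ?thesis by (simp add: H_def min_absorb1)
   qed simp
  qed
  have sq: "epowr (H x) 2 = (\<integral>\<^sup>+s. ennreal 2*(ennreal (s powr 1)*indicator {0<..<t} s)*(if ennreal s < av \<phi> x then 1 else 0) \<partial>lborel)" for x
  proof -
   have "H x < \<top>" by (simp add: H_def min_less_iff_disj)
   then obtain r where r: "H x = ennreal r" "0 <= r" by (cases "H x") auto
   have "epowr (H x) 2 = ennreal (2*(r powr (1 + 1)/(1 + 1)))" using r by simp
   also have "... = ennreal 2*ennreal (r powr (1 + 1)/(1 + 1))" by (rule ennreal_mult) auto
   also have "ennreal (r powr (1 + 1)/(1 + 1)) = (\<integral>\<^sup>+s. ennreal (s powr 1)*indicator {0<..<r} s \<partial>lborel)"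
    using r by (intro nn_integral_powr_Ioo[symmetric]) auto
   also have "ennreal 2*... = (\<integral>\<^sup>+s. ennreal 2*(ennreal (s powr 1)*indicator {0<..<r} s) \<partial>lborel)"
    by (rule nn_integral_cmult[symmetric]) measurable
   also have "... = (\<integral>\<^sup>+s. ennreal 2*(ennreal (s powr 1)*indicator {0<..<t} s)*(if ennreal s < av \<phi> x then 1 else 0) \<partial>lborel)"
   proof (rule nn_integral_cong)
    fix s :: real
    have "s \<in> {0<..<r} \<longleftrightarrow> s \<in> {0<..<t} \<and> ennreal s < av \<phi> x"
    proof (cases "0 < s")
     case True
     hence "s < r \<longleftrightarrow> ennreal s < H x" by (simp add: r ennreal_less_iff)
     also have "... \<longleftrightarrow> s < t \<and> ennreal s < av \<phi> x"
      using True by (auto simp: H_def ennreal_less_iff)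
     finally show ?thesis using True by auto
    qed auto
    thus "ennreal 2*(ennreal (s powr 1)*indicator {0<..<r} s)
      = ennreal 2*(ennreal (s powr 1)*indicator {0<..<t} s)*(if ennreal s < av \<phi> x then 1 else 0)"
     by (simp add: indicator_def)
   qed
   finally show ?thesis .
  qed
  interpret L: pair_sigma_finite vol "lborel :: real measure" ..
  have "(\<integral>\<^sub>+x. wt x*mass x*epowr (H x) 2)
    = (\<integral>\<^sub>+x. (\<integral>\<^sup>+s. wt x*mass x*(ennreal 2*(ennreal (s powr 1)*indicator {0<..<t} s)*(if ennreal s < av \<phi> x then 1 else 0)) \<partial>lborel))"
   unfolding sq by (intro nn_integral_cong nn_integral_cmult[symmetric]) measurable
  also have "... = (\<integral>\<^sup>+s. (\<integral>\<^sub>+x. wt x*mass x*(ennreal 2*(ennreal (s powr 1)*indicator {0<..<t} s)*(if ennreal s < av \<phi> x then 1 else 0))) \<partial>lborel)"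
   by (rule L.Fubini'[symmetric]) measurable
  also have "... <= (\<integral>\<^sup>+s. ennreal (2*C0) * R*indicator {0..t} s \<partial>lborel)"
  proof (rule nn_integral_mono)
   fix s :: real
   show "(\<integral>\<^sub>+x. wt x*mass x*(ennreal 2*(ennreal (s powr 1)*indicator {0<..<t} s)*(if ennreal s < av \<phi> x then 1 else 0)))
     <= ennreal (2*C0) * R*indicator {0..t} s"
   proof (cases "s \<in> {0<..<t}")
    case True
    hence s: "0 < s" "s < t" by auto
    have "(\<integral>\<^sub>+x. wt x*mass x*(ennreal 2*(ennreal (s powr 1)*indicator {0<..<t} s)*(if ennreal s < av \<phi> x then 1 else 0)))
      = (\<integral>\<^sub>+x. ennreal (2 * s)*(wt x*mass x*indicator {x \<in> unit_ball. ennreal s < av \<phi> x} x))"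
     using s by (intro nn_integral_cong) (simp add: indicator_def ennreal_mult mult_ac)
    also have "... = ennreal (2 * s)*(\<integral>\<^sub>+x. wt x*mass x*indicator {x \<in> unit_ball. ennreal s < av \<phi> x} x)"
    proof (rule nn_integral_cmult)
     have "{x \<in> space vol. ennreal s < av \<phi> x} \<in> sets vol" by measurable
     thus "(\<lambda>x. wt x*mass x*indicator {x \<in> unit_ball. ennreal s < av \<phi> x} x) \<in> meas"
      by (intro borel_measurable_times_ennreal measurable_wt_vol measurable_mass borel_measurable_indicator) simp
    qed
    also have "... <= ennreal (2 * s)*(ennreal (C0 / s) * R)"
     using weak[THEN bspec, OF \<phi>, THEN spec, of s] s unfolding R_def by (intro mult_left_mono) simp_all
    also have "... = ennreal (2 * s*(C0 / s)) * R"
     using s C0 by (subst ennreal_mult) (simp_all add: mult.assoc)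
    also have "2 * s*(C0 / s) = 2*C0" using s by simp
    finally show ?thesis using s by simp
   qed simp
  qed
  also have "... = ennreal (2*C0) * R*ennreal t"
   using t by (subst nn_integral_cmult_indicator) auto
  finally have sqint: "(\<integral>\<^sub>+x. wt x*mass x*epowr (H x) 2) <= ennreal (2*C0) * R*ennreal t" .
  have "emeasure S {z \<in> space S. ennreal t < \<Psi>' z} <= emeasure S ({z \<in> space S. 1 <= ennreal (1/t\<^sup>2)*epowr (\<Psi>' z) 2} \<inter> space S)"
  proof (rule emeasure_mono)
   show "{z \<in> space S. ennreal t < \<Psi>' z} \<subseteq> {z \<in> space S. 1 <= ennreal (1/t\<^sup>2)*epowr (\<Psi>' z) 2} \<inter> space S"
   proof
    fix z assume z: "z \<in> {z \<in> space S. ennreal t < \<Psi>' z}"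
    hence "epowr (ennreal t) 2 <= epowr (\<Psi>' z) 2" by (intro epowr_mono) auto
    hence "ennreal (1/t\<^sup>2)*ennreal (t\<^sup>2) <= ennreal (1/t\<^sup>2)*epowr (\<Psi>' z) 2"
     using t by (intro mult_left_mono) (simp_all add: powr_numeral)
    moreover have "ennreal (1/t\<^sup>2)*ennreal (t\<^sup>2) = 1"
     using t by (subst ennreal_mult[symmetric]) auto
    ultimately have "1 <= ennreal (1/t\<^sup>2)*epowr (\<Psi>' z) 2" by simp
    with z show "z \<in> {z \<in> space S. 1 <= ennreal (1/t\<^sup>2)*epowr (\<Psi>' z) 2} \<inter> space S"
     by blast
   qed
  qed measurable
  also have "... <= ennreal (1/t\<^sup>2)*(\<integral>\<^sup>+z. epowr (\<Psi>' z) 2*indicator (space S) z \<partial>S)"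
   using nn_integral_Markov_inequality[of "\<lambda>z. epowr (\<Psi>' z) 2" "space S" S "ennreal (1/t\<^sup>2)"] sets.top[of S]
   by (simp add: Int_def conj_commute)
  also have "(\<integral>\<^sup>+z. epowr (\<Psi>' z) 2*indicator (space S) z \<partial>S) = (\<integral>\<^sup>+z. epowr (\<Psi>' z) 2 \<partial>S)"
   by (rule nn_integral_cong) simp
  also have "... <= ennreal A*(ennreal (2*C0) * R*ennreal t)"
   unfolding \<Psi>'_def by (rule order_trans[OF strong[THEN bspec, OF H]]) (intro mult_left_mono sqint, simp)
  also have "ennreal (1/t\<^sup>2)*(ennreal A*(ennreal (2*C0) * R*ennreal t))
    = (ennreal (1/t\<^sup>2)*ennreal A*ennreal (2*C0)*ennreal t) * R" by (simp only: mult_ac)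
  also have "ennreal (1/t\<^sup>2)*ennreal A*ennreal (2*C0)*ennreal t = ennreal (2*A*C0/t)"
  proof -
   have "ennreal (1/t\<^sup>2)*ennreal A*ennreal (2*C0)*ennreal t = ennreal (1/t\<^sup>2*A*(2*C0)*t)"
    using t A C0 by (simp add: ennreal_mult[symmetric])
   also have "1/t\<^sup>2*A*(2*C0)*t = 2*A*C0/t" using t by (simp add: power2_eq_square)
   finally show ?thesis .
  qed
  finally have 1: "emeasure S {z \<in> space S. ennreal t < \<Psi>' z} <= ennreal (2*A*C0/t) * R"
   by (simp add: mult_left_mono)
  have 2: "emeasure S V <= ennreal (C0/t) * R"
   using weak[THEN bspec, OF \<phi>, THEN spec, of t] t by (simp add: V_def R_def)
  have "emeasure S {z \<in> unit_ball. ennreal t < \<Psi> z} <= emeasure S (V \<union> {z \<in> space S. ennreal t < \<Psi>' z})"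
  proof (rule emeasure_mono)
   show "{z \<in> unit_ball. ennreal t < \<Psi> z} \<subseteq> V \<union> {z \<in> space S. ennreal t < \<Psi>' z}"
    by (auto simp: off[symmetric])
   show "V \<union> {z \<in> space S. ennreal t < \<Psi>' z} \<in> sets S" by (rule sets.Un[OF V W])
  qed
  also have "... <= emeasure S V + emeasure S {z \<in> space S. ennreal t < \<Psi>' z}"
   by (rule emeasure_subadditive[OF V W])
  also have "... <= ennreal (C0/t) * R + ennreal (2*A*C0/t) * R" by (rule add_mono[OF 2 1])
  also have "... = ennreal ((C0 + 2*A*C0)/t) * R"
   using t A C0 by (simp add: distrib_right[symmetric] ennreal_plus[symmetric] add_divide_distrib del: ennreal_plus)
  finally show "emeasure S {z \<in> unit_ball. ennreal t < (\<integral>\<^sub>+x. wt x*indicator (nbhd bb x) z*av \<phi> x)}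
   <= ennreal ((C0 + 2*A*C0)/t)*(\<integral>\<^sup>+w. \<phi> w \<partial>S)"
   unfolding \<Psi>_def R_def .
 qed
qed

end

section \<open>Weights\<close>

lemma tent_subset: "tent y \<subseteq> unit_ball"
 by (auto simp: tent_def)

lemma sets_tent [measurable]: "tent y \<in> sets vol"
proof (cases "y = 0")
 case True
 thus ?thesis using sets.top[of vol] by (simp add: tent_def)
next
 case False
 have "{w \<in> unit_ball. hdist (y /\<^sub>R norm y) w < 1 - norm y} \<in> sets vol" by measurable
 thus ?thesis using False by (simp add: tent_def hdist_def)
qed

lemma nbhd_subset_tent:
 assumes b: "0 <= b"
 shows "\<exists>C>0. \<forall>x::complex^'n::finite\<in>unit_ball. \<exists>y\<in>unit_ball. nbhd b x \<subseteq> tent y \<and>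
  emeasure vol (tent y) <= ennreal (C*rad x^(CARD('n) + 1))"
proof -
 let ?N = "CARD('n) + 1"
 obtain C0 where C0: "0 < C0" "\<And>x :: complex^'n. x \<in> unit_ball ==> emeasure vol (nbhd 5 x) <= ennreal (C0*rad x^?N)"
  using emeasure_nbhd_le[where ?'n = 'n, of 5] by blast
 define B where "B = 2 + 2*b"
 have B: "2 <= B" using b by (simp add: B_def)
 define C where "C = (C0 + 1)*B^?N"
 show ?thesis
 proof (intro exI[of _ C] conjI ballI)
  show "0 < C" using C0 B by (simp add: C_def)
  fix x :: "complex^'n"
  assume x: "x \<in> unit_ball"
  define s where "s = B*rad x"
  have s: "0 < s" unfolding s_def using B rad_pos[OF x] by simp
  have Cs: "C*rad x^?N = (C0 + 1) * s^?N" by (simp only: C_def s_def power_mult_distrib mult.assoc)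
  show "\<exists>y\<in>unit_ball. nbhd b x \<subseteq> tent y \<and> emeasure vol (tent y) <= ennreal (C*rad x^?N)"
  proof (cases "1 <= s")
   case True
   have "emeasure vol (tent (0 :: complex^'n)) = 1"
    using vol.emeasure_space_1[unfolded space_vol] unfolding tent_def by simp
   moreover have "1 <= (C0 + 1) * s^?N"
    using mult_mono[of 1 "C0 + 1" 1 "s^?N"] one_le_power[OF True, of ?N] C0 by simp
   ultimately have "emeasure vol (tent (0 :: complex^'n)) <= ennreal (C*rad x^?N)"
    unfolding Cs by (metis ennreal_1 ennreal_leI)
   thus ?thesis by (intro bexI[of _ 0] conjI) (auto simp: tent_def nbhd_def)
  next
   case False
   obtain \<zeta> where \<zeta>: "norm \<zeta> = 1" "x = norm x *\<^sub>R \<zeta>"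
    by (rule obtain_polar)
   define y where "y = (1 - s) *\<^sub>R \<zeta>"
   have ny: "norm y = 1 - s" "y \<noteq> 0" "y /\<^sub>R norm y = \<zeta>"
    using False \<zeta>(1) by (auto simp: y_def)
   have y: "y \<in> unit_ball" using ny(1) s by simp
   have hr: "hdist \<zeta> (r *\<^sub>R \<zeta>) = 1 - r" if "r <= 1" for r
   proof -
    have "hdist \<zeta> (r *\<^sub>R \<zeta>) = cmod (of_real (1 - r))"
     by (simp add: hdist_def herm_scaleR_right herm_self \<zeta>(1))
    thus ?thesis unfolding norm_of_real using that by simp
   qed
   have hx: "hdist \<zeta> x = rad x" using hr[of "norm x"] x \<zeta>(2) by (simp add: rad_def)
   have hy: "hdist \<zeta> y = s" using hr[of "1 - s"] s by (simp add: y_def)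
   have ty: "tent y = {w \<in> unit_ball. hdist \<zeta> w < s}"
    using ny by (simp add: tent_def hdist_def)
   have z1: "norm \<zeta> <= 1" using \<zeta>(1) by simp
   have 1: "nbhd b x \<subseteq> tent y"
   proof
    fix w assume w: "w \<in> nbhd b x"
    hence wb: "w \<in> unit_ball" and hw: "hdist x w < b*rad x" by (auto simp: nbhd_def)
    have "hdist \<zeta> w <= 2*(hdist \<zeta> x + hdist x w)"
     using z1 x wb by (intro hdist_quasi_triangle) auto
    also have "... < 2*(rad x + b*rad x)" using hx hw by simp
    also have "... = s" by (simp add: s_def B_def algebra_simps)
    finally show "w \<in> tent y" using wb by (simp add: ty)
   qed
   have "tent y \<subseteq> nbhd 5 y"
   proof
    fix w assume w: "w \<in> tent y"
    hence wb: "w \<in> unit_ball" and hw: "hdist \<zeta> w < s" by (auto simp: ty)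
    have "hdist y w <= 2*(hdist y \<zeta> + hdist \<zeta> w)"
     using z1 y wb by (intro hdist_quasi_triangle) auto
    also have "... < 5 * s" using hy hw s by (simp add: hdist_commute)
    finally show "w \<in> nbhd 5 y" using wb by (simp add: nbhd_def rad_def ny(1))
   qed
   hence "emeasure vol (tent y) <= emeasure vol (nbhd 5 y)" by (intro emeasure_mono) auto
   also have "... <= ennreal (C0*rad y^?N)" by (rule C0(2)[OF y])
   also have "rad y = s" by (simp add: rad_def ny(1))
   also have "ennreal (C0 * s^?N) <= ennreal ((C0 + 1) * s^?N)"
    using s by (intro ennreal_leI mult_right_mono) auto
   finally show ?thesis unfolding Cs using 1 y by blast
  qed
 qed
qed

text \<open>
 The core of \<open>x\<close> occupies a fixed proportion of the tent just found. So a finite measure is doubling as soon as the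
 measure of a tent is controlled by the measure of any subset of comparable volume.
\<close>

lemma doubling_measureI:
 fixes S :: "(complex^'n::finite) measure"
 assumes sets: "sets S = sets vol" and fin: "emeasure S unit_ball < \<top>"
  and pos: "\<And>A. A \<in> sets vol ==> 0 < emeasure vol A ==> 0 < emeasure S A"
  and dbl: "\<And>c. 0 < c ==> \<exists>C. \<forall>y\<in>unit_ball. \<forall>E\<in>sets vol. E \<subseteq> tent y -->
   emeasure vol (tent y) <= ennreal c*emeasure vol E --> emeasure S (tent y) <= ennreal C*emeasure S E"
 shows "doubling_measure S"
proof
 let ?N = "CARD('n) + 1"
 obtain \<kappa> where \<kappa>: "0 < \<kappa>" "\<And>(x :: complex^'n::finite). x \<in> unit_ball ==>
  ennreal (\<kappa>*rad x^?N) <= emeasure vol (core x)"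
  using emeasure_core_ge[where ?'n = 'n] by blast
 show "sets S = sets vol" by (rule sets)
 show "emeasure S unit_ball \<noteq> \<infinity>" using fin by simp
 show "0 < emeasure S (core x)" if x: "x \<in> unit_ball" for x
 proof (rule pos)
  have "0 < ennreal (\<kappa>*rad x^?N)" using \<kappa>(1) rad_pos[OF x] by simp
  also note \<kappa>(2)[OF x]
  finally show "0 < emeasure vol (core x)" .
 qed measurable
 fix b :: real
 define b' where "b' = max b 16"
 have "0 <= b'" by (simp add: b'_def)
 from nbhd_subset_tent[OF this, where ?'n = 'n] obtain C1 where C1: "0 < C1" and hull:
  "\<forall>x::complex^'n\<in>unit_ball. \<exists>y\<in>unit_ball. nbhd b' x \<subseteq> tent y \<and> emeasure vol (tent y) <= ennreal (C1*rad x^?N)"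
  by (elim exE conjE) (rule that)
 have "0 < C1/\<kappa>" using C1 \<kappa>(1) by simp
 from dbl[OF this] obtain C where C: "\<forall>y\<in>unit_ball. \<forall>E\<in>sets vol. E \<subseteq> tent y -->
   emeasure vol (tent y) <= ennreal (C1/\<kappa>)*emeasure vol E --> emeasure S (tent y) <= ennreal C*emeasure S E"
  by (elim exE) (rule that)
 show "\<exists>C. \<forall>x\<in>unit_ball. emeasure S (nbhd b x) <= ennreal C*emeasure S (core x)"
 proof (intro exI ballI)
  fix x :: "complex^'n" assume x: "x \<in> unit_ball"
  obtain y where y: "y \<in> unit_ball" "nbhd b' x \<subseteq> tent y" "emeasure vol (tent y) <= ennreal (C1*rad x^?N)"
   using bspec[OF hull x] by (elim bexE conjE) (rule that)
  have "nbhd b x \<subseteq> tent y" "core x \<subseteq> tent y"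
   using nbhd_mono[of b b' x] core_subset_nbhd[of b' x] x y(2) by (auto simp: b'_def)
  hence "emeasure S (nbhd b x) <= emeasure S (tent y)" by (intro emeasure_mono) (auto simp: sets)
  also have "... <= ennreal C*emeasure S (core x)"
  proof (rule C[rule_format, OF y(1)])
   show "core x \<in> sets vol" by measurable
   show "core x \<subseteq> tent y" by fact
   note y(3)
   also have "ennreal (C1*rad x^?N) = ennreal (C1/\<kappa>)*ennreal (\<kappa>*rad x^?N)"
    using C1 \<kappa>(1) rad_pos[OF x] by (subst ennreal_mult[symmetric]) auto
   also have "... <= ennreal (C1/\<kappa>)*emeasure vol (core x)"
    by (intro mult_left_mono \<kappa>(2) x) simp
   finally show "emeasure vol (tent y) <= ennreal (C1/\<kappa>)*emeasure vol (core x)" .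
  qed
  finally show "emeasure S (nbhd b x) <= ennreal C*emeasure S (core x)" .
 qed
qed

lemma emeasure_density_pos:
 fixes f :: "'a => real"
 assumes [measurable]: "f \<in> borel_measurable M" and f: "AE x in M. 0 < f x"
  and A: "A \<in> sets M" "0 < emeasure M A"
 shows "0 < emeasure (density M (\<lambda>x. ennreal (f x))) A"
proof (rule ccontr)
 assume "\<not> ?thesis"
 hence "A \<in> null_sets (density M (\<lambda>x. ennreal (f x)))"
  using A(1) by (intro null_setsI) auto
 hence "AE x in M. x \<in> A --> ennreal (f x) = 0"
  by (subst (asm) null_sets_density_iff) auto
 with f have "AE x in M. x \<notin> A" by eventually_elim (auto simp: ennreal_eq_0_iff)
 hence "emeasure M A = 0"
  using A(1) by (subst (asm) AE_iff_measurable[where N = A]) (auto dest: sets.sets_into_space)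
 with A(2) show False by simp
qed

text \<open>
 The two weights \<open>a = \<sigma>\<close> and \<open>b = \<sigma> powr (1 - p')\<close> of the Bekolle--Bonami condition enter symmetrically when
 the condition is raised to the power \<open>\<alpha> = 1 / p\<close>, with \<open>\<beta> = 1 / p'\<close>.
\<close>

locale weight_pair =
 fixes \<alpha> \<beta> M :: real and a b :: "complex^'n::finite => real"
 assumes exps: "0 < \<alpha>" "0 < \<beta>" "\<alpha> + \<beta> = 1"
  and meas [measurable]: "a \<in> meas" "b \<in> meas"
  and pos: "AE w in vol. 0 < a w" "AE w in vol. 0 < b w"
  and dual: "AE w in vol. a w powr \<alpha>*b w powr \<beta> = 1"
  and fin: "(\<integral>\<^sub>+w. ennreal (a w)) < \<top>" "(\<integral>\<^sub>+w. ennreal (b w)) < \<top>"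
  and M: "0 < M"
  and bound: "\<And>y. y \<in> unit_ball ==>
   measure (density vol (\<lambda>w. ennreal (a w))) (tent y) powr \<alpha>*measure (density vol (\<lambda>w. ennreal (b w))) (tent y) powr \<beta>
    <= M*measure vol (tent y)"
begin

abbreviation A where "A \<equiv> density vol (\<lambda>w. ennreal (a w))"
abbreviation B where "B \<equiv> density vol (\<lambda>w. ennreal (b w))"

lemma flip: "weight_pair \<beta> \<alpha> M b a"
 using exps meas pos dual fin M bound
 by unfold_locales (auto simp: mult.commute add.commute)

sublocale A: finite_measure A
proof (rule finite_measureI)
 have "emeasure A (space vol) = (\<integral>\<^sub>+w. ennreal (a w)*indicator (space vol) w)"
  by (rule emeasure_density) measurable
 also have "... = (\<integral>\<^sub>+w. ennreal (a w))" by (rule nn_integral_cong) simp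
 finally show "emeasure A (space A) \<noteq> \<infinity>" using fin by simp
qed

sublocale B: finite_measure B
proof (rule finite_measureI)
 have "emeasure B (space vol) = (\<integral>\<^sub>+w. ennreal (b w)*indicator (space vol) w)"
  by (rule emeasure_density) measurable
 also have "... = (\<integral>\<^sub>+w. ennreal (b w))" by (rule nn_integral_cong) simp
 finally show "emeasure B (space B) \<noteq> \<infinity>" using fin by simp
qed

lemma pos_A: "E \<in> sets vol ==> 0 < measure vol E ==> 0 < measure A E"
 using emeasure_density_pos[OF meas(1) pos(1), of E]
 by (simp add: A.emeasure_eq_measure vol.emeasure_eq_measure)

lemma pos_B: "E \<in> sets vol ==> 0 < measure vol E ==> 0 < measure B E"
 using emeasure_density_pos[OF meas(2) pos(2), of E]
 by (simp add: B.emeasure_eq_measure vol.emeasure_eq_measure)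

text \<open>
 The weighted inequality between the arithmetic and the geometric mean, applied to \<open>l * a\<close> and \<open>m * b\<close>,
 whose weighted geometric mean is \<open>1\<close>.
\<close>

lemma measure_le_combination:
 assumes lm: "0 < l" "0 < m" "l powr \<alpha>*m powr \<beta> = 1" and E: "E \<in> sets vol"
 shows "measure vol E <= l*measure A E + m*measure B E"
proof -
 have "ennreal (measure vol E) = (\<integral>\<^sub>+w. indicator E w)"
  using E by (simp add: vol.emeasure_eq_measure)
 also have "... <= (\<integral>\<^sub>+w. ennreal l*(ennreal (a w)*indicator E w) + ennreal m*(ennreal (b w)*indicator E w))"
 proof (rule nn_integral_mono_AE)
  show "AE w in vol. indicator E w <= ennreal l*(ennreal (a w)*indicator E w) + ennreal m*(ennreal (b w)*indicator E w)"
   using pos(1) pos(2) dual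
  proof eventually_elim
   case (elim w)
   have "1 <= l*a w + m*b w"
   proof (rule ccontr)
    assume "\<not> ?thesis"
    moreover have "0 < l*a w" "0 < m*b w" using elim lm by simp_all
    ultimately have lt: "l*a w < 1" "m*b w < 1" by simp_all
    have "(l*a w) powr \<alpha> < 1 powr \<alpha>"
     using lt(1) \<open>0 < l * a w\<close> exps by (intro powr_less_mono2) auto
    moreover have "(m*b w) powr \<beta> < 1 powr \<beta>"
     using lt(2) \<open>0 < m * b w\<close> exps by (intro powr_less_mono2) auto
    ultimately have "(l*a w) powr \<alpha>*(m*b w) powr \<beta> < 1*1"
     by (intro mult_strict_mono') auto
    also have "(l*a w) powr \<alpha>*(m*b w) powr \<beta> = (l powr \<alpha>*m powr \<beta>)*(a w powr \<alpha>*b w powr \<beta>)"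
    proof -
     have "(l*a w) powr \<alpha> = l powr \<alpha>*a w powr \<alpha>" "(m*b w) powr \<beta> = m powr \<beta>*b w powr \<beta>"
      using elim lm by (simp_all add: powr_mult)
     thus ?thesis by (simp only: mult_ac)
    qed
    finally show False using elim lm by simp
   qed
   hence "1 <= ennreal (l*a w + m*b w)" by (metis ennreal_1 ennreal_leI)
   also have "... = ennreal l*ennreal (a w) + ennreal m*ennreal (b w)"
    using elim lm by (simp add: ennreal_mult)
   finally show ?case by (simp add: indicator_def)
  qed
 qed
 also have "... = ennreal l*emeasure A E + ennreal m*emeasure B E"
  using E by (simp add: nn_integral_add nn_integral_cmult emeasure_density)
 also have "... = ennreal (l*measure A E + m*measure B E)"
  using lm by (simp add: A.emeasure_eq_measure B.emeasure_eq_measure ennreal_mult)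
 finally show ?thesis using lm by (subst (asm) ennreal_le_iff) (auto intro!: add_nonneg_nonneg)
qed

text \<open>
 If \<open>E\<close> fills a fixed proportion of a tent \<open>T\<close>, choose \<open>m\<close> in the preceding inequality so that the term
 with \<open>B\<close> is at most half of the volume of \<open>E\<close>. This bounds the volume of \<open>E\<close> by a multiple of \<open>A E\<close>,
 and the Bekolle--Bonami condition on \<open>T\<close> turns the bound into one of \<open>A T\<close> by \<open>A E\<close>.
\<close>

lemma doubling_A: "doubling_measure A"
proof (rule doubling_measureI)
 show "emeasure A unit_ball < \<top>" by (simp add: A.emeasure_eq_measure)
 show "0 < emeasure A E" if "E \<in> sets vol" "0 < emeasure vol E" for E
  by (rule emeasure_density_pos[OF meas(1) pos(1) that])
 fix c :: real assume c: "0 < c"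
 show "\<exists>C. \<forall>y\<in>unit_ball. \<forall>E\<in>sets vol. E \<subseteq> tent y -->
   emeasure vol (tent y) <= ennreal c*emeasure vol E --> emeasure A (tent y) <= ennreal C*emeasure A E"
 proof (intro exI ballI impI)
  fix y :: "complex^'n" and E
  assume y: "y \<in> unit_ball" and E: "E \<in> sets vol" "E \<subseteq> tent y"
   and le: "emeasure vol (tent y) <= ennreal c*emeasure vol E"
  define e where "e = measure vol E"
  define t where "t = measure vol (tent y)"
  define aT where "aT = measure A (tent y)"
  define bT where "bT = measure B (tent y)"
  define aE where "aE = measure A E"
  define C where "C = (2*M*c) powr (1/\<alpha>)"
  have tc: "t <= c*e"
   using le c by (simp add: t_def e_def vol.emeasure_eq_measure ennreal_mult'[symmetric] ennreal_le_iff)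
  have "aT <= C*aE"
  proof (cases "e = 0")
   case True
   hence "t <= 0" using tc by simp
   hence "t = 0" by (rule antisym) (simp add: t_def)
   hence "emeasure vol (tent y) = 0" by (simp add: t_def vol.emeasure_eq_measure)
   hence "emeasure A (tent y) = 0" by (simp add: emeasure_density nn_integral_null_set null_setsI)
   hence "aT = 0" by (simp add: aT_def measure_def)
   thus ?thesis by (simp add: aE_def C_def)
  next
   case False
   hence e: "0 < e" by (simp add: e_def less_le)
   have bE: "0 < measure B E" using pos_B[OF E(1)] e by (simp add: e_def)
   also have "measure B E <= bT" unfolding bT_def using E by (intro B.finite_measure_mono) auto
   finally have bT: "0 < bT" .
   define m where "m = e/(2*bT)"
   define l where "l = m powr (- (\<beta>/\<alpha>))"
   have m: "0 < m" using e bT by (simp add: m_def)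
   have l: "0 < l" using m by (simp add: l_def)
   have "l powr \<alpha>*m powr \<beta> = 1"
   proof -
    have "l powr \<alpha> = m powr (- \<beta>)" using exps by (simp add: l_def powr_powr)
    thus ?thesis using m powr_add[of m "- \<beta>" \<beta>] by simp
   qed
   from measure_le_combination[OF l m this E(1)]
   have "e <= l*aE + m*measure B E" by (simp add: e_def aE_def)
   also have "m*measure B E <= m*bT"
    using m \<open>measure B E \<le> bT\<close> by (intro mult_left_mono) auto
   also have "m*bT = e/2" using bT by (simp add: m_def)
   finally have aE: "e/2 <= l*aE" by simp
   have "aT powr \<alpha>*bT powr \<beta> <= M*t"
    unfolding aT_def bT_def t_def by (rule bound[OF y])
   also have "... <= M*(c*e)" using tc M by (intro mult_left_mono) auto
   finally have "aT powr \<alpha> <= M*(c*e)/bT powr \<beta>"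
    using bT by (simp add: pos_le_divide_eq)
   hence "(aT powr \<alpha>) powr (1/\<alpha>) <= (M*(c*e)/bT powr \<beta>) powr (1/\<alpha>)"
    using exps by (intro powr_mono2) auto
   hence "aT <= (M*(c*e)/bT powr \<beta>) powr (1/\<alpha>)"
    using exps by (simp add: powr_powr aT_def)
   also have "... = C*((e/2)/l)"
   proof -
    have s: "1/\<alpha> = 1 + \<beta>/\<alpha>" using exps by (simp add: field_simps)
    have 1: "M*(c*e)/bT powr \<beta> = (2*M*c)*((e/2)*(bT powr (- \<beta>)))"
     by (simp only: powr_minus_divide) simp
    have "((e/2)*(bT powr (- \<beta>))) powr (1/\<alpha>) = (e/2) powr (1/\<alpha>)*(bT powr (- \<beta>)) powr (1/\<alpha>)"
     by (rule powr_mult)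
    also have "(bT powr (- \<beta>)) powr (1/\<alpha>) = bT powr (- (\<beta>/\<alpha>))"
     by (simp add: powr_powr)
    also have "(e/2) powr (1/\<alpha>) = (e/2)*(e/2) powr (\<beta>/\<alpha>)"
     unfolding s using e by (simp add: powr_add)
    also have "(e/2)*(e/2) powr (\<beta>/\<alpha>)*bT powr (- (\<beta>/\<alpha>)) = (e/2)*((e/2)/bT) powr (\<beta>/\<alpha>)"
    proof -
     have "((e/2)/bT) powr (\<beta>/\<alpha>) = (e/2) powr (\<beta>/\<alpha>)/bT powr (\<beta>/\<alpha>)"
      by (rule powr_divide)
     thus ?thesis by (simp only: powr_minus divide_inverse mult.assoc)
    qed
    also have "((e/2)/bT) powr (\<beta>/\<alpha>) = 1/l"
    proof -
     have "(e/2)/bT = m" by (simp add: m_def)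
     thus ?thesis by (simp add: l_def powr_minus_divide)
    qed
    finally have 2: "((e/2)*(bT powr (- \<beta>))) powr (1/\<alpha>) = (e/2)/l"
     by (simp only: times_divide_eq_right mult_1_right)
    show ?thesis unfolding 1 C_def 2[symmetric] by (rule powr_mult)
   qed
   also have "(e/2)/l <= aE" using aE l by (simp add: pos_divide_le_eq mult.commute)
   finally show ?thesis by (simp add: C_def mult_left_mono)
  qed
  thus "emeasure A (tent y) <= ennreal ((2*M*c) powr (1/\<alpha>))*emeasure A E"
   by (simp add: aT_def aE_def C_def A.emeasure_eq_measure ennreal_mult'[symmetric] ennreal_leI)
 qed
qed simp

lemma doubling_B: "doubling_measure B"
proof -
 interpret f: weight_pair \<beta> \<alpha> M b a by (rule flip)
 show ?thesis by (rule f.doubling_A)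
qed

end

section \<open>The positive Bergman operator on weighted spaces\<close>

definition Pplus :: "(complex^'n::finite => real) => complex^'n => ennreal" where
 "Pplus f z = (\<integral>\<^sub>+w. ennreal (f w)*ennreal (1/hdist z w^(CARD('n) + 1)))"

text \<open>
 Up to bounded factors, the average of \<open>f\<close> over \<open>nbhd bb x\<close> with respect to the volume.
\<close>

definition loc :: "(complex^'n::finite => real) => complex^'n => ennreal" where
 "loc f x = wt x*(\<integral>\<^sub>+w. ennreal (f w)*indicator (nbhd bb x) w)"

lemma measurable_loc [measurable]:
 assumes [measurable]: "f \<in> meas"
 shows "loc f \<in> meas"
proof -
 note [measurable] = borel_measurable_indicator_nbhd(1)[OF refl refl]
 have "(\<lambda>x. \<integral>\<^sup>+w. ennreal (f w)*indicator (nbhd bb x) w \<partial>vol) \<in> meas"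
  by (rule vol.borel_measurable_nn_integral[of "\<lambda>x w. ennreal (f w)*indicator (nbhd bb x) w"]) measurable
 thus ?thesis unfolding loc_def[abs_def] by measurable
qed

lemma Pplus_le_superposition:
 "\<exists>C>0. \<forall>f::complex^'n::finite => real\<in>meas. \<forall>z\<in>unit_ball.
  Pplus f z <= ennreal C*(\<integral>\<^sub>+x. wt x*indicator (nbhd bb x) z*loc f x)"
proof -
 let ?N = "CARD('n) + 1"
 interpret VV: pair_sigma_finite "vol :: (complex^'n) measure" "vol :: (complex^'n) measure" ..
 obtain C where C: "0 < C" "\<And>z w :: complex^'n::finite. z \<in> unit_ball ==> w \<in> unit_ball ==>
  ennreal (1/hdist z w^?N) <= ennreal C *
   (\<integral>\<^sub>+x. ennreal (1/rad x^(2*?N))*indicator (nbhd bb x) z*indicator (nbhd bb x) w)"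
  using kernel_le_superposition[where ?'n = 'n] by blast
 show ?thesis
 proof (intro exI[of _ C] conjI ballI)
  show "0 < C" by fact
  fix f :: "complex^'n => real" and z :: "complex^'n"
  assume f [measurable]: "f \<in> meas" and z: "z \<in> unit_ball"
  note ind [measurable] = borel_measurable_indicator_nbhd(1)[OF refl refl]
   measurable_compose[OF measurable_Pair2'[of z vol vol] borel_measurable_indicator_nbhd(1)[OF refl refl]]
  have indz: "(\<lambda>x. indicator (nbhd bb x) z :: ennreal) \<in> meas"
   using ind(2)[of bb] z by simp
  hence [measurable]: "(\<lambda>p. indicator (nbhd bb (fst p)) z :: ennreal) \<in> borel_measurable (vol \<Otimes>\<^sub>M vol)"
   using measurable_compose[OF measurable_fst indz] by simp
  have "(\<lambda>x. wt x*wt x*indicator (nbhd bb x) z) \<in> meas"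
   by (intro borel_measurable_times_ennreal measurable_wt_vol indz)
  from measurable_compose[OF measurable_snd this, of vol]
  have 1: "(\<lambda>p. wt (snd p)*wt (snd p)*indicator (nbhd bb (snd p)) z) \<in> borel_measurable (vol \<Otimes>\<^sub>M vol)" .
  have "(\<lambda>w. ennreal (f w)) \<in> meas" by measurable
  from measurable_compose[OF measurable_fst this, of vol]
  have 2: "(\<lambda>p. ennreal (f (fst p))) \<in> borel_measurable (vol \<Otimes>\<^sub>M vol)" .
  have meas2: "(\<lambda>(w, x). wt x*wt x*indicator (nbhd bb x) z*(ennreal (f w)*indicator (nbhd bb x) w)) \<in> borel_measurable (vol \<Otimes>\<^sub>M vol)"
   unfolding case_prod_beta'
   by (intro borel_measurable_times_ennreal[OF 1] borel_measurable_times_ennreal[OF 2] borel_measurable_indicator_nbhd(2)[OF refl refl])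
  have wt2: "ennreal (1/rad x^(2*?N)) = wt x*wt x" if "x \<in> unit_ball" for x :: "complex^'n"
  proof -
   have "1/rad x^(2*?N) = 1/rad x^?N*(1/rad x^?N)" by (simp only: mult_2 power_add) simp
   thus ?thesis unfolding wt_def using rad_pos[OF that] by (subst ennreal_mult[symmetric]) auto
  qed
  have "Pplus f z <= (\<integral>\<^sub>+w. ennreal C*(\<integral>\<^sub>+x. wt x*wt x*indicator (nbhd bb x) z*(ennreal (f w)*indicator (nbhd bb x) w)))"
   unfolding Pplus_def
  proof (rule nn_integral_mono)
   fix w :: "complex^'n" assume "w \<in> space vol"
   hence w: "w \<in> unit_ball" by simp
   have indw: "(\<lambda>x. indicator (nbhd bb x) w :: ennreal) \<in> meas"
    using measurable_compose[OF measurable_Pair2'[of w vol vol] borel_measurable_indicator_nbhd(1)[OF refl refl]] w by simp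
   have "ennreal (f w)*ennreal (1/hdist z w^?N) <= ennreal (f w)*(ennreal C *
     (\<integral>\<^sub>+x. ennreal (1/rad x^(2*?N))*indicator (nbhd bb x) z*indicator (nbhd bb x) w))"
    by (intro mult_left_mono C(2) z w) simp
   also have "(\<integral>\<^sub>+x. ennreal (1/rad x^(2*?N))*indicator (nbhd bb x) z*indicator (nbhd bb x) w)
     = (\<integral>\<^sub>+x. wt x*wt x*indicator (nbhd bb x) z*indicator (nbhd bb x) w)"
    by (rule nn_integral_cong) (simp only: space_vol wt2)
   also have "ennreal (f w)*(ennreal C*...) = ennreal C*(ennreal (f w)*...)"
    by (simp only: mult_ac)
   also have "ennreal (f w)*(\<integral>\<^sub>+x. wt x*wt x*indicator (nbhd bb x) z*indicator (nbhd bb x) w)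
     = (\<integral>\<^sub>+x. ennreal (f w)*(wt x*wt x*indicator (nbhd bb x) z*indicator (nbhd bb x) w))"
    by (intro nn_integral_cmult[symmetric] borel_measurable_times_ennreal measurable_wt_vol indz indw)
   also have "... = (\<integral>\<^sub>+x. wt x*wt x*indicator (nbhd bb x) z*(ennreal (f w)*indicator (nbhd bb x) w))"
    by (rule nn_integral_cong) (simp only: mult_ac)
   finally show "ennreal (f w)*ennreal (1/hdist z w^?N)
     <= ennreal C*(\<integral>\<^sub>+x. wt x*wt x*indicator (nbhd bb x) z*(ennreal (f w)*indicator (nbhd bb x) w))" .
  qed
  also have "... = ennreal C*(\<integral>\<^sub>+w. (\<integral>\<^sub>+x. wt x*wt x*indicator (nbhd bb x) z*(ennreal (f w)*indicator (nbhd bb x) w)))"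
  proof (rule nn_integral_cmult)
   from meas2
   show "(\<lambda>w. \<integral>\<^sup>+x. wt x*wt x*indicator (nbhd bb x) z*(ennreal (f w)*indicator (nbhd bb x) w) \<partial>vol) \<in> meas"
    by (rule vol.borel_measurable_nn_integral)
  qed
  also have "(\<integral>\<^sub>+w. (\<integral>\<^sub>+x. wt x*wt x*indicator (nbhd bb x) z*(ennreal (f w)*indicator (nbhd bb x) w)))
    = (\<integral>\<^sub>+x. (\<integral>\<^sub>+w. wt x*wt x*indicator (nbhd bb x) z*(ennreal (f w)*indicator (nbhd bb x) w)))"
   by (rule VV.Fubini'[OF meas2, symmetric])
  also have "... = (\<integral>\<^sub>+x. wt x*indicator (nbhd bb x) z*loc f x)"
  proof (rule nn_integral_cong)
   fix x :: "complex^'n"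
   have "(\<integral>\<^sub>+w. wt x*wt x*indicator (nbhd bb x) z*(ennreal (f w)*indicator (nbhd bb x) w))
     = wt x*wt x*indicator (nbhd bb x) z*(\<integral>\<^sub>+w. ennreal (f w)*indicator (nbhd bb x) w)"
    by (rule nn_integral_cmult) measurable
   thus "(\<integral>\<^sub>+w. wt x*wt x*indicator (nbhd bb x) z*(ennreal (f w)*indicator (nbhd bb x) w))
     = wt x*indicator (nbhd bb x) z*loc f x" by (simp add: loc_def mult_ac)
  qed
  finally show "Pplus f z <= ennreal C*(\<integral>\<^sub>+x. wt x*indicator (nbhd bb x) z*loc f x)"
   by (simp add: mult_left_mono)
 qed
qed

context weight_pair
begin

text \<open>
 Write \<open>f = g * b\<close>. Then \<open>loc f\<close> is the average of \<open>g\<close> with respect to \<open>B\<close>, multiplied by \<open>wt\<close> and the \<open>B\<close>-mass.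
 The strong type inequality for superpositions with respect to \<open>A\<close> and the Bekolle--Bonami condition
 reduce the claim to the strong type inequality for averages with respect to \<open>B\<close>.
\<close>

lemma Pplus_strong_type:
 "\<exists>C>0. \<forall>f\<in>meas. (\<forall>w. 0 <= f w) -->
  (\<integral>\<^sub>+z. epowr (Pplus f z) (1/\<alpha>)*ennreal (a z)) <= ennreal C*(\<integral>\<^sub>+z. ennreal (f z powr (1/\<alpha>)*a z))"
proof -
 let ?N = "CARD('n) + 1"
 define p where "p = 1/\<alpha>"
 have p: "1 < p" "p*\<alpha> = 1" using exps by (simp_all add: p_def)
 have p1: "p*\<beta> = p - 1"
 proof -
  have "p*(\<alpha> + \<beta>) = p" using exps(3) by simp
  thus ?thesis using p(2) by (simp add: distrib_left)
 qed
 interpret DA: doubling_measure A by (rule doubling_A)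
 interpret DB: doubling_measure B by (rule doubling_B)
 obtain C0 where C0: "0 < C0" and dom: "\<forall>f::complex^'n => real\<in>meas. \<forall>z\<in>unit_ball.
  Pplus f z <= ennreal C0*(\<integral>\<^sub>+x. wt x*indicator (nbhd bb x) z*loc f x)"
  using Pplus_le_superposition[where ?'n = 'n] by (elim exE conjE) (rule that)
 obtain C1 where C1: "0 < C1" and supA: "\<forall>H\<in>meas.
  (\<integral>\<^sup>+z. epowr (\<integral>\<^sub>+x. wt x*indicator (nbhd bb x) z*H x) p \<partial>A)
   <= ennreal C1*(\<integral>\<^sub>+x. wt x*DA.mass x*epowr (H x) p)"
  using DA.superposition_strong_type[OF p(1)] by (elim exE conjE) (rule that)
 obtain C2 where C2: "0 < C2" and avB: "\<forall>\<phi>\<in>borel_measurable B. (\<forall>w. 0 <= \<phi> w) -->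
  (\<integral>\<^sub>+x. wt x*DB.mass x*epowr (DB.av (\<lambda>w. ennreal (\<phi> w)) x) p)
   <= ennreal C2*(\<integral>\<^sup>+w. ennreal (\<phi> w powr p) \<partial>B)"
  using DB.av_strong_type[OF p(1)] by (elim exE conjE) (rule that)
 have "0 <= bb" by (simp add: bb_def)
 from nbhd_subset_tent[OF this, where ?'n = 'n] obtain C3 where C3: "0 < C3" and hull:
  "\<forall>x::complex^'n\<in>unit_ball. \<exists>y\<in>unit_ball. nbhd bb x \<subseteq> tent y \<and> emeasure vol (tent y) <= ennreal (C3*rad x^?N)"
  by (elim exE conjE) (rule that)
 define K where "K = (M*C3) powr p"
 have K: "0 < K" using M C3 by (simp add: K_def)
 \<comment> \<open>the Bekolle--Bonami condition, for neighbourhoods\<close>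
 have key: "epowr (wt x*DB.mass x) p*DA.mass x <= ennreal K*DB.mass x" if x: "x \<in> unit_ball" for x
 proof -
  obtain y where y: "y \<in> unit_ball" "nbhd bb x \<subseteq> tent y" "emeasure vol (tent y) <= ennreal (C3*rad x^?N)"
   using bspec[OF hull x] by (elim bexE conjE) (rule that)
  define r where "r = rad x^?N"
  have r: "0 < r" using rad_pos[OF x] by (simp add: r_def)
  define ma where "ma = measure A (nbhd bb x)"
  define mb where "mb = measure B (nbhd bb x)"
  have ma: "DA.mass x = ennreal ma" "0 <= ma" and mb: "DB.mass x = ennreal mb" "0 < mb"
   using DB.mass_pos[OF x] by (auto simp: DA.mass_def DB.mass_def ma_def mb_def A.emeasure_eq_measure B.emeasure_eq_measure)
  have "ma powr \<alpha>*mb powr \<beta> <= measure A (tent y) powr \<alpha>*measure B (tent y) powr \<beta>"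
   using exps y(2) unfolding ma_def mb_def
   by (intro mult_mono powr_mono2 A.finite_measure_mono B.finite_measure_mono) auto
  also have "... <= M*measure vol (tent y)" by (rule bound[OF y(1)])
  also have "... <= M*(C3*r)"
   using y(3) M C3 r by (intro mult_left_mono) (auto simp: vol.emeasure_eq_measure r_def)
  finally have "(ma powr \<alpha>*mb powr \<beta>) powr p <= (M*C3*r) powr p"
   using p by (intro powr_mono2) (auto simp: mult.assoc)
  also have "(ma powr \<alpha>*mb powr \<beta>) powr p = ma*mb powr (p - 1)"
   using ma mb p p1 by (simp add: powr_mult powr_powr mult.commute)
  also have "(M*C3*r) powr p = K*r powr p" using M C3 r by (simp add: K_def powr_mult)
  finally have le: "ma*mb powr (p - 1) <= K*r powr p" .
  have "(1/r*mb) powr p*ma = (ma*mb powr (p - 1))*(mb/r powr p)"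
  proof -
   have "(1/r*mb) powr p = mb powr p/r powr p" using r mb by (simp add: powr_divide)
   also have "mb powr p = mb powr (p - 1)*mb" using mb powr_add[of mb "p - 1" 1] by simp
   finally show ?thesis by simp
  qed
  also have "... <= (K*r powr p)*(mb/r powr p)" using le mb by (intro mult_right_mono) auto
  also have "... = K*mb" using r by simp
  finally have fin: "(1/r*mb) powr p*ma <= K*mb" .
  have "epowr (wt x*DB.mass x) p*DA.mass x = ennreal ((1/r*mb) powr p*ma)"
  proof -
   have "wt x*DB.mass x = ennreal (1/r*mb)"
    unfolding wt_def mb(1) r_def[symmetric] using r mb by (intro ennreal_mult[symmetric]) auto
   thus ?thesis using r mb ma by (simp add: ennreal_mult)
  qed
  also have "... <= ennreal (K*mb)" by (rule ennreal_leI[OF fin])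
  also have "... = ennreal K*DB.mass x" unfolding mb(1) using K mb by (intro ennreal_mult) auto
  finally show ?thesis .
 qed
 define C where "C = C0 powr p*(C1*(K*C2))"
 have C: "0 < C" using C0 C1 C2 K by (simp add: C_def)
 show ?thesis
  unfolding p_def[symmetric]
 proof (intro exI[of _ C] conjI ballI impI)
  show "0 < C" by fact
  fix f :: "complex^'n => real"
  assume f [measurable]: "f \<in> meas" and nn: "\<forall>w. 0 <= f w"
  define \<phi> where "\<phi> w = f w/\<bar>b w\<bar>" for w
  have \<phi> [measurable]: "\<phi> \<in> meas" unfolding \<phi>_def[abs_def] by measurable
  have \<phi>0: "0 <= \<phi> w" for w using nn by (simp add: \<phi>_def)
  have loc: "loc f x = wt x*DB.mass x*DB.av (\<lambda>w. ennreal (\<phi> w)) x" if x: "x \<in> unit_ball" for x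
  proof -
   have "(\<integral>\<^sub>+w. ennreal (f w)*indicator (nbhd bb x) w)
     = (\<integral>\<^sub>+w. ennreal (b w)*(ennreal (\<phi> w)*indicator (nbhd bb x) w))"
   proof (rule nn_integral_cong_AE)
    show "AE w in vol. ennreal (f w)*indicator (nbhd bb x) w = ennreal (b w)*(ennreal (\<phi> w)*indicator (nbhd bb x) w)"
     using pos(2)
    proof eventually_elim
     case (elim w)
     hence "ennreal (f w) = ennreal (b w)*ennreal (\<phi> w)"
      using nn by (subst ennreal_mult[symmetric]) (auto simp: \<phi>_def)
     thus ?case by (simp add: mult.assoc)
    qed
   qed
   also have "... = (\<integral>\<^sup>+w. ennreal (\<phi> w)*indicator (nbhd bb x) w \<partial>B)"
    by (rule nn_integral_density[symmetric]) measurable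
   also have "... = DB.av (\<lambda>w. ennreal (\<phi> w)) x*DB.mass x"
    by (rule DB.av_mass[OF x, symmetric])
   finally show ?thesis by (simp add: loc_def mult_ac)
  qed
  have "(\<integral>\<^sub>+z. epowr (Pplus f z) p*ennreal (a z))
    <= (\<integral>\<^sub>+z. ennreal (a z)*(ennreal (C0 powr p)*epowr (\<integral>\<^sub>+x. wt x*indicator (nbhd bb x) z*loc f x) p))"
  proof (rule nn_integral_mono)
   fix z :: "complex^'n" assume "z \<in> space vol"
   hence "Pplus f z <= ennreal C0*(\<integral>\<^sub>+x. wt x*indicator (nbhd bb x) z*loc f x)"
    using dom f by simp
   hence "epowr (Pplus f z) p <= epowr (ennreal C0*(\<integral>\<^sub>+x. wt x*indicator (nbhd bb x) z*loc f x)) p"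
    using p by (intro epowr_mono) auto
   also have "... = ennreal (C0 powr p)*epowr (\<integral>\<^sub>+x. wt x*indicator (nbhd bb x) z*loc f x) p"
    using p C0 by (subst epowr_mult) auto
   finally show "epowr (Pplus f z) p*ennreal (a z)
     <= ennreal (a z)*(ennreal (C0 powr p)*epowr (\<integral>\<^sub>+x. wt x*indicator (nbhd bb x) z*loc f x) p)"
    unfolding mult.commute[of "ennreal (a z)"] by (intro mult_right_mono) auto
  qed
  also have "... = (\<integral>\<^sup>+z. ennreal (C0 powr p)*epowr (\<integral>\<^sub>+x. wt x*indicator (nbhd bb x) z*loc f x) p \<partial>A)"
  proof (rule nn_integral_density[symmetric])
   have "(\<lambda>z. \<integral>\<^sup>+x. wt x*indicator (nbhd bb x) z*loc f x \<partial>vol) \<in> meas"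
    using DA.measurable_superposition[of "loc f"] by simp
   thus "(\<lambda>z. ennreal (C0 powr p)*epowr (\<integral>\<^sub>+x. wt x*indicator (nbhd bb x) z*loc f x) p) \<in> meas"
    by measurable
  qed measurable
  also have "... = ennreal (C0 powr p)*(\<integral>\<^sup>+z. epowr (\<integral>\<^sub>+x. wt x*indicator (nbhd bb x) z*loc f x) p \<partial>A)"
   by (intro nn_integral_cmult borel_measurable_epowr DA.measurable_superposition) measurable
  also have "... <= ennreal (C0 powr p)*(ennreal C1*(\<integral>\<^sub>+x. wt x*DA.mass x*epowr (loc f x) p))"
   by (intro mult_left_mono supA[rule_format]) measurable
  also have "(\<integral>\<^sub>+x. wt x*DA.mass x*epowr (loc f x) p)
    <= (\<integral>\<^sub>+x. ennreal K*(wt x*DB.mass x*epowr (DB.av (\<lambda>w. ennreal (\<phi> w)) x) p))"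
  proof (rule nn_integral_mono)
   fix x :: "complex^'n" assume "x \<in> space vol"
   hence x: "x \<in> unit_ball" by simp
   have "wt x*DA.mass x*epowr (loc f x) p
     = wt x*epowr (DB.av (\<lambda>w. ennreal (\<phi> w)) x) p*(epowr (wt x*DB.mass x) p*DA.mass x)"
    unfolding loc[OF x] using p by (subst (1) epowr_mult) (auto simp: mult_ac)
   also have "... <= wt x*epowr (DB.av (\<lambda>w. ennreal (\<phi> w)) x) p*(ennreal K*DB.mass x)"
    by (intro mult_left_mono key x) simp
   finally show "wt x*DA.mass x*epowr (loc f x) p
     <= ennreal K*(wt x*DB.mass x*epowr (DB.av (\<lambda>w. ennreal (\<phi> w)) x) p)"
    by (simp only: mult_ac)
  qed
  also have "... = ennreal K*(\<integral>\<^sub>+x. wt x*DB.mass x*epowr (DB.av (\<lambda>w. ennreal (\<phi> w)) x) p)"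
   by (rule nn_integral_cmult) measurable
  also have "... <= ennreal K*(ennreal C2*(\<integral>\<^sup>+w. ennreal (\<phi> w powr p) \<partial>B))"
   by (intro mult_left_mono avB[rule_format]) (auto simp: \<phi>0)
  also have "(\<integral>\<^sup>+w. ennreal (\<phi> w powr p) \<partial>B) = (\<integral>\<^sub>+w. ennreal (b w)*ennreal (\<phi> w powr p))"
   by (rule nn_integral_density) measurable
  also have "... = (\<integral>\<^sub>+w. ennreal (f w powr p*a w))"
  proof (rule nn_integral_cong_AE)
   show "AE w in vol. ennreal (b w)*ennreal (\<phi> w powr p) = ennreal (f w powr p*a w)"
    using pos(1) pos(2) dual
   proof eventually_elim
    case (elim w)
    have "(a w powr \<alpha>*b w powr \<beta>) powr p = (a w powr \<alpha>) powr p*(b w powr \<beta>) powr p"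
     by (rule powr_mult)
    also have "... = a w*b w powr (p - 1)"
     using elim(1,2) p p1 by (simp add: powr_powr mult.commute)
    finally have ab: "a w*b w powr (p - 1) = 1" unfolding elim(3) by simp
    have "b w*\<phi> w powr p = f w powr p*(b w/b w powr p)"
     using elim nn by (simp add: \<phi>_def powr_divide)
    also have "b w/b w powr p = 1/b w powr (p - 1)" using elim powr_add[of "b w" "p - 1" 1] by simp
    also have "1/b w powr (p - 1) = a w" using ab elim by (simp add: field_simps)
    finally show ?case using elim by (simp add: ennreal_mult'[symmetric])
   qed
  qed
  finally have "(\<integral>\<^sub>+z. epowr (Pplus f z) p*ennreal (a z))
    <= ennreal (C0 powr p)*(ennreal C1*(ennreal K*(ennreal C2*(\<integral>\<^sub>+w. ennreal (f w powr p*a w)))))"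
   by (simp add: mult_left_mono)
  also have "... = ennreal C*(\<integral>\<^sub>+w. ennreal (f w powr p*a w))"
   using C0 C1 C2 K by (simp add: C_def ennreal_mult mult.assoc)
  finally show "(\<integral>\<^sub>+z. epowr (Pplus f z) p*ennreal (a z)) <= ennreal C*(\<integral>\<^sub>+z. ennreal (f z powr p*a z))" .
 qed
qed

end

lemma avg_eq:
 assumes [measurable]: "f \<in> meas" and "T \<in> sets vol"
 shows "avg f T = emeasure (density vol (\<lambda>w. ennreal (f w))) T/emeasure vol T"
 using assms(2) by (simp add: avg_def emeasure_density)

lemma Bp_weight_pair:
 fixes \<sigma> :: "complex^'n::finite => real"
 assumes p: "1 < p" and \<sigma>: "\<sigma> \<in> Bp p"
 shows "\<exists>M. weight_pair (1/p) (1 - 1/p) M \<sigma> (\<lambda>w. \<sigma> w powr (1 - p/(p - 1)))"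
proof -
 define b where "b w = \<sigma> w powr (1 - p/(p - 1))" for w
 have meas [measurable]: "\<sigma> \<in> meas" and pos: "AE w in vol. 0 < \<sigma> w"
  and sup: "(SUP z\<in>unit_ball. avg \<sigma> (tent z)*epowr (avg b (tent z)) (p - 1)) < \<top>"
  using \<sigma> by (auto simp: Bp_def weight_def Let_def b_def[abs_def])
 have measb [measurable]: "b \<in> meas" unfolding b_def[abs_def] by measurable
 have posb: "AE w in vol. 0 < b w" using pos by eventually_elim (simp add: b_def)
 define A where "A = density vol (\<lambda>w. ennreal (\<sigma> w))"
 define B where "B = density vol (\<lambda>w. ennreal (b w))"
 obtain m where m: "0 <= m" "(SUP z\<in>unit_ball. avg \<sigma> (tent z)*epowr (avg b (tent z)) (p - 1)) = ennreal m"
  using sup by (cases "SUP z\<in>unit_ball. avg \<sigma> (tent z)*epowr (avg b (tent z)) (p - 1)") auto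
 have le: "emeasure A (tent y)/emeasure vol (tent y)*epowr (emeasure B (tent y)/emeasure vol (tent y)) (p - 1) <= ennreal m"
  if y: "y \<in> unit_ball" for y
 proof -
  have "avg \<sigma> (tent y)*epowr (avg b (tent y)) (p - 1) <= ennreal m"
   unfolding m(2)[symmetric] by (rule SUP_upper[OF y])
  thus ?thesis by (simp add: avg_eq A_def B_def)
 qed
 have t0: "tent 0 = (unit_ball :: (complex^'n) set)" by (simp add: tent_def)
 have v1: "emeasure vol (unit_ball :: (complex^'n) set) = 1"
  by (rule vol.emeasure_space_1[unfolded space_vol])
 have ub: "(unit_ball :: (complex^'n) set) \<in> sets vol"
  using sets_tent[of "0 :: complex^'n"] by (simp add: t0)
 have posA: "0 < emeasure A unit_ball" and posB: "0 < emeasure B unit_ball"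
  unfolding A_def B_def by (rule emeasure_density_pos[OF meas pos ub], simp add: v1, rule emeasure_density_pos[OF measb posb ub], simp add: v1)
 have le0: "emeasure A unit_ball*epowr (emeasure B unit_ball) (p - 1) <= ennreal m"
  using le[of 0] by (simp add: t0 v1 divide_ennreal_def)
 have finA: "emeasure A unit_ball < \<top>"
 proof (rule ccontr)
  assume "\<not> ?thesis"
  hence *: "emeasure A unit_ball = \<top>" unfolding less_top[symmetric] by simp
  have "0 < epowr (emeasure B unit_ball) (p - 1)" using posB by (cases "emeasure B unit_ball") auto
  thus False using le0 by (auto simp: * ennreal_top_mult top_unique split: if_splits)
 qed
 have finB: "emeasure B unit_ball < \<top>"
 proof (rule ccontr)
  assume "\<not> ?thesis"
  hence *: "emeasure B unit_ball = \<top>" unfolding less_top[symmetric] by simp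
  show False using le0 posA by (auto simp: * ennreal_mult_top top_unique split: if_splits)
 qed
 have finT: "emeasure A T < \<top>" "emeasure B T < \<top>" if "T \<subseteq> unit_ball" for T
  using that emeasure_mono[of T unit_ball A] emeasure_mono[of T unit_ball B] finA finB ub
  by (auto simp: A_def B_def intro: le_less_trans)
 have intA: "(\<integral>\<^sub>+w. ennreal (\<sigma> w)) = emeasure A unit_ball"
  unfolding A_def using ub by (subst emeasure_density) (auto intro!: nn_integral_cong)
 have intB: "(\<integral>\<^sub>+w. ennreal (b w)) = emeasure B unit_ball"
  unfolding B_def using ub by (subst emeasure_density) (auto intro!: nn_integral_cong)
 define M where "M = m powr (1/p) + 1"
 have "weight_pair (1/p) (1 - 1/p) M \<sigma> b"
 proof
  show "0 < 1/p" "0 < 1 - 1/p" "1/p + (1 - 1/p) = 1" using p by simp_all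
  show "\<sigma> \<in> meas" "b \<in> meas" "AE w in vol. 0 < \<sigma> w" "AE w in vol. 0 < b w"
   by fact+
  show "AE w in vol. \<sigma> w powr (1/p)*b w powr (1 - 1/p) = 1"
   using pos
  proof eventually_elim
   case (elim w)
   have "p - 1 \<noteq> 0" "p \<noteq> 0" using p by simp_all
   hence "1/p + (1 - p/(p - 1))*(1 - 1/p) = 0" by (simp add: field_simps)
   moreover have "\<sigma> w powr (1/p)*b w powr (1 - 1/p) = \<sigma> w powr (1/p + (1 - p/(p - 1))*(1 - 1/p))"
    unfolding b_def powr_powr by (rule powr_add[symmetric])
   ultimately show ?case using elim by simp
  qed
  show "(\<integral>\<^sub>+w. ennreal (\<sigma> w)) < \<top>" "(\<integral>\<^sub>+w. ennreal (b w)) < \<top>"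
   using finA finB by (simp_all add: intA intB)
  show "0 < M" by (simp add: M_def add_nonneg_pos)
  fix y :: "complex^'n" assume y: "y \<in> unit_ball"
  let ?T = "tent y"
  define t where "t = measure vol ?T"
  have t: "emeasure vol ?T = ennreal t" "0 <= t" by (simp_all add: t_def vol.emeasure_eq_measure)
  obtain x where x: "emeasure A ?T = ennreal x" "0 <= x"
   using finT(1)[OF tent_subset[of y]] by (cases "emeasure A ?T") auto
  obtain z where z: "emeasure B ?T = ennreal z" "0 <= z"
   using finT(2)[OF tent_subset[of y]] by (cases "emeasure B ?T") auto
  have "x powr (1/p)*z powr (1 - 1/p) <= M*t"
  proof (cases "t = 0")
   case True
   hence "emeasure A ?T = 0"
    using t by (simp add: A_def emeasure_density nn_integral_null_set null_setsI)
   hence "x = 0" using x by simp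
   thus ?thesis using True by simp
  next
   case False
   hence t0: "0 < t" using t by simp
   have "ennreal (x/t*(z/t) powr (p - 1)) <= ennreal m"
    using le[OF y] x z t t0 by (simp add: divide_ennreal ennreal_mult[symmetric])
   hence "x/t*(z/t) powr (p - 1) <= m" using m(1) by simp
   hence "(x/t*(z/t) powr (p - 1)) powr (1/p) <= m powr (1/p)"
    using p x z t0 by (intro powr_mono2) auto
   also have "(x/t*(z/t) powr (p - 1)) powr (1/p) = (x/t) powr (1/p)*(z/t) powr ((p - 1)*(1/p))"
    by (simp only: powr_mult powr_powr)
   also have "(p - 1)*(1/p) = 1 - 1/p" using p by (simp add: field_simps)
   also have "(x/t) powr (1/p)*(z/t) powr (1 - 1/p) = (x powr (1/p)*z powr (1 - 1/p))/(t powr (1/p)*t powr (1 - 1/p))"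
    by (simp only: powr_divide times_divide_times_eq)
   also have "t powr (1/p)*t powr (1 - 1/p) = t" using t0 powr_add[of t "1/p" "1 - 1/p"] by simp
   finally have "x powr (1/p)*z powr (1 - 1/p) <= m powr (1/p)*t"
    using t0 by (simp add: pos_divide_le_eq)
   also have "... <= M*t" using t0 by (intro mult_right_mono) (auto simp: M_def)
   finally show ?thesis .
  qed
  moreover have "measure A ?T = x" "measure B ?T = z" using x z by (simp_all add: measure_def)
  ultimately show "measure (density vol (\<lambda>w. ennreal (\<sigma> w))) ?T powr (1/p)*measure (density vol (\<lambda>w. ennreal (b w))) ?T powr (1 - 1/p)
    <= M*measure vol ?T" by (simp add: A_def B_def t_def)
 qed
 thus ?thesis unfolding b_def[abs_def] by blast
qed

text \<open>
 The strong type inequality for the Bergman kernel in absolute value, and the embedding into \<open>L^1\<close>, for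
 weights of class \<open>Bp\<close>.
\<close>

lemma Bp_finite:
 assumes "1 < p" "\<sigma> \<in> Bp p"
 shows "(\<integral>\<^sub>+w. ennreal (\<sigma> w)) < \<top>"
 using Bp_weight_pair[OF assms] weight_pair.fin(1) by blast

lemma Bp_Pplus:
 assumes p: "1 < p" and \<sigma>: "\<sigma> \<in> Bp p"
 shows "\<exists>C>0. \<forall>f\<in>meas. (\<forall>w. 0 <= f w) -->
  (\<integral>\<^sub>+z. epowr (Pplus f z) p*ennreal (\<sigma> z)) <= ennreal C*(\<integral>\<^sub>+z. ennreal (f z powr p*\<sigma> z))"
proof -
 obtain M where M: "weight_pair (1/p) (1 - 1/p) M \<sigma> (\<lambda>w. \<sigma> w powr (1 - p/(p - 1)))"
  using Bp_weight_pair[OF assms] by blast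
 have "1/(1/p) = p" by simp
 thus ?thesis using weight_pair.Pplus_strong_type[OF M] by (simp only:)
qed

lemma Bp_L1:
 assumes p: "1 < p" and \<sigma>: "\<sigma> \<in> Bp p"
 shows "\<exists>C\<ge>0. \<forall>f\<in>meas. (\<forall>w. 0 <= f w) -->
  (\<integral>\<^sub>+w. ennreal (f w)) <= (\<integral>\<^sub>+w. ennreal (f w powr p*\<sigma> w)) + ennreal C"
proof -
 define b where "b w = \<sigma> w powr (1 - p/(p - 1))" for w
 obtain M where M: "weight_pair (1/p) (1 - 1/p) M \<sigma> b"
  using Bp_weight_pair[OF assms] unfolding b_def[abs_def] by blast
 interpret weight_pair "1/p" "1 - 1/p" M \<sigma> b by (rule M)
 obtain C where C: "0 <= C" "(\<integral>\<^sub>+w. ennreal (b w)) = ennreal C"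
  using fin(2) by (cases "\<integral>\<^sup>+w. ennreal (b w) \<partial>vol") auto
 show ?thesis
 proof (intro exI[of _ C] conjI ballI impI)
  show "0 <= C" by fact
  fix f :: "complex^'a => real" assume [measurable]: "f \<in> meas" and nn: "\<forall>w. 0 <= f w"
  have "(\<integral>\<^sub>+w. ennreal (f w)) <= (\<integral>\<^sub>+w. ennreal (f w powr p*\<sigma> w) + ennreal (b w))"
  proof (rule nn_integral_mono_AE)
   show "AE w in vol. ennreal (f w) <= ennreal (f w powr p*\<sigma> w) + ennreal (b w)"
    using pos(1)
   proof eventually_elim
    case (elim w)
    have "f w <= f w powr p*\<sigma> w + b w"
    proof (cases "f w <= b w")
     case True
     thus ?thesis using elim by (simp add: add_increasing)
    next
     case False
     have b0: "0 < b w" using elim by (simp add: b_def)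
     hence f0: "0 < f w" using False by simp
     have "p - 1 \<noteq> 0" using p by simp
     hence e: "(1 - p/(p - 1))*(p - 1) = - 1" by (simp add: field_simps)
     have "b w powr (p - 1)*\<sigma> w = \<sigma> w powr (- 1)*\<sigma> w"
      unfolding b_def powr_powr e ..
     also have "... = 1" using elim by (simp add: powr_minus_divide)
     finally have "1 = b w powr (p - 1)*\<sigma> w" by simp
     also have "... <= f w powr (p - 1)*\<sigma> w"
      using False b0 p elim by (intro mult_right_mono powr_mono2) auto
     finally have "f w*1 <= f w*(f w powr (p - 1)*\<sigma> w)"
      using f0 by (intro mult_left_mono) auto
     also have "... = f w powr p*\<sigma> w" using f0 powr_add[of "f w" 1 "p - 1"] by simp
     finally show ?thesis using b0 by simp
    qed
    hence "ennreal (f w) <= ennreal (f w powr p*\<sigma> w + b w)" by (rule ennreal_leI)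
    also have "... = ennreal (f w powr p*\<sigma> w) + ennreal (b w)"
     using elim by (intro ennreal_plus) (auto simp: b_def)
    finally show ?case .
   qed
  qed
  also have "... = (\<integral>\<^sub>+w. ennreal (f w powr p*\<sigma> w)) + ennreal C"
   unfolding C(2)[symmetric] by (rule nn_integral_add) measurable
  finally show "(\<integral>\<^sub>+w. ennreal (f w)) <= (\<integral>\<^sub>+w. ennreal (f w powr p*\<sigma> w)) + ennreal C" .
 qed
qed

text \<open>For a weight of class \<open>B1\<close>, the number \<open>1 / l\<close> below is a lower bound for the weight on a tent.\<close>

lemma B1_lower_bound:
 fixes \<sigma> :: "complex^'n::finite => real"
 assumes \<sigma>: "\<sigma> \<in> B1"
 defines "S \<equiv> density vol (\<lambda>w. ennreal (\<sigma> w))"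
 shows "\<exists>M>0. \<forall>y\<in>unit_ball. \<exists>l>0. (AE w in vol. w \<in> tent y --> 1 <= l*\<sigma> w) \<and>
  emeasure S (tent y)*ennreal l <= ennreal M*emeasure vol (tent y)"
proof -
 define L where "L y = Linf_norm (restrict_space vol (tent y)) (\<lambda>w. inverse (\<sigma> w))" for y
 have meas [measurable]: "\<sigma> \<in> meas" and pos: "AE w in vol. 0 < \<sigma> w"
  and sup: "(SUP y\<in>unit_ball. avg \<sigma> (tent y)*L y) < \<top>"
  using \<sigma> by (auto simp: B1_def weight_def L_def)
 obtain m where m: "0 <= m" "(SUP y\<in>unit_ball. avg \<sigma> (tent y)*L y) = ennreal m"
  using sup by (cases "SUP y\<in>unit_ball. avg \<sigma> (tent y)*L y") auto
 show ?thesis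
 proof (rule exI[of _ "m + 1"], intro conjI ballI)
  show "0 < m + 1" using m by simp
  fix y :: "complex^'n" assume y: "y \<in> unit_ball"
  let ?T = "tent y"
  have le: "emeasure S ?T/emeasure vol ?T*L y <= ennreal m"
  proof -
   have "avg \<sigma> ?T*L y <= ennreal m" unfolding m(2)[symmetric] by (rule SUP_upper[OF y])
   thus ?thesis by (simp add: avg_eq S_def)
  qed
  have low: "AE w in vol. w \<in> ?T --> ennreal (norm (inverse (\<sigma> w))) <= L y"
  proof -
   have "AE w in restrict_space vol ?T. ennreal (norm (inverse (\<sigma> w))) <= L y"
    unfolding L_def Linf_norm_def by (rule esssup_AE)
   thus ?thesis
    by (subst (asm) AE_restrict_space_iff) (simp_all add: sets.Int_space_eq2 del: space_vol)
  qed
  show "\<exists>l>0. (AE w in vol. w \<in> ?T --> 1 <= l*\<sigma> w) \<and>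
    emeasure S ?T*ennreal l <= ennreal (m + 1)*emeasure vol ?T"
  proof (cases "emeasure vol ?T = 0")
   case True
   hence "AE w in vol. w \<notin> ?T" by (intro AE_not_in null_setsI) auto
   hence "AE w in vol. w \<in> ?T --> 1 <= 1*\<sigma> w" by eventually_elim simp
   moreover have "emeasure S ?T = 0"
    using True by (simp add: S_def emeasure_density nn_integral_null_set null_setsI)
   ultimately show ?thesis by (intro exI[of _ 1]) simp
  next
   case False
   hence Tpos: "0 < emeasure vol ?T" by (simp add: zero_less_iff_neq_zero)
   have Tfin: "emeasure vol ?T \<noteq> \<top>" by (simp add: vol.emeasure_eq_measure)
   have Spos: "0 < emeasure S ?T"
    unfolding S_def by (rule emeasure_density_pos[OF meas pos sets_tent Tpos])
   hence avpos: "emeasure S ?T/emeasure vol ?T \<noteq> 0"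
    using Tfin by (simp add: ennreal_divide_eq_0_iff)
   have "L y \<noteq> \<top>"
   proof
    assume "L y = \<top>"
    thus False using le avpos by (simp add: ennreal_mult_top top_unique)
   qed
   then obtain l where l: "L y = ennreal l" "0 <= l" by (cases "L y") auto
   have ae: "AE w in vol. w \<in> ?T --> 0 < l \<and> 1 <= l*\<sigma> w"
    using low pos
   proof eventually_elim
    case (elim w)
    show ?case
    proof
     assume "w \<in> ?T"
     hence le: "inverse (\<sigma> w) <= l" using elim l by (simp add: ennreal_le_iff)
     have "inverse (\<sigma> w)*\<sigma> w <= l*\<sigma> w"
      by (rule mult_right_mono[OF le less_imp_le[OF elim(2)]])
     moreover have "0 < l" by (rule less_le_trans[OF positive_imp_inverse_positive[OF elim(2)] le])
     ultimately show "0 < l \<and> 1 <= l*\<sigma> w" using elim(2) by simp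
    qed
   qed
   have l0: "0 < l"
   proof (rule ccontr)
    assume "\<not> 0 < l"
    with ae have "AE w in vol. w \<notin> ?T" by auto
    hence "emeasure vol ?T = 0"
     by (subst (asm) AE_iff_measurable[where N = ?T]) (auto dest: subsetD[OF tent_subset])
    with False show False ..
   qed
   have "emeasure S ?T*ennreal l = emeasure S ?T/emeasure vol ?T*L y*emeasure vol ?T"
   proof -
    have "emeasure S ?T/emeasure vol ?T*emeasure vol ?T = emeasure S ?T"
     using False Tfin by (simp add: ennreal_divide_times ennreal_divide_self less_top[symmetric])
    hence "emeasure S ?T*ennreal l = (emeasure S ?T/emeasure vol ?T*emeasure vol ?T)*L y"
     by (simp only: l(1))
    thus ?thesis by (simp only: mult_ac)
   qed
   also have "... <= ennreal m*emeasure vol ?T" by (intro mult_right_mono le) simp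
   also have "... <= ennreal (m + 1)*emeasure vol ?T"
    by (intro mult_right_mono ennreal_leI) simp_all
   finally have "emeasure S ?T*ennreal l <= ennreal (m + 1)*emeasure vol ?T" .
   moreover have "AE w in vol. w \<in> ?T --> 1 <= l*\<sigma> w"
    using ae by eventually_elim simp
   ultimately show ?thesis using l0 by blast
  qed
 qed
qed

lemma nn_integral_le_B1:
 assumes [measurable]: "\<sigma> \<in> meas" "f \<in> meas" "E \<in> sets vol"
  and l: "0 < l" "AE w in vol. w \<in> T --> 1 <= l*\<sigma> w" and E: "E \<subseteq> T" and nn: "\<And>w. 0 <= f w"
 shows "(\<integral>\<^sub>+w. ennreal (f w)*indicator E w)
  <= ennreal l*(\<integral>\<^sup>+w. ennreal (f w)*indicator E w \<partial>density vol (\<lambda>w. ennreal (\<sigma> w)))"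
proof -
 have "(\<integral>\<^sub>+w. ennreal (f w)*indicator E w)
   <= (\<integral>\<^sub>+w. ennreal l*(ennreal (\<sigma> w)*(ennreal (f w)*indicator E w)))"
 proof (rule nn_integral_mono_AE)
  show "AE w in vol. ennreal (f w)*indicator E w <= ennreal l*(ennreal (\<sigma> w)*(ennreal (f w)*indicator E w))"
   using l(2)
  proof eventually_elim
   case (elim w)
   show ?case
   proof (cases "w \<in> E")
    case True
    hence "1 <= l*\<sigma> w" using elim E by blast
    hence "1*ennreal (f w) <= ennreal (l*\<sigma> w)*ennreal (f w)"
     by (intro mult_right_mono) (simp_all add: ennreal_1[symmetric] del: ennreal_1)
    thus ?thesis using True l(1) by (simp add: ennreal_mult' mult.assoc)
   qed simp
  qed
 qed
 also have "... = ennreal l*(\<integral>\<^sup>+w. ennreal (f w)*indicator E w \<partial>density vol (\<lambda>w. ennreal (\<sigma> w)))"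
  by (simp add: nn_integral_cmult nn_integral_density)
 finally show ?thesis .
qed

lemma B1_doubling:
 fixes \<sigma> :: "complex^'n::finite => real"
 assumes \<sigma>: "\<sigma> \<in> B1"
 shows "doubling_measure (density vol (\<lambda>w. ennreal (\<sigma> w)))"
proof -
 define S where "S = density vol (\<lambda>w. ennreal (\<sigma> w))"
 have meas [measurable]: "\<sigma> \<in> meas" and pos: "AE w in vol. 0 < \<sigma> w"
  using \<sigma> by (auto simp: B1_def weight_def)
 obtain M where M: "0 < M" "\<forall>y::complex^'n\<in>unit_ball. \<exists>l>0. (AE w in vol. w \<in> tent y --> 1 <= l*\<sigma> w) \<and>
  emeasure S (tent y)*ennreal l <= ennreal M*emeasure vol (tent y)"
  using B1_lower_bound[OF \<sigma>, folded S_def] by (elim exE conjE) (rule that)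
 have "doubling_measure S"
 proof (rule doubling_measureI)
  show "sets S = sets vol" by (simp add: S_def)
  show "0 < emeasure S A" if "A \<in> sets vol" "0 < emeasure vol A" for A
   unfolding S_def by (rule emeasure_density_pos[OF meas pos that])
  have "(0 :: complex^'n) \<in> unit_ball" by simp
  from bspec[OF M(2) this] obtain l where l: "0 < l"
   "emeasure S (tent (0 :: complex^'n))*ennreal l <= ennreal M*emeasure vol (tent (0 :: complex^'n))"
   by blast
  note l(2)
  also have "ennreal M*emeasure vol (tent (0 :: complex^'n)) < \<top>"
   by (simp add: vol.emeasure_eq_measure ennreal_mult_less_top)
  finally have "emeasure S (tent (0 :: complex^'n)) < \<top>"
   using l(1) by (auto simp: ennreal_mult_less_top)
  thus "emeasure S unit_ball < \<top>" by (simp add: tent_def)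
  fix c :: real assume c: "0 < c"
  show "\<exists>C. \<forall>y\<in>unit_ball. \<forall>E\<in>sets vol. E \<subseteq> tent y -->
   emeasure vol (tent y) <= ennreal c*emeasure vol E --> emeasure S (tent y) <= ennreal C*emeasure S E"
  proof (intro exI ballI impI)
   fix y :: "complex^'n" and E
   assume y: "y \<in> unit_ball" and E: "E \<in> sets vol" "E \<subseteq> tent y"
    and le: "emeasure vol (tent y) <= ennreal c*emeasure vol E"
   obtain l where l: "0 < l" "AE w in vol. w \<in> tent y --> 1 <= l*\<sigma> w"
    "emeasure S (tent y)*ennreal l <= ennreal M*emeasure vol (tent y)"
    using bspec[OF M(2) y] by blast
   have vE: "emeasure vol E <= ennreal l*emeasure S E"
    using nn_integral_le_B1[OF meas _ E(1) l(1,2) E(2), of "\<lambda>_. 1"] E(1) by (simp add: S_def)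
   have "emeasure S (tent y)*ennreal l <= ennreal M*(ennreal c*(ennreal l*emeasure S E))"
    by (rule order_trans[OF l(3)], intro mult_left_mono order_trans[OF le] vE) simp_all
   also have "... = ennreal (M*c)*emeasure S E*ennreal l"
    using M(1) c by (simp add: ennreal_mult mult_ac)
   finally have "emeasure S (tent y)*ennreal l/ennreal l <= ennreal (M*c)*emeasure S E*ennreal l/ennreal l"
    by (rule divide_right_mono_ennreal)
   thus "emeasure S (tent y) <= ennreal (M*c)*emeasure S E"
    using l(1) by (simp add: ennreal_mult_divide_eq)
  qed
 qed
 thus ?thesis by (simp add: S_def)
qed

text \<open>
 The lower bound for \<open>\<sigma>\<close> on tents dominates \<open>loc f\<close> by a multiple of the average of \<open>f\<close> with respect to
 \<open>\<sigma>\<close>, so the weak type inequality for superpositions of averages applies.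
\<close>

lemma B1_Pplus:
 fixes \<sigma> :: "complex^'n::finite => real"
 assumes \<sigma>: "\<sigma> \<in> B1"
 shows "\<exists>C>0. \<forall>f\<in>meas. (\<forall>w. 0 <= f w) --> (\<forall>t>0.
  emeasure (density vol (\<lambda>w. ennreal (\<sigma> w))) {z \<in> unit_ball. ennreal t < Pplus f z}
   <= ennreal (C/t)*(\<integral>\<^sub>+z. ennreal (f z*\<sigma> z)))"
proof -
 let ?N = "CARD('n) + 1"
 define S where "S = density vol (\<lambda>w. ennreal (\<sigma> w))"
 have meas [measurable]: "\<sigma> \<in> meas" and pos: "AE w in vol. 0 < \<sigma> w"
  using \<sigma> by (auto simp: B1_def weight_def)
 have sets_S [measurable_cong]: "sets S = sets vol" by (simp add: S_def)
 interpret D: doubling_measure S unfolding S_def by (rule B1_doubling[OF \<sigma>])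
 obtain M where M: "0 < M" "\<forall>y::complex^'n\<in>unit_ball. \<exists>l>0. (AE w in vol. w \<in> tent y --> 1 <= l*\<sigma> w) \<and>
  emeasure S (tent y)*ennreal l <= ennreal M*emeasure vol (tent y)"
  using B1_lower_bound[OF \<sigma>, folded S_def] by (elim exE conjE) (rule that)
 obtain C0 where C0: "0 < C0" and dom: "\<forall>f::complex^'n => real\<in>meas. \<forall>z\<in>unit_ball.
  Pplus f z <= ennreal C0*(\<integral>\<^sub>+x. wt x*indicator (nbhd bb x) z*loc f x)"
  using Pplus_le_superposition[where ?'n = 'n] by (elim exE conjE) (rule that)
 obtain C1 where C1: "0 < C1" and weak: "\<forall>\<phi>\<in>borel_measurable S. \<forall>t>0.
  emeasure S {z \<in> unit_ball. ennreal t < (\<integral>\<^sub>+x. wt x*indicator (nbhd bb x) z*D.av \<phi> x)}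
   <= ennreal (C1/t)*(\<integral>\<^sup>+w. \<phi> w \<partial>S)"
  using D.superposition_weak_type by (elim exE conjE) (rule that)
 have "0 <= bb" by (simp add: bb_def)
 from nbhd_subset_tent[OF this, where ?'n = 'n] obtain C3 where C3: "0 < C3" and hull:
  "\<forall>x::complex^'n\<in>unit_ball. \<exists>y\<in>unit_ball. nbhd bb x \<subseteq> tent y \<and> emeasure vol (tent y) <= ennreal (C3*rad x^?N)"
  by (elim exE conjE) (rule that)
 define K where "K = C0*(M*C3)"
 have K: "0 < K" using C0 M C3 by (simp add: K_def)
 show ?thesis
  unfolding S_def[symmetric]
 proof (intro exI[of _ "C1*K"] conjI ballI impI allI)
  show "0 < C1*K" using C1 K by simp
  fix f :: "complex^'n => real" and t :: real
  assume f [measurable]: "f \<in> meas" and nn: "\<forall>w. 0 <= f w" and t: "0 < t"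
  define \<phi> where "\<phi> w = ennreal (f w)" for w
  have \<phi>: "\<phi> \<in> borel_measurable S" unfolding \<phi>_def[abs_def] by measurable
  have loc_le: "loc f x <= ennreal (M*C3)*D.av \<phi> x" if x: "x \<in> unit_ball" for x
  proof -
   obtain y where y: "y \<in> unit_ball" "nbhd bb x \<subseteq> tent y" "emeasure vol (tent y) <= ennreal (C3*rad x^?N)"
    using bspec[OF hull x] by (elim bexE conjE) (rule that)
   obtain l where l: "0 < l" "AE w in vol. w \<in> tent y --> 1 <= l*\<sigma> w"
    "emeasure S (tent y)*ennreal l <= ennreal M*emeasure vol (tent y)"
    using bspec[OF M(2) y(1)] by blast
   have "(\<integral>\<^sub>+w. ennreal (f w)*indicator (nbhd bb x) w)
     <= ennreal l*(\<integral>\<^sup>+w. \<phi> w*indicator (nbhd bb x) w \<partial>S)"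
    unfolding S_def \<phi>_def using nn
    by (intro nn_integral_le_B1[OF meas f _ l(1,2) y(2)]) auto
   also have "(\<integral>\<^sup>+w. \<phi> w*indicator (nbhd bb x) w \<partial>S) = D.av \<phi> x*D.mass x"
    by (rule D.av_mass[OF x, symmetric])
   also have "ennreal l*(D.av \<phi> x*D.mass x) = D.av \<phi> x*(D.mass x*ennreal l)"
    by (simp only: mult_ac)
   also have "D.mass x*ennreal l <= emeasure S (tent y)*ennreal l"
    unfolding D.mass_def using y(2) by (intro mult_right_mono emeasure_mono) (auto simp: sets_S)
   also have "... <= ennreal M*ennreal (C3*rad x^?N)"
    by (rule order_trans[OF l(3)], intro mult_left_mono y(3)) simp
   finally have "loc f x <= wt x*(D.av \<phi> x*(ennreal M*ennreal (C3*rad x^?N)))"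
    unfolding loc_def by (simp add: mult_left_mono)
   also have "... = (wt x*(ennreal M*ennreal (C3*rad x^?N)))*D.av \<phi> x"
    by (simp only: mult_ac)
   also have "wt x*(ennreal M*ennreal (C3*rad x^?N)) = ennreal (1/rad x^?N*(M*(C3*rad x^?N)))"
    unfolding wt_def using M(1) C3 rad_pos[OF x] by (simp add: ennreal_mult[symmetric] del: power_Suc)
   also have "1/rad x^?N*(M*(C3*rad x^?N)) = M*C3" using rad_pos[OF x] by simp
   finally show ?thesis .
  qed
  have Pp: "Pplus f z <= ennreal K*(\<integral>\<^sub>+x. wt x*indicator (nbhd bb x) z*D.av \<phi> x)" if z: "z \<in> unit_ball" for z
  proof -
   have indz: "(\<lambda>x. indicator (nbhd bb x) z :: ennreal) \<in> meas"
    using measurable_compose[OF measurable_Pair2'[of z vol vol] borel_measurable_indicator_nbhd(1)[OF refl refl]] z by simp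
   have "Pplus f z <= ennreal C0*(\<integral>\<^sub>+x. wt x*indicator (nbhd bb x) z*loc f x)"
    using dom f z by blast
   also have "(\<integral>\<^sub>+x. wt x*indicator (nbhd bb x) z*loc f x)
     <= (\<integral>\<^sub>+x. ennreal (M*C3)*(wt x*indicator (nbhd bb x) z*D.av \<phi> x))"
   proof (rule nn_integral_mono)
    fix x :: "complex^'n" assume "x \<in> space vol"
    hence x: "x \<in> unit_ball" by simp
    have "wt x*indicator (nbhd bb x) z*loc f x <= wt x*indicator (nbhd bb x) z*(ennreal (M*C3)*D.av \<phi> x)"
     by (intro mult_left_mono loc_le x) simp
    thus "wt x*indicator (nbhd bb x) z*loc f x <= ennreal (M*C3)*(wt x*indicator (nbhd bb x) z*D.av \<phi> x)"
     by (simp only: mult_ac)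
   qed
   also have "... = ennreal (M*C3)*(\<integral>\<^sub>+x. wt x*indicator (nbhd bb x) z*D.av \<phi> x)"
    by (intro nn_integral_cmult borel_measurable_times_ennreal measurable_wt_vol indz D.measurable_av \<phi>)
   finally show ?thesis using C0 M(1) C3 by (simp add: K_def ennreal_mult mult.assoc mult_left_mono)
  qed
  have "emeasure S {z \<in> unit_ball. ennreal t < Pplus f z}
    <= emeasure S {z \<in> unit_ball. ennreal (t/K) < (\<integral>\<^sub>+x. wt x*indicator (nbhd bb x) z*D.av \<phi> x)}"
  proof (rule emeasure_mono)
   show "{z \<in> unit_ball. ennreal t < Pplus f z}
     \<subseteq> {z \<in> unit_ball. ennreal (t/K) < (\<integral>\<^sub>+x. wt x*indicator (nbhd bb x) z*D.av \<phi> x)}"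
   proof
    fix z assume "z \<in> {z \<in> unit_ball. ennreal t < Pplus f z}"
    hence z: "z \<in> unit_ball" "ennreal t < Pplus f z" by blast+
    have "ennreal (t/K) < (\<integral>\<^sub>+x. wt x*indicator (nbhd bb x) z*D.av \<phi> x)"
    proof (rule ccontr)
     assume "\<not> ?thesis"
     hence "(\<integral>\<^sub>+x. wt x*indicator (nbhd bb x) z*D.av \<phi> x) <= ennreal (t/K)"
      by simp
     hence "Pplus f z <= ennreal K*ennreal (t/K)"
      using order_trans[OF Pp[OF z(1)]] by (simp add: mult_left_mono)
     also have "... = ennreal t" using K t by (simp add: ennreal_mult[symmetric])
     finally show False using z(2) by simp
    qed
    with z(1) show "z \<in> {z \<in> unit_ball. ennreal (t/K) < (\<integral>\<^sub>+x. wt x*indicator (nbhd bb x) z*D.av \<phi> x)}"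
     by blast
   qed
   have "{z \<in> space S. ennreal (t/K) < (\<integral>\<^sub>+x. wt x*indicator (nbhd bb x) z*D.av \<phi> x)} \<in> sets S"
    by (intro borel_measurable_less borel_measurable_const D.measurable_superposition D.measurable_av \<phi>)
   thus "{z \<in> unit_ball. ennreal (t/K) < (\<integral>\<^sub>+x. wt x*indicator (nbhd bb x) z*D.av \<phi> x)} \<in> sets S"
    by simp
  qed
  also have "... <= ennreal (C1/(t/K))*(\<integral>\<^sup>+w. \<phi> w \<partial>S)"
   using weak[THEN bspec, OF \<phi>, THEN spec, of "t/K"] t K by simp
  also have "C1/(t/K) = C1*K/t" by simp
  also have "(\<integral>\<^sup>+w. \<phi> w \<partial>S) = (\<integral>\<^sub>+w. ennreal (\<sigma> w)*ennreal (f w))"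
   unfolding S_def \<phi>_def by (rule nn_integral_density) measurable
  also have "... = (\<integral>\<^sub>+z. ennreal (f z*\<sigma> z))"
   using nn by (intro nn_integral_cong) (simp add: ennreal_mult'' mult.commute)
  finally show "emeasure S {z \<in> unit_ball. ennreal t < Pplus f z} <= ennreal (C1*K/t)*(\<integral>\<^sub>+z. ennreal (f z*\<sigma> z))" .
 qed
qed

lemma B1_L1:
 assumes \<sigma>: "\<sigma> \<in> B1"
 shows "\<exists>C>0. \<forall>f\<in>meas. (\<forall>w. 0 <= f w) -->
  (\<integral>\<^sub>+w. ennreal (f w)) <= ennreal C*(\<integral>\<^sub>+w. ennreal (f w*\<sigma> w))"
proof -
 have meas [measurable]: "\<sigma> \<in> meas" using \<sigma> by (auto simp: B1_def weight_def)
 have t0: "tent 0 = (unit_ball :: (complex^'a) set)" by (simp add: tent_def)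
 obtain l where l: "0 < l" "AE w::complex^'a in vol. w \<in> tent 0 --> 1 <= l*\<sigma> w"
  using B1_lower_bound[OF \<sigma>] by (metis centre_in_ball zero_less_one)
 show ?thesis
 proof (intro exI[of _ l] conjI ballI impI)
  show "0 < l" by fact
  fix f :: "complex^'a => real" assume f [measurable]: "f \<in> meas" and nn: "\<forall>w. 0 <= f w"
  have "(\<integral>\<^sub>+w. ennreal (f w)) = (\<integral>\<^sub>+w. ennreal (f w)*indicator (tent 0) w)"
   by (rule nn_integral_cong) (simp add: t0)
  also have "... <= ennreal l*(\<integral>\<^sup>+w. ennreal (f w)*indicator (tent 0) w \<partial>density vol (\<lambda>w. ennreal (\<sigma> w)))"
   using nn by (intro nn_integral_le_B1[OF meas f sets_tent l subset_refl]) auto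
  also have "(\<integral>\<^sup>+w. ennreal (f w)*indicator (tent 0) w \<partial>density vol (\<lambda>w. ennreal (\<sigma> w)))
    = (\<integral>\<^sub>+w. ennreal (\<sigma> w)*(ennreal (f w)*indicator (tent 0) w))"
   by (rule nn_integral_density) measurable
  also have "... = (\<integral>\<^sub>+w. ennreal (f w*\<sigma> w))"
   using nn by (intro nn_integral_cong) (simp add: t0 ennreal_mult'' mult.commute)
  finally show "(\<integral>\<^sub>+w. ennreal (f w)) <= ennreal l*(\<integral>\<^sub>+w. ennreal (f w*\<sigma> w))" .
 qed
qed

lemma weight_one: "weight (\<lambda>_ :: complex^'n::finite. 1)"
proof -
 have "set_integrable vol K (\<lambda>_ :: complex^'n. 1 :: real)" if "compact K" "K \<subseteq> unit_ball" for K
 proof -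
  have "K \<in> sets vol" using that by (intro borel_subset_sets_vol borel_compact)
  thus ?thesis unfolding set_integrable_def by (simp add: vol.emeasure_eq_measure)
 qed
 thus ?thesis by (simp add: weight_def)
qed

lemma avg_one_le: "avg (\<lambda>_. 1) (tent y) <= 1"
proof (cases "emeasure vol (tent y) = 0")
 case False
 thus ?thesis
  using vol.emeasure_eq_measure[of "tent y"]
  by (simp add: avg_eq density_1 ennreal_divide_self less_top[symmetric])
qed (simp add: avg_eq density_1)

lemma one_in_Bp:
 assumes "1 < p"
 shows "(\<lambda>_ :: complex^'n::finite. 1) \<in> Bp p"
proof -
 have "(SUP y::complex^'n\<in>unit_ball. avg (\<lambda>_. 1) (tent y)*epowr (avg (\<lambda>_. 1) (tent y)) (p - 1)) <= 1"
 proof (rule SUP_least)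
  fix y :: "complex^'n"
  have "avg (\<lambda>_. 1) (tent y)*epowr (avg (\<lambda>_. 1) (tent y)) (p - 1) <= 1*epowr 1 (p - 1)"
   using assms by (intro mult_mono avg_one_le epowr_mono) auto
  also have "... = 1" using epowr_ennreal[of 1 "p - 1"] by (simp del: epowr_ennreal)
  finally show "avg (\<lambda>_. 1) (tent y)*epowr (avg (\<lambda>_. 1) (tent y)) (p - 1) <= 1" .
 qed
 hence "(SUP y::complex^'n\<in>unit_ball. avg (\<lambda>_. 1) (tent y)*epowr (avg (\<lambda>_. 1) (tent y)) (p - 1)) < \<top>"
  by (rule le_less_trans) simp
 thus ?thesis by (simp add: Bp_def weight_one)
qed

lemma one_in_B1: "(\<lambda>_. 1) \<in> B1"
proof -
 have "(SUP y::complex^'n::finite\<in>unit_ball. avg (\<lambda>_. 1) (tent y) *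
   Linf_norm (restrict_space vol (tent y)) (\<lambda>w. inverse 1 :: real)) <= 1"
 proof (rule SUP_least)
  fix y :: "complex^'n"
  have "Linf_norm (restrict_space vol (tent y)) (\<lambda>w. inverse 1 :: real) <= 1"
   unfolding Linf_norm_def by (rule esssup_I) auto
  hence "avg (\<lambda>_. 1) (tent y)*Linf_norm (restrict_space vol (tent y)) (\<lambda>w. inverse 1 :: real) <= 1*1"
   by (intro mult_mono avg_one_le) auto
  thus "avg (\<lambda>_. 1) (tent y)*Linf_norm (restrict_space vol (tent y)) (\<lambda>w. inverse 1 :: real) <= 1"
   by simp
 qed
 hence "(SUP y::complex^'n\<in>unit_ball. avg (\<lambda>_. 1) (tent y) *
   Linf_norm (restrict_space vol (tent y)) (\<lambda>w. inverse 1 :: real)) < \<top>"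
  by (rule le_less_trans) simp
 thus ?thesis by (simp add: B1_def weight_one del: inverse_1)
qed

section \<open>Compactness in quasinormed function spaces\<close>

text \<open>
 The constant \<open>4\<close> leaves room for the \<open>L\<^sup>p\<close> norms, for which \<open>2\<close> would do, and for the weak \<open>L\<^sup>1\<close> quasi-norm.
\<close>

locale quasinorm =
 fixes N :: "(complex^'n::finite => complex) => ennreal"
 assumes norm_zero': "N (\<lambda>_. 0) = 0"
  and norm_minus: "N (\<lambda>z. - f z) = N f"
  and norm_add: "f \<in> meas ==> g \<in> meas ==>
   N (\<lambda>z. f z + g z) <= 4*max (N f) (N g)"
begin

lemma fspace_measurable: "f \<in> fspace N ==> f \<in> meas"
 by (simp add: fspace_def)

lemma norm_diff_commute: "N (\<lambda>z. f z - g z) = N (\<lambda>z. g z - f z)"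
 using norm_minus[of "\<lambda>z. f z - g z"] by simp

lemma norm_diff:
 assumes "f \<in> meas" "g \<in> meas"
 shows "N (\<lambda>z. f z - g z) <= 4*max (N f) (N g)"
 using norm_add[of f "\<lambda>z. - g z"] assms by (simp add: norm_minus)

lemma norm_triangle:
 assumes "f \<in> meas" "g \<in> meas" "h \<in> meas"
 shows "N (\<lambda>z. f z - h z) <= 4*max (N (\<lambda>z. f z - g z)) (N (\<lambda>z. g z - h z))"
 using norm_add[of "\<lambda>z. f z - g z" "\<lambda>z. g z - h z"] assms by simp

lemma four_max_le: "a <= ennreal (r/4) ==> b <= ennreal (r/4) ==> 0 <= r ==> 4*max a b <= ennreal r"
proof -
 assume *: "a <= ennreal (r/4)" "b <= ennreal (r/4)" "0 <= r"
 hence "4*max a b <= 4*ennreal (r/4)" by (intro mult_left_mono) auto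
 also have "... = ennreal (4*(r/4))" using *(3) by (subst ennreal_mult) auto
 finally show ?thesis by simp
qed

lemma norm_triangle_le:
 assumes "f \<in> meas" "g \<in> meas" "h \<in> meas"
  and "N (\<lambda>z. f z - g z) <= ennreal (r/4)" "N (\<lambda>z. g z - h z) <= ennreal (r/4)" "0 <= r"
 shows "N (\<lambda>z. f z - h z) <= ennreal r"
 using norm_triangle[OF assms(1-3)] four_max_le[OF assms(4-6)] by (rule order_trans)

lemma fspace_diff: "f \<in> fspace N ==> g \<in> fspace N ==> (\<lambda>z. f z - g z) \<in> fspace N"
proof -
 assume fg: "f \<in> fspace N" "g \<in> fspace N"
 hence "N (\<lambda>z. f z - g z) <= 4*max (N f) (N g)"
  by (intro norm_diff) (auto simp: fspace_def)
 also have "... < \<top>" using fg by (auto simp: fspace_def ennreal_mult_less_top)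
 finally show ?thesis using fg by (auto simp: fspace_def)
qed

text \<open>
 The balls of a quasi-norm need not be open, but the set of centres of balls inside a given ball is.
\<close>

lemma ball_contains_open:
 assumes f: "f \<in> fspace N" and e: "0 < e"
 shows "\<exists>U. openin (ftopology N) U \<and> f \<in> U \<and> (\<forall>g\<in>U. N (\<lambda>z. g z - f z) <= ennreal e)"
proof -
 let ?Q = "\<lambda>g d. {h \<in> fspace N. N (\<lambda>z. h z - g z) <= ennreal d}"
 define U where "U = {g \<in> fspace N. \<exists>d>0. ?Q g d \<subseteq> ?Q f e}"
 have "openin (ftopology N) U"
  unfolding openin_ftopology
 proof (intro conjI ballI)
  show "U \<subseteq> fspace N" by (auto simp: U_def)
  fix g assume "g \<in> U"
  then obtain d where g: "g \<in> fspace N" and d: "0 < d" "?Q g d \<subseteq> ?Q f e"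
   by (auto simp: U_def)
  show "\<exists>\<epsilon>>0. \<forall>g'\<in>fspace N. N (\<lambda>z. g' z - g z) < \<epsilon> --> g' \<in> U"
  proof (rule exI[of _ "ennreal (d/4)"], intro conjI ballI impI)
   show "0 < ennreal (d/4)" using d by simp
   fix g' assume g': "g' \<in> fspace N" "N (\<lambda>z. g' z - g z) < ennreal (d/4)"
   have "?Q g' (d/4) \<subseteq> ?Q g d"
   proof
    fix h assume h: "h \<in> ?Q g' (d/4)"
    hence "N (\<lambda>z. h z - g z) <= ennreal d"
     using g g' d by (intro norm_triangle_le[of h g' g d] fspace_measurable) auto
    with h show "h \<in> ?Q g d" by simp
   qed
   hence "?Q g' (d/4) \<subseteq> ?Q f e" using d(2) by (rule subset_trans)
   moreover have "0 < d/4" using d by simp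
   ultimately show "g' \<in> U" unfolding U_def using g'(1) by blast
  qed
 qed
 moreover have "f \<in> U" unfolding U_def using f e by blast
 moreover have "N (\<lambda>z. g z - f z) <= ennreal e" if "g \<in> U" for g
 proof -
  from that obtain d where "g \<in> fspace N" "0 < d" "?Q g d \<subseteq> ?Q f e"
   by (auto simp: U_def)
  moreover have "g \<in> ?Q g d"
   using \<open>g \<in> fspace N\<close> \<open>0 < d\<close> by (simp add: norm_zero')
  ultimately show ?thesis by blast
 qed
 ultimately show ?thesis by blast
qed

lemma closure_approx:
 assumes f: "f \<in> ftopology N closure_of S" and e: "0 < e"
 shows "\<exists>g\<in>S. N (\<lambda>z. g z - f z) <= ennreal e"
proof -
 have "f \<in> fspace N" using f by (simp add: in_closure_of topspace_ftopology)
 from ball_contains_open[OF this e] obtain U where U: "openin (ftopology N) U" "f \<in> U"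
  "\<forall>g\<in>U. N (\<lambda>z. g z - f z) <= ennreal e" by (elim exE conjE) (rule that)
 from f U(1,2) obtain g where "g \<in> S" "g \<in> U" by (auto simp: in_closure_of)
 with U(3) show ?thesis by blast
qed

text \<open>
 Finitely many small balls cover a precompact set, so two terms of the sequence lie in the same one.
\<close>

lemma precompact_not_separated:
 assumes S: "precompact_in N S" and x: "\<And>j::nat. x j \<in> S" and d: "0 < d"
  and sep: "\<And>i j. i < j ==> ennreal d <= N (\<lambda>z. x j z - x i z)"
 shows False
proof -
 let ?K = "ftopology N closure_of S"
 have SS: "S \<subseteq> fspace N" and comp: "compactin (ftopology N) ?K"
  using S by (auto simp: precompact_in_def)
 have d': "0 < d/8" using d by simp
 define \<U> where "\<U> = {U. openin (ftopology N) U \<and> (\<exists>f\<in>fspace N. \<forall>g\<in>U. N (\<lambda>z. g z - f z) <= ennreal (d/8))}"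
 have "?K \<subseteq> \<Union> \<U>"
 proof
  fix f assume "f \<in> ?K"
  hence f: "f \<in> fspace N" by (simp add: in_closure_of topspace_ftopology)
  from ball_contains_open[OF f d'] obtain U where "openin (ftopology N) U" "f \<in> U"
   "\<forall>g\<in>U. N (\<lambda>z. g z - f z) <= ennreal (d/8)" by (elim exE conjE) (rule that)
  thus "f \<in> \<Union> \<U>" unfolding \<U>_def using f by blast
 qed
 moreover have "\<forall>U\<in>\<U>. openin (ftopology N) U" by (auto simp: \<U>_def)
 ultimately obtain F where F: "finite F" "F \<subseteq> \<U>" "?K \<subseteq> \<Union> F"
  using comp unfolding compactin_def by metis
 have "S \<subseteq> ?K" using SS by (intro closure_of_subset) (simp add: topspace_ftopology)
 hence "\<exists>U\<in>F. x j \<in> U" for j using x F(3) by blast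
 then obtain h where h: "h j \<in> F" "x j \<in> h j" for j by metis
 have "\<not> inj h"
 proof
  assume "inj h"
  hence "infinite (range h)" by (simp add: finite_image_iff)
  moreover have "range h \<subseteq> F" using h(1) by auto
  ultimately show False using F(1) finite_subset by blast
 qed
 then obtain i j where ij: "i < j" "h i = h j" unfolding inj_def by (metis linorder_neqE_nat)
 from h(1)[of i] F(2) obtain f where f: "f \<in> fspace N" "\<forall>g\<in>h i. N (\<lambda>z. g z - f z) <= ennreal (d/8)"
  by (auto simp: \<U>_def)
 have "N (\<lambda>z. x j z - x i z) <= ennreal (d/2)"
 proof (rule norm_triangle_le[of "x j" f "x i" "d/2"])
  show "x j \<in> meas" "f \<in> meas" "x i \<in> meas"
   using x SS f(1) by (auto intro: fspace_measurable)
  have "d/2/4 = d/8" by simp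
  thus "N (\<lambda>z. x j z - f z) <= ennreal (d/2/4)" "N (\<lambda>z. f z - x i z) <= ennreal (d/2/4)"
   using f(2) h(2)[of i] h(2)[of j] ij(2) norm_diff_commute[of f "x i"] by auto
 qed (use d in simp)
 with sep[OF ij(1)] have "ennreal d <= ennreal (d/2)" by (rule order_trans)
 thus False using d by (simp add: ennreal_le_iff)
qed

text \<open>
 If an open cover of the closure had no finite subcover, total boundedness would give a decreasing sequence of subsets
 that have no finite subcover either and whose diameters tend to \<open>0\<close>. By completeness, points chosen from them
 converge, and the member of the cover that contains the limit contains one of these subsets.
\<close>

lemma precompactI:
 assumes SS: "S \<subseteq> fspace N"
  and tb: "\<And>e. 0 < e ==> \<exists>P. finite P \<and> S \<subseteq> \<Union> P \<and> (\<forall>A\<in>P. \<forall>f\<in>A. \<forall>g\<in>A. N (\<lambda>z. f z - g z) <= ennreal e)"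
  and complete: "\<And>x. (\<And>n. x n \<in> fspace N) ==> (\<And>n m. n <= m ==> N (\<lambda>z. x n z - x m z) <= ennreal ((1/4)^n)) ==>
   \<exists>g\<in>fspace N. \<forall>n. N (\<lambda>z. x n z - g z) <= ennreal ((1/4)^n)"
 shows "precompact_in N S"
proof -
 let ?K = "ftopology N closure_of S"
 have KS: "?K \<subseteq> fspace N" by (auto simp: in_closure_of topspace_ftopology)
 have meas: "f \<in> meas" if "f \<in> ?K" for f using that KS by (auto intro: fspace_measurable)
 have tbK: "\<exists>P. finite P \<and> ?K \<subseteq> \<Union> P \<and> (\<forall>A\<in>P. \<forall>f\<in>A. \<forall>g\<in>A. N (\<lambda>z. f z - g z) <= ennreal e)" if e: "0 < e" for e
 proof -
  have e16: "0 < e/16" using e by simp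
  from tb[OF this] obtain P where P: "finite P" "S \<subseteq> \<Union> P"
   "\<forall>A\<in>P. \<forall>f\<in>A. \<forall>g\<in>A. N (\<lambda>z. f z - g z) <= ennreal (e/16)"
   by (elim exE conjE) (rule that)
  define A' where "A' A = {g \<in> ?K. \<exists>f\<in>A \<inter> S. N (\<lambda>z. f z - g z) <= ennreal (e/16)}" for A
  show ?thesis
  proof (rule exI[of _ "A' ` P"], intro conjI ballI)
   show "finite (A' ` P)" using P(1) by simp
   show "?K \<subseteq> \<Union> (A' ` P)"
   proof
    fix g assume g: "g \<in> ?K"
    from closure_approx[OF g e16] obtain f where f: "f \<in> S" "N (\<lambda>z. f z - g z) <= ennreal (e/16)"
     by blast
    then obtain A where "A \<in> P" "f \<in> A" using P(2) by blast
    thus "g \<in> \<Union> (A' ` P)" using f g by (auto simp: A'_def)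
   qed
   fix B g h assume "B \<in> A' ` P" and gh: "g \<in> B" "h \<in> B"
   then obtain A where A: "A \<in> P" "B = A' A" by blast
   from gh A(2) obtain f1 f2 where f: "g \<in> ?K" "h \<in> ?K" "f1 \<in> A" "f1 \<in> S" "f2 \<in> A" "f2 \<in> S"
    "N (\<lambda>z. f1 z - g z) <= ennreal (e/16)" "N (\<lambda>z. f2 z - h z) <= ennreal (e/16)"
    by (auto simp: A'_def)
   have m: "f1 \<in> meas" "f2 \<in> meas" "g \<in> meas" "h \<in> meas"
    using f SS meas by (auto intro: fspace_measurable)
   have 1: "e/4/4 = e/16" by simp
   have 0: "0 <= e/4" using e by simp
   have 3: "N (\<lambda>z. f1 z - f2 z) <= ennreal (e/16)" using P(3) A(1) f(3,5) by blast
   have 2: "N (\<lambda>z. f1 z - h z) <= ennreal (e/4)"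
    by (rule norm_triangle_le[OF m(1,2,4) _ _ 0, unfolded 1, OF 3 f(8)])
   have "N (\<lambda>z. g z - f1 z) <= ennreal (e/16)"
    unfolding norm_diff_commute[of g f1] by (rule f(7))
   also have "... <= ennreal (e/4)" using e by (simp add: ennreal_leI)
   finally show "N (\<lambda>z. g z - h z) <= ennreal e"
    by (rule norm_triangle_le[OF m(3,1,4) _ 2]) (use e in simp)
  qed
 qed
 have "compactin (ftopology N) ?K"
  unfolding compactin_def
 proof (intro conjI allI impI)
  show "?K \<subseteq> topspace (ftopology N)" by (rule closure_of_subset_topspace)
  fix \<U> assume \<U>: "(\<forall>U\<in>\<U>. openin (ftopology N) U) \<and> ?K \<subseteq> \<Union> \<U>"
  define bad where "bad A \<longleftrightarrow> A \<subseteq> ?K \<and> \<not> (\<exists>F. finite F \<and> F \<subseteq> \<U> \<and> A \<subseteq> \<Union> F)" for A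
  define small where "small A n \<longleftrightarrow> (\<forall>f\<in>A. \<forall>g\<in>A. N (\<lambda>z. f z - g z) <= ennreal ((1/4)^n))" for A and n :: nat
  show "\<exists>F. finite F \<and> F \<subseteq> \<U> \<and> ?K \<subseteq> \<Union> F"
  proof (rule ccontr)
   assume "\<not> ?thesis"
   hence badK: "bad ?K" by (simp add: bad_def)
   have step: "\<exists>B. B \<subseteq> A \<and> bad B \<and> small B n" if A: "bad A" for A n
   proof (rule ccontr)
    assume neg: "\<not> (\<exists>B. B \<subseteq> A \<and> bad B \<and> small B n)"
    have "0 < (1/4 :: real)^n" by simp
    from tbK[OF this] obtain P where P: "finite P" "?K \<subseteq> \<Union> P"
     "\<forall>A\<in>P. \<forall>f\<in>A. \<forall>g\<in>A. N (\<lambda>z. f z - g z) <= ennreal ((1/4)^n)"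
     by (elim exE conjE) (rule that)
    have "\<forall>B\<in>P. \<exists>F. finite F \<and> F \<subseteq> \<U> \<and> A \<inter> B \<subseteq> \<Union> F"
    proof
     fix B assume B: "B \<in> P"
     have "small (A \<inter> B) n" using P(3) B by (auto simp: small_def)
     hence "\<not> bad (A \<inter> B)"
      using spec[OF neg[unfolded not_ex], of "A \<inter> B"] by simp
     moreover have "A \<inter> B \<subseteq> ?K" using A unfolding bad_def by (simp add: le_infI1)
     ultimately show "\<exists>F. finite F \<and> F \<subseteq> \<U> \<and> A \<inter> B \<subseteq> \<Union> F"
      unfolding bad_def by blast
    qed
    then obtain F where F: "\<forall>B\<in>P. finite (F B) \<and> F B \<subseteq> \<U> \<and> A \<inter> B \<subseteq> \<Union> (F B)"
     by (rule bchoice[THEN exE])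
    have "finite (\<Union> (F ` P))" "\<Union> (F ` P) \<subseteq> \<U>" using P(1) F by auto
    moreover have "A \<subseteq> \<Union> (\<Union> (F ` P))"
    proof
     fix f assume f: "f \<in> A"
     have "A \<subseteq> ?K" using A by (simp only: bad_def)
     hence "f \<in> \<Union> P" using f P(2) by (meson subsetD)
     then obtain B where B: "B \<in> P" "f \<in> B" by (elim UnionE)
     hence "f \<in> \<Union> (F B)" using F f by blast
     thus "f \<in> \<Union> (\<Union> (F ` P))" using B(1) by blast
    qed
    ultimately have "\<exists>F. finite F \<and> F \<subseteq> \<U> \<and> A \<subseteq> \<Union> F"
     by (intro exI[of _ "\<Union> (F ` P)"] conjI)
    with A show False by (simp add: bad_def)
   qed
   have "\<exists>A. \<forall>n. (bad (A n) \<and> small (A n) n) \<and> A (Suc n) \<subseteq> A n"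
   proof (rule dependent_nat_choice)
    show "\<exists>A. bad A \<and> small A 0" using step[OF badK, of 0] by blast
    show "\<exists>B. (bad B \<and> small B (Suc n)) \<and> B \<subseteq> A" if "bad A \<and> small A n" for A n
     using step[of A "Suc n"] that by blast
   qed
   then obtain A where A: "\<And>n. bad (A n)" "\<And>n. small (A n) n" "\<And>n. A (Suc n) \<subseteq> A n"
    by blast
   have "\<exists>f. f \<in> A n" for n
   proof (rule ccontr)
    assume "\<not> ?thesis"
    hence "\<exists>F. finite F \<and> F \<subseteq> \<U> \<and> A n \<subseteq> \<Union> F"
     by (intro exI[of _ "{}"]) auto
    thus False using A(1)[of n] by (simp add: bad_def)
   qed
   then obtain x where x: "\<And>n. x n \<in> A n" by metis
   have mono: "A m \<subseteq> A n" if "n <= m" for n m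
    using lift_Suc_antimono_le[of A, OF A(3) that] .
   have AK: "A n \<subseteq> ?K" for n using A(1) by (simp add: bad_def)
   have xK: "x n \<in> ?K" for n using x AK by blast
   have "\<exists>g\<in>fspace N. \<forall>n. N (\<lambda>z. x n z - g z) <= ennreal ((1/4)^n)"
   proof (rule complete)
    show "x n \<in> fspace N" for n using xK KS by blast
    show "N (\<lambda>z. x n z - x m z) <= ennreal ((1/4)^n)" if "n <= m" for n m
     using A(2)[of n] x[of n] x[of m] mono[OF that] by (auto simp: small_def)
   qed
   then obtain g where g: "g \<in> fspace N" "\<And>n. N (\<lambda>z. x n z - g z) <= ennreal ((1/4)^n)"
    by blast
   have lim: "\<exists>n. ennreal (4*(1/4)^n) < \<epsilon>" if "0 < \<epsilon>" for \<epsilon> :: ennreal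
   proof -
    obtain r where r: "0 < r" "ennreal r <= \<epsilon>"
    proof (cases \<epsilon>)
     case (real a)
     thus thesis using \<open>0 < \<epsilon>\<close> that[of a] by simp
    next
     case top
     thus thesis using that[of 1] by simp
    qed
    obtain n where "(1/4 :: real)^n < r/4" using real_arch_pow_inv[of "r/4" "1/4"] r(1) by auto
    hence "ennreal (4*(1/4)^n) < ennreal r" using r(1) by (intro ennreal_lessI) auto
    thus ?thesis using r(2) by (intro exI[of _ n]) (rule less_le_trans)
   qed
   have near: "N (\<lambda>z. f z - g z) <= ennreal (4*(1/4)^n)" if "f \<in> A n" for f n
   proof (rule norm_triangle_le[of f "x n" g])
    show "f \<in> meas" "x n \<in> meas" "g \<in> meas"
     using that AK[of n] xK[of n] meas g(1) by (auto intro: fspace_measurable)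
    show "N (\<lambda>z. f z - x n z) <= ennreal (4*(1/4)^n/4)"
     using A(2)[of n] that x[of n] by (simp add: small_def)
    show "N (\<lambda>z. x n z - g z) <= ennreal (4*(1/4)^n/4)" using g(2)[of n] by simp
   qed simp
   have "g \<in> ?K"
   proof (rule ccontr)
    assume "g \<notin> ?K"
    hence "g \<in> topspace (ftopology N) - ?K" using g(1) by (simp add: topspace_ftopology)
    moreover have "openin (ftopology N) (topspace (ftopology N) - ?K)"
     by (intro openin_diff openin_topspace closedin_closure_of)
    ultimately obtain \<epsilon> where \<epsilon>: "0 < \<epsilon>" "\<forall>h\<in>fspace N. N (\<lambda>z. h z - g z) < \<epsilon> --> h \<in> topspace (ftopology N) - ?K"
     unfolding openin_ftopology by meson
    obtain n where n: "ennreal (4*(1/4)^n) < \<epsilon>" using lim[OF \<epsilon>(1)] by (elim exE)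
    have "N (\<lambda>z. x n z - g z) < \<epsilon>" using near[OF x] n by (rule le_less_trans)
    thus False using \<epsilon>(2) xK[of n] KS by blast
   qed
   then obtain U where U: "U \<in> \<U>" "g \<in> U" using \<U> by blast
   hence "openin (ftopology N) U" using \<U> by blast
   then obtain \<epsilon> where \<epsilon>: "0 < \<epsilon>" "\<forall>h\<in>fspace N. N (\<lambda>z. h z - g z) < \<epsilon> --> h \<in> U"
    using U(2) unfolding openin_ftopology by meson
   obtain n where n: "ennreal (4*(1/4)^n) < \<epsilon>" using lim[OF \<epsilon>(1)] by (elim exE)
   have "A n \<subseteq> U"
   proof
    fix f assume f: "f \<in> A n"
    have "N (\<lambda>z. f z - g z) < \<epsilon>" using near[OF f] n by (rule le_less_trans)
    moreover have "f \<in> fspace N" using f AK KS by blast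
    ultimately show "f \<in> U" using \<epsilon>(2) by blast
   qed
   hence "\<exists>F. finite F \<and> F \<subseteq> \<U> \<and> A n \<subseteq> \<Union> F"
    using U(1) by (intro exI[of _ "{U}"]) auto
   thus False using A(1)[of n] by (simp add: bad_def)
  qed
 qed
 thus ?thesis using SS by (simp add: precompact_in_def)
qed

end

section \<open>Weighted Lebesgue spaces and weak Lebesgue spaces\<close>

text \<open>
 The properties shared by weighted \<open>L\<^sup>p\<close> and weak \<open>L\<^sup>1\<close> that give completeness and let small uniform
 errors be neglected.
\<close>

locale function_norm = quasinorm N for N :: "(complex^'n::finite => complex) => ennreal" +
 fixes \<sigma> :: "complex^'n => real"
 assumes weight_measurable [measurable]: "\<sigma> \<in> meas"
  and weight_pos: "AE z in vol. 0 < \<sigma> z"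
  and fatou: "\<And>f F c. (\<And>j::nat. F j \<in> meas) ==> f \<in> meas ==>
   (AE z in vol. (\<lambda>j. F j z) \<longlonglongrightarrow> f z) ==> (\<And>j. N (F j) <= c) ==> N f <= c"
  and chebyshev: "\<And>f t c. f \<in> meas ==> 0 < t ==> 0 <= c ==> c <= 1 ==> N f <= ennreal (c*t) ==>
   emeasure (density vol (\<lambda>z. ennreal (\<sigma> z))) {z \<in> unit_ball. t < norm (f z)} <= ennreal c"
  and norm_bounded: "\<exists>C\<ge>0. \<forall>f\<in>meas. \<forall>c\<ge>0. (\<forall>z\<in>unit_ball. norm (f z) <= c) --> N f <= ennreal (C*c)"
begin

text \<open>
 By the Chebyshev inequality and the Borel--Cantelli lemma the sequence converges almost everywhere, and the
 Fatou property carries the Cauchy estimates over to the limit.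
\<close>

lemma complete_fspace:
 fixes x :: "nat => complex^'n => complex"
 assumes x: "\<And>n. x n \<in> fspace N"
  and cauchy: "\<And>n m. n <= m ==> N (\<lambda>z. x n z - x m z) <= ennreal ((1/4)^n)"
 shows "\<exists>g\<in>fspace N. \<forall>n. N (\<lambda>z. x n z - g z) <= ennreal ((1/4)^n)"
proof -
 define S where "S = density vol (\<lambda>z. ennreal (\<sigma> z))"
 have meas [measurable]: "x n \<in> meas" for n using x by (rule fspace_measurable)
 define E where "E n = {z \<in> unit_ball. (1/2)^n < norm (x n z - x (Suc n) z)}" for n
 have E_sets: "E n \<in> sets S" for n
 proof -
  have "E n = {z \<in> space vol. (1/2)^n < norm (x n z - x (Suc n) z)}" by (simp add: E_def)
  also have "... \<in> sets vol" by measurable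
  finally show ?thesis by (simp add: S_def)
 qed
 have E_le: "emeasure S (E n) <= ennreal ((1/2)^n)" for n
  unfolding S_def E_def
 proof (rule chebyshev)
  have "(1/4 :: real)^n = (1/2)^n*(1/2)^n" by (simp add: power_mult_distrib[symmetric])
  thus "N (\<lambda>z. x n z - x (Suc n) z) <= ennreal ((1/2)^n*(1/2)^n)"
   using cauchy[of n "Suc n"] by simp
 qed (auto simp: power_le_one)
 have "AE z in S. eventually (\<lambda>n. z \<in> space S - E n) sequentially"
 proof (rule borel_cantelli_AE1)
  show "E n \<in> sets S" for n by (rule E_sets)
  show "emeasure S (E n) < \<infinity>" for n using le_less_trans[OF E_le[of n]] by simp
  have "measure S (E n) <= (1/2)^n" for n
   using E_le[of n] by (simp add: measure_def enn2real_leI)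
  thus "summable (\<lambda>n. measure S (E n))"
   by (intro summable_comparison_test'[OF complete_algebra_summable_geometric[of "1/2 :: real"], of 0])
     (auto simp: measure_nonneg)
 qed
 hence "AE z in vol. 0 < ennreal (\<sigma> z) --> eventually (\<lambda>n. z \<in> space S - E n) sequentially"
  unfolding S_def by (subst (asm) AE_density) auto
 hence conv: "AE z in vol. convergent (\<lambda>n. x n z)"
  using weight_pos AE_space
 proof eventually_elim
  case (elim z)
  hence ev: "eventually (\<lambda>n. z \<in> space S - E n) sequentially" by simp
  have "eventually (\<lambda>n. norm (x (Suc n) z - x n z) <= (1/2)^n) sequentially"
   by (rule eventually_mono[OF ev]) (use elim(3) in \<open>auto simp: E_def norm_minus_commute not_less\<close>)
  hence "summable (\<lambda>n. x (Suc n) z - x n z)"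
   by (rule summable_comparison_test_ev) (rule complete_algebra_summable_geometric, simp)
  hence "convergent (\<lambda>n. \<Sum>i<n. x (Suc i) z - x i z)"
   by (simp add: summable_iff_convergent)
  hence "convergent (\<lambda>n. x n z - x 0 z)"
   using sum_lessThan_telescope[of "\<lambda>i. x i z"] by simp
  hence "convergent (\<lambda>n. (x n z - x 0 z) + x 0 z)"
   by (intro convergent_add convergent_const)
  thus ?case by simp
 qed
 define g where "g z = lim (\<lambda>n. x n z)" for z
 have g [measurable]: "g \<in> meas"
  unfolding g_def[abs_def] by (rule borel_measurable_lim_metric) (rule meas)
 have lim: "AE z in vol. (\<lambda>n. x n z) \<longlonglongrightarrow> g z"
  using conv by eventually_elim (simp add: g_def convergent_LIMSEQ_iff)
 have bound: "N (\<lambda>z. x n z - g z) <= ennreal ((1/4)^n)" for n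
 proof (rule fatou[where F = "\<lambda>j z. x n z - x (j + n) z"])
  show "AE z in vol. (\<lambda>j. x n z - x (j + n) z) \<longlonglongrightarrow> x n z - g z"
   using lim
  proof eventually_elim
   case (elim z)
   hence "(\<lambda>j. x (j + n) z) \<longlonglongrightarrow> g z"
    by (rule LIMSEQ_ignore_initial_segment)
   thus ?case by (intro tendsto_diff tendsto_const)
  qed
  show "N (\<lambda>z. x n z - x (j + n) z) <= ennreal ((1/4)^n)" for j by (rule cauchy) simp
 qed measurable
 have "N g <= 4*max (N (x 0)) (N (\<lambda>z. g z - x 0 z))"
  using norm_add[of "x 0" "\<lambda>z. g z - x 0 z"] by simp
 also have "... < \<top>"
  using x[of 0] bound[of 0] norm_diff_commute[of g "x 0"]
  by (auto simp: fspace_def ennreal_mult_less_top intro: le_less_trans)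
 finally have "g \<in> fspace N" by (simp add: fspace_def)
 thus ?thesis using bound by blast
qed

end

lemma epowr_powr_le: "0 < p ==> epowr x (1/p) <= c \<longleftrightarrow> x <= epowr c p"
 using epowr_le_iff[of p "epowr x (1/p)" c] by (simp add: epowr_epowr)

lemma function_norm_Lp:
 fixes \<sigma> :: "complex^'n::finite => real"
 assumes p: "1 <= p" and \<sigma> [measurable]: "\<sigma> \<in> meas" and pos: "AE z in vol. 0 < \<sigma> z"
  and fin: "(\<integral>\<^sub>+z. ennreal (\<sigma> z)) < \<top>"
 shows "function_norm (Lp_norm p \<sigma>) \<sigma>"
proof
 define I where "I f = (\<integral>\<^sub>+z. ennreal (norm (f z) powr p*\<sigma> z))" for f :: "complex^'n => complex"
 have N: "Lp_norm p \<sigma> f = epowr (I f) (1/p)" for f by (simp add: Lp_norm_def I_def)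
 have p0: "0 < p" using p by simp
 have N_le: "Lp_norm p \<sigma> f <= c \<longleftrightarrow> I f <= epowr c p" for f c
  unfolding N by (rule epowr_powr_le[OF p0])
 show "Lp_norm p \<sigma> (\<lambda>_. 0) = 0" using p0 by (simp add: N I_def)
 show "Lp_norm p \<sigma> (\<lambda>z. - f z) = Lp_norm p \<sigma> f" for f by (simp add: N I_def)
 show "\<sigma> \<in> meas" "AE z in vol. 0 < \<sigma> z" by fact+
 show "Lp_norm p \<sigma> (\<lambda>z. f z + g z) <= 4*max (Lp_norm p \<sigma> f) (Lp_norm p \<sigma> g)"
  if [measurable]: "f \<in> meas" "g \<in> meas" for f g
 proof -
  define c where "c = max (Lp_norm p \<sigma> f) (Lp_norm p \<sigma> g)"
  have "I f <= epowr c p" "I g <= epowr c p"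
   unfolding N_le[symmetric] by (simp_all add: c_def)
  have "I (\<lambda>z. f z + g z) <= (\<integral>\<^sub>+z. ennreal (2 powr p)*(ennreal (norm (f z) powr p*\<sigma> z) + ennreal (norm (g z) powr p*\<sigma> z)))"
   unfolding I_def
  proof (rule nn_integral_mono_AE)
   show "AE z in vol. ennreal (norm (f z + g z) powr p*\<sigma> z)
     <= ennreal (2 powr p)*(ennreal (norm (f z) powr p*\<sigma> z) + ennreal (norm (g z) powr p*\<sigma> z))"
    using pos
   proof eventually_elim
    case (elim z)
    define m where "m = max (norm (f z)) (norm (g z))"
    have "norm (f z + g z) <= 2*m" using norm_triangle_ineq[of "f z" "g z"] by (simp add: m_def)
    hence "norm (f z + g z) powr p <= (2*m) powr p" using p0 by (intro powr_mono2) auto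
    also have "... = 2 powr p*m powr p" by (rule powr_mult)
    also have "... <= 2 powr p*(norm (f z) powr p + norm (g z) powr p)"
     by (intro mult_left_mono) (auto simp: m_def max_def)
    finally have "norm (f z + g z) powr p*\<sigma> z <= 2 powr p*(norm (f z) powr p + norm (g z) powr p)*\<sigma> z"
     using elim by (intro mult_right_mono) auto
    hence "ennreal (norm (f z + g z) powr p*\<sigma> z) <= ennreal (2 powr p*(norm (f z) powr p*\<sigma> z + norm (g z) powr p*\<sigma> z))"
     by (intro ennreal_leI) (simp add: algebra_simps)
    also have "... = ennreal (2 powr p)*(ennreal (norm (f z) powr p*\<sigma> z) + ennreal (norm (g z) powr p*\<sigma> z))"
     using elim by (simp add: ennreal_mult)
    finally show ?case .
   qed
  qed
  also have "... = ennreal (2 powr p)*(I f + I g)"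
   unfolding I_def by (subst nn_integral_cmult) (auto simp: nn_integral_add)
  also have "... <= ennreal (2 powr p)*(epowr c p + epowr c p)"
   by (intro mult_left_mono add_mono) (fact, fact, simp)
  also have "... = ennreal (2 powr p*2)*epowr c p"
   by (simp add: ennreal_mult mult_2[symmetric] mult.assoc)
  also have "... <= ennreal (4 powr p)*epowr c p"
  proof (intro mult_right_mono ennreal_leI)
   have "(2 :: real) = 2 powr 1" by simp
   also have "... <= 2 powr p" using p by (intro powr_mono) auto
   finally have "2 powr p*2 <= 2 powr p*(2 powr p :: real)" by (intro mult_left_mono) auto
   also have "... = (2*2) powr p" by (rule powr_mult[symmetric])
   finally show "2 powr p*2 <= (4 powr p :: real)" by simp
  qed simp
  also have "... = epowr (4*c) p" using p0 epowr_ennreal[of 4 p] by (subst epowr_mult) auto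
  finally show ?thesis
   unfolding N_le c_def .
 qed
 show "Lp_norm p \<sigma> f <= c"
  if F [measurable]: "\<And>j::nat. F j \<in> meas" and [measurable]: "f \<in> meas"
   and lim: "AE z in vol. (\<lambda>j. F j z) \<longlonglongrightarrow> f z" and le: "\<And>j. Lp_norm p \<sigma> (F j) <= c" for F f c
 proof -
  have "I f <= (\<integral>\<^sub>+z. liminf (\<lambda>j. ennreal (norm (F j z) powr p*\<sigma> z)))"
   unfolding I_def
  proof (rule nn_integral_mono_AE)
   show "AE z in vol. ennreal (norm (f z) powr p*\<sigma> z) <= liminf (\<lambda>j. ennreal (norm (F j z) powr p*\<sigma> z))"
    using lim
   proof eventually_elim
    case (elim z)
    have "(\<lambda>j. ennreal (norm (F j z) powr p*\<sigma> z)) \<longlonglongrightarrow> ennreal (norm (f z) powr p*\<sigma> z)"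
     using elim p0 by (intro tendsto_ennrealI tendsto_mult tendsto_const tendsto_powr' tendsto_norm) auto
    hence "liminf (\<lambda>j. ennreal (norm (F j z) powr p*\<sigma> z)) = ennreal (norm (f z) powr p*\<sigma> z)"
     by (intro lim_imp_Liminf) auto
    thus ?case by simp
   qed
  qed
  also have "... <= liminf (\<lambda>j. I (F j))"
   unfolding I_def by (rule nn_integral_liminf) measurable
  also have "... <= liminf (\<lambda>j. epowr c p)"
   using le by (intro Liminf_mono) (simp add: N_le)
  also have "... = epowr c p" by (simp add: Liminf_const)
  finally show ?thesis by (simp add: N_le)
 qed
 show "emeasure (density vol (\<lambda>z. ennreal (\<sigma> z))) {z \<in> unit_ball. t < norm (f z)} <= ennreal c"
  if f [measurable]: "f \<in> meas" and t: "0 < t" and c: "0 <= c" "c <= 1" and le: "Lp_norm p \<sigma> f <= ennreal (c*t)" for f t c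
 proof -
  let ?A = "{z \<in> unit_ball. t < norm (f z)}"
  have A [measurable]: "?A \<in> sets vol"
  proof -
   have "{z \<in> space vol. t < norm (f z)} \<in> sets vol"
    by (intro borel_measurable_less borel_measurable_const measurable_compose[OF f borel_measurable_norm])
   thus ?thesis
    unfolding space_vol .
  qed
  have "emeasure (density vol (\<lambda>z. ennreal (\<sigma> z))) ?A = (\<integral>\<^sub>+z. ennreal (\<sigma> z)*indicator ?A z)"
   by (rule emeasure_density[OF _ A]) measurable
  hence "ennreal (t powr p)*emeasure (density vol (\<lambda>z. ennreal (\<sigma> z))) ?A
    = ennreal (t powr p)*(\<integral>\<^sub>+z. ennreal (\<sigma> z)*indicator ?A z)"
   by (rule arg_cong)
  also have "... = (\<integral>\<^sub>+z. ennreal (t powr p)*(ennreal (\<sigma> z)*indicator ?A z))"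
   by (intro nn_integral_cmult[symmetric] borel_measurable_times_ennreal borel_measurable_indicator A) measurable
  also have "... <= I f"
   unfolding I_def
  proof (rule nn_integral_mono_AE)
   show "AE z in vol. ennreal (t powr p)*(ennreal (\<sigma> z)*indicator ?A z) <= ennreal (norm (f z) powr p*\<sigma> z)"
    using pos
   proof eventually_elim
    case (elim z)
    show ?case
    proof (cases "z \<in> ?A")
     case True
     hence "t powr p <= norm (f z) powr p" using t p0 by (intro powr_mono2) auto
     hence "t powr p*\<sigma> z <= norm (f z) powr p*\<sigma> z"
      using elim by (intro mult_right_mono) auto
     thus ?thesis using True elim by (simp add: ennreal_mult[symmetric] ennreal_leI)
    qed simp
   qed
  qed
  also have "... <= epowr (ennreal (c*t)) p" using le by (simp add: N_le)
  also have "... = ennreal (t powr p*c powr p)" using c t by (simp add: powr_mult mult.commute)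
  also have "... <= ennreal (t powr p*c)"
  proof (intro ennreal_leI mult_left_mono)
   show "c powr p <= c" using c p powr_mono'[of 1 p c] by simp
  qed simp
  also have "... = ennreal (t powr p)*ennreal c" using c by (intro ennreal_mult) auto
  finally show ?thesis using t by (subst (asm) ennreal_mult_le_mult_iff) auto
 qed
 obtain s where s: "0 <= s" "(\<integral>\<^sub>+z. ennreal (\<sigma> z)) = ennreal s"
  using fin by (cases "\<integral>\<^sup>+z. ennreal (\<sigma> z) \<partial>vol") auto
 show "\<exists>C\<ge>0. \<forall>f\<in>meas. \<forall>c\<ge>0. (\<forall>z\<in>unit_ball. norm (f z) <= c) --> Lp_norm p \<sigma> f <= ennreal (C*c)"
 proof (rule exI[of _ "s powr (1/p)"], intro conjI ballI allI impI)
  show "0 <= s powr (1/p)" by simp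
  fix f :: "complex^'n => complex" and c :: real
  assume [measurable]: "f \<in> meas" and c: "0 <= c" and le: "\<forall>z\<in>unit_ball. norm (f z) <= c"
  have "I f <= (\<integral>\<^sub>+z. ennreal (c powr p)*ennreal (\<sigma> z))"
   unfolding I_def
  proof (rule nn_integral_mono_AE)
   show "AE z in vol. ennreal (norm (f z) powr p*\<sigma> z) <= ennreal (c powr p)*ennreal (\<sigma> z)"
    using pos AE_space
   proof eventually_elim
    case (elim z)
    hence "norm (f z) powr p <= c powr p" using le p0 by (intro powr_mono2) auto
    hence "norm (f z) powr p*\<sigma> z <= c powr p*\<sigma> z"
     using elim by (intro mult_right_mono) auto
    thus ?case using elim by (simp add: ennreal_mult[symmetric] ennreal_leI)
   qed
  qed
  also have "... = ennreal (c powr p)*ennreal s" by (simp add: nn_integral_cmult s)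
  also have "... = epowr (ennreal (s powr (1/p)*c)) p"
   using s c p0 by (simp add: powr_mult powr_powr ennreal_mult[symmetric] mult.commute)
  finally show "Lp_norm p \<sigma> f <= ennreal (s powr (1/p)*c)" by (simp add: N_le)
 qed
qed

lemma function_norm_weak_L1:
 fixes \<sigma> :: "complex^'n::finite => real"
 assumes \<sigma> [measurable]: "\<sigma> \<in> meas" and pos: "AE z in vol. 0 < \<sigma> z"
  and fin: "(\<integral>\<^sub>+z. ennreal (\<sigma> z)) < \<top>"
 shows "function_norm (weak_L1_norm \<sigma>) \<sigma>"
proof
 define S where "S = density vol (\<lambda>z. ennreal (\<sigma> z))"
 define A where "A f t = {z \<in> unit_ball. t < norm (f z)}" for f :: "complex^'n => complex" and t :: real
 have A [measurable]: "A f t \<in> sets vol" if [measurable]: "f \<in> meas" for f t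
 proof -
  have "{z \<in> space vol. t < norm (f z)} \<in> sets vol" by measurable
  thus ?thesis by (simp add: A_def)
 qed
 have wm: "wmeasure \<sigma> (A f t) = emeasure S (A f t)" if "f \<in> meas" for f t
  using A[OF that] by (simp add: wmeasure_def S_def emeasure_density)
 have N: "weak_L1_norm \<sigma> f = (SUP t\<in>{0<..}. ennreal t*wmeasure \<sigma> (A f t))" for f
  by (simp add: weak_L1_norm_def A_def)
 have upper: "ennreal t*emeasure S (A f t) <= weak_L1_norm \<sigma> f" if "f \<in> meas" "0 < t" for f t
  unfolding N wm[OF that(1), symmetric] using that(2) by (intro SUP_upper) simp
 have least: "weak_L1_norm \<sigma> f <= c" if "f \<in> meas" "\<And>t. 0 < t ==> ennreal t*emeasure S (A f t) <= c" for f c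
  unfolding N using that(2) by (intro SUP_least) (simp add: wm[OF that(1)])
 show "weak_L1_norm \<sigma> (\<lambda>_. 0) = 0" by (rule antisym, rule least) (auto simp: A_def)
 show "weak_L1_norm \<sigma> (\<lambda>z. - f z) = weak_L1_norm \<sigma> f" for f
  by (simp add: weak_L1_norm_def)
 show "\<sigma> \<in> meas" "AE z in vol. 0 < \<sigma> z" by fact+
 show "weak_L1_norm \<sigma> (\<lambda>z. f z + g z) <= 4*max (weak_L1_norm \<sigma> f) (weak_L1_norm \<sigma> g)"
  if f [measurable]: "f \<in> meas" and g [measurable]: "g \<in> meas" for f g
 proof (rule least)
  show "(\<lambda>z. f z + g z) \<in> meas" by measurable
  fix t :: real assume t: "0 < t"
  define c where "c = max (weak_L1_norm \<sigma> f) (weak_L1_norm \<sigma> g)"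
  have "A (\<lambda>z. f z + g z) t \<subseteq> A f (t/2) \<union> A g (t/2)"
  proof
   fix z assume "z \<in> A (\<lambda>z. f z + g z) t"
   hence "z \<in> unit_ball" "t < norm (f z) + norm (g z)"
    using norm_triangle_ineq[of "f z" "g z"] by (auto simp: A_def)
   thus "z \<in> A f (t/2) \<union> A g (t/2)" by (auto simp: A_def)
  qed
  hence "emeasure S (A (\<lambda>z. f z + g z) t) <= emeasure S (A f (t/2) \<union> A g (t/2))"
   using A[OF f, of "t/2"] A[OF g, of "t/2"] by (intro emeasure_mono) (auto simp: S_def)
  also have "... <= emeasure S (A f (t/2)) + emeasure S (A g (t/2))"
   using A[OF f, of "t/2"] A[OF g, of "t/2"] by (intro emeasure_subadditive) (auto simp: S_def)
  finally have "ennreal t*emeasure S (A (\<lambda>z. f z + g z) t)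
    <= ennreal t*(emeasure S (A f (t/2)) + emeasure S (A g (t/2)))"
   by (intro mult_left_mono) auto
  also have "... = 2*(ennreal (t/2)*emeasure S (A f (t/2)) + ennreal (t/2)*emeasure S (A g (t/2)))"
  proof -
   have "ennreal t = 2*ennreal (t/2)" using t ennreal_mult[of 2 "t/2"] by simp
   thus ?thesis by (simp only: distrib_left mult.assoc)
  qed
  also have "... <= 2*(c + c)"
   using upper[OF f, of "t/2"] upper[OF g, of "t/2"] t unfolding c_def
   by (intro mult_left_mono add_mono) (auto intro: order_trans)
  also have "... = 4*c" by (simp add: mult_2[symmetric] mult.assoc[symmetric])
  finally show "ennreal t*emeasure S (A (\<lambda>z. f z + g z) t) <= 4*max (weak_L1_norm \<sigma> f) (weak_L1_norm \<sigma> g)"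
   unfolding c_def .
 qed
 show "weak_L1_norm \<sigma> f <= c"
  if F [measurable]: "\<And>j::nat. F j \<in> meas" and f [measurable]: "f \<in> meas"
   and lim: "AE z in vol. (\<lambda>j. F j z) \<longlonglongrightarrow> f z" and le: "\<And>j. weak_L1_norm \<sigma> (F j) <= c" for F f c
 proof (rule least[OF f])
  fix t :: real assume t: "0 < t"
  have limS: "AE z in S. (\<lambda>j. F j z) \<longlonglongrightarrow> f z"
   unfolding S_def using lim by (subst AE_density) auto
  have AS: "A h t \<in> sets S" if "h \<in> meas" for h using A[OF that] by (simp add: S_def)
  have "ennreal t*emeasure S (A f t) = (\<integral>\<^sup>+z. ennreal t*indicator (A f t) z \<partial>S)"
   using AS[OF f] by (simp add: nn_integral_cmult)
  also have "... <= (\<integral>\<^sup>+z. liminf (\<lambda>j. ennreal t*indicator (A (F j) t) z) \<partial>S)"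
  proof (rule nn_integral_mono_AE)
   show "AE z in S. ennreal t*indicator (A f t) z <= liminf (\<lambda>j. ennreal t*indicator (A (F j) t) z)"
    using limS
   proof eventually_elim
    case (elim z)
    show ?case
    proof (cases "z \<in> A f t")
     case True
     have "(\<lambda>j. norm (F j z)) \<longlonglongrightarrow> norm (f z)"
      using elim by (rule tendsto_norm)
     hence "eventually (\<lambda>j. t < norm (F j z)) sequentially"
      using True by (intro order_tendstoD) (auto simp: A_def)
     hence "eventually (\<lambda>j. ennreal t*indicator (A f t) z <= ennreal t*indicator (A (F j) t) z) sequentially"
      by (rule eventually_mono) (use True in \<open>auto simp: A_def\<close>)
     thus ?thesis by (rule Liminf_bounded)
    qed simp
   qed
  qed
  also have "... <= liminf (\<lambda>j. \<integral>\<^sup>+z. ennreal t*indicator (A (F j) t) z \<partial>S)"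
   by (intro nn_integral_liminf borel_measurable_times_ennreal borel_measurable_const borel_measurable_indicator AS F)
  also have "... <= liminf (\<lambda>j. c)"
  proof (rule Liminf_mono, rule always_eventually, rule allI)
   fix j
   have "(\<integral>\<^sup>+z. ennreal t*indicator (A (F j) t) z \<partial>S) = ennreal t*emeasure S (A (F j) t)"
    using AS[OF F] by (simp add: nn_integral_cmult)
   also have "... <= c" using upper[OF F t] le by (rule order_trans)
   finally show "(\<integral>\<^sup>+z. ennreal t*indicator (A (F j) t) z \<partial>S) <= c" .
  qed
  also have "... = c" by (simp add: Liminf_const)
  finally show "ennreal t*emeasure S (A f t) <= c" .
 qed
 show "emeasure (density vol (\<lambda>z. ennreal (\<sigma> z))) {z \<in> unit_ball. t < norm (f z)} <= ennreal c"
  if f [measurable]: "f \<in> meas" and t: "0 < t" and c: "0 <= c" "c <= 1" and le: "weak_L1_norm \<sigma> f <= ennreal (c*t)" for f t c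
 proof -
  have "ennreal t*emeasure S (A f t) <= ennreal (c*t)"
   using upper[OF f t] le by (rule order_trans)
  also have "... = ennreal t*ennreal c" using t c by (simp add: ennreal_mult mult.commute)
  finally have "emeasure S (A f t) <= ennreal c"
   using t by (subst (asm) ennreal_mult_le_mult_iff) auto
  thus ?thesis by (simp add: S_def A_def)
 qed
 obtain s where s: "0 <= s" "(\<integral>\<^sub>+z. ennreal (\<sigma> z)) = ennreal s"
  using fin by (cases "\<integral>\<^sup>+z. ennreal (\<sigma> z) \<partial>vol") auto
 show "\<exists>C\<ge>0. \<forall>f\<in>meas. \<forall>c\<ge>0. (\<forall>z\<in>unit_ball. norm (f z) <= c) --> weak_L1_norm \<sigma> f <= ennreal (C*c)"
 proof (rule exI[of _ s], intro conjI ballI allI impI)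
  show "0 <= s" by fact
  fix f :: "complex^'n => complex" and c :: real
  assume f [measurable]: "f \<in> meas" and c: "0 <= c" and le: "\<forall>z\<in>unit_ball. norm (f z) <= c"
  show "weak_L1_norm \<sigma> f <= ennreal (s*c)"
  proof (rule least[OF f])
   fix t :: real assume t: "0 < t"
   show "ennreal t*emeasure S (A f t) <= ennreal (s*c)"
   proof (cases "t < c")
    case True
    have "emeasure S (A f t) = (\<integral>\<^sub>+z. ennreal (\<sigma> z)*indicator (A f t) z)"
     unfolding S_def by (rule emeasure_density) measurable
    also have "... <= (\<integral>\<^sub>+z. ennreal (\<sigma> z))"
     by (rule nn_integral_mono) (auto simp: indicator_def)
    finally have "emeasure S (A f t) <= ennreal s" by (simp add: s)
    hence "ennreal t*emeasure S (A f t) <= ennreal c*ennreal s"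
     using True by (intro mult_mono ennreal_leI) auto
    also have "... = ennreal (s*c)" using c s by (simp add: ennreal_mult mult.commute)
    finally show ?thesis .
   next
    case False
    hence "A f t = {}"
    proof (intro equals0I)
     fix z assume "z \<in> A f t"
     hence "z \<in> unit_ball" "t < norm (f z)" by (simp_all add: A_def)
     moreover from this(1) have "norm (f z) <= c" using le by blast
     ultimately show False using False by simp
    qed
    thus ?thesis by simp
   qed
  qed
 qed
qed

section \<open>Toeplitz operators and the positive Bergman operator\<close>

lemma measurable_kernel [measurable]:
 fixes a :: "complex^'n::finite => complex"
 assumes a: "a \<in> meas"
 shows "(\<lambda>(z, w). a w/(1 - herm z w)^(CARD('n) + 1)) \<in> borel_measurable (vol \<Otimes>\<^sub>M vol)"
proof -
 note [measurable] = measurable_compose[OF measurable_snd a]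
 show ?thesis unfolding case_prod_beta by measurable
qed

lemma measurable_toeplitz:
 assumes [measurable]: "a \<in> meas" "f \<in> meas"
 shows "toeplitz a f \<in> meas"
 unfolding toeplitz_def[abs_def]
 by (rule vol.borel_measurable_lebesgue_integral) (rule measurable_kernel, measurable)

lemma measurable_Pplus [measurable]:
 fixes f :: "complex^'n::finite => real"
 assumes f: "f \<in> meas"
 shows "Pplus f \<in> meas"
proof -
 note [measurable] = measurable_compose[OF measurable_snd f]
 have "(\<lambda>(z, w). ennreal (f w)*ennreal (1/hdist z w^(CARD('n) + 1))) \<in> borel_measurable (vol \<Otimes>\<^sub>M vol)"
  unfolding case_prod_beta by measurable
 thus ?thesis unfolding Pplus_def[abs_def] by (rule vol.borel_measurable_nn_integral)
qed

lemma toeplitz_le_Pplus: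
 fixes a :: "complex^'n::finite => complex"
 assumes a: "AE w in vol. norm (a w) <= e" and [measurable]: "f \<in> meas"
 shows "ennreal (norm (toeplitz a f z)) <= ennreal e*Pplus (\<lambda>w. norm (f w)) z"
proof (cases "integrable vol (\<lambda>w. a w*f w/(1 - herm z w)^(CARD('n) + 1))")
 case True
 hence "ennreal (norm (toeplitz a f z)) <= (\<integral>\<^sub>+w. norm (a w*f w/(1 - herm z w)^(CARD('n) + 1)))"
  unfolding toeplitz_def by (rule integral_norm_bound_ennreal)
 also have "... <= (\<integral>\<^sub>+w. ennreal e*(ennreal (norm (f w))*ennreal (1/hdist z w^(CARD('n) + 1))))"
 proof (rule nn_integral_mono_AE)
  show "AE w in vol. ennreal (norm (a w*f w/(1 - herm z w)^(CARD('n) + 1)))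
    <= ennreal e*(ennreal (norm (f w))*ennreal (1/hdist z w^(CARD('n) + 1)))"
   using a
  proof eventually_elim
   case (elim w)
   have "0 <= e" using elim norm_ge_zero[of "a w"] by linarith
   have "norm (a w*f w/(1 - herm z w)^(CARD('n) + 1)) = norm (a w)*(norm (f w)*(1/hdist z w^(CARD('n) + 1)))"
    by (simp add: hdist_def norm_mult norm_divide norm_power)
   also have "... <= e*(norm (f w)*(1/hdist z w^(CARD('n) + 1)))"
    by (rule mult_right_mono[OF elim]) simp
   finally show ?case
    using \<open>0 \<le> e\<close> by (simp only: ennreal_mult[symmetric] ennreal_leI norm_ge_zero hdist_nonneg
     zero_le_power zero_le_divide_1_iff mult_nonneg_nonneg)
  qed
 qed
 also have "... = ennreal e*Pplus (\<lambda>w. norm (f w)) z"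
  unfolding Pplus_def by (rule nn_integral_cmult) measurable
 finally show ?thesis .
qed (simp add: toeplitz_def not_integrable_integral_eq)

lemma toeplitz_integrable:
 fixes a :: "complex^'n::finite => complex"
 assumes [measurable]: "a \<in> meas" "f \<in> meas"
  and a: "AE w in vol. norm (a w) <= M" and f: "(\<integral>\<^sub>+w. norm (f w)) < \<top>"
  and d: "0 < d" "\<And>w. w \<in> unit_ball ==> a w \<noteq> 0 ==> d <= hdist z w"
 shows "integrable vol (\<lambda>w. a w*f w/(1 - herm z w)^(CARD('n) + 1))"
proof (rule integrableI_bounded)
 show "(\<lambda>w. a w*f w/(1 - herm z w)^(CARD('n) + 1)) \<in> meas" by measurable
 have "(\<integral>\<^sub>+w. norm (a w*f w/(1 - herm z w)^(CARD('n) + 1)))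
   <= (\<integral>\<^sub>+w. ennreal (M/d^(CARD('n) + 1))*ennreal (norm (f w)))"
 proof (rule nn_integral_mono_AE)
  show "AE w in vol. ennreal (norm (a w*f w/(1 - herm z w)^(CARD('n) + 1)))
    <= ennreal (M/d^(CARD('n) + 1))*ennreal (norm (f w))"
   using a AE_space
  proof eventually_elim
   case (elim w)
   have M: "0 <= M" using elim norm_ge_zero[of "a w"] by linarith
   have "norm (a w*f w/(1 - herm z w)^(CARD('n) + 1)) = norm (a w)/hdist z w^(CARD('n) + 1)*norm (f w)"
    by (simp add: hdist_def norm_mult norm_divide norm_power)
   also have "... <= M/d^(CARD('n) + 1)*norm (f w)"
   proof (cases "a w = 0")
    case True
    thus ?thesis using M d by simp
   next
    case False
    thus ?thesis using d elim M by (intro mult_right_mono frac_le power_mono) auto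
   qed
   finally show ?case using M d(1) by (simp add: ennreal_mult[symmetric] ennreal_leI)
  qed
 qed
 also have "... = ennreal (M/d^(CARD('n) + 1))*(\<integral>\<^sub>+w. norm (f w))"
  by (rule nn_integral_cmult) measurable
 also have "... < \<top>" using f by (simp add: ennreal_mult_less_top)
 finally show "(\<integral>\<^sub>+w. norm (a w*f w/(1 - herm z w)^(CARD('n) + 1))) < \<infinity>"
  by simp
qed

text \<open>
 The two spaces enter the compactness argument only through this locale: the functions of the
 source are integrable, and everything dominated by the positive Bergman operator is bounded from the
 source to the target.
\<close>

locale bergman_dominated = function_norm N \<sigma> + src: quasinorm N\<^sub>0
 for N :: "(complex^'n::finite => complex) => ennreal" and \<sigma> and N\<^sub>0 :: "(complex^'n => complex) => ennreal" +
 assumes L1: "\<forall>B\<ge>0. \<exists>L\<ge>0. \<forall>f\<in>fspace N\<^sub>0. N\<^sub>0 f <= ennreal B --> (\<integral>\<^sub>+w. norm (f w)) <= ennreal L"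
  and dominated: "\<exists>C\<ge>0. \<forall>f\<in>fspace N\<^sub>0. \<forall>F\<in>meas. \<forall>e\<ge>0.
   (\<forall>z\<in>unit_ball. ennreal (norm (F z)) <= ennreal e*Pplus (\<lambda>w. norm (f w)) z) --> N F <= ennreal (C*e)*N\<^sub>0 f"
begin

lemma fspace_L1:
 assumes "f \<in> fspace N\<^sub>0"
 shows "(\<integral>\<^sub>+w. norm (f w)) < \<top>"
proof -
 have "N\<^sub>0 f < \<top>" using assms by (simp add: fspace_def)
 then obtain B where B: "0 <= B" "N\<^sub>0 f = ennreal B" by (cases "N\<^sub>0 f") auto
 obtain L where "\<forall>f\<in>fspace N\<^sub>0. N\<^sub>0 f <= ennreal B --> (\<integral>\<^sub>+w. norm (f w)) <= ennreal L"
  using L1 B(1) by (elim allE[of _ B] impE exE conjE) (simp, rule that)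
 hence "(\<integral>\<^sub>+w. norm (f w)) <= ennreal L" using assms B by simp
 also have "... < \<top>" by simp
 finally show ?thesis .
qed

text \<open>
 The symbol supported in a smaller ball gives an operator with values in an
 equicontinuous family, so the images are described up to a small uniform error by their values at
 finitely many points.
\<close>

lemma equicontinuous_images:
 fixes a :: "complex^'n => complex"
 assumes [measurable]: "a \<in> meas"
  and a: "AE w in vol. norm (a w) <= M" and M: "0 <= M"
  and r: "0 <= r" "r < 1" "\<forall>w. r < norm w --> a w = 0"
  and L: "0 <= L" and \<eta>: "0 < \<eta>"
 shows "\<exists>\<delta>>0. \<forall>f\<in>meas. (\<integral>\<^sub>+w. norm (f w)) <= ennreal L -->
  (\<forall>z\<in>cball 0 1. \<forall>z'\<in>cball 0 1. norm (z - z') < \<delta> --> norm (toeplitz a f z - toeplitz a f z') <= \<eta>)"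
proof -
 let ?N = "CARD('n) + 1"
 define h :: "complex => complex" where "h \<xi> = 1/(1 - \<xi>)^?N" for \<xi>
 have "continuous_on (cball 0 r) h" unfolding h_def using r(2) by (intro continuous_intros) auto
 hence "uniformly_continuous_on (cball 0 r) h" by (rule compact_uniformly_continuous) simp
 moreover define \<eta>' where "\<eta>' = \<eta>/(M*L + 1)"
 moreover have pos: "0 < M*L + 1" using M L by (intro add_nonneg_pos) auto
 moreover have "0 < \<eta>'" unfolding \<eta>'_def using \<eta> pos by (rule divide_pos_pos)
 ultimately obtain \<delta> where \<delta>: "0 < \<delta>"
  "\<forall>\<xi>\<in>cball 0 r. \<forall>\<xi>'\<in>cball 0 r. dist \<xi>' \<xi> < \<delta> --> dist (h \<xi>') (h \<xi>) < \<eta>'"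
  unfolding uniformly_continuous_on_def by meson
 show ?thesis
 proof (rule exI[of _ \<delta>], intro conjI ballI impI)
  show "0 < \<delta>" by fact
  fix f :: "complex^'n => complex" and z z' :: "complex^'n"
  assume [measurable]: "f \<in> meas" and fL: "(\<integral>\<^sub>+w. norm (f w)) <= ennreal L"
   and z: "z \<in> cball 0 1" "z' \<in> cball 0 1" "norm (z - z') < \<delta>"
  have near: "1 - r <= hdist y w" "herm y w \<in> cball 0 r" if "y \<in> cball 0 1" "a w \<noteq> 0" for y w
  proof -
   have w: "norm w <= r" using spec[OF r(3), of w] that by force
   have "norm y*norm w <= 1*r" using that w r(1) by (intro mult_mono) auto
   thus "1 - r <= hdist y w" "herm y w \<in> cball 0 r"
    using hdist_ge[of y w] norm_herm_le[of y w] by auto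
  qed
  have L': "(\<integral>\<^sub>+w. norm (f w)) < \<top>" using fL by (rule le_less_trans) simp
  have int: "integrable vol (\<lambda>w. a w*f w/(1 - herm y w)^?N)" if "y \<in> cball 0 1" for y
   by (rule toeplitz_integrable[OF _ _ a L', of "1 - r"]) (use r near(1) that in auto)
  have "toeplitz a f z - toeplitz a f z' = (\<integral>w. a w*f w*(h (herm z w) - h (herm z' w)) \<partial>vol)"
   unfolding toeplitz_def h_def
   by (subst Bochner_Integration.integral_diff[OF int int, symmetric]) (use z in \<open>auto simp: algebra_simps\<close>)
  also have "ennreal (norm ...) <= (\<integral>\<^sub>+w. norm (a w*f w*(h (herm z w) - h (herm z' w))))"
  proof (rule integral_norm_bound_ennreal)
   show "integrable vol (\<lambda>w. a w*f w*(h (herm z w) - h (herm z' w)))"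
    using Bochner_Integration.integrable_diff[OF int[OF z(1)] int[OF z(2)]] by (simp add: h_def algebra_simps)
  qed
  also have "... <= (\<integral>\<^sub>+w. ennreal (M*\<eta>')*ennreal (norm (f w)))"
  proof (rule nn_integral_mono_AE)
   show "AE w in vol. ennreal (norm (a w*f w*(h (herm z w) - h (herm z' w)))) <= ennreal (M*\<eta>')*ennreal (norm (f w))"
    using a AE_space
   proof eventually_elim
    case (elim w)
    have "norm (a w*f w*(h (herm z w) - h (herm z' w))) <= M*\<eta>'*norm (f w)"
    proof (cases "a w = 0")
     case True
     thus ?thesis using M \<open>0 < \<eta>'\<close> by simp
    next
     case False
     have "norm (herm z w - herm z' w) <= norm (z - z')*norm w"
      using norm_herm_le[of "z - z'" w] by (simp add: herm_diff_left)
     also have "... <= norm (z - z')*1" using elim(2) by (intro mult_left_mono) auto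
     finally have "dist (herm z w) (herm z' w) < \<delta>" using z(3) by (simp add: dist_norm)
     hence "norm (h (herm z w) - h (herm z' w)) < \<eta>'"
      using \<delta>(2) near(2)[OF z(1) False] near(2)[OF z(2) False] unfolding dist_norm by blast
     hence "norm (a w)*norm (h (herm z w) - h (herm z' w))*norm (f w) <= M*\<eta>'*norm (f w)"
      using elim(1) M by (intro mult_right_mono mult_mono) auto
     thus ?thesis by (simp add: norm_mult mult_ac)
    qed
    thus ?case using M \<open>0 < \<eta>'\<close> by (simp add: ennreal_mult[symmetric] ennreal_leI)
   qed
  qed
  also have "... = ennreal (M*\<eta>')*(\<integral>\<^sub>+w. norm (f w))"
   by (rule nn_integral_cmult) measurable
  also have "... <= ennreal (M*\<eta>')*ennreal L" using fL by (rule mult_left_mono) simp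
  also have "... = ennreal (\<eta>'*(M*L))"
   using M L \<open>0 < \<eta>'\<close> by (simp add: ennreal_mult[symmetric] mult_ac)
  also have "... <= ennreal \<eta>"
  proof (rule ennreal_leI)
   have "\<eta>'*(M*L) <= \<eta>'*(M*L + 1)"
    using \<open>0 < \<eta>'\<close> by (intro mult_left_mono) auto
   also have "... = \<eta>" unfolding \<eta>'_def using pos by auto
   finally show "\<eta>'*(M*L) <= \<eta>" .
  qed
  finally show "norm (toeplitz a f z - toeplitz a f z') <= \<eta>"
   using \<eta> by (simp add: ennreal_le_iff)
 qed
qed

lemma uniform_net_of_images:
 fixes a :: "complex^'n => complex"
 assumes [measurable]: "a \<in> meas"
  and a: "AE w in vol. norm (a w) <= M" and M: "0 <= M"
  and r: "0 <= r" "r < 1" "\<forall>w. r < norm w --> a w = 0"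
  and L: "0 <= L" and \<eta>: "0 < \<eta>"
  and S: "\<forall>f\<in>S. f \<in> meas \<and> (\<integral>\<^sub>+w. norm (f w)) <= ennreal L"
 shows "\<exists>Q. finite Q \<and> S \<subseteq> \<Union> Q \<and> (\<forall>A\<in>Q. A \<subseteq> S) \<and>
  (\<forall>A\<in>Q. \<forall>f\<in>A. \<forall>g\<in>A. \<forall>z\<in>unit_ball. norm (toeplitz a f z - toeplitz a g z) <= 4*\<eta>)"
proof -
 let ?N = "CARD('n) + 1"
 from equicontinuous_images[OF assms(1) a M r L \<eta>] obtain \<delta> where \<delta>: "0 < \<delta>"
  "\<forall>f\<in>meas. (\<integral>\<^sub>+w. norm (f w)) <= ennreal L -->
  (\<forall>z\<in>cball 0 1. \<forall>z'\<in>cball 0 1. norm (z - z') < \<delta> --> norm (toeplitz a f z - toeplitz a f z') <= \<eta>)"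
  by (elim exE conjE) (rule that)
 have eq: "norm (toeplitz a f z - toeplitz a f z') <= \<eta>"
  if "f \<in> S" "z \<in> cball 0 1" "z' \<in> cball 0 1" "norm (z - z') < \<delta>" for f z z'
  using \<delta>(2)[rule_format, of f z z'] bspec[OF S that(1)] that(2-4) by simp
 define R where "R = M*L/(1 - r)^?N"
 have R: "toeplitz a f z \<in> cball 0 R" if f: "f \<in> S" and z: "z \<in> cball 0 1" for f z
 proof -
  have [measurable]: "f \<in> meas" using S f by simp
  have "ennreal (norm (toeplitz a f z)) <= (\<integral>\<^sub>+w. ennreal (M/(1 - r)^?N)*ennreal (norm (f w)))"
  proof (cases "integrable vol (\<lambda>w. a w*f w/(1 - herm z w)^?N)")
   case True
   hence "ennreal (norm (toeplitz a f z)) <= (\<integral>\<^sub>+w. norm (a w*f w/(1 - herm z w)^?N))"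
    unfolding toeplitz_def by (rule integral_norm_bound_ennreal)
   also have "... <= (\<integral>\<^sub>+w. ennreal (M/(1 - r)^?N)*ennreal (norm (f w)))"
   proof (rule nn_integral_mono_AE)
    show "AE w in vol. ennreal (norm (a w*f w/(1 - herm z w)^?N)) <= ennreal (M/(1 - r)^?N)*ennreal (norm (f w))"
     using a
    proof eventually_elim
     case (elim w)
     have "norm (a w*f w/(1 - herm z w)^?N) <= M/(1 - r)^?N*norm (f w)"
     proof (cases "a w = 0")
      case True
      thus ?thesis using M r by simp
     next
      case False
      have w: "norm w <= r" using spec[OF r(3), of w] False by force
      have "norm z*norm w <= 1*r" using z w r(1) by (intro mult_mono) auto
      hence "1 - r <= hdist z w" using hdist_ge[of z w] by linarith
      hence "norm (a w)/hdist z w^?N*norm (f w) <= M/(1 - r)^?N*norm (f w)"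
       using elim M r by (intro mult_right_mono frac_le power_mono) auto
      thus ?thesis by (simp add: hdist_def norm_mult norm_divide norm_power)
     qed
     thus ?case using M r by (simp add: ennreal_mult[symmetric] ennreal_leI)
    qed
   qed
   finally show ?thesis .
  qed (simp add: toeplitz_def not_integrable_integral_eq)
  also have "... = ennreal (M/(1 - r)^?N)*(\<integral>\<^sub>+w. norm (f w))"
   by (rule nn_integral_cmult) measurable
  also have "... <= ennreal (M/(1 - r)^?N)*ennreal L"
   using bspec[OF S f] by (intro mult_left_mono) auto
  also have "... = ennreal R" using M L r by (simp add: R_def ennreal_mult[symmetric])
  finally show ?thesis using M L r by (simp add: R_def ennreal_le_iff)
 qed
 obtain Z where Z: "finite Z" "Z \<subseteq> cball 0 1" "cball 0 1 \<subseteq> (\<Union>x\<in>Z. ball x \<delta> :: (complex^'n) set)"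
  using seq_compact_imp_totally_bounded[OF compact_imp_seq_compact[OF compact_cball[of "0 :: complex^'n" 1]]] \<delta>(1) by metis
 obtain V where V: "finite V" "cball 0 R \<subseteq> (\<Union>x\<in>V. ball x \<eta> :: complex set)"
  using seq_compact_imp_totally_bounded[OF compact_imp_seq_compact[OF compact_cball[of "0 :: complex" R]]] \<eta> by metis
 define A where "A c = {f \<in> S. \<forall>z\<in>Z. toeplitz a f z \<in> ball (c z) \<eta>}" for c
 show ?thesis
 proof (rule exI[of _ "A ` (Z \<rightarrow>\<^sub>E V)"], intro conjI ballI)
  show "finite (A ` (Z \<rightarrow>\<^sub>E V))"
   using Z(1) V(1) by (intro finite_imageI finite_PiE)
  show "S \<subseteq> \<Union> (A ` (Z \<rightarrow>\<^sub>E V))"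
  proof
   fix f assume f: "f \<in> S"
   have "\<exists>v\<in>V. toeplitz a f z \<in> ball v \<eta>" if "z \<in> Z" for z
    using R[OF f, of z] that Z(2) V(2) by blast
   then obtain c where c: "\<And>z. z \<in> Z ==> c z \<in> V \<and> toeplitz a f z \<in> ball (c z) \<eta>"
    by metis
   hence "restrict c Z \<in> Z \<rightarrow>\<^sub>E V" "f \<in> A (restrict c Z)"
    using f by (auto simp: A_def)
   thus "f \<in> \<Union> (A ` (Z \<rightarrow>\<^sub>E V))" by blast
  qed
  show "B \<subseteq> S" if "B \<in> A ` (Z \<rightarrow>\<^sub>E V)" for B
   using that by (auto simp: A_def)
  fix B f g and z :: "complex^'n"
  assume "B \<in> A ` (Z \<rightarrow>\<^sub>E V)" "f \<in> B" "g \<in> B" and z: "z \<in> unit_ball"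
  then obtain c where fg: "f \<in> A c" "g \<in> A c" by blast
  have "z \<in> cball 0 1" using z by simp
  then obtain y where y: "y \<in> Z" "norm (z - y) < \<delta>"
   using Z(3) by (auto simp: dist_norm norm_minus_commute)
  have "norm (toeplitz a f z - toeplitz a f y) <= \<eta>" "norm (toeplitz a g z - toeplitz a g y) <= \<eta>"
   using eq fg y Z(2) \<open>z \<in> cball 0 1\<close> by (auto simp: A_def)
  moreover have "dist (c y) (toeplitz a f y) < \<eta>" "dist (c y) (toeplitz a g y) < \<eta>"
   using fg y(1) by (auto simp: A_def)
  ultimately show "norm (toeplitz a f z - toeplitz a g z) <= 4*\<eta>"
   unfolding dist_norm by norm
 qed
qed

text \<open>
 Split \<open>u\<close> at a radius \<open>r\<close> beyond which it is small. The outer part has small norm, because it is dominated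
 by a small multiple of the positive Bergman operator. The inner part sends a bounded set to a family
 that is totally bounded in the uniform norm.
\<close>

lemma toeplitz_compact:
 fixes u :: "complex^'n => complex"
 assumes u [measurable]: "u \<in> meas"
  and uM: "AE w in vol. norm (u w) <= M" and M: "0 <= M"
  and decay: "\<And>e. 0 < e ==> \<exists>r\<ge>0. r < 1 \<and> (\<forall>w\<in>unit_ball. r < norm w --> norm (u w) <= e)"
 shows "acts_compactly N\<^sub>0 N (toeplitz u)"
 unfolding acts_compactly_def
proof (intro conjI allI impI funcsetI)
 obtain C where C: "0 <= C" "\<forall>f\<in>fspace N\<^sub>0. \<forall>F\<in>meas. \<forall>e\<ge>0.
   (\<forall>z\<in>unit_ball. ennreal (norm (F z)) <= ennreal e*Pplus (\<lambda>w. norm (f w)) z) --> N F <= ennreal (C*e)*N\<^sub>0 f"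
  using dominated by (elim exE conjE) (rule that)
 obtain C' where C': "0 <= C'" "\<forall>f\<in>meas. \<forall>c\<ge>0. (\<forall>z\<in>unit_ball. norm (f z) <= c) --> N f <= ennreal (C'*c)"
  using norm_bounded by (elim exE conjE) (rule that)
 show range: "toeplitz u f \<in> fspace N" if f: "f \<in> fspace N\<^sub>0" for f
 proof -
  have fm: "f \<in> meas" using f by (rule src.fspace_measurable)
  have m: "toeplitz u f \<in> meas" using u fm by (rule measurable_toeplitz)
  have "N (toeplitz u f) <= ennreal (C*M)*N\<^sub>0 f"
   using C(2)[rule_format, OF f m M] toeplitz_le_Pplus[OF uM fm] by blast
  also have "... < \<top>" using f by (simp add: fspace_def ennreal_mult_less_top)
  finally show ?thesis using m by (simp add: fspace_def)
 qed
 fix S assume "bounded_in N\<^sub>0 S"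
 then obtain B0 where SB: "S \<subseteq> fspace N\<^sub>0" and "\<forall>f\<in>S. N\<^sub>0 f <= ennreal B0"
  by (auto simp: bounded_in_def)
 moreover define B where "B = max B0 0"
 ultimately have B: "0 <= B" "N\<^sub>0 f <= ennreal B" if "f \<in> S" for f
  using that by (auto simp: ennreal_max_0' max.commute)
 have B0: "0 <= B" by (simp add: B_def)
 show "precompact_in N (toeplitz u ` S)"
 proof (rule precompactI[OF _ _ complete_fspace])
  show "toeplitz u ` S \<subseteq> fspace N" using range SB by blast
  fix e :: real assume e: "0 < e"
  obtain L where L: "0 <= L" "\<forall>f\<in>fspace N\<^sub>0. N\<^sub>0 f <= ennreal B --> (\<integral>\<^sub>+w. norm (f w)) <= ennreal L"
   using L1 B0 by (elim allE[of _ B] impE exE conjE) (simp, rule that)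
  have SL: "\<forall>f\<in>S. f \<in> meas \<and> (\<integral>\<^sub>+w. norm (f w)) <= ennreal L"
   using L(2) SB B src.fspace_measurable by blast
  define \<epsilon> where "\<epsilon> = e/(16*(C*B + 1))"
  have "0 < C*B + 1" using C(1) B0 by (simp add: add_nonneg_pos)
  hence \<epsilon>: "0 < \<epsilon>" "(C*\<epsilon>)*(4*B) <= e/4"
   using e C(1) B0 by (auto simp: \<epsilon>_def field_simps)
  obtain r where r: "0 <= r" "r < 1" "\<forall>w\<in>unit_ball. r < norm w --> norm (u w) <= \<epsilon>"
   using decay[OF \<epsilon>(1)] by blast
  define a where "a w = (if norm w <= r then u w else 0)" for w
  define b where "b w = (if norm w <= r then 0 else u w)" for w
  have am [measurable]: "a \<in> meas" and bm [measurable]: "b \<in> meas"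
   unfolding a_def[abs_def] b_def[abs_def] by measurable
  have aM: "AE w in vol. norm (a w) <= M" using uM by (rule AE_mp) (auto simp: a_def M)
  have bM: "AE w in vol. norm (b w) <= \<epsilon>"
   using AE_space by (rule AE_mp) (use r \<epsilon> in \<open>auto simp: b_def\<close>)
  define \<eta> where "\<eta> = e/(16*(C' + 1))"
  have "0 < \<eta>" "C'*(4*\<eta>) <= e/4" using e C'(1) by (auto simp: \<eta>_def field_simps)
  note \<eta> = this
  have az: "\<forall>w. r < norm w --> a w = 0" by (simp add: a_def)
  obtain Q where Q: "finite Q" "S \<subseteq> \<Union> Q" "\<forall>A\<in>Q. A \<subseteq> S"
   "\<forall>A\<in>Q. \<forall>f\<in>A. \<forall>g\<in>A. \<forall>z\<in>unit_ball. norm (toeplitz a f z - toeplitz a g z) <= 4*\<eta>"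
   using uniform_net_of_images[OF am aM M r(1,2) az L(1) \<eta>(1) SL] by (elim exE conjE) (rule that)
  show "\<exists>P. finite P \<and> toeplitz u ` S \<subseteq> \<Union> P \<and> (\<forall>A\<in>P. \<forall>f\<in>A. \<forall>g\<in>A. N (\<lambda>z. f z - g z) <= ennreal e)"
  proof (rule exI[of _ "(`) (toeplitz u) ` Q"], intro conjI ballI)
   show "finite ((`) (toeplitz u) ` Q)" using Q(1) by simp
   show "toeplitz u ` S \<subseteq> \<Union> ((`) (toeplitz u) ` Q)" using Q(2) by blast
   fix A F G assume "A \<in> (`) (toeplitz u) ` Q" "F \<in> A" "G \<in> A"
   then obtain A' f g where A': "A' \<in> Q" and fg: "f \<in> A'" "g \<in> A'" "F = toeplitz u f" "G = toeplitz u g"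
    by blast
   have fgS: "f \<in> S" "g \<in> S" using Q(3) A' fg(1,2) by blast+
   have fgF: "f \<in> fspace N\<^sub>0" "g \<in> fspace N\<^sub>0" using fgS SB by blast+
   have fm [measurable]: "f \<in> meas" and gm [measurable]: "g \<in> meas"
    using fgF by (auto intro: src.fspace_measurable)
   have Tm: "toeplitz u f \<in> meas" "toeplitz u g \<in> meas"
    "toeplitz a f \<in> meas" "toeplitz a g \<in> meas" by (intro measurable_toeplitz; measurable)+
   define H where "H z = toeplitz a f z - toeplitz a g z" for z
   define J where "J z = (F z - G z) - H z" for z
   have Hm: "H \<in> meas" and Jm: "J \<in> meas"
    unfolding J_def[abs_def] H_def[abs_def] fg(3,4) using Tm by measurable
   have "N H <= ennreal (C'*(4*\<eta>))"
    using C'(2)[rule_format, OF Hm, of "4*\<eta>"] Q(4) A' fg(1,2) \<eta>(1) unfolding H_def by simp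
   also have "... <= ennreal (e/4)" using \<eta>(2) by (rule ennreal_leI)
   finally have NH: "N H <= ennreal (e/4)" .
   have fgd: "(\<lambda>w. f w - g w) \<in> fspace N\<^sub>0" using fgF by (rule src.fspace_diff)
   have J: "J z = toeplitz b (\<lambda>w. f w - g w) z" if z: "z \<in> unit_ball" for z
   proof -
    have rz: "0 < rad z" "\<And>w. w \<in> unit_ball ==> rad z <= hdist z w"
     using z by (auto intro: rad_le_hdist)
    have int: "integrable vol (\<lambda>w. c w*h w/(1 - herm z w)^(CARD('n) + 1))"
     if "c \<in> meas" "AE w in vol. norm (c w) <= K" "h \<in> fspace N\<^sub>0" for c h K
     by (rule toeplitz_integrable[OF that(1) src.fspace_measurable[OF that(3)] that(2) fspace_L1[OF that(3)] rz(1)])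
      (rule rz(2))
    have lin: "toeplitz c (\<lambda>w. f w - g w) z = toeplitz c f z - toeplitz c g z"
     if c: "c \<in> meas" "AE w in vol. norm (c w) <= K" for c K
     unfolding toeplitz_def
     by (subst Bochner_Integration.integral_diff[OF int[OF c fgF(1)] int[OF c fgF(2)], symmetric])
      (simp add: algebra_simps diff_divide_distrib)
    have split: "toeplitz u h z = toeplitz a h z + toeplitz b h z" if h: "h \<in> fspace N\<^sub>0" for h
     unfolding toeplitz_def
     by (subst Bochner_Integration.integral_add[OF int[OF am aM h] int[OF bm bM h], symmetric])
      (auto intro!: Bochner_Integration.integral_cong simp: a_def b_def)
    show ?thesis
     unfolding lin[OF bm bM] J_def H_def fg(3,4) split[OF fgF(1)] split[OF fgF(2)] by simp
   qed
   have "N\<^sub>0 (\<lambda>w. f w - g w) <= 4*max (N\<^sub>0 f) (N\<^sub>0 g)"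
    by (rule src.norm_diff) measurable
   also have "... <= 4*ennreal B" using B fgS by (intro mult_left_mono) auto
   also have "... = ennreal (4*B)" using B0 by (subst ennreal_mult) auto
   finally have N0: "N\<^sub>0 (\<lambda>w. f w - g w) <= ennreal (4*B)" .
   have "\<forall>z\<in>unit_ball. ennreal (norm (J z)) <= ennreal \<epsilon>*Pplus (\<lambda>w. norm (f w - g w)) z"
   proof
    fix z :: "complex^'n" assume z: "z \<in> unit_ball"
    have "(\<lambda>w. f w - g w) \<in> meas" by measurable
    from toeplitz_le_Pplus[OF bM this] show "ennreal (norm (J z)) <= ennreal \<epsilon>*Pplus (\<lambda>w. norm (f w - g w)) z"
     unfolding J[OF z] .
   qed
   hence "N J <= ennreal (C*\<epsilon>)*N\<^sub>0 (\<lambda>w. f w - g w)"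
    using C(2)[rule_format, OF fgd Jm] \<epsilon>(1) by simp
   also have "... <= ennreal (C*\<epsilon>)*ennreal (4*B)"
    using N0 by (rule mult_left_mono) simp
   also have "... = ennreal ((C*\<epsilon>)*(4*B))"
    using C(1) \<epsilon>(1) B0 by (intro ennreal_mult[symmetric]) auto
   also have "... <= ennreal (e/4)" using \<epsilon>(2) by (rule ennreal_leI)
   finally have NJ: "N J <= ennreal (e/4)" .
   have "N (\<lambda>z. F z - G z) <= 4*max (N H) (N J)"
    using norm_add[OF Hm Jm] by (simp add: J_def)
   also have "... <= ennreal e" using NH NJ e by (intro four_max_le) auto
   finally show "N (\<lambda>z. F z - G z) <= ennreal e" .
  qed
 qed
qed

end

lemma bergman_dominated_Lp:
 fixes \<sigma> :: "complex^'n::finite => real"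
 assumes p: "1 < p" and \<sigma>: "\<sigma> \<in> Bp p"
 shows "bergman_dominated (Lp_norm p \<sigma>) \<sigma> (Lp_norm p \<sigma>)"
proof -
 have \<sigma>m [measurable]: "\<sigma> \<in> meas" and pos: "AE z in vol. 0 < \<sigma> z"
  using \<sigma> by (auto simp: Bp_def weight_def)
 interpret function_norm "Lp_norm p \<sigma>" \<sigma>
  using p by (intro function_norm_Lp \<sigma>m pos Bp_finite[OF p \<sigma>]) simp
 have p0: "0 < p" using p by simp
 define I where "I f = (\<integral>\<^sub>+z. ennreal (norm (f z) powr p*\<sigma> z))" for f :: "complex^'n => complex"
 have N: "Lp_norm p \<sigma> f = epowr (I f) (1/p)" for f by (simp add: Lp_norm_def I_def)
 have N_le: "Lp_norm p \<sigma> f <= c \<longleftrightarrow> I f <= epowr c p" for f c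
  unfolding N by (rule epowr_powr_le[OF p0])
 show ?thesis
 proof
  show "\<forall>B\<ge>0. \<exists>L\<ge>0. \<forall>f\<in>fspace (Lp_norm p \<sigma>). Lp_norm p \<sigma> f <= ennreal B --> (\<integral>\<^sub>+w. norm (f w)) <= ennreal L"
  proof (intro allI impI)
   fix B :: real assume B: "0 <= B"
   obtain C where C: "0 <= C" "\<forall>f\<in>meas. (\<forall>w. 0 <= f w) -->
    (\<integral>\<^sub>+w. ennreal (f w)) <= (\<integral>\<^sub>+w. ennreal (f w powr p*\<sigma> w)) + ennreal C"
    using Bp_L1[OF p \<sigma>] by (elim exE conjE) (rule that)
   show "\<exists>L\<ge>0. \<forall>f\<in>fspace (Lp_norm p \<sigma>). Lp_norm p \<sigma> f <= ennreal B --> (\<integral>\<^sub>+w. norm (f w)) <= ennreal L"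
   proof (rule exI[of _ "B powr p + C"], intro conjI ballI impI)
    show "0 <= B powr p + C" using C(1) by simp
    fix f assume f: "f \<in> fspace (Lp_norm p \<sigma>)" and le: "Lp_norm p \<sigma> f <= ennreal B"
    have [measurable]: "f \<in> meas" using f by (rule fspace_measurable)
    have "(\<integral>\<^sub>+w. norm (f w)) <= I f + ennreal C"
     unfolding I_def using C(2)[rule_format, of "\<lambda>w. norm (f w)"] by simp
    also have "... <= epowr (ennreal B) p + ennreal C"
     using le unfolding N_le by (rule add_right_mono)
    also have "... = ennreal (B powr p + C)" using B C(1) by simp
    finally show "(\<integral>\<^sub>+w. norm (f w)) <= ennreal (B powr p + C)" .
   qed
  qed
  obtain C where C: "0 < C" "\<forall>f\<in>meas. (\<forall>w. 0 <= f w) -->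
   (\<integral>\<^sub>+z. epowr (Pplus f z) p*ennreal (\<sigma> z)) <= ennreal C*(\<integral>\<^sub>+z. ennreal (f z powr p*\<sigma> z))"
   using Bp_Pplus[OF p \<sigma>] by (elim exE conjE) (rule that)
  show "\<exists>C\<ge>0. \<forall>f\<in>fspace (Lp_norm p \<sigma>). \<forall>F\<in>meas. \<forall>e\<ge>0.
   (\<forall>z\<in>unit_ball. ennreal (norm (F z)) <= ennreal e*Pplus (\<lambda>w. norm (f w)) z) -->
   Lp_norm p \<sigma> F <= ennreal (C*e)*Lp_norm p \<sigma> f"
  proof (rule exI[of _ "C powr (1/p)"], intro conjI ballI allI impI)
   fix f F :: "complex^'n => complex" and e :: real
   assume f: "f \<in> fspace (Lp_norm p \<sigma>)" and [measurable]: "F \<in> meas" and e: "0 <= e"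
    and le: "\<forall>z\<in>unit_ball. ennreal (norm (F z)) <= ennreal e*Pplus (\<lambda>w. norm (f w)) z"
   have [measurable]: "f \<in> meas" using f by (rule fspace_measurable)
   have "I F <= (\<integral>\<^sub>+z. epowr (ennreal e) p*(epowr (Pplus (\<lambda>w. norm (f w)) z) p*ennreal (\<sigma> z)))"
    unfolding I_def
   proof (rule nn_integral_mono_AE)
    show "AE z in vol. ennreal (norm (F z) powr p*\<sigma> z) <= epowr (ennreal e) p*(epowr (Pplus (\<lambda>w. norm (f w)) z) p*ennreal (\<sigma> z))"
     using pos AE_space
    proof eventually_elim
     case (elim z)
     have "ennreal (norm (F z) powr p*\<sigma> z) = epowr (ennreal (norm (F z))) p*ennreal (\<sigma> z)"
      using elim by (simp add: ennreal_mult)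
     also have "... <= epowr (ennreal e*Pplus (\<lambda>w. norm (f w)) z) p*ennreal (\<sigma> z)"
      using elim le p0 by (intro mult_right_mono epowr_mono) auto
     finally show ?case using p0 by (simp only: epowr_mult mult.assoc)
    qed
   qed
   also have "... = epowr (ennreal e) p*(\<integral>\<^sub>+z. epowr (Pplus (\<lambda>w. norm (f w)) z) p*ennreal (\<sigma> z))"
    by (rule nn_integral_cmult) measurable
   also have "... <= epowr (ennreal e) p*(ennreal C*I f)"
    unfolding I_def using C(2)[rule_format, of "\<lambda>w. norm (f w)"] by (intro mult_left_mono) auto
   also have "... = epowr (ennreal e*(epowr (ennreal C) (1/p)*epowr (I f) (1/p))) p"
    using p0 by (simp add: epowr_mult epowr_epowr del: epowr_ennreal)
   also have "... = epowr (ennreal (C powr (1/p)*e)*Lp_norm p \<sigma> f) p"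
    using C(1) e by (simp add: N ennreal_mult mult_ac)
   finally show "Lp_norm p \<sigma> F <= ennreal (C powr (1/p)*e)*Lp_norm p \<sigma> f"
    unfolding N_le .
  qed simp
 qed
qed

lemma bergman_dominated_weak_L1:
 fixes \<sigma> :: "complex^'n::finite => real"
 assumes \<sigma>: "\<sigma> \<in> B1"
 shows "bergman_dominated (weak_L1_norm \<sigma>) \<sigma> (Lp_norm 1 \<sigma>)"
proof -
 have \<sigma>m [measurable]: "\<sigma> \<in> meas" and pos: "AE z in vol. 0 < \<sigma> z"
  using \<sigma> by (auto simp: B1_def weight_def)
 interpret S: doubling_measure "density vol (\<lambda>w. ennreal (\<sigma> w))"
  by (rule B1_doubling[OF \<sigma>])
 have fin: "(\<integral>\<^sub>+z. ennreal (\<sigma> z)) < \<top>"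
 proof -
  have "(\<integral>\<^sub>+z. ennreal (\<sigma> z)) = (\<integral>\<^sub>+z. ennreal (\<sigma> z)*indicator unit_ball z)"
   by (rule nn_integral_cong) simp
  also have "... = emeasure (density vol (\<lambda>w. ennreal (\<sigma> w))) unit_ball"
   using sets.top[of vol] by (intro emeasure_density[symmetric]) auto
  finally show ?thesis using S.emeasure_S_less_top by simp
 qed
 interpret function_norm "weak_L1_norm \<sigma>" \<sigma>
  by (intro function_norm_weak_L1 \<sigma>m pos fin)
 interpret L: function_norm "Lp_norm 1 \<sigma>" \<sigma>
  by (intro function_norm_Lp \<sigma>m pos fin) simp
 have N: "Lp_norm 1 \<sigma> f = (\<integral>\<^sub>+z. ennreal (norm (f z)*\<sigma> z))" for f
  by (simp add: Lp_norm_def)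
 show ?thesis
 proof
  obtain C where C: "0 < C" "\<forall>f\<in>meas. (\<forall>w. 0 <= f w) -->
   (\<integral>\<^sub>+w. ennreal (f w)) <= ennreal C*(\<integral>\<^sub>+w. ennreal (f w*\<sigma> w))"
   using B1_L1[OF \<sigma>] by (elim exE conjE) (rule that)
  show "\<forall>B\<ge>0. \<exists>L\<ge>0. \<forall>f\<in>fspace (Lp_norm 1 \<sigma>). Lp_norm 1 \<sigma> f <= ennreal B --> (\<integral>\<^sub>+w. norm (f w)) <= ennreal L"
  proof (intro allI impI)
   fix B :: real assume B: "0 <= B"
   show "\<exists>L\<ge>0. \<forall>f\<in>fspace (Lp_norm 1 \<sigma>). Lp_norm 1 \<sigma> f <= ennreal B --> (\<integral>\<^sub>+w. norm (f w)) <= ennreal L"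
   proof (rule exI[of _ "C*B"], intro conjI ballI impI)
    show "0 <= C*B" using C(1) B by simp
    fix f assume f: "f \<in> fspace (Lp_norm 1 \<sigma>)" and le: "Lp_norm 1 \<sigma> f <= ennreal B"
    have [measurable]: "f \<in> meas" using f by (rule L.fspace_measurable)
    have "(\<integral>\<^sub>+w. norm (f w)) <= ennreal C*Lp_norm 1 \<sigma> f"
     unfolding N using C(2)[rule_format, of "\<lambda>w. norm (f w)"] by simp
    also have "... <= ennreal C*ennreal B" using le by (rule mult_left_mono) simp
    also have "... = ennreal (C*B)" using B C(1) by (simp add: ennreal_mult)
    finally show "(\<integral>\<^sub>+w. norm (f w)) <= ennreal (C*B)" .
   qed
  qed
  obtain C where C: "0 < C" "\<forall>f\<in>meas. (\<forall>w. 0 <= f w) --> (\<forall>t>0.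
   emeasure (density vol (\<lambda>w. ennreal (\<sigma> w))) {z \<in> unit_ball. ennreal t < Pplus f z}
    <= ennreal (C/t)*(\<integral>\<^sub>+z. ennreal (f z*\<sigma> z)))"
   using B1_Pplus[OF \<sigma>] by (elim exE conjE) (rule that)
  show "\<exists>C\<ge>0. \<forall>f\<in>fspace (Lp_norm 1 \<sigma>). \<forall>F\<in>meas. \<forall>e\<ge>0.
   (\<forall>z\<in>unit_ball. ennreal (norm (F z)) <= ennreal e*Pplus (\<lambda>w. norm (f w)) z) -->
   weak_L1_norm \<sigma> F <= ennreal (C*e)*Lp_norm 1 \<sigma> f"
  proof (rule exI[of _ C], intro conjI ballI allI impI)
   show "0 <= C" using C(1) by simp
   fix f F :: "complex^'n => complex" and e :: real
   assume f: "f \<in> fspace (Lp_norm 1 \<sigma>)" and [measurable]: "F \<in> meas" and e: "0 <= e"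
    and le: "\<forall>z\<in>unit_ball. ennreal (norm (F z)) <= ennreal e*Pplus (\<lambda>w. norm (f w)) z"
   have [measurable]: "f \<in> meas" using f by (rule L.fspace_measurable)
   show "weak_L1_norm \<sigma> F <= ennreal (C*e)*Lp_norm 1 \<sigma> f"
    unfolding weak_L1_norm_def
   proof (rule SUP_least)
    fix t :: real assume "t \<in> {0<..}"
    hence t: "0 < t" by simp
    let ?A = "{z \<in> unit_ball. t < norm (F z)}"
    let ?B = "{z \<in> unit_ball. ennreal (t/e) < Pplus (\<lambda>w. norm (f w)) z}"
    have A: "?A \<in> sets vol"
    proof -
     have "{z \<in> space vol. t < norm (F z)} \<in> sets vol" by measurable
     thus ?thesis by simp
    qed
    show "ennreal t*wmeasure \<sigma> ?A <= ennreal (C*e)*Lp_norm 1 \<sigma> f"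
    proof (cases "e = 0")
     case True
     have "norm (F z) = 0" if "z \<in> unit_ball" for z using le that True by simp
     hence "?A = {}" using t by auto
     thus ?thesis by (simp only: wmeasure_def) simp
    next
     case False
     hence e: "0 < e" using e by simp
     have sub: "?A \<subseteq> ?B"
     proof
      fix z assume "z \<in> ?A"
      hence z: "z \<in> unit_ball" "t < norm (F z)" by auto
      show "z \<in> ?B"
      proof (rule ccontr)
       assume "z \<notin> ?B"
       hence "Pplus (\<lambda>w. norm (f w)) z <= ennreal (t/e)" using z(1) by simp
       hence "ennreal e*Pplus (\<lambda>w. norm (f w)) z <= ennreal e*ennreal (t/e)"
        by (rule mult_left_mono) simp
       also have "... = ennreal t" using e t by (simp add: ennreal_mult[symmetric])
       finally have "ennreal (norm (F z)) <= ennreal t"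
        using bspec[OF le z(1)] by (rule order_trans[rotated])
       thus False using z(2) t by (simp add: ennreal_le_iff)
      qed
     qed
     have Bs: "?B \<in> sets vol"
     proof -
      have "{z \<in> space vol. ennreal (t/e) < Pplus (\<lambda>w. norm (f w)) z} \<in> sets vol"
       by measurable
      thus ?thesis by simp
     qed
     have "wmeasure \<sigma> ?A = emeasure (density vol (\<lambda>w. ennreal (\<sigma> w))) ?A"
      unfolding wmeasure_def using A by (intro emeasure_density[symmetric]) auto
     also have "... <= emeasure (density vol (\<lambda>w. ennreal (\<sigma> w))) ?B"
      using Bs by (intro emeasure_mono[OF sub]) simp
     also have "... <= ennreal (C/(t/e))*Lp_norm 1 \<sigma> f"
      unfolding N using C(2)[rule_format, of "\<lambda>w. norm (f w)" "t/e"] t e by simp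
     finally have "ennreal t*wmeasure \<sigma> ?A <= ennreal t*(ennreal (C/(t/e))*Lp_norm 1 \<sigma> f)"
      by (rule mult_left_mono) simp
     also have "... = ennreal (C*e)*Lp_norm 1 \<sigma> f"
      using t e C(1) by (simp add: ennreal_mult[symmetric] mult.assoc[symmetric])
     finally show ?thesis .
    qed
   qed
  qed
 qed
qed

section \<open>Compactness forces the symbol to vanish on the sphere\<close>

lemma integral_norm_le_measure:
 fixes f :: "complex^'n::finite => complex"
 assumes [measurable]: "f \<in> meas" and D: "D \<in> sets vol"
  and le: "\<And>w. w \<in> D ==> norm (f w) <= k" "\<And>w. w \<notin> D ==> f w = 0" and k: "0 <= k"
 shows "integrable vol f" "norm (\<integral>w. f w \<partial>vol) <= k*measure vol D"
proof -
 have le': "norm (f w) <= k*indicator D w" for w using le by (cases "w \<in> D") auto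
 show 1: "integrable vol f"
  by (rule vol.integrable_const_bound[of _ k]) (use le' k le in \<open>auto intro!: AE_I2 order_trans[OF le'] simp: indicator_def\<close>)
 have 2: "integrable vol (\<lambda>w. k*indicator D w)"
  using D by (intro integrable_mult_right integrable_real_indicator) (auto simp: vol.emeasure_eq_measure)
 have "norm (\<integral>w. f w \<partial>vol) <= (\<integral>w. k*indicator D w \<partial>vol)"
  by (rule Bochner_Integration.integral_norm_bound_integral[OF 1 2]) (rule le')
 also have "... = k*measure vol D" using sets.sets_into_space[OF D] by (simp add: Int_absorb2)
 finally show "norm (\<integral>w. f w \<partial>vol) <= k*measure vol D" .
qed

lemma inverse_power_near_one:
 "\<exists>c>0. c <= 1/2 \<and> (\<forall>\<theta>::complex. cmod \<theta> <= c --> cmod (1/(1 + \<theta>)^m - 1) <= 1/4)"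
proof -
 have "((\<lambda>\<theta>::complex. 1/(1 + \<theta>)^m) \<longlongrightarrow> 1/(1 + 0)^m) (at 0)"
  by (intro tendsto_intros) auto
 hence "\<exists>d>0. \<forall>\<theta>::complex. \<theta> \<noteq> 0 \<and> norm (\<theta> - 0) < d --> norm (1/(1 + \<theta>)^m - 1) < 1/4"
  by (intro LIM_D) auto
 then obtain d where d: "0 < d" "\<forall>\<theta>::complex. \<theta> \<noteq> 0 \<and> norm (\<theta> - 0) < d --> norm (1/(1 + \<theta>)^m - 1) < 1/4"
  by (elim exE conjE) (rule that)
 show ?thesis
 proof (rule exI[of _ "min (d/2) (1/2)"], intro conjI allI impI)
  show "0 < min (d/2) (1/2)" "min (d/2) (1/2) <= 1/2" using d(1) by auto
  fix \<theta> :: complex assume *: "cmod \<theta> <= min (d/2) (1/2)"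
  show "cmod (1/(1 + \<theta>)^m - 1) <= 1/4"
  proof (cases "\<theta> = 0")
   case False
   have "norm (\<theta> - 0) < d" using * d(1) by simp
   thus ?thesis using d(2) False less_imp_le by blast
  qed simp
 qed
qed

text \<open>
 On a box \<open>D\<close> at distance \<open>r\<close> from \<open>\<zeta>\<close> the kernel and \<open>u\<close> are almost constant, and the kernel is of the order of the
 inverse of the volume of \<open>D\<close>. Hence the image of the indicator is bounded below on \<open>D\<close>. It is bounded above everywhere,
 because the kernel is at most of that order when one variable lies in \<open>D\<close>.
\<close>

lemma toeplitz_indicator_bounds:
 fixes u :: "complex^'n::finite => complex"
 assumes u [measurable]: "u \<in> meas" and \<zeta>: "norm \<zeta> = 1" and nz: "u \<zeta> \<noteq> 0"
  and cont: "\<forall>e>0. \<exists>d>0. \<forall>w\<in>unit_ball. norm (w - \<zeta>) < d --> norm (u w - u \<zeta>) <= e"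
 shows "\<exists>c1>0. \<exists>C2>0. \<exists>\<kappa>>0. \<exists>r0>0. r0 < 1 \<and> (\<forall>r. 0 < r \<and> r <= r0 -->
  (\<exists>D\<in>sets vol. ennreal (\<kappa>*r^(CARD('n) + 1)) <= emeasure vol D \<and> emeasure vol D <= ennreal (C2*r^(CARD('n) + 1)) \<and>
   (\<forall>z\<in>D. c1 <= norm (toeplitz u (indicator D) z)) \<and> (\<forall>z\<in>unit_ball. norm (toeplitz u (indicator D) z) <= C2)))"
proof -
 let ?N = "CARD('n) + 1"
 define A where "A = norm (u \<zeta>)"
 have A: "0 < A" using nz by (simp add: A_def)
 obtain c where c: "0 < c" "c <= 1/2" "\<forall>\<theta>::complex. cmod \<theta> <= c --> cmod (1/(1 + \<theta>)^?N - 1) <= 1/4"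
  using inverse_power_near_one[of ?N] by (elim exE conjE) (rule that)
 have c1: "c < 1" using c(2) by simp
 obtain \<kappa> where \<kappa>: "0 < \<kappa>" "\<And>x :: complex^'n::finite. x \<in> unit_ball ==>
  \<exists>D. D \<in> sets vol \<and> x \<in> D \<and> ennreal (\<kappa>*rad x^?N) <= emeasure vol D \<and>
   (\<forall>v\<in>D. \<forall>w\<in>D. cmod (herm v w - of_real ((norm x)\<^sup>2)) <= c*rad x)"
  using bergman_box_vol[OF c(1) c1, where ?'n = 'n] by blast
 obtain C where C: "0 < C" "\<And>(x :: complex^'n::finite). x \<in> unit_ball ==>
  emeasure vol (nbhd 4 x) <= ennreal (C*rad x^?N)"
  using emeasure_nbhd_le[where ?'n = 'n, of 4] by blast
 have A5: "0 < A/5" using A by simp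
 from cont[rule_format, OF A5] obtain d where d: "0 < d" "\<forall>w\<in>unit_ball. norm (w - \<zeta>) < d --> norm (u w - u \<zeta>) <= A/5"
  by (elim exE conjE) (rule that)
 define r0 where "r0 = min (1/2) (min (d/4) (d\<^sup>2/25))"
 define C2 where "C2 = C + 2*A*4^?N*C"
 define c2 where "c2 = A*\<kappa>/2^(?N + 1)"
 have r0: "0 < r0" "r0 < 1" using d(1) by (auto simp: r0_def)
 have "C <= C2" "2*A*4^?N*C <= C2" "0 < C2" using A C(1) by (auto simp: C2_def add_pos_nonneg)
 note C2 = this
 have "\<exists>D\<in>sets vol. ennreal (\<kappa>*r^?N) <= emeasure vol D \<and> emeasure vol D <= ennreal (C2*r^?N) \<and>
   (\<forall>z\<in>D. c2 <= norm (toeplitz u (indicator D) z)) \<and> (\<forall>z\<in>unit_ball. norm (toeplitz u (indicator D) z) <= C2)"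
  if r: "0 < r \<and> r <= r0" for r
 proof -
  define x where "x = (1 - r) *\<^sub>R \<zeta>"
  have r1: "0 < r" "r <= 1/2" "r <= d/4" "r <= d\<^sup>2/25" using r by (auto simp: r0_def)
  have nx: "norm x = 1 - r" using r1 \<zeta> by (simp add: x_def)
  have x: "x \<in> unit_ball" "rad x = r" using nx r1 by (auto simp: rad_def)
  define s where "s = 1 - (norm x)\<^sup>2"
  have s_eq: "s = r*(2 - r)" by (simp add: s_def nx power2_eq_square algebra_simps)
  have "r*1 <= r*(2 - r)" "r*(2 - r) <= r*2" using r1 by (intro mult_left_mono; simp)+
  hence s: "r <= s" "s <= 2*r" "0 < s" using r1(1) by (simp_all add: s_eq)
  obtain D where D: "D \<in> sets vol" "x \<in> D" "ennreal (\<kappa>*r^?N) <= emeasure vol D"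
   "\<forall>v\<in>D. \<forall>w\<in>D. cmod (herm v w - of_real ((norm x)\<^sup>2)) <= c*r"
   using \<kappa>(2)[OF x(1)] unfolding x(2) by (elim exE conjE) (rule that)
  have Dball: "w \<in> unit_ball" if "w \<in> D" for w
   using sets.sets_into_space[OF D(1)] that by auto
  define \<theta> where "\<theta> z w = (of_real ((norm x)\<^sup>2) - herm z w) / of_real s" for z w :: "complex^'n"
  have kern: "1 - herm z w = of_real s*(1 + \<theta> z w)" for z w
  proof -
   have "of_real s*\<theta> z w = of_real ((norm x)\<^sup>2) - herm z w"
    using s(3) by (simp add: \<theta>_def)
   thus ?thesis by (simp add: distrib_left s_def)
  qed
  have \<theta>: "cmod (\<theta> z w) <= c" if "z \<in> D" "w \<in> D" for z w
  proof -
   have "cmod (\<theta> z w) = cmod (herm z w - of_real ((norm x)\<^sup>2)) / s"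
    using s(3) by (simp add: \<theta>_def norm_divide norm_minus_commute)
   also have "... <= (c*r)/r" using D(4) that s r1(1) c(1) by (intro frac_le) auto
   finally show ?thesis using r1(1) by simp
  qed
  have hd: "hdist z w <= 3*r" if "z \<in> D" "w \<in> D" for z w
  proof -
   have "hdist z w = s*cmod (1 + \<theta> z w)" using s(3) by (simp add: hdist_def kern norm_mult)
   also have "... <= s*(1 + c)"
    using s(3) \<theta>[OF that] norm_triangle_ineq[of 1 "\<theta> z w"] by (intro mult_left_mono) auto
   also have "... <= (2*r)*(3/2)" using s c r1 by (intro mult_mono) auto
   finally show ?thesis by simp
  qed
  have radw: "r/4 <= rad w" if w: "w \<in> D" for w
  proof -
   have "cmod (herm w w - of_real ((norm x)\<^sup>2)) <= c*r" using D(4) w by blast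
   hence "\<bar>(norm w)\<^sup>2 - (norm x)\<^sup>2\<bar> <= c*r"
    unfolding herm_self of_real_diff[symmetric] norm_of_real .
   also have "c*r <= 1/2*r" using c r1 by (intro mult_right_mono) auto
   finally have "r/2 <= 1 - (norm w)\<^sup>2" using s(1) unfolding s_def by linarith
   also have "... = rad w*(1 + norm w)" by (simp add: rad_def power2_eq_square algebra_simps)
   also have "... <= rad w*2" using Dball[OF w] by (intro mult_left_mono) auto
   finally show ?thesis by simp
  qed
  have near: "norm (u w - u \<zeta>) <= A/5" if w: "w \<in> D" for w
  proof -
   have "(norm (w - x))\<^sup>2 <= 2*hdist w x"
    using Dball[OF w] x(1) by (intro norm_diff_square_le_hdist) auto
   also have "... <= 6*r" using hd[OF w D(2)] by simp
   also have "... <= (d/2)\<^sup>2" using r1(1,4) by (simp add: power_divide)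
   finally have "norm (w - x) <= d/2" by (rule power2_le_imp_le) (use d(1) in simp)
   moreover have "norm (x - \<zeta>) = r"
   proof -
    have "x - \<zeta> = (- r) *\<^sub>R \<zeta>" by (simp add: x_def scaleR_left_diff_distrib)
    hence "norm (x - \<zeta>) = \<bar>- r\<bar>*norm \<zeta>" by (simp only: norm_scaleR)
    thus ?thesis using \<zeta> r1(1) by simp
   qed
   ultimately have "norm (w - \<zeta>) < d"
    using norm_triangle_ineq[of "w - x" "x - \<zeta>"] r1(3) d(1) by simp
   thus ?thesis using d(2) Dball[OF w] by blast
  qed
  have unear: "norm (u w) <= 2*A" if "w \<in> D" for w
  proof -
   have "norm (u w) <= norm (u w - u \<zeta>) + A"
    using norm_triangle_ineq[of "u w - u \<zeta>" "u \<zeta>"] by (simp add: A_def)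
   thus ?thesis using near[OF that] A by linarith
  qed
  have Dm: "emeasure vol D <= ennreal (C*r^?N)"
  proof -
   have "D \<subseteq> nbhd 4 x"
   proof
    fix w assume w: "w \<in> D"
    have "hdist x w < 4*rad x" using hd[OF D(2) w] r1(1) by (simp add: x(2))
    thus "w \<in> nbhd 4 x" using Dball[OF w] by (simp add: nbhd_def)
   qed
   hence "emeasure vol D <= emeasure vol (nbhd 4 x)" by (rule emeasure_mono) measurable
   also have "... <= ennreal (C*r^?N)" using C(2)[OF x(1)] by (simp add: x(2))
   finally show ?thesis .
  qed
  have Dm': "measure vol D <= C*r^?N" "\<kappa>*r^?N <= measure vol D"
   using Dm D(3) C(1) r1(1) by (simp_all add: vol.emeasure_eq_measure ennreal_le_iff)
  have fm: "(\<lambda>w. u w*indicator D w/(1 - herm z w)^?N) \<in> meas" for z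
   using D(1) by measurable
  have upper: "integrable vol (\<lambda>w. u w*indicator D w/(1 - herm z w)^?N)" (is ?int)
   "norm (toeplitz u (indicator D) z) <= C2" (is ?bd) if z: "z \<in> unit_ball" for z
  proof -
   have le: "norm (u w*indicator D w/(1 - herm z w)^?N) <= 2*A/(r/4)^?N" if w: "w \<in> D" for w
   proof -
    have "rad w <= hdist z w" using z Dball[OF w] by (rule rad_le_hdist)
    hence "norm (u w)/hdist z w^?N <= 2*A/(r/4)^?N"
     using unear[OF w] radw[OF w] A r1(1) by (intro frac_le power_mono) auto
    thus ?thesis using w by (simp add: norm_divide norm_mult norm_power hdist_def)
   qed
   have k: "0 <= 2*A/(r/4)^?N" using A r1(1) by simp
   show ?int by (rule integral_norm_le_measure(1)[OF fm D(1) le _ k]) auto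
   have "norm (toeplitz u (indicator D) z) <= 2*A/(r/4)^?N*measure vol D"
    unfolding toeplitz_def by (rule integral_norm_le_measure(2)[OF fm D(1) le _ k]) auto
   also have "... <= 2*A/(r/4)^?N*(C*r^?N)" using Dm'(1) k by (rule mult_left_mono)
   also have "... = 2*A*4^?N*C" using r1(1) by (simp add: power_divide del: power_Suc)
   finally show ?bd using C2(2) by linarith
  qed
  have lower: "c2 <= norm (toeplitz u (indicator D) z)" if z: "z \<in> D" for z
  proof -
   define g where "g w = u w*indicator D w/(1 - herm z w)^?N - u \<zeta> / of_real s^?N*indicator D w" for w
   have gm: "g \<in> meas" unfolding g_def[abs_def] using fm D(1) by measurable
   have gD: "norm (g w) <= A/2 / s^?N" if w: "w \<in> D" for w
   proof -
    define h where "h = 1/(1 + \<theta> z w)^?N"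
    have h: "norm (h - 1) <= 1/4" unfolding h_def using c(3) \<theta>[OF z w] by blast
    have h': "norm h <= 5/4" using h norm_triangle_ineq[of "h - 1" 1] by simp
    have "g w = (u w*h - u \<zeta>) / of_real s^?N"
     using w by (simp only: g_def kern power_mult_distrib h_def indicator_simps) (simp add: diff_divide_distrib)
    hence "norm (g w) = norm ((u w - u \<zeta>)*h + u \<zeta>*(h - 1)) / s^?N"
     using s(3) by (simp add: norm_divide norm_mult norm_power algebra_simps)
    also have "... <= (A/2) / s^?N"
    proof (rule divide_right_mono)
     have "norm ((u w - u \<zeta>)*h + u \<zeta>*(h - 1)) <= norm (u w - u \<zeta>)*norm h + A*norm (h - 1)"
      using norm_triangle_ineq[of "(u w - u \<zeta>)*h" "u \<zeta>*(h - 1)"] by (simp add: norm_mult A_def)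
     also have "... <= A/5*(5/4) + A*(1/4)"
      using near[OF w] h h' A by (intro add_mono mult_mono) auto
     finally show "norm ((u w - u \<zeta>)*h + u \<zeta>*(h - 1)) <= A/2" by simp
    qed (use s in simp)
    finally show ?thesis .
   qed
   have k: "0 <= A/2 / s^?N" using A s(3) by simp
   have gb: "norm (\<integral>w. g w \<partial>vol) <= A/2 / s^?N*measure vol D"
    by (rule integral_norm_le_measure(2)[OF gm D(1) gD _ k]) (auto simp: g_def)
   have "integrable vol (\<lambda>w. u \<zeta> / of_real s^?N*(indicator D w :: complex))"
    by (rule integral_norm_le_measure(1)[of _ D "A / s^?N"])
     (use D(1) A s(3) in \<open>auto simp: norm_divide norm_power A_def norm_mult\<close>)
   hence "(\<integral>w. g w \<partial>vol) = toeplitz u (indicator D) z - (\<integral>w. u \<zeta> / of_real s^?N*indicator D w \<partial>vol)"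
    unfolding g_def toeplitz_def using upper(1)[OF Dball[OF z]] by (intro Bochner_Integration.integral_diff)
   moreover have "(\<integral>w. u \<zeta> / of_real s^?N*indicator D w \<partial>vol) = u \<zeta> / of_real s^?N * of_real (measure vol D)"
   proof -
    have "(\<integral>w. (indicator D w :: complex) \<partial>vol) = (\<integral>w. of_real (indicator D w) \<partial>vol)"
     by (rule Bochner_Integration.integral_cong) (auto simp: indicator_def)
    also have "... = of_real (measure vol D)"
     using sets.sets_into_space[OF D(1)] by (simp add: Int_absorb2)
    finally show ?thesis by simp
   qed
   ultimately have ge: "(\<integral>w. g w \<partial>vol) = toeplitz u (indicator D) z - u \<zeta> / of_real s^?N * of_real (measure vol D)"
    by (simp only:)
   have "norm K <= norm T + norm (T - K)" for T K :: complex
    using norm_triangle_ineq4[of T "T - K"] by simp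
   hence "norm (u \<zeta> / of_real s^?N * of_real (measure vol D)) <= norm (toeplitz u (indicator D) z) + norm (\<integral>w. g w \<partial>vol)"
    unfolding ge .
   also have "norm (u \<zeta> / of_real s^?N * of_real (measure vol D)) = A / s^?N*measure vol D"
    using s(3) by (simp add: norm_mult norm_divide norm_mult norm_power A_def)
   finally have le: "A / s^?N*measure vol D <= norm (toeplitz u (indicator D) z) + norm (\<integral>w. g w \<partial>vol)" .
   have half: "A/2/S*m = (A/S*m)/2" for S m :: real by simp
   have "A/2 / s^?N*measure vol D <= norm (toeplitz u (indicator D) z)"
    using gb le unfolding half by linarith
   moreover have "c2 <= A/2 / s^?N*measure vol D"
   proof -
    have "c2 = A/2/(2*r)^?N*(\<kappa>*r^?N)" using r1(1) by (simp add: c2_def power_mult_distrib)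
    also have "... <= A/2 / s^?N*measure vol D"
     using A s r1(1) \<kappa>(1) Dm'(2) by (intro mult_mono divide_left_mono power_mono mult_pos_pos) auto
    finally show ?thesis .
   qed
   ultimately show ?thesis by linarith
  qed
  have "emeasure vol D <= ennreal (C2*r^?N)"
   using Dm C2(1) r1(1) by (elim order_trans) (intro ennreal_leI mult_right_mono, auto)
  thus ?thesis using D(1,3) lower upper(2) by (intro bexI[of _ D] conjI ballI) auto
 qed
 moreover have "0 < c2" using A \<kappa>(1) by (simp add: c2_def)
 ultimately show ?thesis
  using C2(3) \<kappa>(1) r0 by (intro exI[of _ c2] exI[of _ C2] exI[of _ \<kappa>] exI[of _ r0] conjI allI impI)
qed

text \<open>
 The indicators of the boxes of sizes \<open>r j = r0 * q ^ j\<close>, normalized in \<open>L\<^sup>p\<close>, form a bounded sequence. On its own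
 box each image is large, while the images that belong to larger boxes are much smaller there, if \<open>q\<close> is
 small. So the images are uniformly separated, which contradicts compactness.
\<close>

lemma compact_imp_vanishing:
 fixes u :: "complex^'n::finite => complex"
 assumes u [measurable]: "u \<in> meas" and \<zeta>: "norm \<zeta> = 1"
  and cont: "\<forall>e>0. \<exists>d>0. \<forall>w\<in>unit_ball. norm (w - \<zeta>) < d --> norm (u w - u \<zeta>) <= e"
  and p: "1 <= p" and "quasinorm N"
  and lower: "\<And>F D \<alpha>. F \<in> meas ==> D \<in> sets vol ==> 0 < \<alpha> ==> (\<forall>z\<in>D. \<alpha> <= norm (F z)) ==>
   ennreal (\<alpha>/2)*epowr (emeasure vol D) (1/p) <= N F"
  and compact: "acts_compactly (Lp_norm p (\<lambda>_. 1)) N (toeplitz u)"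
 shows "u \<zeta> = 0"
proof (rule ccontr)
 interpret quasinorm N by fact
 let ?N = "CARD('n) + 1"
 assume nz: "u \<zeta> \<noteq> 0"
 obtain c1 C2 \<kappa> r0 where c: "0 < c1" "0 < C2" "0 < \<kappa>" "0 < r0" "r0 < 1"
  and D0: "\<forall>r. 0 < r \<and> r <= r0 -->
  (\<exists>D\<in>sets vol. ennreal (\<kappa>*r^?N) <= emeasure vol D \<and> emeasure vol D <= ennreal (C2*r^?N) \<and>
   (\<forall>z\<in>D. c1 <= norm (toeplitz u (indicator D) z)) \<and> (\<forall>z\<in>unit_ball. norm (toeplitz u (indicator D) z) <= C2))"
  using toeplitz_indicator_bounds[OF u \<zeta> nz cont] by (elim exE conjE) (rule that)
 define \<gamma> where "\<gamma> = real ?N/p"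
 have \<gamma>: "0 < \<gamma>" using p by (simp add: \<gamma>_def)
 define q where "q = min (1/2) ((c1/(2*C2)) powr (1/\<gamma>))"
 have q: "0 < q" "q <= 1/2" "q powr \<gamma> <= c1/(2*C2)"
 proof -
  show "0 < q" "q <= 1/2" using c by (auto simp: q_def)
  hence "q powr \<gamma> <= ((c1/(2*C2)) powr (1/\<gamma>)) powr \<gamma>"
   using \<gamma> by (intro powr_mono2) (auto simp: q_def)
  also have "... = c1/(2*C2)" using c \<gamma> by (simp add: powr_powr)
  finally show "q powr \<gamma> <= c1/(2*C2)" .
 qed
 define r where "r j = r0*q^j" for j :: nat
 have r: "0 < r j" "r j <= r0" for j
  using c q by (auto simp: r_def mult_le_cancel_left1 intro!: power_le_one)
 have "\<forall>j. \<exists>D. D \<in> sets vol \<and> ennreal (\<kappa>*r j^?N) <= emeasure vol D \<and> emeasure vol D <= ennreal (C2*r j^?N) \<and>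
   (\<forall>z\<in>D. c1 <= norm (toeplitz u (indicator D) z)) \<and> (\<forall>z\<in>unit_ball. norm (toeplitz u (indicator D) z) <= C2)"
  using D0 r by (metis (no_types, lifting))
 then obtain D where D: "\<forall>j. D j \<in> sets vol \<and> ennreal (\<kappa>*r j^?N) <= emeasure vol (D j) \<and> emeasure vol (D j) <= ennreal (C2*r j^?N) \<and>
   (\<forall>z\<in>D j. c1 <= norm (toeplitz u (indicator (D j)) z)) \<and> (\<forall>z\<in>unit_ball. norm (toeplitz u (indicator (D j)) z) <= C2)"
  by (rule choice[THEN exE])
 have Ds: "D j \<in> sets vol" and D1: "ennreal (\<kappa>*r j^?N) <= emeasure vol (D j)" and D2: "emeasure vol (D j) <= ennreal (C2*r j^?N)"
  and T1: "\<And>z. z \<in> D j ==> c1 <= norm (toeplitz u (indicator (D j)) z)"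
  and T2: "\<And>z. z \<in> unit_ball ==> norm (toeplitz u (indicator (D j)) z) <= C2" for j
  using spec[OF D, of j] by blast+
 define f where "f j w = complex_of_real (r j powr (- \<gamma>))*indicator (D j) w" for j w
 have fm: "f j \<in> meas" for j unfolding f_def[abs_def] using Ds[of j] by measurable
 have rN: "(r j powr (- \<gamma>)) powr p*r j^?N = 1" for j
 proof -
  have "(r j powr (- \<gamma>)) powr p*r j^?N = r j powr (- real ?N)*r j powr real ?N"
   using p r(1)[of j] by (simp only: powr_powr powr_realpow) (simp add: \<gamma>_def)
  also have "... = 1" using r(1)[of j] by (simp only: powr_add[symmetric]) simp
  finally show ?thesis .
 qed
 have Lp: "Lp_norm p (\<lambda>_. 1) (f j) <= ennreal (C2 powr (1/p))" for j
 proof -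
  have "(\<integral>\<^sub>+z. ennreal (norm (f j z) powr p*1)) = (\<integral>\<^sub>+z. ennreal ((r j powr (- \<gamma>)) powr p)*indicator (D j) z)"
   by (rule nn_integral_cong) (use p in \<open>auto simp: f_def indicator_def norm_mult\<close>)
  also have "... = ennreal ((r j powr (- \<gamma>)) powr p)*emeasure vol (D j)"
   using Ds by (rule nn_integral_cmult_indicator)
  also have "... <= ennreal ((r j powr (- \<gamma>)) powr p)*ennreal (C2*r j^?N)"
   using D2 by (rule mult_left_mono) simp
  also have "... = ennreal (C2*((r j powr (- \<gamma>)) powr p*r j^?N))"
   using c(2) less_imp_le[OF r(1)[of j]] by (simp only: ennreal_mult[symmetric] powr_ge_zero zero_le_power mult_nonneg_nonneg less_imp_le mult_ac)
  also have "... = ennreal C2" unfolding rN by simp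
  finally show ?thesis
   unfolding Lp_norm_def using c(2) p epowr_mono[of "1/p" _ "ennreal C2"] by simp
 qed
 have "bounded_in (Lp_norm p (\<lambda>_. 1)) (range f)"
  unfolding bounded_in_def fspace_def
 proof (intro conjI subsetI exI[of _ "C2 powr (1/p)"] ballI)
  fix g assume "g \<in> range f"
  then obtain j where "g = f j" by blast
  thus "g \<in> {f \<in> meas. Lp_norm p (\<lambda>_. 1) f < \<top>}" "Lp_norm p (\<lambda>_. 1) g <= ennreal (C2 powr (1/p))"
   using Lp[of j] fm[of j] by (auto intro: le_less_trans)
 qed
 hence pre: "precompact_in N (toeplitz u ` range f)"
  using compact unfolding acts_compactly_def by blast
 have T: "toeplitz u (f j) z = complex_of_real (r j powr (- \<gamma>))*toeplitz u (indicator (D j)) z" for j z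
 proof -
  have "toeplitz u (f j) z = (\<integral>w. complex_of_real (r j powr (- \<gamma>))*(u w*indicator (D j) w/(1 - herm z w)^?N) \<partial>vol)"
   unfolding toeplitz_def f_def by (rule Bochner_Integration.integral_cong) (auto simp: mult_ac)
  also have "... = complex_of_real (r j powr (- \<gamma>))*(\<integral>w. u w*indicator (D j) w/(1 - herm z w)^?N \<partial>vol)"
   by (rule integral_mult_right_zero)
  finally show ?thesis
   unfolding toeplitz_def .
 qed
 show False
 proof (rule precompact_not_separated[OF pre])
  show "toeplitz u (f j) \<in> toeplitz u ` range f" for j by blast
  show "0 < c1/4*\<kappa> powr (1/p)" using c by simp
  fix i j :: nat assume ij: "i < j"
  let ?F = "\<lambda>z. toeplitz u (f j) z - toeplitz u (f i) z"
  define \<rho> where "\<rho> = r j powr (- \<gamma>)"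
  have \<rho>: "0 < \<rho>" using r(1)[of j] by (simp add: \<rho>_def)
  have ratio: "r i powr (- \<gamma>) <= \<rho>*(c1/(2*C2))"
  proof -
   have "q^j <= q^Suc i" using q ij by (intro power_decreasing) auto
   hence "r j <= q*r i" using c(4) by (simp add: r_def)
   hence "r j powr \<gamma> <= (q*r i) powr \<gamma>"
    using r \<gamma> less_imp_le by (intro powr_mono2) auto
   also have "... = q powr \<gamma>*r i powr \<gamma>" by (rule powr_mult)
   also have "... <= c1/(2*C2)*r i powr \<gamma>" using q(3) by (rule mult_right_mono) simp
   finally have le: "r j powr \<gamma> <= c1/(2*C2)*r i powr \<gamma>" .
   have inv: "inverse b <= inverse a * k" if "0 < a" "0 < b" "a <= k*b" for a b k :: real
    using that by (simp add: field_simps)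
   have "inverse (r i powr \<gamma>) <= inverse (r j powr \<gamma>)*(c1/(2*C2))"
    by (rule inv[OF _ _ le]) (use r(1)[of i] r(1)[of j] in simp_all)
   thus ?thesis by (simp only: \<rho>_def powr_minus)
  qed
  have "\<rho>*(c1/2) <= norm (?F z)" if z: "z \<in> D j" for z
  proof -
   have zb: "z \<in> unit_ball" using z sets.sets_into_space[OF Ds[of j]] by auto
   have "\<rho>*c1 <= norm (toeplitz u (f j) z)"
    using T1[OF z] \<rho> by (simp add: T norm_mult \<rho>_def[symmetric])
   moreover have "norm (toeplitz u (f i) z) <= (\<rho>*(c1/(2*C2)))*C2"
    unfolding T norm_mult using ratio T2[OF zb, of i] c \<rho> by (intro mult_mono) auto
   moreover have "(\<rho>*(c1/(2*C2)))*C2 = \<rho>*(c1/2)" using c(2) by simp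
   ultimately show ?thesis
    using norm_triangle_ineq2[of "toeplitz u (f j) z" "toeplitz u (f i) z"] by (simp add: field_simps)
  qed
  hence *: "ennreal (\<rho>*(c1/2)/2)*epowr (emeasure vol (D j)) (1/p) <= N ?F"
   using c(1) \<rho> measurable_toeplitz[OF u fm] by (intro lower Ds borel_measurable_diff ballI mult_pos_pos) auto
  have eq: "\<rho>*(\<kappa>*r j^?N) powr (1/p) = \<kappa> powr (1/p)"
  proof -
   have "\<rho>*(\<kappa>*r j^?N) powr (1/p) = \<rho>*(\<kappa> powr (1/p)*(r j powr real ?N) powr (1/p))"
    using r(1)[of j] by (simp only: powr_mult powr_realpow)
   also have "... = \<kappa> powr (1/p)*(r j powr (- \<gamma>)*r j powr \<gamma>)"
    by (simp add: \<rho>_def powr_powr \<gamma>_def)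
   also have "... = \<kappa> powr (1/p)"
    using r(1)[of j] by (simp only: powr_add[symmetric]) simp
   finally show ?thesis .
  qed
  have "\<rho>*(c1/2)/2*Y = c1/4*(\<rho>*Y)" for Y by simp
  hence "ennreal (c1/4*\<kappa> powr (1/p)) = ennreal ((\<rho>*(c1/2)/2)*(\<kappa>*r j^?N) powr (1/p))"
   by (simp only: eq)
  also have "... = ennreal (\<rho>*(c1/2)/2)*epowr (ennreal (\<kappa>*r j^?N)) (1/p)"
   using \<rho> c r(1)[of j] by (subst ennreal_mult) auto
  also have "... <= ennreal (\<rho>*(c1/2)/2)*epowr (emeasure vol (D j)) (1/p)"
   using D1 p by (intro mult_left_mono epowr_mono) auto
  finally show "ennreal (c1/4*\<kappa> powr (1/p)) <= N ?F" using * by (rule order_trans)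
 qed
qed

lemma Lp_norm_lower:
 assumes p: "1 <= p" and D: "D \<in> sets vol" and \<alpha>: "0 < \<alpha>" "\<forall>z\<in>D. \<alpha> <= norm (F z)"
 shows "ennreal (\<alpha>/2)*epowr (emeasure vol D) (1/p) <= Lp_norm p (\<lambda>_. 1) F"
proof -
 have "ennreal (\<alpha>/2)*epowr (emeasure vol D) (1/p) = epowr (ennreal ((\<alpha>/2) powr p)*emeasure vol D) (1/p)"
  using p \<alpha> by (simp add: epowr_mult powr_powr)
 also have "... <= epowr (\<integral>\<^sub>+z. ennreal (norm (F z) powr p*1)) (1/p)"
 proof (rule epowr_mono)
  have "ennreal ((\<alpha>/2) powr p)*emeasure vol D = (\<integral>\<^sub>+z. ennreal ((\<alpha>/2) powr p)*indicator D z)"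
   using D by (rule nn_integral_cmult_indicator[symmetric])
  also have "... <= (\<integral>\<^sub>+z. ennreal (norm (F z) powr p*1))"
  proof (rule nn_integral_mono)
   fix z :: "complex^'a"
   show "ennreal ((\<alpha>/2) powr p)*indicator D z <= ennreal (norm (F z) powr p*1)"
   proof (cases "z \<in> D")
    case True
    hence "\<alpha> <= norm (F z)" using \<alpha>(2) by blast
    hence "(\<alpha>/2) powr p <= norm (F z) powr p"
     using \<alpha>(1) p by (intro powr_mono2) auto
    thus ?thesis using True by (simp add: ennreal_leI)
   qed simp
  qed
  finally show "ennreal ((\<alpha>/2) powr p)*emeasure vol D <= (\<integral>\<^sub>+z. ennreal (norm (F z) powr p*1))" .
 qed (use p in simp)
 finally show ?thesis by (simp add: Lp_norm_def)
qed

lemma weak_L1_norm_lower: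
 assumes [measurable]: "F \<in> meas" and D: "D \<in> sets vol" and \<alpha>: "0 < \<alpha>" "\<forall>z\<in>D. \<alpha> <= norm (F z)"
 shows "ennreal (\<alpha>/2)*epowr (emeasure vol D) (1/1) <= weak_L1_norm (\<lambda>_. 1) F"
proof -
 let ?A = "{z \<in> unit_ball. \<alpha>/2 < norm (F z)}"
 have A: "?A \<in> sets vol"
 proof -
  have "{z \<in> space vol. \<alpha>/2 < norm (F z)} \<in> sets vol" by measurable
  thus ?thesis by simp
 qed
 have "D \<subseteq> ?A"
 proof
  fix z assume z: "z \<in> D"
  hence "\<alpha> <= norm (F z)" using \<alpha>(2) by blast
  thus "z \<in> ?A" using z \<alpha>(1) sets.sets_into_space[OF D] by auto
 qed
 hence "emeasure vol D <= emeasure vol ?A" using A by (rule emeasure_mono)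
 also have "... = wmeasure (\<lambda>_. 1) ?A" unfolding wmeasure_def using A by simp
 finally have "ennreal (\<alpha>/2)*emeasure vol D <= ennreal (\<alpha>/2)*wmeasure (\<lambda>_. 1) ?A"
  by (rule mult_left_mono) simp
 also have "... <= weak_L1_norm (\<lambda>_. 1) F"
  unfolding weak_L1_norm_def using \<alpha>(1) by (intro SUP_upper) simp
 finally show ?thesis by simp
qed

section \<open>Positive definiteness of the Bergman kernel\<close>

lemma integral_vol_bounded:
 fixes f :: "complex^'n::finite => complex"
 assumes "f \<in> meas" and le: "\<And>w. w \<in> unit_ball ==> norm (f w) <= k"
 shows "integrable vol f" "norm (\<integral>w. f w \<partial>vol) <= k"
proof -
 have AE: "AE w in vol. norm (f w) <= k" using le by (intro AE_I2) simp
 show 1: "integrable vol f" using AE assms(1) by (rule vol.integrable_const_bound)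
 have "norm (\<integral>w. f w \<partial>vol) <= (\<integral>w. k \<partial>(vol :: (complex^'n) measure))"
  by (rule Bochner_Integration.integral_norm_bound_integral[OF 1]) (use le in auto)
 also have "... = measure (vol :: (complex^'n) measure) (space vol) *\<^sub>R k"
  by (rule lebesgue_integral_const)
 also have "... = k" by (simp only: vol.prob_space scaleR_one)
 finally show "norm (\<integral>w. f w \<partial>vol) <= k" .
qed

text \<open>
 Positive definiteness of a kernel \<open>h \<langle>z, w\<rangle>\<close> is tested on the sum of a bounded density \<open>F\<close> and a point mass
 \<open>s\<close> at \<open>a\<close>; \<open>form F s h\<close> is the resulting quadratic form. The support is kept in a ball of radius
 \<open>\<rho> < 1\<close>, so that only values of \<open>h\<close> on a compact disc matter.
\<close>

locale kernel_form =
 fixes \<rho> :: real and a :: "complex^'n::finite"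
 assumes rho: "0 <= \<rho>" "\<rho> < 1" and a: "norm a <= \<rho>"
begin

definition adm :: "(complex^'n => complex) => bool" where
 "adm F \<longleftrightarrow> F \<in> meas \<and> (\<forall>w. \<rho> < norm w --> F w = 0) \<and> (\<exists>B. \<forall>w\<in>unit_ball. norm (F w) <= B)"

definition good :: "(complex => complex) => bool" where
 "good h \<longleftrightarrow> h \<in> borel_measurable borel \<and> (\<exists>H. \<forall>\<xi>\<in>cball 0 \<rho>. norm (h \<xi>) <= H)"

definition inner_int :: "(complex^'n => complex) => (complex => complex) => complex^'n => complex" where
 "inner_int F h z = (\<integral>w. F w*h (herm z w) \<partial>vol)"

definition form :: "(complex^'n => complex) => complex => (complex => complex) => real" where
 "form F s h = Re (\<integral>z. cnj (F z)*inner_int F h z \<partial>vol) + 2 * Re (cnj s*inner_int F h a)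
  + (norm s)\<^sup>2 * Re (h (herm a a))"

definition pos :: "(complex => complex) => bool" where
 "pos h \<longleftrightarrow> good h \<and> (\<forall>F s. adm F --> 0 <= form F s h)"

lemma a_ball: "a \<in> unit_ball"
 using rho a by simp

lemma adm_measurable: "adm F ==> F \<in> meas"
 by (simp add: adm_def)

lemma good_measurable: "good h ==> h \<in> borel_measurable borel"
 by (simp add: good_def)

lemma measurable_integrand:
 assumes "adm F" "good h"
 shows "(\<lambda>w. F w*h (herm z w)) \<in> meas"
proof -
 note [measurable] = adm_measurable[OF assms(1)] measurable_compose[OF _ good_measurable[OF assms(2)]]
 show ?thesis by measurable
qed

lemma measurable_inner_int:
 assumes "adm F" "good h"
 shows "inner_int F h \<in> meas"
proof -
 note [measurable] = measurable_compose[OF measurable_snd adm_measurable[OF assms(1)]]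
  measurable_compose[OF _ good_measurable[OF assms(2)]]
 have "(\<lambda>(z, w). F w*h (herm z w)) \<in> borel_measurable (vol \<Otimes>\<^sub>M vol)"
  unfolding case_prod_beta by measurable
 thus ?thesis unfolding inner_int_def[abs_def] by (rule vol.borel_measurable_lebesgue_integral)
qed

lemma integrand_le:
 assumes F: "adm F" and B: "\<forall>w\<in>unit_ball. norm (F w) <= B" and H: "\<forall>\<xi>\<in>cball 0 \<rho>. norm (h \<xi>) <= H"
  and z: "z \<in> unit_ball" and w: "w \<in> unit_ball"
 shows "norm (F w*h (herm z w)) <= B*H"
proof -
 have H0: "0 <= H" using order_trans[OF norm_ge_zero bspec[OF H, of 0]] rho(1) by simp
 have B0: "0 <= B" using bspec[OF B w] norm_ge_zero[of "F w"] by linarith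
 show ?thesis
 proof (cases "\<rho> < norm w")
  case True
  hence "F w = 0" using F by (simp add: adm_def)
  thus ?thesis using B0 H0 by simp
 next
  case False
  have "cmod (herm z w) <= norm z*norm w" by (rule norm_herm_le)
  also have "... <= 1*\<rho>" using z False by (intro mult_mono) auto
  finally have "norm (h (herm z w)) <= H" using H by simp
  thus ?thesis unfolding norm_mult using bspec[OF B w] B0 by (intro mult_mono) auto
 qed
qed

lemma inner_int_bound:
 assumes "adm F" "good h" "\<forall>w\<in>unit_ball. norm (F w) <= B" "\<forall>\<xi>\<in>cball 0 \<rho>. norm (h \<xi>) <= H" "z \<in> unit_ball"
 shows "integrable vol (\<lambda>w. F w*h (herm z w))" "norm (inner_int F h z) <= B*H"
 unfolding inner_int_def
 by (rule integral_vol_bounded[OF measurable_integrand[OF assms(1,2)]], rule integrand_le[OF assms(1,3,4,5)], assumption)+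

lemma integrable_inner:
 assumes "adm F" "good h" "z \<in> unit_ball"
 shows "integrable vol (\<lambda>w. F w*h (herm z w))"
proof -
 obtain B where B: "\<forall>w\<in>unit_ball. norm (F w) <= B"
  using assms(1) unfolding adm_def by (elim exE conjE)
 obtain H where H: "\<forall>\<xi>\<in>cball 0 \<rho>. norm (h \<xi>) <= H"
  using assms(2) unfolding good_def by (elim exE conjE)
 show ?thesis by (rule inner_int_bound(1)[OF assms(1,2) B H assms(3)])
qed

lemma outer_bound:
 assumes F: "adm F" and h: "good h" and G: "adm G" and B: "\<forall>w\<in>unit_ball. norm (F w) <= B" "\<forall>w\<in>unit_ball. norm (G w) <= B"
  and H: "\<forall>\<xi>\<in>cball 0 \<rho>. norm (h \<xi>) <= H"
 shows "integrable vol (\<lambda>z. cnj (G z)*inner_int F h z)" "norm (\<integral>z. cnj (G z)*inner_int F h z \<partial>vol) <= B*(B*H)"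
proof -
 have "(\<lambda>z. cnj (G z)) \<in> meas"
  using adm_measurable[OF G] by (rule measurable_compose) (intro borel_measurable_continuous_onI continuous_intros)
 hence m: "(\<lambda>z. cnj (G z)*inner_int F h z) \<in> meas"
  using measurable_inner_int[OF F h] by (rule borel_measurable_times)
 have le: "norm (cnj (G z)*inner_int F h z) <= B*(B*H)" if z: "z \<in> unit_ball" for z
 proof -
  have "norm (cnj (G z)*inner_int F h z) = norm (G z)*norm (inner_int F h z)"
   by (simp add: norm_mult)
  also have "... <= B*(B*H)"
  proof (rule mult_mono)
   show "norm (G z) <= B" "norm (inner_int F h z) <= B*H"
    using B(2) z inner_int_bound(2)[OF F h B(1) H z] by auto
   show "0 <= B" using bspec[OF B(2) z] norm_ge_zero[of "G z"] by linarith
  qed simp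
  finally show ?thesis .
 qed
 show "integrable vol (\<lambda>z. cnj (G z)*inner_int F h z)" "norm (\<integral>z. cnj (G z)*inner_int F h z \<partial>vol) <= B*(B*H)"
  using integral_vol_bounded[OF m le] by auto
qed

lemma integrable_outer:
 assumes F: "adm F" and h: "good h"
 shows "integrable vol (\<lambda>z. cnj (F z)*inner_int F h z)"
proof -
 obtain B where B: "\<forall>w\<in>unit_ball. norm (F w) <= B"
  using F unfolding adm_def by (elim exE conjE)
 obtain H where H: "\<forall>\<xi>\<in>cball 0 \<rho>. norm (h \<xi>) <= H"
  using h unfolding good_def by (elim exE conjE)
 show ?thesis by (rule outer_bound(1)[OF F h F B B H])
qed

lemma form_ge:
 assumes F: "adm F" and h: "good h" and B: "\<forall>w\<in>unit_ball. norm (F w) <= B" and H: "\<forall>\<xi>\<in>cball 0 \<rho>. norm (h \<xi>) <= H"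
 shows "- ((B + norm s)\<^sup>2*H) <= form F s h"
proof -
 have "norm (\<integral>z. cnj (F z)*inner_int F h z \<partial>vol) <= B*(B*H)"
  by (rule outer_bound(2)[OF F h F B B H])
 hence 1: "- (B*(B*H)) <= Re (\<integral>z. cnj (F z)*inner_int F h z \<partial>vol)"
  using abs_Re_le_cmod[of "\<integral>z. cnj (F z)*inner_int F h z \<partial>vol"] by linarith
 have "norm (cnj s*inner_int F h a) <= norm s*(B*H)"
  using inner_int_bound(2)[OF F h B H a_ball] by (simp add: norm_mult mult_left_mono)
 hence 2: "- (norm s*(B*H)) <= Re (cnj s*inner_int F h a)"
  using abs_Re_le_cmod[of "cnj s*inner_int F h a"] by linarith
 have "norm a*norm a <= 1*\<rho>" using a rho by (intro mult_mono) auto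
 hence "herm a a \<in> cball 0 \<rho>" using norm_herm_le[of a a] by simp
 hence "- H <= Re (h (herm a a))"
  using H abs_Re_le_cmod[of "h (herm a a)"] by (meson abs_le_D2 minus_le_iff order_trans)
 hence 3: "(norm s)\<^sup>2*(- H) <= (norm s)\<^sup>2 * Re (h (herm a a))"
  by (rule mult_left_mono) simp
 have "(B + norm s)\<^sup>2*H = B*(B*H) + 2*(norm s*(B*H)) + (norm s)\<^sup>2*H"
  by (simp add: power2_eq_square algebra_simps)
 thus ?thesis unfolding form_def using 1 2 3 by simp
qed

lemma form_add:
 assumes F: "adm F" and h: "good h" and g: "good g"
 shows "form F s (\<lambda>\<xi>. h \<xi> + g \<xi>) = form F s h + form F s g"
proof -
 have inner: "inner_int F (\<lambda>\<xi>. h \<xi> + g \<xi>) z = inner_int F h z + inner_int F g z" if "z \<in> unit_ball" for z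
  unfolding inner_int_def distrib_left
  by (rule Bochner_Integration.integral_add[OF integrable_inner[OF F h that] integrable_inner[OF F g that]])
 have "(\<integral>z. cnj (F z)*inner_int F (\<lambda>\<xi>. h \<xi> + g \<xi>) z \<partial>vol)
   = (\<integral>z. cnj (F z)*inner_int F h z + cnj (F z)*inner_int F g z \<partial>vol)"
  by (rule Bochner_Integration.integral_cong) (simp_all add: inner distrib_left)
 also have "... = (\<integral>z. cnj (F z)*inner_int F h z \<partial>vol) + (\<integral>z. cnj (F z)*inner_int F g z \<partial>vol)"
  by (rule Bochner_Integration.integral_add[OF integrable_outer[OF F h] integrable_outer[OF F g]])
 finally show ?thesis unfolding form_def inner[OF a_ball] by (simp add: algebra_simps)
qed

lemma good_add:
 assumes h: "good h" and g: "good g"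
 shows "good (\<lambda>\<xi>. h \<xi> + g \<xi>)"
proof -
 note [measurable] = good_measurable[OF h] good_measurable[OF g]
 obtain H where H: "\<forall>\<xi>\<in>cball 0 \<rho>. norm (h \<xi>) <= H"
  using h unfolding good_def by (elim exE conjE)
 obtain G where G: "\<forall>\<xi>\<in>cball 0 \<rho>. norm (g \<xi>) <= G"
  using g unfolding good_def by (elim exE conjE)
 have le: "norm (h \<xi> + g \<xi>) <= H + G" if "\<xi> \<in> cball 0 \<rho>" for \<xi>
  using bspec[OF H that] bspec[OF G that] norm_triangle_ineq[of "h \<xi>" "g \<xi>"] by linarith
 have m: "(\<lambda>\<xi>. h \<xi> + g \<xi>) \<in> borel_measurable borel" by measurable
 show ?thesis unfolding good_def by (rule conjI[OF m], rule exI[of _ "H + G"], rule ballI, rule le)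
qed

lemma good_mult:
 assumes h: "good h" and g: "good g"
 shows "good (\<lambda>\<xi>. h \<xi>*g \<xi>)"
proof -
 note [measurable] = good_measurable[OF h] good_measurable[OF g]
 obtain H where H: "\<forall>\<xi>\<in>cball 0 \<rho>. norm (h \<xi>) <= H"
  using h unfolding good_def by (elim exE conjE)
 obtain G where G: "\<forall>\<xi>\<in>cball 0 \<rho>. norm (g \<xi>) <= G"
  using g unfolding good_def by (elim exE conjE)
 have le: "norm (h \<xi>*g \<xi>) <= H*G" if "\<xi> \<in> cball 0 \<rho>" for \<xi>
  unfolding norm_mult using bspec[OF H that] bspec[OF G that] by (intro mult_mono) (auto intro: order_trans[OF norm_ge_zero bspec[OF H that]])
 have m: "(\<lambda>\<xi>. h \<xi>*g \<xi>) \<in> borel_measurable borel" by measurable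
 show ?thesis unfolding good_def by (rule conjI[OF m], rule exI[of _ "H*G"], rule ballI, rule le)
qed

lemma good_const: "good (\<lambda>_. c)"
 unfolding good_def by auto

lemma good_ident: "good (\<lambda>\<xi>. \<xi>)"
 unfolding good_def by auto

lemma good_geom: "good (\<lambda>\<xi>. 1/(1 - \<xi>))"
proof -
 have le: "norm (1/(1 - \<xi>)) <= 1/(1 - \<rho>)" if "\<xi> \<in> cball 0 \<rho>" for \<xi> :: complex
 proof -
  have "1 - \<rho> <= norm (1 - \<xi>)" using norm_triangle_ineq2[of 1 \<xi>] that by simp
  thus ?thesis using rho by (simp add: norm_divide frac_le)
 qed
 have m: "(\<lambda>\<xi>::complex. 1/(1 - \<xi>)) \<in> borel_measurable borel" by measurable
 show ?thesis
  unfolding good_def by (rule conjI[OF m], rule exI[of _ "1/(1 - \<rho>)"], rule ballI, rule le)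
qed

lemma adm_coordinate:
 assumes F: "adm F"
 shows "adm (\<lambda>w. cnj (w $ j)*F w)"
proof -
 note [measurable] = adm_measurable[OF F]
 have c: "(\<lambda>w :: complex^'n. cnj (w $ j)) \<in> borel_measurable borel"
  by (intro borel_measurable_continuous_onI continuous_intros)
 note [measurable] = measurable_compose[OF measurable_ident_vol_borel c]
 obtain B where B: "\<forall>w\<in>unit_ball. norm (F w) <= B"
  using F unfolding adm_def by (elim exE conjE)
 have le: "norm (cnj (w $ j)*F w) <= B" if w: "w \<in> unit_ball" for w
 proof -
  have "norm (cnj (w $ j)*F w) = norm (w $ j)*norm (F w)" by (simp add: norm_mult)
  also have "... <= 1*norm (F w)"
   using Finite_Cartesian_Product.norm_nth_le[of w j] w by (intro mult_right_mono) auto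
  finally show ?thesis using bspec[OF B w] by simp
 qed
 have m: "(\<lambda>w. cnj (w $ j)*F w) \<in> meas" by measurable
 have "\<forall>w. \<rho> < norm w --> cnj (w $ j)*F w = 0"
  using F by (simp add: adm_def)
 thus ?thesis unfolding adm_def using m by (intro conjI exI[of _ B] ballI le)
qed

text \<open>
 The kernel \<open>\<langle>z, w\<rangle>\<close> is a sum of products \<open>z\<^sub>j cnj w\<^sub>j\<close>, so that multiplication by it amounts to summing the form
 over the test measures multiplied by the coordinates.
\<close>

lemma form_mult_ident:
 assumes F: "adm F" and h: "good h"
 shows "form F s (\<lambda>\<xi>. \<xi>*h \<xi>) = (\<Sum>j\<in>UNIV. form (\<lambda>w. cnj (w $ j)*F w) (cnj (a $ j) * s) h)"
proof -
 note Fj = adm_coordinate[OF F]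
 have inner: "inner_int F (\<lambda>\<xi>. \<xi>*h \<xi>) z = (\<Sum>j\<in>UNIV. z $ j*inner_int (\<lambda>w. cnj (w $ j)*F w) h z)"
  if z: "z \<in> unit_ball" for z
 proof -
  have "inner_int F (\<lambda>\<xi>. \<xi>*h \<xi>) z = (\<integral>w. (\<Sum>j\<in>UNIV. z $ j*(cnj (w $ j)*F w*h (herm z w))) \<partial>vol)"
   unfolding inner_int_def
  proof (rule Bochner_Integration.integral_cong[OF refl])
   fix w
   have "F w*(herm z w*h (herm z w)) = herm z w*(F w*h (herm z w))" by simp
   also have "... = (\<Sum>j\<in>UNIV. z $ j*cnj (w $ j))*(F w*h (herm z w))"
    by (simp only: herm_def[of z w])
   also have "... = (\<Sum>j\<in>UNIV. z $ j*(cnj (w $ j)*F w*h (herm z w)))"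
    unfolding sum_distrib_right by (simp only: mult.assoc)
   finally show "F w*(herm z w*h (herm z w)) = (\<Sum>j\<in>UNIV. z $ j*(cnj (w $ j)*F w*h (herm z w)))" .
  qed
  also have "... = (\<Sum>j\<in>UNIV. \<integral>w. z $ j*(cnj (w $ j)*F w*h (herm z w)) \<partial>vol)"
   by (rule Bochner_Integration.integral_sum) (intro integrable_mult_right integrable_inner[OF Fj h z])
  finally show ?thesis by (simp add: inner_int_def)
 qed
 have "(\<integral>z. cnj (F z)*inner_int F (\<lambda>\<xi>. \<xi>*h \<xi>) z \<partial>vol)
   = (\<integral>z. (\<Sum>j\<in>UNIV. cnj (cnj (z $ j)*F z)*inner_int (\<lambda>w. cnj (w $ j)*F w) h z) \<partial>vol)"
  by (rule Bochner_Integration.integral_cong[OF refl]) (simp add: inner sum_distrib_left mult_ac)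
 also have "... = (\<Sum>j\<in>UNIV. \<integral>z. cnj (cnj (z $ j)*F z)*inner_int (\<lambda>w. cnj (w $ j)*F w) h z \<partial>vol)"
  by (rule Bochner_Integration.integral_sum) (rule integrable_outer[OF Fj h])
 finally have 1: "Re (\<integral>z. cnj (F z)*inner_int F (\<lambda>\<xi>. \<xi>*h \<xi>) z \<partial>vol)
   = (\<Sum>j\<in>UNIV. Re (\<integral>z. cnj (cnj (z $ j)*F z)*inner_int (\<lambda>w. cnj (w $ j)*F w) h z \<partial>vol))"
  by (simp only: Re_sum)
 have 2: "2 * Re (cnj s*inner_int F (\<lambda>\<xi>. \<xi>*h \<xi>) a)
   = (\<Sum>j\<in>UNIV. 2 * Re (cnj (cnj (a $ j) * s)*inner_int (\<lambda>w. cnj (w $ j)*F w) h a))"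
  unfolding inner[OF a_ball] sum_distrib_left Re_sum by (simp only: complex_cnj_mult complex_cnj_cnj mult_ac)
 have "(norm s)\<^sup>2 * Re (herm a a*h (herm a a)) = (\<Sum>j\<in>UNIV. (norm (a $ j))\<^sup>2)*((norm s)\<^sup>2 * Re (h (herm a a)))"
 proof -
  have "herm a a = of_real (\<Sum>j\<in>UNIV. (norm (a $ j))\<^sup>2)"
   unfolding herm_def[of a a] of_real_sum by (simp only: complex_norm_square)
  hence "Re (herm a a*h (herm a a)) = (\<Sum>j\<in>UNIV. (norm (a $ j))\<^sup>2) * Re (h (herm a a))"
   by (metis Re_complex_of_real Im_complex_of_real mult_zero_left diff_zero times_complex.sel(1))
  thus ?thesis by simp
 qed
 also have "... = (\<Sum>j\<in>UNIV. (norm (cnj (a $ j) * s))\<^sup>2 * Re (h (herm a a)))"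
  unfolding sum_distrib_right by (simp add: norm_mult power_mult_distrib mult.assoc)
 finally show ?thesis unfolding form_def 1 2 by (simp only: sum.distrib)
qed

lemma pos_one: "pos (\<lambda>_. 1)"
 unfolding pos_def
proof (intro conjI allI impI good_const)
 fix F s assume F: "adm F"
 define I where "I = (\<integral>w. F w \<partial>vol)"
 have i: "inner_int F (\<lambda>_. 1) z = I" for z by (simp add: inner_int_def I_def)
 have "(\<integral>z. cnj (F z)*inner_int F (\<lambda>_. 1) z \<partial>vol) = (\<integral>z. cnj (F z) \<partial>vol)*I"
  unfolding i by (rule integral_mult_left_zero)
 also have "(\<integral>z. cnj (F z) \<partial>vol) = cnj I" unfolding I_def by simp
 finally have o: "(\<integral>z. cnj (F z)*inner_int F (\<lambda>_. 1) z \<partial>vol) = cnj I*I" .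
 have "form F s (\<lambda>_. 1) = Re (cnj I*I) + 2 * Re (cnj s*I) + (norm s)\<^sup>2"
  unfolding form_def o by (simp add: i)
 also have "... = (norm (I + s))\<^sup>2"
  by (simp only: cmod_power2) (simp add: power2_eq_square algebra_simps)
 finally show "0 <= form F s (\<lambda>_. 1)" by simp
qed

lemma pos_add: "pos h ==> pos g ==> pos (\<lambda>\<xi>. h \<xi> + g \<xi>)"
 unfolding pos_def by (auto simp: good_add form_add)

lemma pos_mult_ident: "pos h ==> pos (\<lambda>\<xi>. \<xi>*h \<xi>)"
 unfolding pos_def
proof (intro conjI allI impI)
 assume h: "good h \<and> (\<forall>F s. adm F --> 0 <= form F s h)"
 thus "good (\<lambda>\<xi>. \<xi>*h \<xi>)" by (intro good_mult good_ident) simp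
 fix F s assume F: "adm F"
 show "0 <= form F s (\<lambda>\<xi>. \<xi>*h \<xi>)"
  unfolding form_mult_ident[OF F conjunct1[OF h]] using h adm_coordinate[OF F] by (intro sum_nonneg) simp
qed

lemma pos_partial_sum: "pos h ==> pos (\<lambda>\<xi>. (\<Sum>k\<le>n. \<xi> ^ k)*h \<xi>)"
proof (induction n)
 case (Suc n)
 have "(\<Sum>k\<le>Suc n. \<xi> ^ k)*h \<xi> = h \<xi> + \<xi>*((\<Sum>k\<le>n. \<xi> ^ k)*h \<xi>)" for \<xi>
  unfolding sum.atMost_Suc_shift by (simp add: sum_distrib_left algebra_simps)
 thus ?case using pos_add[OF Suc.prems pos_mult_ident[OF Suc.IH[OF Suc.prems]]] by (simp only:)
qed simp

text \<open>
 Here \<open>h \<xi> / (1 - \<xi>)\<close> is the uniform limit, on the disc of radius \<open>\<rho>\<close>, of its geometric partial sums.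
\<close>

lemma pos_geom:
 assumes h: "pos h"
 shows "pos (\<lambda>\<xi>. 1/(1 - \<xi>)*h \<xi>)"
 unfolding pos_def
proof (intro conjI allI impI)
 have gh: "good h" using h by (simp add: pos_def)
 define g where "g \<xi> = 1/(1 - \<xi>)*h \<xi>" for \<xi>
 have gg: "good g" unfolding g_def[abs_def] by (rule good_mult[OF good_geom gh])
 thus "good (\<lambda>\<xi>. 1/(1 - \<xi>)*h \<xi>)" by (simp only: g_def[abs_def])
 fix F and s :: complex assume F: "adm F"
 obtain B where B: "\<forall>w\<in>unit_ball. norm (F w) <= B"
  using F unfolding adm_def by (elim exE conjE)
 obtain G where G: "\<forall>\<xi>\<in>cball 0 \<rho>. norm (g \<xi>) <= G"
  using gg unfolding good_def by (elim exE conjE)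
 define K where "K = (B + norm s)\<^sup>2*G"
 have low: "- (K*\<rho>^Suc n) <= form F s g" for n
 proof -
  define p where "p \<xi> = (\<Sum>k\<le>n. \<xi> ^ k)*h \<xi>" for \<xi>
  define q where "q \<xi> = \<xi>^Suc n*g \<xi>" for \<xi>
  have pp: "pos p" unfolding p_def[abs_def] by (rule pos_partial_sum[OF h])
  have gpow: "good (\<lambda>\<xi>. \<xi>^m)" for m
   by (induction m) (auto intro: good_const good_mult[OF good_ident])
  have gq: "good q" unfolding q_def[abs_def] by (rule good_mult[OF gpow gg])
  have g0: "0 <= G" using order_trans[OF norm_ge_zero bspec[OF G, of 0]] rho(1) by simp
  have qle: "\<forall>\<xi>\<in>cball 0 \<rho>. norm (q \<xi>) <= \<rho>^Suc n*G"
  proof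
   fix \<xi> :: complex assume x: "\<xi> \<in> cball 0 \<rho>"
   hence "norm \<xi>^Suc n <= \<rho>^Suc n" by (intro power_mono) auto
   thus "norm (q \<xi>) <= \<rho>^Suc n*G"
    unfolding q_def norm_mult norm_power using bspec[OF G x] rho(1) by (intro mult_mono) auto
  qed
  have eq: "cnj (F z)*inner_int F g z = cnj (F z)*inner_int F (\<lambda>\<xi>. p \<xi> + q \<xi>) z"
   "F w*g (herm z w) = F w*(p (herm z w) + q (herm z w))" if "z \<in> unit_ball" for z w
  proof -
   have pq: "g \<xi> = p \<xi> + q \<xi>" if "\<xi> \<noteq> 1" for \<xi>
   proof -
    have "(1 - \<xi>)*(\<Sum>k\<le>n. \<xi> ^ k) = 1 - \<xi>^Suc n"
     by (simp add: sum_gp_basic del: power_Suc)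
    hence "(\<Sum>k\<le>n. \<xi> ^ k) = (1 - \<xi>^Suc n)*(1/(1 - \<xi>))"
     using that by (simp add: field_simps del: power_Suc)
    hence "p \<xi> = (1 - \<xi>^Suc n)*g \<xi>" unfolding p_def g_def by (simp only: mult.assoc)
    thus ?thesis unfolding q_def by (simp add: algebra_simps del: power_Suc)
   qed
   have F0: "F w*g (herm z w) = F w*(p (herm z w) + q (herm z w))" for w
   proof (cases "\<rho> < norm w")
    case True
    thus ?thesis using F by (simp add: adm_def)
   next
    case False
    have "cmod (herm z w) <= norm z*norm w" by (rule norm_herm_le)
    also have "... <= 1*\<rho>" using that False by (intro mult_mono) auto
    finally have "herm z w \<noteq> 1" using rho(2) by auto
    hence "g (herm z w) = p (herm z w) + q (herm z w)" by (rule pq)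
    thus ?thesis by (simp only:)
   qed
   show "F w*g (herm z w) = F w*(p (herm z w) + q (herm z w))" by (rule F0)
   show "cnj (F z)*inner_int F g z = cnj (F z)*inner_int F (\<lambda>\<xi>. p \<xi> + q \<xi>) z"
    unfolding inner_int_def F0 ..
  qed
  have ha: "g (herm a a) = p (herm a a) + q (herm a a)"
  proof -
   have "norm a*norm a <= 1*\<rho>" using a rho by (intro mult_mono) auto
   hence "herm a a \<noteq> 1" using norm_herm_le[of a a] rho(2) by auto
   moreover have "(1 - \<xi>)*(\<Sum>k\<le>n. \<xi> ^ k) = 1 - \<xi>^Suc n" for \<xi> :: complex
    by (simp add: sum_gp_basic del: power_Suc)
   ultimately have "(\<Sum>k\<le>n. herm a a ^ k) = (1 - herm a a^Suc n)*(1/(1 - herm a a))"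
    by (simp add: field_simps del: power_Suc)
   hence "p (herm a a) = (1 - herm a a^Suc n)*g (herm a a)"
    unfolding p_def g_def by (simp only: mult.assoc)
   thus ?thesis unfolding q_def by (simp add: algebra_simps del: power_Suc)
  qed
  have "form F s g = form F s (\<lambda>\<xi>. p \<xi> + q \<xi>)"
  proof -
   have "(\<integral>z. cnj (F z)*inner_int F g z \<partial>vol) = (\<integral>z. cnj (F z)*inner_int F (\<lambda>\<xi>. p \<xi> + q \<xi>) z \<partial>vol)"
    by (rule Bochner_Integration.integral_cong[OF refl]) (rule eq(1), simp)
   moreover have "inner_int F g a = inner_int F (\<lambda>\<xi>. p \<xi> + q \<xi>) a"
    unfolding inner_int_def eq(2)[OF a_ball] ..
   ultimately show ?thesis unfolding form_def ha by (simp only:)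
  qed
  also have "... = form F s p + form F s q"
   using pp by (intro form_add F gq) (simp add: pos_def)
  finally have "form F s g = form F s p + form F s q" .
  moreover have "0 <= form F s p" using pp F by (simp add: pos_def)
  moreover have "- ((B + norm s)\<^sup>2*(\<rho>^Suc n*G)) <= form F s q"
   by (rule form_ge[OF F gq B qle])
  moreover have "(B + norm s)\<^sup>2*(\<rho>^Suc n*G) = K*\<rho>^Suc n"
   by (simp only: K_def mult_ac)
  ultimately show ?thesis by linarith
 qed
 have "(\<lambda>n. - (K*\<rho>^Suc n)) \<longlonglongrightarrow> - (K*0)"
  by (intro tendsto_minus tendsto_mult_left LIMSEQ_Suc[OF LIMSEQ_realpow_zero[OF rho]])
 hence "- (K*0) <= form F s g" by (rule LIMSEQ_le_const2) (intro exI[of _ 0] allI impI low)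
 thus "0 <= form F s (\<lambda>\<xi>. 1/(1 - \<xi>)*h \<xi>)"
  unfolding g_def[abs_def] by (simp only: mult_zero_right neg_0_equal_iff_equal minus_zero)
qed

lemma pos_bergman: "pos (\<lambda>\<xi>. 1/(1 - \<xi>)^m)"
proof (induction m)
 case 0
 thus ?case using pos_one by simp
next
 case (Suc m)
 have "1/(1 - \<xi>)^Suc m = 1/(1 - \<xi>)*(1/(1 - \<xi>)^m)" for \<xi> :: complex by simp
 thus ?case using pos_geom[OF Suc.IH] by (simp only:)
qed

end

section \<open>Estimates for the Berezin transform\<close>

lemma powr_two: "0 <= x ==> x powr 2 = x\<^sup>2" for x :: real
 by (cases "x = 0") (auto simp: powr_numeral)

lemma Pplus_L2:
 "\<exists>C>0. \<forall>f\<in>borel_measurable (vol :: (complex^'n::finite) measure). (\<forall>w. 0 <= f w) -->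
  (\<integral>\<^sub>+z. epowr (Pplus f z) 2) <= ennreal C*(\<integral>\<^sub>+z. ennreal ((f z)\<^sup>2))"
 using Bp_Pplus[of 2 "\<lambda>_ :: complex^'n. 1"] one_in_Bp[of 2, where ?'n = 'n] by (simp add: powr_two)

lemma kz_scale: "z \<in> unit_ball ==> 0 < 1 - (norm z)\<^sup>2 \<and> rad z <= 1 - (norm z)\<^sup>2 \<and> 1 - (norm z)\<^sup>2 <= 2*rad z"
proof -
 assume z: "z \<in> unit_ball"
 have e: "1 - (norm z)\<^sup>2 = rad z*(1 + norm z)"
  by (simp add: rad_def power2_eq_square algebra_simps)
 have r: "0 < rad z" using z by simp
 have "rad z*1 <= rad z*(1 + norm z)" "rad z*(1 + norm z) <= rad z*2"
  using r z by (intro mult_left_mono; simp)+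
 moreover have "0 < rad z*(1 + norm z)" using r by (intro mult_pos_pos add_pos_nonneg) auto
 ultimately show ?thesis unfolding e by (intro conjI) (linarith+)
qed

lemma norm_kz:
 fixes z :: "complex^'n::finite"
 shows "norm (kz z w) = (1 - (norm z)\<^sup>2) powr ((real CARD('n) + 1)/2)/hdist z w^(CARD('n) + 1)"
proof -
 have "cmod (1 - herm w z) = hdist z w" using hdist_commute[of z w] by (simp add: hdist_def)
 thus ?thesis unfolding kz_def norm_divide norm_power by simp
qed

lemma kz_scale_square:
 fixes z :: "complex^'n::finite"
 assumes "z \<in> unit_ball"
 shows "((1 - (norm z)\<^sup>2) powr ((real CARD('n) + 1)/2))\<^sup>2 = (1 - (norm z)\<^sup>2)^(CARD('n) + 1)"
proof -
 let ?s = "1 - (norm z)\<^sup>2"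
 have s: "0 < ?s" using kz_scale[OF assms] by simp
 have h: "(real CARD('n) + 1)/2 + (real CARD('n) + 1)/2 = real (CARD('n) + 1)" by simp
 have "(?s powr ((real CARD('n) + 1)/2))\<^sup>2 = ?s powr ((real CARD('n) + 1)/2 + (real CARD('n) + 1)/2)"
  unfolding powr_add power2_eq_square ..
 also have "... = ?s powr real (CARD('n) + 1)"
  unfolding h ..
 also have "... = ?s^(CARD('n) + 1)" using s by (rule powr_realpow)
 finally show ?thesis .
qed

lemma norm_kz_square:
 fixes z :: "complex^'n::finite"
 assumes "z \<in> unit_ball"
 shows "(norm (kz z w))\<^sup>2 = (1 - (norm z)\<^sup>2)^(CARD('n) + 1)/(hdist z w^(CARD('n) + 1))\<^sup>2"
 unfolding norm_kz power_divide kz_scale_square[OF assms] ..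

lemma measurable_kz [measurable]: "kz z \<in> meas"
 unfolding kz_def[abs_def] by measurable

lemma kz_bounded:
 assumes z: "z \<in> unit_ball"
 shows "\<exists>B\<ge>0. \<forall>w\<in>unit_ball. norm (kz z w) <= B"
proof (rule exI[of _ "(1 - (norm z)\<^sup>2) powr ((real CARD('a) + 1)/2)/rad z^(CARD('a) + 1)"], intro conjI ballI)
 show "0 <= (1 - (norm z)\<^sup>2) powr ((real CARD('a) + 1)/2)/rad z^(CARD('a) + 1)"
  using z by simp
 fix w :: "complex^'a" assume w: "w \<in> unit_ball"
 show "norm (kz z w) <= (1 - (norm z)\<^sup>2) powr ((real CARD('a) + 1)/2)/rad z^(CARD('a) + 1)"
  unfolding norm_kz using z rad_le_hdist(1)[OF z w] by (intro divide_left_mono power_mono mult_pos_pos zero_less_power) (auto intro: less_le_trans[OF rad_pos])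
qed

text \<open>
 The kernel with pole \<open>z\<close> is pointwise at most of the order of the image under the positive Bergman operator of the
 normalized indicator of \<open>nbhd 16 z\<close>, so the bound on \<open>L\<^sup>2\<close> applies.
\<close>

lemma kz_L2_upper:
 "\<exists>C>0. \<forall>z::complex^'n::finite\<in>unit_ball. (\<integral>\<^sub>+w. ennreal ((norm (kz z w))\<^sup>2)) <= ennreal C"
proof -
 let ?N = "CARD('n) + 1"
 obtain P where P: "0 < P" "\<forall>f\<in>borel_measurable (vol :: (complex^'n::finite) measure). (\<forall>w. 0 <= f w) -->
  (\<integral>\<^sub>+z. epowr (Pplus f z) 2) <= ennreal P*(\<integral>\<^sub>+z. ennreal ((f z)\<^sup>2))"
  using Pplus_L2[where ?'n = 'n] by (elim exE conjE) (rule that)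
 obtain \<kappa> where \<kappa>: "0 < \<kappa>" "\<And>(x :: complex^'n::finite). x \<in> unit_ball ==>
  ennreal (\<kappa>*rad x^?N) <= emeasure vol (core x)"
  using emeasure_core_ge[where ?'n = 'n] by blast
 obtain C where C: "0 < C" "\<And>(x :: complex^'n::finite). x \<in> unit_ball ==>
  emeasure vol (nbhd 16 x) <= ennreal (C*rad x^?N)"
  using emeasure_nbhd_le[where ?'n = 'n, of 16] by blast
 define L where "L = 2^?N*(34^?N/\<kappa>)\<^sup>2*P*C"
 show ?thesis
 proof (rule exI[of _ L], intro conjI ballI)
  show "0 < L" using \<kappa>(1) P(1) C(1) by (simp add: L_def)
  fix z :: "complex^'n" assume z: "z \<in> unit_ball"
  define r where "r = rad z"
  have r: "0 < r" using z by (simp add: r_def)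
  define D where "D = nbhd 16 z"
  have D [measurable]: "D \<in> sets vol" unfolding D_def by (rule sets_nbhd)
  have Dlow: "ennreal (\<kappa>*r^?N) <= emeasure vol D"
   using \<kappa>(2)[OF z] emeasure_mono[OF core_subset_nbhd[OF order_refl z] sets_nbhd] unfolding r_def D_def by (rule order_trans)
  define K where "K = 2^?N*(34^?N/\<kappa>)\<^sup>2/r^?N"
  have K: "0 < K" using r \<kappa>(1) by (simp add: K_def)
  have pointwise: "ennreal ((norm (kz z w))\<^sup>2) <= ennreal K*epowr (Pplus (indicator D) w) 2" if w: "w \<in> unit_ball" for w
  proof -
   define h where "h = hdist z w"
   have h: "r <= h" "0 < h" using rad_le_hdist(1)[OF z w] r by (auto simp: h_def r_def)
   define m where "m = \<kappa>*r^?N/(34*h)^?N"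
   have "ennreal m = ennreal (1/(34*h)^?N)*ennreal (\<kappa>*r^?N)"
    using \<kappa>(1) r h by (simp add: m_def ennreal_mult[symmetric])
   also have "... <= ennreal (1/(34*h)^?N)*emeasure vol D"
    using Dlow by (rule mult_left_mono) simp
   also have "... = (\<integral>\<^sub>+y. ennreal (1/(34*h)^?N)*indicator D y)"
    using D by (rule nn_integral_cmult_indicator[symmetric])
   also have "... <= Pplus (indicator D) w"
    unfolding Pplus_def
   proof (rule nn_integral_mono)
    fix y :: "complex^'n" assume "y \<in> space vol"
    hence y: "y \<in> unit_ball" by simp
    show "ennreal (1/(34*h)^?N)*indicator D y <= ennreal (indicator D y)*ennreal (1/hdist w y^?N)"
    proof (cases "y \<in> D")
     case True
     hence "hdist z y < 16*r" by (simp add: D_def nbhd_def r_def)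
     hence "hdist w y <= 34*h"
      using hdist_triangle_ball[OF w z y] h(1) hdist_commute[of w z] by (simp add: h_def)
     moreover have "0 < hdist w y" using rad_le_hdist(1)[OF w y] rad_pos[OF w] by linarith
     ultimately have "1/(34*h)^?N <= 1/hdist w y^?N"
      by (intro divide_left_mono power_mono mult_pos_pos zero_less_power) auto
     thus ?thesis using True by (simp add: ennreal_leI)
    qed simp
   qed
   finally have "epowr (ennreal m) 2 <= epowr (Pplus (indicator D) w) 2"
    by (rule epowr_mono[rotated]) simp
   moreover have m0: "0 <= m" using \<kappa>(1) r h by (simp add: m_def)
   ultimately have m2: "ennreal (m\<^sup>2) <= epowr (Pplus (indicator D) w) 2"
    by (simp add: powr_two)
   have "(norm (kz z w))\<^sup>2 <= (2*r)^?N/(h^?N)\<^sup>2"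
    unfolding norm_kz_square[OF z] h_def r_def using kz_scale[OF z] by (intro divide_right_mono power_mono) auto
   also have "... = K*m\<^sup>2"
    using r h \<kappa>(1) by (simp add: K_def m_def power_mult_distrib power_divide power2_eq_square field_simps del: power_Suc)
   finally have "ennreal ((norm (kz z w))\<^sup>2) <= ennreal (K*m\<^sup>2)"
    by (rule ennreal_leI)
   also have "... = ennreal K*ennreal (m\<^sup>2)" using K by (intro ennreal_mult) auto
   also have "... <= ennreal K*epowr (Pplus (indicator D) w) 2"
    using m2 by (rule mult_left_mono) simp
   finally show ?thesis .
  qed
  have ind: "(indicator D :: _ => real) \<in> meas" by measurable
  have "(\<integral>\<^sub>+w. ennreal ((norm (kz z w))\<^sup>2)) <= (\<integral>\<^sub>+w. ennreal K*epowr (Pplus (indicator D) w) 2)"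
   using pointwise by (intro nn_integral_mono) simp
  also have "... = ennreal K*(\<integral>\<^sub>+w. epowr (Pplus (indicator D) w) 2)"
   by (rule nn_integral_cmult) measurable
  also have "... <= ennreal K*(ennreal P*(\<integral>\<^sub>+w. ennreal ((indicator D w)\<^sup>2)))"
   using P(2)[rule_format, OF ind] by (intro mult_left_mono) auto
  also have "(\<integral>\<^sub>+w. ennreal ((indicator D w)\<^sup>2)) = emeasure vol D"
  proof -
   have "(\<integral>\<^sub>+w. ennreal ((indicator D w)\<^sup>2)) = (\<integral>\<^sub>+w. indicator D w)"
    by (rule nn_integral_cong) (simp add: indicator_def)
   thus ?thesis using D by simp
  qed
  also have "ennreal K*(ennreal P*emeasure vol D) <= ennreal K*(ennreal P*ennreal (C*r^?N))"
   using C(2)[OF z] unfolding D_def r_def by (intro mult_left_mono) auto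
  also have "... = ennreal (K*(P*(C*r^?N)))" using K P(1) C(1) r by (simp add: ennreal_mult)
  also have "K*(P*(C*r^?N)) = L" using r by (simp add: K_def L_def)
  finally show "(\<integral>\<^sub>+w. ennreal ((norm (kz z w))\<^sup>2)) <= ennreal L" .
 qed
qed

lemma kz_L2_lower:
 "\<exists>c>0. \<forall>z::complex^'n::finite\<in>unit_ball. ennreal c <= (\<integral>\<^sub>+w. ennreal ((norm (kz z w))\<^sup>2))"
proof -
 let ?N = "CARD('n) + 1"
 obtain \<kappa> where \<kappa>: "0 < \<kappa>" "\<And>(x :: complex^'n::finite). x \<in> unit_ball ==>
  ennreal (\<kappa>*rad x^?N) <= emeasure vol (core x)"
  using emeasure_core_ge[where ?'n = 'n] by blast
 show ?thesis
 proof (rule exI[of _ "\<kappa>/(16^?N)\<^sup>2"], intro conjI ballI)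
  show "0 < \<kappa>/(16^?N)\<^sup>2" using \<kappa>(1) by simp
  fix z :: "complex^'n" assume z: "z \<in> unit_ball"
  define r where "r = rad z"
  have r: "0 < r" using z by (simp add: r_def)
  define m where "m = r^?N/((16*r)^?N)\<^sup>2"
  have m: "0 < m" using r by (simp add: m_def)
  have "\<kappa>/(16^?N)\<^sup>2 = m*(\<kappa>*r^?N)"
   using r by (simp add: m_def power_mult_distrib power2_eq_square del: power_Suc)
  hence "ennreal (\<kappa>/(16^?N)\<^sup>2) = ennreal m*ennreal (\<kappa>*r^?N)"
   using m \<kappa>(1) r by (simp only:) (intro ennreal_mult, auto)
  also have "... <= ennreal m*emeasure vol (core z)"
   unfolding r_def using \<kappa>(2)[OF z] by (rule mult_left_mono) simp
  also have "... = (\<integral>\<^sub>+w. ennreal m*indicator (core z) w)"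
   by (rule nn_integral_cmult_indicator[symmetric]) (rule sets_core)
  also have "... <= (\<integral>\<^sub>+w. ennreal ((norm (kz z w))\<^sup>2))"
  proof (rule nn_integral_mono)
   fix w :: "complex^'n"
   show "ennreal m*indicator (core z) w <= ennreal ((norm (kz z w))\<^sup>2)"
   proof (cases "w \<in> core z")
    case True
    hence w: "w \<in> nbhd 16 z" using core_subset_nbhd[OF order_refl z] by blast
    hence wb: "w \<in> unit_ball" and "hdist z w <= 16*r" by (auto simp: nbhd_def r_def)
    moreover have "0 < hdist z w" using rad_le_hdist(1)[OF z wb] r by (simp add: r_def)
    ultimately have "m <= (norm (kz z w))\<^sup>2"
     unfolding m_def norm_kz_square[OF z] using kz_scale[OF z] r
     by (intro frac_le power_mono) (auto simp: r_def)
    thus ?thesis using True by (simp add: ennreal_leI)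
   qed simp
  qed
  finally show "ennreal (\<kappa>/(16^?N)\<^sup>2) <= (\<integral>\<^sub>+w. ennreal ((norm (kz z w))\<^sup>2))" .
 qed
qed

lemma product_le_squares:
 assumes \<delta>: "0 < \<delta>" and b: "0 <= b"
 shows "x*ennreal b <= ennreal (1/\<delta>)*epowr x 2 + ennreal \<delta>*ennreal (b\<^sup>2)"
proof (cases x)
 case top
 thus ?thesis using \<delta> by (simp add: ennreal_mult_top)
next
 case (real t)
 have "0 <= (t - \<delta>*b)\<^sup>2 + t\<^sup>2 + (\<delta>*b)\<^sup>2" by simp
 hence "\<delta>*(t*b) <= t\<^sup>2 + (\<delta>*b)\<^sup>2"
  by (simp add: power2_eq_square algebra_simps)
 hence "t*b <= (t\<^sup>2 + (\<delta>*b)\<^sup>2)/\<delta>"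
  using \<delta> by (simp add: pos_le_divide_eq mult.commute)
 also have "... = 1/\<delta>*t\<^sup>2 + \<delta>*b\<^sup>2"
  using \<delta> by (simp add: power2_eq_square add_divide_distrib)
 finally have "ennreal (t*b) <= ennreal (1/\<delta>*t\<^sup>2 + \<delta>*b\<^sup>2)"
  by (rule ennreal_leI)
 also have "... = ennreal (1/\<delta>*t\<^sup>2) + ennreal (\<delta>*b\<^sup>2)"
  using \<delta> by (intro ennreal_plus) auto
 also have "... = ennreal (1/\<delta>)*ennreal (t\<^sup>2) + ennreal \<delta>*ennreal (b\<^sup>2)"
  using \<delta> by (simp only: ennreal_mult zero_le_power2 zero_le_divide_1_iff less_imp_le)
 finally have "ennreal (t*b) <= ennreal (1/\<delta>)*ennreal (t\<^sup>2) + ennreal \<delta>*ennreal (b\<^sup>2)" .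
 moreover have "epowr x 2 = ennreal (t\<^sup>2)" using real by (simp add: powr_two)
 moreover have "x*ennreal b = ennreal (t*b)" using real b by (simp add: ennreal_mult)
 ultimately show ?thesis by (simp only:)
qed

text \<open>
 The Toeplitz operator is moved past the symbol: \<open>toeplitz v (kz z)\<close> is at most the positive Bergman
 operator applied to \<open>v * kz z\<close>. The free parameter \<open>\<delta>\<close> of the elementary inequality \<open>a b \<le> a\<^sup>2 / \<delta> + \<delta> b\<^sup>2\<close> makes
 the result small when \<open>v * kz z\<close> is small in \<open>L\<^sup>2\<close>.
\<close>

lemma berezin_integrand_le:
 "\<exists>C>0. \<forall>v\<in>borel_measurable (vol :: (complex^'n::finite) measure). \<forall>z\<in>unit_ball. \<forall>\<delta>>0.
  (\<integral>\<^sub>+y. norm (toeplitz v (kz z) y*cnj (kz z y)))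
   <= ennreal (C/\<delta>)*(\<integral>\<^sub>+w. ennreal ((norm (v w * kz z w))\<^sup>2))
    + ennreal \<delta>*(\<integral>\<^sub>+w. ennreal ((norm (kz z w))\<^sup>2))"
proof -
 obtain P where P: "0 < P" "\<forall>f\<in>borel_measurable (vol :: (complex^'n::finite) measure). (\<forall>w. 0 <= f w) -->
  (\<integral>\<^sub>+z. epowr (Pplus f z) 2) <= ennreal P*(\<integral>\<^sub>+z. ennreal ((f z)\<^sup>2))"
  using Pplus_L2[where ?'n = 'n] by (elim exE conjE) (rule that)
 show ?thesis
 proof (rule exI[of _ P], intro conjI ballI allI impI)
  show "0 < P" by fact
  fix v :: "complex^'n => complex" and z :: "complex^'n" and \<delta> :: real
  assume v [measurable]: "v \<in> meas" and z: "z \<in> unit_ball" and \<delta>: "0 < \<delta>"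
  define f where "f w = v w * kz z w" for w
  have fm [measurable]: "f \<in> meas" unfolding f_def[abs_def] by measurable
  have fn: "(\<lambda>w. norm (f w)) \<in> meas" by measurable
  have T: "toeplitz v (kz z) y = toeplitz (\<lambda>_. 1) f y" for y
   unfolding toeplitz_def f_def by simp
  have "(\<integral>\<^sub>+y. norm (toeplitz v (kz z) y*cnj (kz z y)))
   <= (\<integral>\<^sub>+y. ennreal (1/\<delta>)*epowr (Pplus (\<lambda>w. norm (f w)) y) 2 + ennreal \<delta>*ennreal ((norm (kz z y))\<^sup>2))"
  proof (rule nn_integral_mono)
   fix y :: "complex^'n"
   have "ennreal (norm (toeplitz (\<lambda>_. 1) f y)) <= ennreal 1*Pplus (\<lambda>w. norm (f w)) y"
    by (rule toeplitz_le_Pplus[OF _ fm]) simp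
   hence "ennreal (norm (toeplitz v (kz z) y))*ennreal (norm (kz z y)) <= Pplus (\<lambda>w. norm (f w)) y*ennreal (norm (kz z y))"
    unfolding T by (intro mult_right_mono) auto
   also have "... <= ennreal (1/\<delta>)*epowr (Pplus (\<lambda>w. norm (f w)) y) 2 + ennreal \<delta>*ennreal ((norm (kz z y))\<^sup>2)"
    using \<delta> by (rule product_le_squares) simp
   finally show "ennreal (norm (toeplitz v (kz z) y*cnj (kz z y)))
    <= ennreal (1/\<delta>)*epowr (Pplus (\<lambda>w. norm (f w)) y) 2 + ennreal \<delta>*ennreal ((norm (kz z y))\<^sup>2)"
    by (simp add: norm_mult ennreal_mult)
  qed
  also have "... = ennreal (1/\<delta>)*(\<integral>\<^sub>+y. epowr (Pplus (\<lambda>w. norm (f w)) y) 2)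
    + ennreal \<delta>*(\<integral>\<^sub>+y. ennreal ((norm (kz z y))\<^sup>2))"
   by (subst nn_integral_add; (measurable; fail)?) (subst nn_integral_cmult; (measurable; fail)?)+
  also have "... <= ennreal (1/\<delta>)*(ennreal P*(\<integral>\<^sub>+y. ennreal ((norm (f y))\<^sup>2)))
    + ennreal \<delta>*(\<integral>\<^sub>+y. ennreal ((norm (kz z y))\<^sup>2))"
   using P(2)[rule_format, OF fn] by (intro add_right_mono mult_left_mono) auto
  also have "ennreal (1/\<delta>)*(ennreal P*(\<integral>\<^sub>+y. ennreal ((norm (f y))\<^sup>2))) = ennreal (P/\<delta>)*(\<integral>\<^sub>+y. ennreal ((norm (f y))\<^sup>2))"
   using \<delta> P(1) by (simp add: mult.assoc[symmetric] ennreal_mult[symmetric])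
  finally show "(\<integral>\<^sub>+y. norm (toeplitz v (kz z) y*cnj (kz z y)))
   <= ennreal (P/\<delta>)*(\<integral>\<^sub>+w. ennreal ((norm (v w * kz z w))\<^sup>2))
    + ennreal \<delta>*(\<integral>\<^sub>+w. ennreal ((norm (kz z w))\<^sup>2))"
   unfolding f_def .
 qed
qed

lemma kz_L1: "z \<in> unit_ball ==> (\<integral>\<^sub>+w. norm (kz z w)) < \<top>"
proof -
 assume "z \<in> unit_ball"
 hence "\<exists>B\<ge>0. \<forall>w\<in>unit_ball. norm (kz z w) <= B" by (rule kz_bounded)
 then obtain B where B: "0 <= B" "\<forall>w\<in>unit_ball. norm (kz z w) <= B"
  by (elim exE conjE) (rule that)
 have "integrable vol (kz z)"
  using measurable_kz B(2) by (intro integral_vol_bounded(1)[of _ B]) auto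
 thus ?thesis by (simp add: integrable_iff_bounded)
qed

lemma berezin_integrable:
 fixes z :: "complex^'n::finite"
 assumes v [measurable]: "v \<in> meas" and M: "AE w in vol. norm (v w) <= M" and z: "z \<in> unit_ball"
 shows "integrable vol (\<lambda>y. toeplitz v (kz z) y*cnj (kz z y))"
proof (rule integrableI_bounded)
 have c: "(\<lambda>y. cnj (kz z y)) \<in> meas"
  using measurable_kz by (rule measurable_compose) (intro borel_measurable_continuous_onI continuous_intros)
 show "(\<lambda>y. toeplitz v (kz z) y*cnj (kz z y)) \<in> meas"
  using measurable_toeplitz[OF v measurable_kz] c by (rule borel_measurable_times)
 obtain C where C: "0 < C" "\<forall>v\<in>borel_measurable (vol :: (complex^'n::finite) measure). \<forall>z\<in>unit_ball. \<forall>\<delta>>0.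
  (\<integral>\<^sub>+y. norm (toeplitz v (kz z) y*cnj (kz z y)))
   <= ennreal (C/\<delta>)*(\<integral>\<^sub>+w. ennreal ((norm (v w * kz z w))\<^sup>2))
    + ennreal \<delta>*(\<integral>\<^sub>+w. ennreal ((norm (kz z w))\<^sup>2))"
  using berezin_integrand_le[where ?'n = 'n] by (elim exE conjE) (rule that)
 obtain L where L: "0 < L" "\<forall>z::complex^'n::finite\<in>unit_ball. (\<integral>\<^sub>+w. ennreal ((norm (kz z w))\<^sup>2)) <= ennreal L"
  using kz_L2_upper[where ?'n = 'n] by (elim exE conjE) (rule that)
 have Lz: "(\<integral>\<^sub>+w. ennreal ((norm (kz z w))\<^sup>2)) <= ennreal L"
  using L(2) z by (rule bspec)
 have "(\<integral>\<^sub>+w. ennreal ((norm (v w * kz z w))\<^sup>2)) <= (\<integral>\<^sub>+w. ennreal (M\<^sup>2)*ennreal ((norm (kz z w))\<^sup>2))"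
 proof (rule nn_integral_mono_AE)
  show "AE w in vol. ennreal ((norm (v w * kz z w))\<^sup>2) <= ennreal (M\<^sup>2)*ennreal ((norm (kz z w))\<^sup>2)"
   using M
  proof eventually_elim
   case (elim w)
   hence "(norm (v w))\<^sup>2*(norm (kz z w))\<^sup>2 <= M\<^sup>2*(norm (kz z w))\<^sup>2"
    by (intro mult_right_mono power_mono) auto
   thus ?case by (simp add: norm_mult power_mult_distrib ennreal_mult[symmetric] ennreal_leI)
  qed
 qed
 also have "... = ennreal (M\<^sup>2)*(\<integral>\<^sub>+w. ennreal ((norm (kz z w))\<^sup>2))"
  by (rule nn_integral_cmult) measurable
 also have "... < \<top>"
  using le_less_trans[OF Lz ennreal_less_top] by (simp add: ennreal_mult_less_top)
 finally have "ennreal (C/1)*(\<integral>\<^sub>+w. ennreal ((norm (v w * kz z w))\<^sup>2)) + ennreal 1*(\<integral>\<^sub>+w. ennreal ((norm (kz z w))\<^sup>2)) < \<top>"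
  using le_less_trans[OF Lz ennreal_less_top] by (simp add: ennreal_mult_less_top)
 thus "(\<integral>\<^sub>+y. norm (toeplitz v (kz z) y*cnj (kz z y))) < \<infinity>"
  using le_less_trans[OF C(2)[rule_format, OF v z zero_less_one]] by simp
qed

text \<open>
 Where \<open>hdist z w\<close> is bounded below, the normalized kernel tends to \<open>0\<close> as \<open>z\<close> approaches the sphere. So only the
 values of \<open>v\<close> at the other points contribute.
\<close>

lemma berezin_small:
 "\<exists>K>0. \<forall>v\<in>borel_measurable (vol :: (complex^'n::finite) measure). \<forall>M\<ge>0. \<forall>\<epsilon>>0. \<forall>\<beta>>0. \<forall>z\<in>unit_ball.
  (AE w in vol. norm (v w) <= M) --> (\<forall>w\<in>unit_ball. norm (v w) <= \<epsilon> \<or> \<beta> <= hdist z w) -->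
  norm (berezin v z) <= K*(\<epsilon> + M\<^sup>2*rad z^(CARD('n) + 1)/(\<epsilon>*(\<beta>^(CARD('n) + 1))\<^sup>2))"
proof -
 let ?N = "CARD('n) + 1"
 obtain C where C: "0 < C" "\<forall>v\<in>borel_measurable (vol :: (complex^'n::finite) measure). \<forall>z\<in>unit_ball. \<forall>\<delta>>0.
  (\<integral>\<^sub>+y. norm (toeplitz v (kz z) y*cnj (kz z y)))
   <= ennreal (C/\<delta>)*(\<integral>\<^sub>+w. ennreal ((norm (v w * kz z w))\<^sup>2))
    + ennreal \<delta>*(\<integral>\<^sub>+w. ennreal ((norm (kz z w))\<^sup>2))"
  using berezin_integrand_le[where ?'n = 'n] by (elim exE conjE) (rule that)
 obtain L where L: "0 < L" "\<forall>z::complex^'n::finite\<in>unit_ball. (\<integral>\<^sub>+w. ennreal ((norm (kz z w))\<^sup>2)) <= ennreal L"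
  using kz_L2_upper[where ?'n = 'n] by (elim exE conjE) (rule that)
 define K where "K = C*L + L + C*2^?N"
 show ?thesis
 proof (rule exI[of _ K], intro conjI ballI allI impI)
  show "0 < K" using C(1) L(1) by (simp add: K_def add_pos_pos)
  fix v :: "complex^'n => complex" and M \<epsilon> \<beta> :: real and z :: "complex^'n"
  assume v [measurable]: "v \<in> meas" and M0: "0 <= M" and \<epsilon>: "0 < \<epsilon>" and \<beta>: "0 < \<beta>"
   and z: "z \<in> unit_ball" and M: "AE w in vol. norm (v w) <= M"
   and far: "\<forall>w\<in>unit_ball. norm (v w) <= \<epsilon> \<or> \<beta> <= hdist z w"
  define r where "r = rad z"
  have r: "0 < r" using z by (simp add: r_def)
  define E where "E = M\<^sup>2*((2*r)^?N/(\<beta>^?N)\<^sup>2)"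
  have E: "0 <= E" using r \<beta> by (simp add: E_def)
  have Lz: "(\<integral>\<^sub>+w. ennreal ((norm (kz z w))\<^sup>2)) <= ennreal L"
   using L(2) z by (rule bspec)
  have "(\<integral>\<^sub>+w. ennreal ((norm (v w * kz z w))\<^sup>2)) <= (\<integral>\<^sub>+w. ennreal (\<epsilon>\<^sup>2)*ennreal ((norm (kz z w))\<^sup>2) + ennreal E)"
  proof (rule nn_integral_mono_AE)
   show "AE w in vol. ennreal ((norm (v w * kz z w))\<^sup>2) <= ennreal (\<epsilon>\<^sup>2)*ennreal ((norm (kz z w))\<^sup>2) + ennreal E"
    using M AE_space
   proof eventually_elim
    case (elim w)
    hence w: "w \<in> unit_ball" by simp
    have eq: "(norm (v w * kz z w))\<^sup>2 = (norm (v w))\<^sup>2*(norm (kz z w))\<^sup>2"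
     by (simp add: norm_mult power_mult_distrib)
    have "(norm (v w * kz z w))\<^sup>2 <= \<epsilon>\<^sup>2*(norm (kz z w))\<^sup>2 + E"
    proof (cases "norm (v w) <= \<epsilon>")
     case True
     hence "(norm (v w))\<^sup>2*(norm (kz z w))\<^sup>2 <= \<epsilon>\<^sup>2*(norm (kz z w))\<^sup>2"
      by (intro mult_right_mono power_mono) auto
     thus ?thesis unfolding eq using E by linarith
    next
     case False
     hence h: "\<beta> <= hdist z w" using far w by blast
     have "(norm (kz z w))\<^sup>2 <= (2*r)^?N/(\<beta>^?N)\<^sup>2"
      unfolding norm_kz_square[OF z] using kz_scale[OF z] h \<beta> r by (intro frac_le power_mono) (auto simp: r_def)
     hence "(norm (v w))\<^sup>2*(norm (kz z w))\<^sup>2 <= E"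
      unfolding E_def using elim(1) by (intro mult_mono power_mono) auto
     moreover have "0 <= \<epsilon>\<^sup>2*(norm (kz z w))\<^sup>2" by simp
     ultimately show ?thesis unfolding eq by linarith
    qed
    hence "ennreal ((norm (v w * kz z w))\<^sup>2) <= ennreal (\<epsilon>\<^sup>2*(norm (kz z w))\<^sup>2 + E)"
     by (rule ennreal_leI)
    also have "... = ennreal (\<epsilon>\<^sup>2)*ennreal ((norm (kz z w))\<^sup>2) + ennreal E"
     using E by (simp add: ennreal_mult[symmetric])
    finally show ?case .
   qed
  qed
  also have "... = ennreal (\<epsilon>\<^sup>2)*(\<integral>\<^sub>+w. ennreal ((norm (kz z w))\<^sup>2)) + ennreal E"
  proof -
   have "emeasure (vol :: (complex^'n) measure) (space vol) = 1" by (rule vol.emeasure_space_1)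
   hence "(\<integral>\<^sup>+w. ennreal E \<partial>(vol :: (complex^'n) measure)) = ennreal E"
    by (simp only: nn_integral_const mult_1_right)
   moreover have "(\<integral>\<^sub>+w. ennreal (\<epsilon>\<^sup>2)*ennreal ((norm (kz z w))\<^sup>2)) = ennreal (\<epsilon>\<^sup>2)*(\<integral>\<^sub>+w. ennreal ((norm (kz z w))\<^sup>2))"
    by (rule nn_integral_cmult) measurable
   ultimately show ?thesis
    by (subst nn_integral_add) (simp_all only: borel_measurable_const, measurable)
  qed
  also have "... <= ennreal (\<epsilon>\<^sup>2)*ennreal L + ennreal E"
   using Lz by (intro add_right_mono mult_left_mono) auto
  also have "... = ennreal (\<epsilon>\<^sup>2*L + E)" using L(1) E by (simp add: ennreal_mult)
  finally have vk: "(\<integral>\<^sub>+w. ennreal ((norm (v w * kz z w))\<^sup>2)) <= ennreal (\<epsilon>\<^sup>2*L + E)" .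
  have "ennreal (norm (berezin v z)) <= (\<integral>\<^sub>+y. norm (toeplitz v (kz z) y*cnj (kz z y)))"
   unfolding berezin_def L2_inner_def by (rule integral_norm_bound_ennreal[OF berezin_integrable[OF v M z]])
  also have "... <= ennreal (C/\<epsilon>)*(\<integral>\<^sub>+w. ennreal ((norm (v w * kz z w))\<^sup>2))
    + ennreal \<epsilon>*(\<integral>\<^sub>+w. ennreal ((norm (kz z w))\<^sup>2))"
   by (rule C(2)[rule_format, OF v z \<epsilon>])
  also have "... <= ennreal (C/\<epsilon>)*ennreal (\<epsilon>\<^sup>2*L + E) + ennreal \<epsilon>*ennreal L"
   using vk Lz by (intro add_mono mult_left_mono) auto
  also have "... = ennreal (C/\<epsilon>*(\<epsilon>\<^sup>2*L + E) + \<epsilon>*L)"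
   using C(1) L(1) \<epsilon> E by (simp add: ennreal_mult[symmetric] ennreal_plus[symmetric] del: ennreal_plus)
  finally have "norm (berezin v z) <= C/\<epsilon>*(\<epsilon>\<^sup>2*L + E) + \<epsilon>*L"
   using C(1) L(1) \<epsilon> E by (subst (asm) ennreal_le_iff) auto
  also have "... = (C*L + L)*\<epsilon> + C*2^?N*(M\<^sup>2*r^?N/(\<epsilon>*(\<beta>^?N)\<^sup>2))"
  proof -
   have "C/\<epsilon>*(\<epsilon>\<^sup>2*L) = C*L*\<epsilon>"
    using \<epsilon> by (simp add: power2_eq_square)
   moreover have "C/\<epsilon>*E = C*2^?N*(M\<^sup>2*r^?N/(\<epsilon>*(\<beta>^?N)\<^sup>2))"
    unfolding E_def power_mult_distrib by (simp del: power_Suc)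
   ultimately show ?thesis
    by (simp only: distrib_left distrib_right mult.commute[of \<epsilon> L] add.assoc)
  qed
  also have "... <= K*\<epsilon> + K*(M\<^sup>2*r^?N/(\<epsilon>*(\<beta>^?N)\<^sup>2))"
  proof -
   have "C*L + L <= K" "C*2^?N <= K" using C(1) L(1) by (auto simp: K_def)
   thus ?thesis using \<epsilon> r \<beta> by (intro add_mono mult_right_mono) auto
  qed
  finally show "norm (berezin v z) <= K*(\<epsilon> + M\<^sup>2*rad z^?N/(\<epsilon>*(\<beta>^?N)\<^sup>2))"
   by (simp only: distrib_left r_def)
 qed
qed

lemma berezin_split:
 fixes z :: "complex^'n::finite"
 assumes u: "u \<in> meas" and M: "AE w in vol. norm (u w) <= M" and z: "z \<in> unit_ball"
 shows "berezin u z = c*berezin (\<lambda>_. 1) z + berezin (\<lambda>w. u w - c) z"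
proof -
 have vm: "(\<lambda>w. u w - c) \<in> meas" using u by measurable
 have vM: "AE w in vol. norm (u w - c) <= M + norm c"
  using M by eventually_elim (use norm_triangle_ineq4 in \<open>metis add_right_mono order_trans\<close>)
 have om: "(\<lambda>_. 1) \<in> borel_measurable (vol :: (complex^'n) measure)" and oM: "AE w :: complex^'n in vol. norm (1 :: complex) <= 1"
  by auto
 have int: "integrable vol (\<lambda>w. v w * kz z w/(1 - herm y w)^(CARD('n) + 1))"
  if "v \<in> meas" "AE w in vol. norm (v w) <= B" "y \<in> unit_ball" for v B y
  by (rule toeplitz_integrable[OF that(1) measurable_kz that(2) kz_L1[OF z] rad_pos[OF that(3)]])
   (rule rad_le_hdist(1)[OF that(3)])
 have T: "toeplitz u (kz z) y = c*toeplitz (\<lambda>_. 1) (kz z) y + toeplitz (\<lambda>w. u w - c) (kz z) y" if y: "y \<in> unit_ball" for y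
 proof -
  have "toeplitz u (kz z) y = (\<integral>w. c*(1 * kz z w/(1 - herm y w)^(CARD('n) + 1)) + (u w - c) * kz z w/(1 - herm y w)^(CARD('n) + 1) \<partial>vol)"
   unfolding toeplitz_def by (rule Bochner_Integration.integral_cong[OF refl]) (simp add: left_diff_distrib diff_divide_distrib)
  also have "... = (\<integral>w. c*(1 * kz z w/(1 - herm y w)^(CARD('n) + 1)) \<partial>vol) + (\<integral>w. (u w - c) * kz z w/(1 - herm y w)^(CARD('n) + 1) \<partial>vol)"
   by (rule Bochner_Integration.integral_add[OF integrable_mult_right[OF int[OF om oM y]] int[OF vm vM y]])
  also have "(\<integral>w. c*(1 * kz z w/(1 - herm y w)^(CARD('n) + 1)) \<partial>vol) = c*(\<integral>w. 1 * kz z w/(1 - herm y w)^(CARD('n) + 1) \<partial>vol)"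
   by (rule integral_mult_right_zero)
  finally show ?thesis
   unfolding toeplitz_def .
 qed
 have "berezin u z = (\<integral>y. c*(toeplitz (\<lambda>_. 1) (kz z) y*cnj (kz z y)) + toeplitz (\<lambda>w. u w - c) (kz z) y*cnj (kz z y) \<partial>vol)"
  unfolding berezin_def L2_inner_def by (rule Bochner_Integration.integral_cong[OF refl]) (simp add: T distrib_right mult.assoc)
 also have "... = (\<integral>y. c*(toeplitz (\<lambda>_. 1) (kz z) y*cnj (kz z y)) \<partial>vol) + (\<integral>y. toeplitz (\<lambda>w. u w - c) (kz z) y*cnj (kz z y) \<partial>vol)"
  by (rule Bochner_Integration.integral_add[OF integrable_mult_right[OF berezin_integrable[OF om oM z]] berezin_integrable[OF vm vM z]])
 also have "(\<integral>y. c*(toeplitz (\<lambda>_. 1) (kz z) y*cnj (kz z y)) \<partial>vol) = c*(\<integral>y. toeplitz (\<lambda>_. 1) (kz z) y*cnj (kz z y) \<partial>vol)"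
  by (rule integral_mult_right_zero)
 finally show ?thesis
  unfolding berezin_def L2_inner_def .
qed

text \<open>
 Apply the form to the density \<open>k = kz z\<close> with a real point mass \<open>\<sigma>\<close> at \<open>z\<close>, after a truncation of \<open>k\<close> to balls
 of radius less than \<open>1\<close>. Since the kernel at \<open>z\<close> is a multiple of \<open>cnj k\<close>, the mixed term is a multiple of
 \<open>j = \<integral> (norm k)\<^sup>2\<close>. The choice of \<open>\<sigma>\<close> that minimizes the form shows that the transform of \<open>1\<close> has real part at
 least \<open>j\<^sup>2\<close>, and \<open>j\<close> is bounded below.
\<close>

lemma berezin_one_ge:
 "\<exists>c>0. \<forall>z::complex^'n::finite\<in>unit_ball. c <= norm (berezin (\<lambda>_. 1) z)"
proof -
 let ?N = "CARD('n) + 1"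
 let ?one = "\<lambda>_ :: complex^'n. 1 :: complex"
 obtain P where P: "0 < P" "\<forall>f\<in>borel_measurable (vol :: (complex^'n::finite) measure). (\<forall>w. 0 <= f w) -->
  (\<integral>\<^sub>+z. epowr (Pplus f z) 2) <= ennreal P*(\<integral>\<^sub>+z. ennreal ((f z)\<^sup>2))"
  using Pplus_L2[where ?'n = 'n] by (elim exE conjE) (rule that)
 obtain L where L: "0 < L" "\<forall>z::complex^'n::finite\<in>unit_ball. (\<integral>\<^sub>+w. ennreal ((norm (kz z w))\<^sup>2)) <= ennreal L"
  using kz_L2_upper[where ?'n = 'n] by (elim exE conjE) (rule that)
 obtain l where l: "0 < l" "\<forall>z::complex^'n::finite\<in>unit_ball. ennreal l <= (\<integral>\<^sub>+w. ennreal ((norm (kz z w))\<^sup>2))"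
  using kz_L2_lower[where ?'n = 'n] by (elim exE conjE) (rule that)
 show ?thesis
 proof (rule exI[of _ "l\<^sup>2"], intro conjI ballI)
  show "0 < l\<^sup>2" using l(1) by simp
  fix z :: "complex^'n" assume z: "z \<in> unit_ball"
  define k where "k = kz z"
  have km [measurable]: "k \<in> meas" unfolding k_def by (rule measurable_kz)
  have "\<exists>B\<ge>0. \<forall>w\<in>unit_ball. norm (k w) <= B"
   unfolding k_def by (rule kz_bounded[OF z])
  then obtain B where B: "0 <= B" "\<forall>w\<in>unit_ball. norm (k w) <= B"
   by (elim exE conjE) (rule that)
  define \<rho> where "\<rho> i = 1 - (1 - norm z)/real (Suc i)" for i :: nat
  have \<rho>: "norm z <= \<rho> i" "\<rho> i < 1" for i
  proof -
   have "(1 - norm z)/real (Suc i) <= (1 - norm z)/1" using z by (intro divide_left_mono) auto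
   thus "norm z <= \<rho> i" by (simp add: \<rho>_def)
   show "\<rho> i < 1" using z by (simp add: \<rho>_def)
  qed
  have \<rho>_lim: "\<rho> \<longlonglongrightarrow> 1"
  proof -
   have "(\<lambda>i. 1 - (1 - norm z)/real (Suc i)) \<longlonglongrightarrow> 1 - 0"
    by (intro tendsto_diff tendsto_const LIMSEQ_Suc[OF lim_const_over_n])
   thus ?thesis by (simp add: \<rho>_def[abs_def])
  qed
  define F where "F i w = (if norm w <= \<rho> i then k w else 0)" for i w
  have Fm [measurable]: "F i \<in> meas" for i unfolding F_def[abs_def] by measurable
  have Fk: "norm (F i w) <= norm (k w)" for i w by (simp add: F_def)
  have Flim: "(\<lambda>i. F i w) \<longlonglongrightarrow> k w" if "w \<in> unit_ball" for w
  proof (rule tendsto_eventually)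
   have "eventually (\<lambda>i. norm w < \<rho> i) sequentially"
    using that by (intro order_tendstoD(1)[OF \<rho>_lim]) simp
   thus "eventually (\<lambda>i. F i w = k w) sequentially"
    by (rule eventually_mono) (simp add: F_def)
  qed
  define G where "G f y = (\<integral>w. f w*(1/(1 - herm y w)^?N) \<partial>vol)" for f and y :: "complex^'n"
  have GT: "G f = toeplitz ?one f" for f by (rule ext) (simp add: G_def toeplitz_def)
  have Gm: "G f \<in> meas" if "f \<in> meas" for f
   unfolding GT using that by (intro measurable_toeplitz) auto
  define D where "D y = enn2real (Pplus (\<lambda>w. norm (k w)) y)" for y
  have kn: "(\<lambda>w. norm (k w)) \<in> meas" by measurable
  have Pint: "(\<integral>\<^sub>+y. Pplus (\<lambda>w. norm (k w)) y) < \<top>"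
  proof -
   have "(\<integral>\<^sub>+y. Pplus (\<lambda>w. norm (k w)) y) <= (\<integral>\<^sub>+y. epowr (Pplus (\<lambda>w. norm (k w)) y) 2 + 1)"
   proof (rule nn_integral_mono)
    fix y
    show "Pplus (\<lambda>w. norm (k w)) y <= epowr (Pplus (\<lambda>w. norm (k w)) y) 2 + 1"
     using product_le_squares[of 1 1 "Pplus (\<lambda>w. norm (k w)) y"] by simp
   qed
   also have "... = (\<integral>\<^sub>+y. epowr (Pplus (\<lambda>w. norm (k w)) y) 2) + (\<integral>\<^sup>+y. 1 \<partial>(vol :: (complex^'n) measure))"
    by (rule nn_integral_add) (intro borel_measurable_epowr measurable_Pplus kn, simp)
   also have "(\<integral>\<^sup>+y. 1 \<partial>(vol :: (complex^'n) measure)) = 1"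
    unfolding nn_integral_const vol.emeasure_space_1 by simp
   also have "(\<integral>\<^sub>+y. epowr (Pplus (\<lambda>w. norm (k w)) y) 2) + 1 <= ennreal P*ennreal L + 1"
   proof (rule add_right_mono)
    have "(\<integral>\<^sub>+y. epowr (Pplus (\<lambda>w. norm (k w)) y) 2) <= ennreal P*(\<integral>\<^sub>+w. ennreal ((norm (k w))\<^sup>2))"
     using P(2)[rule_format, OF kn] by simp
    also have "... <= ennreal P*ennreal L"
     using bspec[OF L(2) z] unfolding k_def by (rule mult_left_mono) simp
    finally show "(\<integral>\<^sub>+y. epowr (Pplus (\<lambda>w. norm (k w)) y) 2) <= ennreal P*ennreal L" .
   qed
   also have "... < \<top>" by (simp add: ennreal_mult_less_top)
   finally show ?thesis .
  qed
  have Pfin: "AE y in vol. Pplus (\<lambda>w. norm (k w)) y \<noteq> \<top>"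
   using nn_integral_PInf_AE[OF measurable_Pplus[OF kn]] Pint by simp
  have Dint: "integrable vol D"
  proof (rule integrableI_bounded)
   show "D \<in> meas"
    unfolding D_def[abs_def] using measurable_Pplus[OF kn] by (rule measurable_compose) measurable
   have "(\<integral>\<^sub>+y. ennreal (norm (D y))) <= (\<integral>\<^sub>+y. Pplus (\<lambda>w. norm (k w)) y)"
    unfolding D_def by (intro nn_integral_mono) (auto simp: ennreal_enn2real_if)
   thus "(\<integral>\<^sub>+y. ennreal (norm (D y))) < \<infinity>"
    using Pint by (simp add: le_less_trans)
  qed
  have GD: "AE y in vol. norm (G (F i) y) <= D y" for i
   using Pfin
  proof eventually_elim
   case (elim y)
   have "ennreal (norm (toeplitz ?one (F i) y)) <= ennreal 1*Pplus (\<lambda>w. norm (F i w)) y"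
    by (rule toeplitz_le_Pplus[OF _ Fm]) simp
   also have "... <= Pplus (\<lambda>w. norm (k w)) y"
    unfolding Pplus_def using Fk by (simp add: nn_integral_mono mult_right_mono ennreal_leI)
   also have "... = ennreal (D y)" using elim by (simp add: D_def less_top)
   finally show ?case unfolding GT by (simp add: D_def ennreal_le_iff)
  qed
  have Glim: "(\<lambda>i. G (F i) y) \<longlonglongrightarrow> G k y" if y: "y \<in> unit_ball" for y
   unfolding G_def
  proof (rule integral_dominated_convergence[where w = "\<lambda>_. B*(1/rad y^?N)"])
   show "(\<lambda>w. k w*(1/(1 - herm y w)^?N)) \<in> meas" "(\<lambda>w. F i w*(1/(1 - herm y w)^?N)) \<in> meas" for i
    by measurable
   show "integrable (vol :: (complex^'n) measure) (\<lambda>_. B*(1/rad y^?N))" by simp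
   show "AE w in vol. (\<lambda>i. F i w*(1/(1 - herm y w)^?N)) \<longlonglongrightarrow> k w*(1/(1 - herm y w)^?N)"
    using AE_space by eventually_elim (intro tendsto_mult tendsto_const Flim, simp)
   show "AE w in vol. norm (F i w*(1/(1 - herm y w)^?N)) <= B*(1/rad y^?N)" for i
    using AE_space
   proof eventually_elim
    case (elim w)
    hence w: "w \<in> unit_ball" by simp
    have "norm (F i w) <= B" using Fk[of i w] bspec[OF B(2) w] by linarith
    moreover have "1/hdist y w^?N <= 1/rad y^?N"
     using rad_le_hdist(1)[OF y w] rad_pos[OF y] by (intro divide_left_mono power_mono mult_pos_pos zero_less_power) auto
    ultimately have "norm (F i w)*(1/hdist y w^?N) <= B*(1/rad y^?N)"
     using B(1) by (intro mult_mono) auto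
    thus ?case
     unfolding hdist_def norm_mult norm_divide norm_power norm_one .
   qed
  qed
  define X where "X = (\<integral>y. cnj (k y)*G k y \<partial>vol)"
  have cm: "(\<lambda>y. cnj (f y)) \<in> meas" if "f \<in> meas" for f :: "complex^'n => complex"
   using that by (rule measurable_compose) (intro borel_measurable_continuous_onI continuous_intros)
  have Xlim: "(\<lambda>i. \<integral>y. cnj (F i y)*G (F i) y \<partial>vol) \<longlonglongrightarrow> X"
   unfolding X_def
  proof (rule integral_dominated_convergence[where w = "\<lambda>y. B*D y"])
   show "(\<lambda>y. cnj (k y)*G k y) \<in> meas" "(\<lambda>y. cnj (F i y)*G (F i) y) \<in> meas" for i
    by (intro borel_measurable_times cm Gm km Fm)+
   show "integrable vol (\<lambda>y. B*D y)" using Dint by (rule integrable_mult_right)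
   show "AE y in vol. (\<lambda>i. cnj (F i y)*G (F i) y) \<longlonglongrightarrow> cnj (k y)*G k y"
    using AE_space by eventually_elim (intro tendsto_mult tendsto_cnj Flim Glim, simp_all)
   show "AE y in vol. norm (cnj (F i y)*G (F i) y) <= B*D y" for i
    using GD[of i] AE_space
   proof eventually_elim
    case (elim y)
    hence y: "y \<in> unit_ball" by simp
    have "norm (F i y) <= B" using Fk[of i y] bspec[OF B(2) y] by linarith
    thus ?case unfolding norm_mult complex_mod_cnj using elim(1) B(1) by (intro mult_mono) auto
   qed
  qed
  have X: "X = berezin ?one z"
   unfolding X_def berezin_def L2_inner_def GT k_def by (simp only: mult.commute)
  define s0 where "s0 = (1 - (norm z)\<^sup>2) powr ((real CARD('n) + 1)/2)"
  have s0: "0 < s0" "s0\<^sup>2 = (1 - (norm z)\<^sup>2)^?N"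
   using kz_scale[OF z] kz_scale_square[OF z] by (auto simp: s0_def)
  define j where "j = (\<integral>w. (norm (k w))\<^sup>2 \<partial>vol)"
  have k2: "integrable vol (\<lambda>w. (norm (k w))\<^sup>2)"
  proof (rule integrableI_bounded)
   show "(\<lambda>w. (norm (k w))\<^sup>2) \<in> meas" by measurable
   show "(\<integral>\<^sub>+w. ennreal (norm ((norm (k w))\<^sup>2))) < \<infinity>"
    using le_less_trans[OF bspec[OF L(2) z] ennreal_less_top] by (simp add: k_def)
  qed
  have "ennreal l <= ennreal j"
   unfolding j_def using bspec[OF l(2) z] nn_integral_eq_integral[OF k2] by (simp add: k_def)
  hence jl: "l <= j" using l(1) by (metis ennreal_le_iff2 less_le_not_le)
  have Gkz: "G k z = of_real (j / s0)"
  proof -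
   have "G k z = (\<integral>w. of_real (1 / s0) * of_real ((norm (k w))\<^sup>2) \<partial>vol)"
    unfolding G_def
   proof (rule Bochner_Integration.integral_cong[OF refl])
    fix w
    have "cnj (k w) = of_real s0*(1/(1 - herm z w)^?N)"
     unfolding k_def kz_def s0_def by (simp add: cnj_herm)
    hence "1/(1 - herm z w)^?N = of_real (1 / s0)*cnj (k w)" using s0(1) by simp
    thus "k w*(1/(1 - herm z w)^?N) = of_real (1 / s0) * of_real ((norm (k w))\<^sup>2)"
     unfolding complex_norm_square by (simp only: mult_ac)
   qed
   also have "... = of_real (1 / s0)*(\<integral>w. complex_of_real ((norm (k w))\<^sup>2) \<partial>vol)"
    by (rule integral_mult_right_zero)
   also have "(\<integral>w. complex_of_real ((norm (k w))\<^sup>2) \<partial>vol) = of_real j"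
    unfolding j_def by (rule integral_complex_of_real)
   finally show ?thesis by simp
  qed
  define \<sigma> where "\<sigma> = - (j * s0)"
  have pos: "0 <= Re (\<integral>y. cnj (F i y)*G (F i) y \<partial>vol) + 2 * Re (cnj (of_real \<sigma>)*G (F i) z)
   + (norm (complex_of_real \<sigma>))\<^sup>2 * Re (1/(1 - herm z z)^?N)" for i
  proof -
   interpret kernel_form "\<rho> i" z
    using \<rho>[of i] by unfold_locales (auto intro: order_trans[OF norm_ge_zero])
   have "\<forall>w\<in>unit_ball. norm (F i w) <= B" using Fk[of i] B(2) by (meson order_trans)
   hence "adm (F i)"
    unfolding adm_def using Fm[of i] by (intro conjI exI[of _ B]) (auto simp: F_def)
   hence "0 <= form (F i) (of_real \<sigma>) (\<lambda>\<xi>. 1/(1 - \<xi>)^?N)"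
    using pos_bergman[of ?N] unfolding pos_def by blast
   thus ?thesis
    unfolding form_def inner_int_def[abs_def] G_def .
  qed
  have "(\<lambda>i. Re (\<integral>y. cnj (F i y)*G (F i) y \<partial>vol) + 2 * Re (cnj (of_real \<sigma>)*G (F i) z)
   + (norm (complex_of_real \<sigma>))\<^sup>2 * Re (1/(1 - herm z z)^?N)) \<longlonglongrightarrow>
   Re X + 2 * Re (cnj (of_real \<sigma>)*G k z) + (norm (complex_of_real \<sigma>))\<^sup>2 * Re (1/(1 - herm z z)^?N)"
   by (intro tendsto_add tendsto_mult tendsto_const tendsto_Re Xlim Glim[OF z])
  hence "0 <= Re X + 2 * Re (cnj (of_real \<sigma>)*G k z) + (norm (complex_of_real \<sigma>))\<^sup>2 * Re (1/(1 - herm z z)^?N)"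
   by (rule LIMSEQ_le_const) (intro exI[of _ 0] allI impI pos)
  also have "Re (1/(1 - herm z z)^?N) = 1 / s0\<^sup>2"
  proof -
   have "1/(1 - herm z z)^?N = of_real (1/(1 - (norm z)\<^sup>2)^?N)" unfolding herm_self by simp
   thus ?thesis unfolding s0(2) by (simp only: Re_complex_of_real)
  qed
  also have "Re (cnj (of_real \<sigma>)*G k z) = \<sigma>*(j / s0)" unfolding Gkz by simp
  also have "Re X + 2*(\<sigma>*(j / s0)) + (norm (complex_of_real \<sigma>))\<^sup>2*(1 / s0\<^sup>2) = Re X - j\<^sup>2"
   unfolding \<sigma>_def norm_of_real power2_abs using s0(1) by (simp add: power2_eq_square)
  finally have "j\<^sup>2 <= Re X" by simp
  also have "... <= norm X" by (rule complex_Re_le_cmod)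
  finally have "j\<^sup>2 <= norm (berezin ?one z)"
   unfolding X .
  moreover have "l\<^sup>2 <= j\<^sup>2" using jl l(1) by (intro power_mono) auto
  ultimately show "l\<^sup>2 <= norm (berezin ?one z)" by linarith
 qed
qed

lemma berezin_small_near_sphere:
 "\<exists>K>0. \<forall>v\<in>borel_measurable (vol :: (complex^'n::finite) measure). \<forall>M\<ge>0. \<forall>\<epsilon>>0. \<forall>\<beta>>0.
  (AE w in vol. norm (v w) <= M) --> (\<exists>\<eta>>0. \<forall>z\<in>unit_ball. rad z < \<eta> -->
   (\<forall>w\<in>unit_ball. norm (v w) <= \<epsilon> \<or> \<beta> <= hdist z w) --> norm (berezin v z) <= K*\<epsilon>)"
proof -
 let ?N = "CARD('n) + 1"
 obtain K where K: "0 < K" "\<forall>v\<in>borel_measurable (vol :: (complex^'n::finite) measure). \<forall>M\<ge>0. \<forall>\<epsilon>>0. \<forall>\<beta>>0. \<forall>z\<in>unit_ball.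
  (AE w in vol. norm (v w) <= M) --> (\<forall>w\<in>unit_ball. norm (v w) <= \<epsilon> \<or> \<beta> <= hdist z w) -->
  norm (berezin v z) <= K*(\<epsilon> + M\<^sup>2*rad z^?N/(\<epsilon>*(\<beta>^?N)\<^sup>2))"
  using berezin_small[where ?'n = 'n] by (elim exE conjE) (rule that)
 show ?thesis
 proof (rule exI[of _ "2*K"], intro conjI ballI allI impI)
  show "0 < 2*K" using K(1) by simp
  fix v :: "complex^'n => complex" and M \<epsilon> \<beta> :: real
  assume v: "v \<in> meas" and M0: "0 <= M" and \<epsilon>: "0 < \<epsilon>" and \<beta>: "0 < \<beta>" and M: "AE w in vol. norm (v w) <= M"
  define B where "B = (\<beta>^?N)\<^sup>2"
  have B: "0 < B" using \<beta> by (simp add: B_def)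
  define \<eta> where "\<eta> = \<epsilon>\<^sup>2*B/(M\<^sup>2 + 1)"
  have M1: "0 < M\<^sup>2 + 1" using zero_le_power2[of M] by linarith
  show "\<exists>\<eta>>0. \<forall>z\<in>unit_ball. rad z < \<eta> -->
   (\<forall>w\<in>unit_ball. norm (v w) <= \<epsilon> \<or> \<beta> <= hdist z w) --> norm (berezin v z) <= 2*K*\<epsilon>"
  proof (rule exI[of _ \<eta>], intro conjI ballI impI)
   show "0 < \<eta>" unfolding \<eta>_def using \<epsilon> B M1 by simp
   fix z :: "complex^'n"
   assume z: "z \<in> unit_ball" and r: "rad z < \<eta>" and far: "\<forall>w\<in>unit_ball. norm (v w) <= \<epsilon> \<or> \<beta> <= hdist z w"
   have "rad z^?N <= rad z^1" using z rad_le1[of z] by (intro power_decreasing) auto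
   hence "rad z^?N <= \<eta>" using r by simp
   hence "M\<^sup>2*rad z^?N <= (M\<^sup>2 + 1)*\<eta>" using z by (intro mult_mono) auto
   also have "... = \<epsilon>*(\<epsilon>*B)"
    using M1 by (simp add: \<eta>_def power2_eq_square)
   finally have "M\<^sup>2*rad z^?N/(\<epsilon>*B) <= \<epsilon>"
    using \<epsilon> B by (simp add: pos_divide_le_eq)
   hence "K*(\<epsilon> + M\<^sup>2*rad z^?N/(\<epsilon>*B)) <= K*(\<epsilon> + \<epsilon>)"
    using K(1) by (intro mult_left_mono add_left_mono) auto
   moreover have "norm (berezin v z) <= K*(\<epsilon> + M\<^sup>2*rad z^?N/(\<epsilon>*B))"
    unfolding B_def by (rule K(2)[rule_format, OF v M0 \<epsilon> \<beta> z M far[rule_format]])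
   ultimately show "norm (berezin v z) <= 2*K*\<epsilon>" by (simp add: algebra_simps)
  qed
 qed
qed

section \<open>The symbol on the sphere\<close>

locale continuous_near_sphere =
 fixes u :: "complex^'n::finite => complex" and K :: "(complex^'n) set" and M :: real
 assumes measurable_u: "u \<in> meas" and M0: "0 <= M" and bounded: "AE w in vol. norm (u w) <= M"
  and compact_K: "compact K" and K_ball: "K \<subseteq> unit_ball" and continuous: "continuous_on (cball 0 1 - K) u"
begin

lemma continuous_at_sphere:
 assumes \<zeta>: "norm \<zeta> = 1"
 shows "\<forall>e>0. \<exists>d>0. \<forall>w\<in>unit_ball. norm (w - \<zeta>) < d --> norm (u w - u \<zeta>) <= e"
proof (intro allI impI)
 fix e :: real assume e: "0 < e"
 have \<zeta>K: "\<zeta> \<in> cball 0 1 - K" using \<zeta> K_ball by auto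
 then obtain d where d: "0 < d" "\<forall>w\<in>cball 0 1 - K. dist w \<zeta> < d --> dist (u w) (u \<zeta>) < e"
  using continuous e unfolding continuous_on_iff by meson
 have "open (- K)" using compact_imp_closed[OF compact_K] by (rule open_Compl)
 moreover have "\<zeta> \<in> - K" using \<zeta>K by simp
 ultimately obtain d' where d': "0 < d'" "ball \<zeta> d' \<subseteq> - K" by (rule openE)
 show "\<exists>d>0. \<forall>w\<in>unit_ball. norm (w - \<zeta>) < d --> norm (u w - u \<zeta>) <= e"
 proof (rule exI[of _ "min d d'"], intro conjI ballI impI)
  show "0 < min d d'" using d(1) d'(1) by simp
  fix w :: "complex^'n" assume w: "w \<in> unit_ball" "norm (w - \<zeta>) < min d d'"
  hence "w \<in> ball \<zeta> d'" by (simp add: dist_norm norm_minus_commute)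
  hence "w \<in> cball 0 1 - K" using d'(2) w(1) by auto
  moreover have "dist w \<zeta> < d" using w(2) by (simp add: dist_norm)
  ultimately have "dist (u w) (u \<zeta>) < e" using d(2) by blast
  thus "norm (u w - u \<zeta>) <= e" by (simp add: dist_norm)
 qed
qed

text \<open>
 Uniform continuity on a closed shell, applied to \<open>w\<close> and its radial projection to the sphere.
\<close>

lemma decay:
 assumes zero: "\<forall>\<zeta>. norm \<zeta> = 1 --> u \<zeta> = 0" and e: "0 < e"
 shows "\<exists>r\<ge>0. r < 1 \<and> (\<forall>w\<in>unit_ball. r < norm w --> norm (u w) <= e)"
proof -
 obtain r1 where r1: "0 < r1" "r1 < 1" "K \<subseteq> ball 0 r1"
 proof (cases "K = {}")
  case True
  thus ?thesis using that[of "1/2"] by simp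
 next
  case False
  then obtain x where x: "x \<in> K" "\<forall>y\<in>K. norm y <= norm x"
   using continuous_attains_sup[OF compact_K, of norm] continuous_on_norm_id by blast
  have nx: "norm x < 1" using x(1) K_ball by auto
  have "K \<subseteq> ball 0 ((1 + norm x)/2)"
  proof
   fix y assume "y \<in> K"
   hence "norm y <= norm x" using x(2) by blast
   thus "y \<in> ball 0 ((1 + norm x)/2)" using nx by simp
  qed
  moreover have "0 < (1 + norm x)/2" by (intro divide_pos_pos add_pos_nonneg) auto
  moreover have "(1 + norm x)/2 < 1" using nx by simp
  ultimately show ?thesis using that by blast
 qed
 define A where "A = cball 0 1 - ball (0 :: complex^'n) r1"
 have "compact A" unfolding A_def by (intro compact_diff compact_cball open_ball)
 moreover have "continuous_on A u"
  using continuous by (rule continuous_on_subset) (use r1(3) in \<open>auto simp: A_def\<close>)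
 ultimately have "uniformly_continuous_on A u" by (intro compact_uniformly_continuous)
 then obtain d where d: "0 < d" "\<forall>x\<in>A. \<forall>x'\<in>A. dist x' x < d --> dist (u x') (u x) < e"
  unfolding uniformly_continuous_on_def using e by meson
 show ?thesis
 proof (rule exI[of _ "max r1 (1 - d)"], intro conjI ballI impI)
  show "0 <= max r1 (1 - d)" "max r1 (1 - d) < 1" using r1 d(1) by auto
  fix w :: "complex^'n" assume w: "w \<in> unit_ball" "max r1 (1 - d) < norm w"
  define \<zeta> where "\<zeta> = w /\<^sub>R norm w"
  have "r1 < norm w" using w(2) by simp
  with r1(1) have w0: "0 < norm w" by (rule less_trans)
  have \<zeta>: "norm \<zeta> = 1" using w0 by (simp add: \<zeta>_def)
  have "w - \<zeta> = (1 - 1/norm w) *\<^sub>R w"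
   by (simp add: \<zeta>_def scaleR_left_diff_distrib inverse_eq_divide)
  hence "norm (w - \<zeta>) = \<bar>(1 - 1/norm w)*norm w\<bar>" by (simp add: abs_mult)
  also have "(1 - 1/norm w)*norm w = norm w - 1" using w0 by (simp add: left_diff_distrib)
  finally have "dist w \<zeta> < d" using w by (simp add: dist_norm)
  moreover have "w \<in> A" "\<zeta> \<in> A" using w \<zeta> r1 by (auto simp: A_def)
  ultimately have "dist (u w) (u \<zeta>) < e" using d(2) by blast
  thus "norm (u w) <= e" using zero \<zeta> by (simp add: dist_norm)
 qed
qed

lemma berezin_tendsto_zero:
 assumes zero: "\<forall>\<zeta>. norm \<zeta> = 1 --> u \<zeta> = 0"
 shows "(berezin u \<longlongrightarrow> 0) (filtercomap norm (at_left 1))"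
proof (rule tendstoI)
 obtain C where C: "0 < C" "\<forall>v\<in>borel_measurable (vol :: (complex^'n::finite) measure). \<forall>M\<ge>0. \<forall>\<epsilon>>0. \<forall>\<beta>>0.
  (AE w in vol. norm (v w) <= M) --> (\<exists>\<eta>>0. \<forall>z\<in>unit_ball. rad z < \<eta> -->
   (\<forall>w\<in>unit_ball. norm (v w) <= \<epsilon> \<or> \<beta> <= hdist z w) --> norm (berezin v z) <= C*\<epsilon>)"
  using berezin_small_near_sphere[where ?'n = 'n] by (elim exE conjE) (rule that)
 fix e :: real assume e: "0 < e"
 define \<epsilon> where "\<epsilon> = e/(2*C)"
 have \<epsilon>: "0 < \<epsilon>" "C*\<epsilon> < e" using e C(1) by (auto simp: \<epsilon>_def)
 obtain r where r: "0 <= r" "r < 1" "\<forall>w\<in>unit_ball. r < norm w --> norm (u w) <= \<epsilon>"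
  using decay[OF zero \<epsilon>(1)] by (elim exE conjE) (rule that)
 have \<beta>: "0 < 1 - r" using r(2) by simp
 obtain \<eta> where \<eta>: "0 < \<eta>" "\<forall>z\<in>unit_ball. rad z < \<eta> -->
   (\<forall>w\<in>unit_ball. norm (u w) <= \<epsilon> \<or> 1 - r <= hdist z w) --> norm (berezin u z) <= C*\<epsilon>"
  using C(2)[rule_format, OF measurable_u M0 \<epsilon>(1) \<beta> bounded] by (elim exE conjE) (rule that)
 have b: "norm (berezin u z) < e" if z: "1 - \<eta> < norm z" "norm z < 1" for z
 proof -
  have zb: "z \<in> unit_ball" and rz: "rad z < \<eta>" using z by (auto simp: rad_def)
  have "\<forall>w\<in>unit_ball. norm (u w) <= \<epsilon> \<or> 1 - r <= hdist z w"
  proof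
   fix w :: "complex^'n" assume w: "w \<in> unit_ball"
   show "norm (u w) <= \<epsilon> \<or> 1 - r <= hdist z w"
   proof (cases "r < norm w")
    case True
    thus ?thesis using r(3) w by blast
   next
    case False
    thus ?thesis using rad_le_hdist(2)[OF zb w] by (simp add: rad_def)
   qed
  qed
  hence "norm (berezin u z) <= C*\<epsilon>" using \<eta>(2) zb rz by blast
  thus ?thesis using \<epsilon>(2) by linarith
 qed
 have "eventually (\<lambda>t. 1 - \<eta> < t \<and> t < 1) (at_left (1 :: real))"
  using \<eta>(1) by (intro eventually_at_leftI[of "1 - \<eta>"]) auto
 thus "\<forall>\<^sub>F z in filtercomap norm (at_left 1). dist (berezin u z) 0 < e"
  unfolding eventually_filtercomap using b by (intro exI[of _ "\<lambda>t. 1 - \<eta> < t \<and> t < 1"]) auto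
qed

text \<open>
 Near \<open>\<zeta>\<close> the transform of \<open>u\<close> differs from \<open>u \<zeta>\<close> times the transform of \<open>1\<close> by the transform of \<open>u - u \<zeta>\<close>,
 to which only points near \<open>\<zeta>\<close> contribute.
\<close>

lemma berezin_tendsto_zero_imp:
 assumes lim: "(berezin u \<longlongrightarrow> 0) (filtercomap norm (at_left 1))" and \<zeta>: "norm \<zeta> = 1"
 shows "u \<zeta> = 0"
proof -
 obtain C where C: "0 < C" "\<forall>v\<in>borel_measurable (vol :: (complex^'n::finite) measure). \<forall>M\<ge>0. \<forall>\<epsilon>>0. \<forall>\<beta>>0.
  (AE w in vol. norm (v w) <= M) --> (\<exists>\<eta>>0. \<forall>z\<in>unit_ball. rad z < \<eta> -->
   (\<forall>w\<in>unit_ball. norm (v w) <= \<epsilon> \<or> \<beta> <= hdist z w) --> norm (berezin v z) <= C*\<epsilon>)"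
  using berezin_small_near_sphere[where ?'n = 'n] by (elim exE conjE) (rule that)
 obtain c where c: "0 < c" "\<forall>z::complex^'n\<in>unit_ball. c <= norm (berezin (\<lambda>_. 1) z)"
  using berezin_one_ge[where ?'n = 'n] by (elim exE conjE) (rule that)
 define v where "v w = u w - u \<zeta>" for w
 have vm: "v \<in> meas" unfolding v_def[abs_def] using measurable_u by measurable
 have vM: "AE w in vol. norm (v w) <= M + norm (u \<zeta>)"
  using bounded
 proof eventually_elim
  case (elim w)
  thus ?case using norm_triangle_ineq4[of "u w" "u \<zeta>"] by (simp add: v_def)
 qed
 have M': "0 <= M + norm (u \<zeta>)" using M0 by simp
 have "norm (u \<zeta>)*c <= 0 + e" if e: "0 < e" for e
 proof -
  define \<epsilon> where "\<epsilon> = e/(2*C)"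
  have \<epsilon>: "0 < \<epsilon>" "C*\<epsilon> = e/2" using e C(1) by (auto simp: \<epsilon>_def)
  obtain d where d: "0 < d" "\<forall>w\<in>unit_ball. norm (w - \<zeta>) < d --> norm (u w - u \<zeta>) <= \<epsilon>"
   using continuous_at_sphere[OF \<zeta>, rule_format, OF \<epsilon>(1)] by (elim exE conjE) (rule that)
  have \<beta>: "0 < d\<^sup>2/8" using d(1) by simp
  obtain \<eta> where \<eta>: "0 < \<eta>" "\<forall>z\<in>unit_ball. rad z < \<eta> -->
   (\<forall>w\<in>unit_ball. norm (v w) <= \<epsilon> \<or> d\<^sup>2/8 <= hdist z w) --> norm (berezin v z) <= C*\<epsilon>"
   using C(2)[rule_format, OF vm M' \<epsilon>(1) \<beta> vM] by (elim exE conjE) (rule that)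
  have e2: "0 < e/2" using e by simp
  obtain Q where Q: "eventually Q (at_left (1 :: real))" "\<forall>z. Q (norm z) --> dist (berezin u z) 0 < e/2"
   using tendstoD[OF lim e2] unfolding eventually_filtercomap by (elim exE conjE) (rule that)
  obtain b where b: "b < 1" "\<forall>y>b. y < 1 --> Q y"
   using Q(1) unfolding eventually_at_left_field by blast
  define \<tau> where "\<tau> = min (min \<eta> (d/2)) (min (1 - b) 1)/2"
  have \<tau>: "0 < \<tau>" "\<tau> < \<eta>" "\<tau> < d/2" "\<tau> < 1 - b" "\<tau> < 1"
   using \<eta>(1) d(1) b(1) unfolding \<tau>_def by (auto simp: min_def)
  define z where "z = (1 - \<tau>) *\<^sub>R \<zeta>"
  have nz: "norm z = 1 - \<tau>" using \<tau> \<zeta> by (simp add: z_def)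
  have z: "z \<in> unit_ball" "rad z < \<eta>" using nz \<tau> by (auto simp: rad_def)
  have "z - \<zeta> = (- \<tau>) *\<^sub>R \<zeta>" by (simp add: z_def scaleR_left_diff_distrib)
  hence "norm (z - \<zeta>) = \<bar>- \<tau>\<bar>*norm \<zeta>" by (simp only: norm_scaleR)
  hence z\<zeta>: "norm (z - \<zeta>) < d/2" using \<zeta> \<tau> by simp
  have "\<forall>w\<in>unit_ball. norm (v w) <= \<epsilon> \<or> d\<^sup>2/8 <= hdist z w"
  proof
   fix w :: "complex^'n" assume w: "w \<in> unit_ball"
   show "norm (v w) <= \<epsilon> \<or> d\<^sup>2/8 <= hdist z w"
   proof (cases "norm (w - \<zeta>) < d")
    case True
    thus ?thesis using d(2) w by (simp add: v_def)
   next
    case False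
    hence "d/2 <= norm (z - w)"
     using z\<zeta> norm_triangle_ineq[of "w - z" "z - \<zeta>"] norm_minus_commute[of w z] by simp
    hence "(d/2)\<^sup>2 <= (norm (z - w))\<^sup>2" using d(1) by (intro power_mono) auto
    also have "... <= 2*hdist z w" using z(1) w by (intro norm_diff_square_le_hdist) auto
    finally show ?thesis by (simp add: power_divide)
   qed
  qed
  hence v: "norm (berezin v z) <= e/2" using \<eta>(2) z \<epsilon>(2) by metis
  have "Q (norm z)" using b(2) nz \<tau> by simp
  hence u: "norm (berezin u z) < e/2" using Q(2) by (simp add: dist_norm)
  have "norm (u \<zeta>)*c <= norm (u \<zeta>)*norm (berezin (\<lambda>_. 1) z)"
   using bspec[OF c(2) z(1)] by (rule mult_left_mono) simp
  also have "... = norm (berezin u z - berezin v z)"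
   using berezin_split[OF measurable_u bounded z(1), of "u \<zeta>"] by (simp add: v_def[abs_def] norm_mult)
  also have "... <= norm (berezin u z) + norm (berezin v z)" by (rule norm_triangle_ineq4)
  finally show ?thesis using u v by simp
 qed
 hence "norm (u \<zeta>)*c <= 0" by (rule field_le_epsilon)
 thus ?thesis using c(1) by (simp add: mult_le_0_iff)
qed

lemma compact_on_Bp:
 assumes "\<forall>\<zeta>. norm \<zeta> = 1 --> u \<zeta> = 0" "1 < p" "\<sigma> \<in> Bp p"
 shows "acts_compactly (Lp_norm p \<sigma>) (Lp_norm p \<sigma>) (toeplitz u)"
 by (rule bergman_dominated.toeplitz_compact[OF bergman_dominated_Lp[OF assms(2,3)] measurable_u bounded M0 decay[OF assms(1)]])

lemma compact_on_B1:
 assumes "\<forall>\<zeta>. norm \<zeta> = 1 --> u \<zeta> = 0" "\<sigma> \<in> B1"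
 shows "acts_compactly (Lp_norm 1 \<sigma>) (weak_L1_norm \<sigma>) (toeplitz u)"
 by (rule bergman_dominated.toeplitz_compact[OF bergman_dominated_weak_L1[OF assms(2)] measurable_u bounded M0 decay[OF assms(1)]])

lemma finite_mass_one: "(\<integral>\<^sup>+z. ennreal 1 \<partial>(vol :: (complex^'n) measure)) < \<top>"
 unfolding nn_integral_const vol.emeasure_space_1 by simp

lemma vanishing_of_compact_Lp:
 assumes p: "1 < p" and compact: "acts_compactly (Lp_norm p (\<lambda>_. 1)) (Lp_norm p (\<lambda>_. 1)) (toeplitz u)" and \<zeta>: "norm \<zeta> = 1"
 shows "u \<zeta> = 0"
proof (rule compact_imp_vanishing[OF measurable_u \<zeta> continuous_at_sphere[OF \<zeta>] _ _ _ compact])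
 show "1 <= p" using p by simp
 hence "function_norm (Lp_norm p (\<lambda>_ :: complex^'n. 1)) (\<lambda>_. 1)"
  using finite_mass_one by (intro function_norm_Lp) auto
 thus "quasinorm (Lp_norm p (\<lambda>_ :: complex^'n. 1))" by (rule function_norm.axioms(1))
 show "ennreal (\<alpha>/2)*epowr (emeasure vol D) (1/p) <= Lp_norm p (\<lambda>_. 1) F"
  if "D \<in> sets vol" "0 < \<alpha>" "\<forall>z\<in>D. \<alpha> <= norm (F z)" for F :: "complex^'n => complex" and D \<alpha>
  using \<open>1 \<le> p\<close> that by (rule Lp_norm_lower)
qed

lemma vanishing_of_compact_weak_L1:
 assumes compact: "acts_compactly (Lp_norm 1 (\<lambda>_. 1)) (weak_L1_norm (\<lambda>_. 1)) (toeplitz u)" and \<zeta>: "norm \<zeta> = 1"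
 shows "u \<zeta> = 0"
proof (rule compact_imp_vanishing[OF measurable_u \<zeta> continuous_at_sphere[OF \<zeta>] _ _ _ compact])
 show "(1 :: real) <= 1" by simp
 have "function_norm (weak_L1_norm (\<lambda>_ :: complex^'n. 1)) (\<lambda>_. 1)"
  using finite_mass_one by (intro function_norm_weak_L1) auto
 thus "quasinorm (weak_L1_norm (\<lambda>_ :: complex^'n. 1))" by (rule function_norm.axioms(1))
 show "ennreal (\<alpha>/2)*epowr (emeasure vol D) (1/1) <= weak_L1_norm (\<lambda>_. 1) F"
  if "F \<in> meas" "D \<in> sets vol" "0 < \<alpha>" "\<forall>z\<in>D. \<alpha> <= norm (F z)" for F :: "complex^'n => complex" and D \<alpha>
  using that by (rule weak_L1_norm_lower)
qed

end

theorem corollary1p2: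
  fixes u :: "complex ^ 'n::finite \<Rightarrow> complex"
    and K :: "(complex ^ 'n) set"
  assumes "u \<in> Linf"
    and "compact K" and "K \<subseteq> unit_ball"
    and "continuous_on (closure unit_ball - K) u"
  shows "((\<exists>p>1. acts_compactly (Lp_norm p (\<lambda>_. 1)) (Lp_norm p (\<lambda>_. 1)) (toeplitz u)) \<longleftrightarrow>
            (berezin u \<longlongrightarrow> 0) (filtercomap norm (at_left 1))) \<and>
         ((\<forall>p>1. \<forall>\<sigma>\<in>Bp p. acts_compactly (Lp_norm p \<sigma>) (Lp_norm p \<sigma>) (toeplitz u)) \<longleftrightarrow>
            (berezin u \<longlongrightarrow> 0) (filtercomap norm (at_left 1))) \<and>
         ((\<forall>\<sigma>\<in>B1. acts_compactly (Lp_norm 1 \<sigma>) (weak_L1_norm \<sigma>) (toeplitz u)) \<longleftrightarrow>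
            (berezin u \<longlongrightarrow> 0) (filtercomap norm (at_left 1)))"
proof -
  have um: "u \<in> borel_measurable vol" and fin: "Linf_norm vol u < \<top>"
    using assms(1) by (auto simp: Linf_def)
  obtain M where M: "0 \<le> M" "Linf_norm vol u = ennreal M"
    using fin by (cases "Linf_norm vol u") auto
  have "AE w in vol. ennreal (norm (u w)) \<le> ennreal M"
    using esssup_AE[of "\<lambda>w. ennreal (norm (u w))" vol] M(2) by (simp add: Linf_norm_def)
  then have bound: "AE w in vol. norm (u w) \<le> M"
    using M(1) by (simp add: ennreal_le_iff)
  have "closure unit_ball = cball (0 :: complex ^ 'n) 1"
    by (rule closure_ball) simp
  then interpret continuous_near_sphere u K M
    using um M(1) bound assms(2-4) by unfold_locales simp_all
  let ?zero = "\<forall>\<zeta>. norm \<zeta> = 1 \<longrightarrow> u \<zeta> = 0"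
  have d: "(berezin u \<longlongrightarrow> 0) (filtercomap norm (at_left 1)) \<longleftrightarrow> ?zero"
    using berezin_tendsto_zero berezin_tendsto_zero_imp by blast
  have a: "(\<exists>p>1. acts_compactly (Lp_norm p (\<lambda>_. 1)) (Lp_norm p (\<lambda>_. 1)) (toeplitz u)) \<longleftrightarrow> ?zero"
  proof
    assume "\<exists>p>1. acts_compactly (Lp_norm p (\<lambda>_. 1)) (Lp_norm p (\<lambda>_. 1)) (toeplitz u)"
    then obtain p where p: "1 < p" "acts_compactly (Lp_norm p (\<lambda>_. 1)) (Lp_norm p (\<lambda>_. 1)) (toeplitz u)"
      by (elim exE conjE)
    then show ?zero
      using vanishing_of_compact_Lp[OF p] by (intro allI impI)
  next
    assume z: ?zero
    show "\<exists>p>1. acts_compactly (Lp_norm p (\<lambda>_. 1)) (Lp_norm p (\<lambda>_. 1)) (toeplitz u)"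
      by (rule exI[of _ 2], intro conjI compact_on_Bp[OF z] one_in_Bp) simp_all
  qed
  have b: "(\<forall>p>1. \<forall>\<sigma>\<in>Bp p. acts_compactly (Lp_norm p \<sigma>) (Lp_norm p \<sigma>) (toeplitz u)) \<longleftrightarrow> ?zero"
  proof
    assume all: "\<forall>p>1. \<forall>\<sigma>\<in>Bp p. acts_compactly (Lp_norm p \<sigma>) (Lp_norm p \<sigma>) (toeplitz u)"
    have "acts_compactly (Lp_norm 2 (\<lambda>_. 1)) (Lp_norm 2 (\<lambda>_. 1)) (toeplitz u)"
      using all[rule_format, of 2 "\<lambda>_. 1"] one_in_Bp[of 2, where ?'n = 'n] by simp
    then show ?zero
      using vanishing_of_compact_Lp[of 2] by simp
  next
    assume z: ?zero
    show "\<forall>p>1. \<forall>\<sigma>\<in>Bp p. acts_compactly (Lp_norm p \<sigma>) (Lp_norm p \<sigma>) (toeplitz u)"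
      by (intro allI impI ballI compact_on_Bp[OF z])
  qed
  have c: "(\<forall>\<sigma>\<in>B1. acts_compactly (Lp_norm 1 \<sigma>) (weak_L1_norm \<sigma>) (toeplitz u)) \<longleftrightarrow> ?zero"
  proof
    assume "\<forall>\<sigma>\<in>B1. acts_compactly (Lp_norm 1 \<sigma>) (weak_L1_norm \<sigma>) (toeplitz u)"
    from bspec[OF this one_in_B1] show ?zero
      by (intro allI impI vanishing_of_compact_weak_L1)
  next
    assume z: ?zero
    show "\<forall>\<sigma>\<in>B1. acts_compactly (Lp_norm 1 \<sigma>) (weak_L1_norm \<sigma>) (toeplitz u)"
      by (intro ballI compact_on_B1[OF z])
  qed
  show ?thesis
    unfolding a b c d by simp
qed

end
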